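(* Let $k$ be an algebraically closed field, $0\le n\le l$ integers, $v$ a partial diagram on $l$ dots with exactly $n$ labelled parts, $\lambda$ a partition of $l$, and let $\prod_\alpha\times\prod_\beta\le\Sigma_l$ be the stabilizer of $v$. Let $\pi_1,\dots,\pi_q$ be representatives of the double cosets $(\prod_\alpha\times\prod_\beta)\backslash\Sigma_l/\Sigma_\lambda$. Then the left $k\Sigma_n$-module $$k\Sigma_n\otimes_{k(\prod_\alpha\times\prod_\beta)}k\Sigma_l\otimes_{k\Sigma_\lambda}k$$ is isomorphic to the direct sum $\bigoplus_{i=1}^q\bigl(k\Sigma_n\otimes_{k\Sigma_{\nu^i}}k\bigr)$ of permutation modules. In particular, it admits a filtration by dual $k\Sigma_n$-Specht modules.
   Context: $\Sigma_m$ is the symmetric group on $m$ letters ($\Sigma_0$ trivial), $\Sigma_\lambda\le\Sigma_l$ the Young subgroup of $\lambda$, and $k$ the trivial module. Products of permutations follow concatenation of diagrams: $\sigma\tau$ means first $\sigma$, then $\tau$, where $\sigma$ is drawn as the diagram joining top dot $i$ to bottom dot $\sigma(i)$. A partial diagram $v$ on $l$ dots with $n$ labelled parts is a set partition of $\{1,\dots,l\}$ with exactly $n$ of its parts marked as labelled (and possibly further unlabelled parts); the labelled parts are numbered $1,\dots,n$ from left to right according to their leftmost dots. (Such diagrams are the basis elements of the space $V_n^l$ attached to the partition algebra $P_k(r,\delta)$, where the last $r-l+1$ dots, which lie in a common part, are counted as one dot.) Let $\alpha_i$, respectively $\beta_i$, be the number of labelled, respectively unlabelled, parts of size $i$. $\prod_\alpha\simeq\prod_{i\ge1,\alpha_i\neq0}(\Sigma_i\wr\Sigma_{\alpha_i})$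 is the group of permutations of the dots in labelled parts which permute the labelled parts among themselves (fixing all other dots), and $\prod_\beta\simeq\prod_{i\ge1,\beta_i\ne0}(\Sigma_i\wr\Sigma_{\beta_i})$ is the analogous group for unlabelled parts; thus $\prod_\alpha\times\prod_\beta\le\Sigma_l$ is the stabilizer of $v$ as a set partition with labelled parts. Every $\zeta\in\prod_\alpha\times\prod_\beta$ induces a permutation of the $n$ labelled parts, denoted $\rho(\zeta)\in\Sigma_n$ (in the paper, $\rho(\zeta)=\Pi(d\zeta)$); $\rho$ is a group homomorphism onto $\Sigma_\alpha=\prod_i\Sigma_{\alpha_i}\le\Sigma_n$ (products over parts of equal size). The right action of $\prod_\alpha\times\prod_\beta$ on $k\Sigma_n$ is $\eta\cdot\zeta:=\eta\,\rho(\zeta)$. For each $i$ set $\prod_{\nu^i}:=(\prod_\alpha\times\prod_\beta)\cap\pi_i\Sigma_\lambda\pi_i^{-1}$, and $\Sigma_{\nu^i}:=\rho(\prod_{\nu^i})\le\Sigma_n$, which is a Young subgroup of $\Sigma_n$ (the stabilizer of a decomposition of $\{1,\dots,n\}$ into disjoint subsets). A dual Specht module is the $k$-dual of a Specht module. *)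

theory Defs
  imports
    "HOL-Combinatorics.Permutations"
    "HOL-Computational_Algebra.Polynomial"
    "HOL-Library.Disjoint_Sets"
    "HOL-Library.Poly_Mapping"
    "HOL-Algebra.Free_Abelian_Groups"
    "HOL-Algebra.AbelCoset"
    "HOL-Algebra.Module"
begin

section \<open>Modules over non-commutative rings\<close>

text \<open>
  The locale \<^locale>\<open>module\<close> requires a commutative ring of scalars, so left modules are introduced
  here on top of the same record type. The ring fields \<open>mult\<close> and \<open>one\<close> of that record carry no
  information about a module and are left undefined in the constructions below.
\<close>

locale left_module = R?: ring R + M?: abelian_group M for R (structure) and M (structure) +
  assumes smult_closed:
      "\<lbrakk>a \<in> carrier R; x \<in> carrier M\<rbrakk> \<Longrightarrow> a \<odot>\<^bsub>M\<^esub> x \<in> carrier M"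
    and smult_l_distr:
      "\<lbrakk>a \<in> carrier R; b \<in> carrier R; x \<in> carrier M\<rbrakk> \<Longrightarrow>
        (a \<oplus> b) \<odot>\<^bsub>M\<^esub> x = a \<odot>\<^bsub>M\<^esub> x \<oplus>\<^bsub>M\<^esub> b \<odot>\<^bsub>M\<^esub> x"
    and smult_r_distr:
      "\<lbrakk>a \<in> carrier R; x \<in> carrier M; y \<in> carrier M\<rbrakk> \<Longrightarrow>
        a \<odot>\<^bsub>M\<^esub> (x \<oplus>\<^bsub>M\<^esub> y) = a \<odot>\<^bsub>M\<^esub> x \<oplus>\<^bsub>M\<^esub> a \<odot>\<^bsub>M\<^esub> y"
    and smult_assoc:
      "\<lbrakk>a \<in> carrier R; b \<in> carrier R; x \<in> carrier M\<rbrakk> \<Longrightarrow>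
        (a \<otimes> b) \<odot>\<^bsub>M\<^esub> x = a \<odot>\<^bsub>M\<^esub> (b \<odot>\<^bsub>M\<^esub> x)"
    and smult_one:
      "x \<in> carrier M \<Longrightarrow> \<one> \<odot>\<^bsub>M\<^esub> x = x"

definition module_isomorphic ::
  "'r ring \<Rightarrow> ('r, 'm) module \<Rightarrow> ('r, 'n) module \<Rightarrow> bool" where
  "module_isomorphic R M N \<longleftrightarrow> left_module R M \<and> left_module R N \<and>
     (\<exists>f. bij_betw f (carrier M) (carrier N) \<and>
          (\<forall>x\<in>carrier M. \<forall>y\<in>carrier M. f (x \<oplus>\<^bsub>M\<^esub> y) = f x \<oplus>\<^bsub>N\<^esub> f y) \<and>
          (\<forall>a\<in>carrier R. \<forall>x\<in>carrier M. f (a \<odot>\<^bsub>M\<^esub> x) = a \<odot>\<^bsub>N\<^esub> f x))"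

definition regular_module :: "'r ring \<Rightarrow> ('r, 'r) module" where
  "regular_module R = \<lparr>carrier = carrier R, mult = undefined, one = undefined,
     zero = \<zero>\<^bsub>R\<^esub>, add = (\<oplus>\<^bsub>R\<^esub>), smult = (\<otimes>\<^bsub>R\<^esub>)\<rparr>"

text \<open>
  In a quotient, the scalar multiple of a coset \<open>X\<close> by \<open>a\<close> is written as \<open>H + a X\<close>; for \<open>X = H + x\<close>
  and \<open>a H \<subseteq> H\<close> this is the coset \<open>H + a x\<close>.
\<close>

definition quotient_module :: "('r, 'm) module \<Rightarrow> 'm set \<Rightarrow> ('r, 'm set) module" where
  "quotient_module M H = \<lparr>carrier = a_rcosets\<^bsub>M\<^esub> H, mult = undefined, one = undefined,
     zero = H, add = (<+>\<^bsub>M\<^esub>), smult = (\<lambda>a X. H <+>\<^bsub>M\<^esub> ((\<lambda>x. a \<odot>\<^bsub>M\<^esub> x) ` X))\<rparr>"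

definition direct_sum :: "'i set \<Rightarrow> ('i \<Rightarrow> ('r, 'm) module) \<Rightarrow> ('r, 'i \<Rightarrow> 'm) module" where
  "direct_sum I M = \<lparr>
     carrier = {x \<in> \<Pi>\<^sub>E i\<in>I. carrier (M i). finite {i \<in> I. x i \<noteq> \<zero>\<^bsub>M i\<^esub>}},
     mult = undefined, one = undefined,
     zero = (\<lambda>i\<in>I. \<zero>\<^bsub>M i\<^esub>),
     add = (\<lambda>x y. \<lambda>i\<in>I. x i \<oplus>\<^bsub>M i\<^esub> y i),
     smult = (\<lambda>a x. \<lambda>i\<in>I. a \<odot>\<^bsub>M i\<^esub> x i)\<rparr>"

text \<open>
  The tensor product over \<open>R\<close> of an \<open>(S, R)\<close>-bimodule with a left \<open>R\<close>-module \<open>N\<close>, as a left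
  \<open>S\<close>-module. The bimodule is given by its left module \<open>M\<close> over \<open>S\<close> together with the right action
  \<open>act :: 'm \<Rightarrow> 'r \<Rightarrow> 'm\<close>. The construction is the usual one: the free abelian group on
  \<open>M \<times> N\<close> modulo the subgroup generated by the bilinearity and balancing relations; the map
  \<open>(m, n) \<mapsto> (s m, n)\<close> of generators induces multiplication by \<open>s\<close>.
\<close>

definition tensor_relations ::
  "('s, 'm) module \<Rightarrow> ('m \<Rightarrow> 'r \<Rightarrow> 'm) \<Rightarrow> 'r ring \<Rightarrow> ('r, 'n) module \<Rightarrow> ('m \<times> 'n \<Rightarrow>\<^sub>0 int) set"
  where
  "tensor_relations M act R N =
     {frag_of (x \<oplus>\<^bsub>M\<^esub> y, z) - frag_of (x, z) - frag_of (y, z) | x y z.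
        x \<in> carrier M \<and> y \<in> carrier M \<and> z \<in> carrier N} \<union>
     {frag_of (x, y \<oplus>\<^bsub>N\<^esub> z) - frag_of (x, y) - frag_of (x, z) | x y z.
        x \<in> carrier M \<and> y \<in> carrier N \<and> z \<in> carrier N} \<union>
     {frag_of (act x a, y) - frag_of (x, a \<odot>\<^bsub>N\<^esub> y) | x a y.
        x \<in> carrier M \<and> a \<in> carrier R \<and> y \<in> carrier N}"

definition tensor_product ::
  "('s, 'm) module \<Rightarrow> ('m \<Rightarrow> 'r \<Rightarrow> 'm) \<Rightarrow> 'r ring \<Rightarrow> ('r, 'n) module
     \<Rightarrow> ('s, ('m \<times> 'n \<Rightarrow>\<^sub>0 int) set) module" where
  "tensor_product M act R N =
     (let F = free_Abelian_group (carrier M \<times> carrier N) in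
      quotient_module
        \<lparr>carrier = carrier F, mult = undefined, one = undefined, zero = \<one>\<^bsub>F\<^esub>, add = (\<otimes>\<^bsub>F\<^esub>),
         smult = (\<lambda>s. frag_extend (\<lambda>(x, y). frag_of (s \<odot>\<^bsub>M\<^esub> x, y)))\<rparr>
        (generate F (tensor_relations M act R N)))"

definition has_filtration_by ::
  "'r ring \<Rightarrow> ('r, 'm) module \<Rightarrow> ('r, 'n) module set \<Rightarrow> bool" where
  "has_filtration_by R M \<C> \<longleftrightarrow>
     (\<exists>s N. N 0 = {\<zero>\<^bsub>M\<^esub>} \<and> N s = carrier M \<and>
        (\<forall>i\<le>s. submodule (N i) R M) \<and>
        (\<forall>i<s. N i \<subseteq> N (Suc i) \<and>
           (\<exists>C\<in>\<C>. module_isomorphic R (quotient_module (M\<lparr>carrier := N (Suc i)\<rparr>) (N i)) C)))"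


section \<open>Group algebras and their modules\<close>

text \<open>
  Elements of \<open>k G\<close> are finitely supported functions with support in the carrier, so that for a
  subgroup \<open>H\<close> the algebra of \<open>G\<lparr>carrier := H\<rparr>\<close> is literally a subset of that of \<open>G\<close>, and the
  record of a \<open>k G\<close>-module also serves as its restriction to \<open>k H\<close>.
\<close>

definition group_algebra :: "'g monoid \<Rightarrow> ('g \<Rightarrow>\<^sub>0 'k::field) ring" where
  "group_algebra G = \<lparr>
     carrier = {a. Poly_Mapping.keys a \<subseteq> carrier G},
     mult = (\<lambda>a b. \<Sum>x\<in>Poly_Mapping.keys a. \<Sum>y\<in>Poly_Mapping.keys b.
       Poly_Mapping.single (x \<otimes>\<^bsub>G\<^esub> y) (Poly_Mapping.lookup a x * Poly_Mapping.lookup b y)),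
     one = Poly_Mapping.single \<one>\<^bsub>G\<^esub> 1,
     zero = 0,
     add = (+)\<rparr>"

definition linear_ext :: "('g \<Rightarrow> 'h) \<Rightarrow> ('g \<Rightarrow>\<^sub>0 'k::field) \<Rightarrow> ('h \<Rightarrow>\<^sub>0 'k)" where
  "linear_ext f a =
     (\<Sum>x\<in>Poly_Mapping.keys a. Poly_Mapping.single (f x) (Poly_Mapping.lookup a x))"

definition trivial_module :: "('g \<Rightarrow>\<^sub>0 'k::field, 'k) module" where
  "trivial_module = \<lparr>carrier = UNIV, mult = undefined, one = undefined, zero = 0, add = (+),
     smult = (\<lambda>a c. (\<Sum>x\<in>Poly_Mapping.keys a. Poly_Mapping.lookup a x) * c)\<rparr>"

text \<open>\<open>k G \<otimes>\<^bsub>k H\<^esub> k\<close>\<close>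

definition permutation_module ::
  "'g monoid \<Rightarrow> 'g set
     \<Rightarrow> ('g \<Rightarrow>\<^sub>0 'k::field, (('g \<Rightarrow>\<^sub>0 'k) \<times> 'k \<Rightarrow>\<^sub>0 int) set) module" where
  "permutation_module G H =
     tensor_product (regular_module (group_algebra G)) (\<otimes>\<^bsub>group_algebra G\<^esub>)
       (group_algebra (G\<lparr>carrier := H\<rparr>)) trivial_module"

text \<open>
  The \<open>k\<close>-dual of a left \<open>k G\<close>-module, with \<open>(g f) x = f (g\<^sup>-\<^sup>1 x)\<close> for \<open>g\<close> in \<open>G\<close>. Scalars of \<open>k\<close> act
  through the multiples of the identity of \<open>G\<close>.
\<close>

definition dual_module ::
  "'g monoid \<Rightarrow> ('g \<Rightarrow>\<^sub>0 'k::field, 'm) module \<Rightarrow> ('g \<Rightarrow>\<^sub>0 'k, 'm \<Rightarrow> 'k) module" where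
  "dual_module G M = \<lparr>
     carrier = {f \<in> extensional (carrier M).
       (\<forall>x\<in>carrier M. \<forall>y\<in>carrier M. f (x \<oplus>\<^bsub>M\<^esub> y) = f x + f y) \<and>
       (\<forall>c. \<forall>x\<in>carrier M. f (Poly_Mapping.single \<one>\<^bsub>G\<^esub> c \<odot>\<^bsub>M\<^esub> x) = c * f x)},
     mult = undefined, one = undefined,
     zero = (\<lambda>x\<in>carrier M. 0),
     add = (\<lambda>f h. \<lambda>x\<in>carrier M. f x + h x),
     smult = (\<lambda>a f. \<lambda>x\<in>carrier M. \<Sum>g\<in>Poly_Mapping.keys a.
       Poly_Mapping.lookup a g * f (Poly_Mapping.single (inv\<^bsub>G\<^esub> g) 1 \<odot>\<^bsub>M\<^esub> x))\<rparr>"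

definition double_coset_reps ::
  "'g monoid \<Rightarrow> 'g set \<Rightarrow> 'g set \<Rightarrow> nat \<Rightarrow> (nat \<Rightarrow> 'g) \<Rightarrow> bool" where
  "double_coset_reps G H K q p \<longleftrightarrow> (\<forall>i\<in>{1..q}. p i \<in> carrier G) \<and>
     bij_betw (\<lambda>i. H <#>\<^bsub>G\<^esub> (p i <#\<^bsub>G\<^esub> K)) {1..q} ((\<lambda>g. H <#>\<^bsub>G\<^esub> (g <#\<^bsub>G\<^esub> K)) ` carrier G)"


section \<open>Symmetric groups, Young subgroups and Specht modules\<close>

text \<open>
  Multiplication is concatenation of diagrams, that is, \<open>\<sigma> \<otimes> \<tau>\<close> is first \<open>\<sigma>\<close>, then \<open>\<tau>\<close>. Consequently the
  left action on dots is \<open>(\<sigma>, i) \<mapsto> \<sigma>\<^sup>-\<^sup>1 i\<close>.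
\<close>

definition symmetric_group :: "nat \<Rightarrow> (nat \<Rightarrow> nat) monoid" where
  "symmetric_group m = \<lparr>carrier = {\<sigma>. \<sigma> permutes {1..m}}, mult = (\<lambda>\<sigma> \<tau>. \<tau> \<circ> \<sigma>), one = id\<rparr>"

definition is_partition :: "nat list \<Rightarrow> nat \<Rightarrow> bool" where
  "is_partition lam m \<longleftrightarrow> sorted_wrt (\<ge>) lam \<and> 0 \<notin> set lam \<and> sum_list lam = m"

definition young_subgroup :: "nat list \<Rightarrow> (nat \<Rightarrow> nat) set" where
  "young_subgroup lam = {\<sigma>. \<sigma> permutes {1..sum_list lam} \<and>
     (\<forall>i<length lam. \<sigma> ` {sum_list (take i lam)<..sum_list (take (Suc i) lam)} =
       {sum_list (take i lam)<..sum_list (take (Suc i) lam)})}"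

definition young_diagram :: "nat list \<Rightarrow> (nat \<times> nat) set" where
  "young_diagram \<mu> = {(i, j). i < length \<mu> \<and> j < \<mu> ! i}"

definition tableaux :: "nat list \<Rightarrow> (nat \<times> nat \<Rightarrow> nat) set" where
  "tableaux \<mu> = {t \<in> extensional (young_diagram \<mu>). bij_betw t (young_diagram \<mu>) {1..sum_list \<mu>}}"

definition row_entries :: "nat list \<Rightarrow> (nat \<times> nat \<Rightarrow> nat) \<Rightarrow> nat \<Rightarrow> nat set" where
  "row_entries \<mu> t i = t ` {x \<in> young_diagram \<mu>. fst x = i}"

definition column_entries :: "nat list \<Rightarrow> (nat \<times> nat \<Rightarrow> nat) \<Rightarrow> nat \<Rightarrow> nat set" where
  "column_entries \<mu> t j = t ` {x \<in> young_diagram \<mu>. snd x = j}"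

definition tabloid :: "nat list \<Rightarrow> (nat \<times> nat \<Rightarrow> nat) \<Rightarrow> (nat \<times> nat \<Rightarrow> nat) set" where
  "tabloid \<mu> t = {s \<in> tableaux \<mu>. \<forall>i. row_entries \<mu> s i = row_entries \<mu> t i}"

definition tabloid_act ::
  "nat list \<Rightarrow> (nat \<Rightarrow> nat) \<Rightarrow> (nat \<times> nat \<Rightarrow> nat) set \<Rightarrow> (nat \<times> nat \<Rightarrow> nat) set" where
  "tabloid_act \<mu> \<sigma> T =
     (\<lambda>t. \<lambda>x\<in>young_diagram \<mu>. (inv\<^bsub>symmetric_group (sum_list \<mu>)\<^esub> \<sigma>) (t x)) ` T"

definition tabloid_module ::
  "nat list \<Rightarrow> ((nat \<Rightarrow> nat) \<Rightarrow>\<^sub>0 'k::field, (nat \<times> nat \<Rightarrow> nat) set \<Rightarrow>\<^sub>0 'k) module" where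
  "tabloid_module \<mu> = \<lparr>
     carrier = {v. Poly_Mapping.keys v \<subseteq> tabloid \<mu> ` tableaux \<mu>},
     mult = undefined, one = undefined, zero = 0, add = (+),
     smult = (\<lambda>a v. \<Sum>\<sigma>\<in>Poly_Mapping.keys a. \<Sum>T\<in>Poly_Mapping.keys v.
       Poly_Mapping.single (tabloid_act \<mu> \<sigma> T)
         (Poly_Mapping.lookup a \<sigma> * Poly_Mapping.lookup v T))\<rparr>"

definition column_stabilizer :: "nat list \<Rightarrow> (nat \<times> nat \<Rightarrow> nat) \<Rightarrow> (nat \<Rightarrow> nat) set" where
  "column_stabilizer \<mu> t = {\<sigma>. \<sigma> permutes {1..sum_list \<mu>} \<and>
     (\<forall>j. \<sigma> ` column_entries \<mu> t j = column_entries \<mu> t j)}"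

definition polytabloid ::
  "nat list \<Rightarrow> (nat \<times> nat \<Rightarrow> nat) \<Rightarrow> ((nat \<times> nat \<Rightarrow> nat) set \<Rightarrow>\<^sub>0 'k::field)" where
  "polytabloid \<mu> t = (\<Sum>\<sigma>\<in>column_stabilizer \<mu> t.
     Poly_Mapping.single (tabloid_act \<mu> \<sigma> (tabloid \<mu> t)) (of_int (sign \<sigma>)))"

definition specht_module ::
  "nat list \<Rightarrow> ((nat \<Rightarrow> nat) \<Rightarrow>\<^sub>0 'k::field, (nat \<times> nat \<Rightarrow> nat) set \<Rightarrow>\<^sub>0 'k) module" where
  "specht_module \<mu> = (tabloid_module \<mu>)\<lparr>carrier :=
     \<Inter>{N. submodule N (group_algebra (symmetric_group (sum_list \<mu>)) :: (_ \<Rightarrow>\<^sub>0 'k) ring)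
             (tabloid_module \<mu>) \<and> polytabloid \<mu> ` tableaux \<mu> \<subseteq> N}\<rparr>"

definition dual_specht_modules ::
  "nat \<Rightarrow> ((nat \<Rightarrow> nat) \<Rightarrow>\<^sub>0 'k::field, ((nat \<times> nat \<Rightarrow> nat) set \<Rightarrow>\<^sub>0 'k) \<Rightarrow> 'k) module set" where
  "dual_specht_modules m =
     {dual_module (symmetric_group m) (specht_module \<mu>) | \<mu>. is_partition \<mu> m}"


section \<open>Partial diagrams\<close>

text \<open>A partial diagram is given by the set \<open>P\<close> of all its parts and the set \<open>L\<close> of labelled ones.\<close>

definition partial_diagram :: "nat \<Rightarrow> nat \<Rightarrow> nat set set \<Rightarrow> nat set set \<Rightarrow> bool" where
  "partial_diagram l n P L \<longleftrightarrow> partition_on {1..l} P \<and> L \<subseteq> P \<and> card L = n"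

definition diagram_stabilizer :: "nat \<Rightarrow> nat set set \<Rightarrow> nat set set \<Rightarrow> (nat \<Rightarrow> nat) set" where
  "diagram_stabilizer l P L =
     {\<sigma>. \<sigma> permutes {1..l} \<and> (\<lambda>A. \<sigma> ` A) ` L = L \<and> (\<lambda>A. \<sigma> ` A) ` (P - L) = P - L}"

definition part_number :: "nat set set \<Rightarrow> nat set \<Rightarrow> nat" where
  "part_number L A = card {B \<in> L. Min B \<le> Min A}"

definition labelled_part :: "nat set set \<Rightarrow> nat \<Rightarrow> nat set" where
  "labelled_part L j = (THE A. A \<in> L \<and> part_number L A = j)"

text \<open>The permutation of the numbers of the labelled parts induced by \<open>\<zeta>\<close>.\<close>

definition induced_perm :: "nat set set \<Rightarrow> (nat \<Rightarrow> nat) \<Rightarrow> nat \<Rightarrow> nat" where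
  "induced_perm L \<zeta> j =
     (if j \<in> {1..card L} then part_number L (\<zeta> ` labelled_part L j) else j)"

end

theory Submission
  imports Defs
begin

text \<open>
  All modules in sight are permutation modules. If a subgroup \<open>H\<close> acts on \<open>X\<close> and maps to \<open>G\<close> by \<open>\<rho>\<close>, then
  \<open>k G \<otimes>\<^bsub>k H\<^esub> k X\<close> is the permutation module on \<open>G \<times>\<^bsub>H\<^esub> X\<close>. Cosets of the Young subgroup of \<open>\<lambda>\<close> are
  colourings of the dots; a representative \<open>\<pi> i\<close> gives a colouring \<open>\<chi> i\<close>, and listing the colour types of the
  labelled parts gives a word \<open>\<tau> i\<close> of length \<open>n\<close>, whose stabilizer is \<open>\<nu> i\<close>. Hence both sides are the
  permutation module on the disjoint union of the orbits of the words \<open>\<tau> i\<close>.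

  For the filtration, let \<open>T\<close> be a semistandard tableau of shape \<open>\<mu>\<close>, with content that of the words. Row
  symmetrization of \<open>T\<close> defines a homomorphism \<open>\<theta> T\<close> from the tabloid module of \<open>\<mu>\<close> to the module of words.
  Pairing with column antisymmetrizers shows that, if the \<open>T\<close> are suitably ordered, \<open>\<theta> T m\<close> can lie in the sum
  of the images of the earlier homomorphisms only if \<open>m\<close> is orthogonal to the Specht module of \<open>\<mu>\<close>. So the layers
  of the chain of these sums are at least as large as the duals of the Specht modules. On the other hand, there are
  at least as many pairs of a standard and a semistandard tableau of the same shape as there are words, by
  the commutation of adding a box with removing a horizontal strip. For dimension reasons the layers are
  exactly the dual Specht modules; no straightening is needed and the characteristic plays no role.
\<close>

section \<open>Linear algebra of finitely supported functions\<close>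

text \<open>Dual Specht modules appear as quotients of tabloid modules: for an invariant
  nondegenerate form, the quotient by the orthogonal complement of a submodule S is the dual of S.
  Two numbers order the tableaux. Shapes are compared by the sum of the row indices of their boxes,
  in the role of the dominance order: letters placed in rows such that each column of a given
  tableau meets every row at most once have at least the row sum of that tableau, with equality only
  if they again fill its diagram. Tableaux of one shape are compared by the sum over the boxes of
  row index times entry; by the rearrangement inequality, a nontrivial column permutation of a
  semistandard tableau makes it smaller. All pairings are computed over the integers, and those on
  the diagonal are 1, so they survive in every field. Independence shows that there are at most as
  many pairs of tableaux as words; the count gives the opposite inequality, and equality bounds all
  layers from above at once. Since permutations multiply by concatenation, the left action on words
  is precomposition without an inverse.\<close>

abbreviation "keys \<equiv> Poly_Mapping.keys"
abbreviation "lookup \<equiv> Poly_Mapping.lookup"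
abbreviation "single \<equiv> Poly_Mapping.single"

definition scl :: "'k::field \<Rightarrow> ('a \<Rightarrow>\<^sub>0 'k) \<Rightarrow> ('a \<Rightarrow>\<^sub>0 'k)" where
  "scl c v = Poly_Mapping.map ((*) c) v"

lemma lookup_scl [simp]: "lookup (scl c v) x = c * lookup v x"
  unfolding scl_def by (simp add: Poly_Mapping.map.rep_eq when_def)

lemma scl_single [simp]: "scl c (single x d) = single x (c * d)"
  by (rule poly_mapping_eqI) (simp add: lookup_single when_def)

interpretation pm: vector_space "scl :: 'k::field \<Rightarrow> ('a \<Rightarrow>\<^sub>0 'k) \<Rightarrow> ('a \<Rightarrow>\<^sub>0 'k)"
  by standard (auto intro!: poly_mapping_eqI simp: lookup_add algebra_simps)

lemma keys_scl: "keys (scl c v) \<subseteq> keys v"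
  by (auto simp: in_keys_iff)

lemma keys_addI: "keys a \<subseteq> X \<Longrightarrow> keys b \<subseteq> X \<Longrightarrow> keys (a + b) \<subseteq> X"
  using Poly_Mapping.keys_add[of a b] by auto

text \<open>The linear map that takes the basis vector of \<open>x\<close> to
  \<open>u x\<close>.\<close>

definition lin :: "('a \<Rightarrow> 'b \<Rightarrow>\<^sub>0 'k::field) \<Rightarrow> ('a \<Rightarrow>\<^sub>0 'k) \<Rightarrow> ('b \<Rightarrow>\<^sub>0 'k)" where
  "lin u a = (\<Sum>x\<in>keys a. scl (lookup a x) (u x))"

text \<open>Cancellation can shrink the support of a sum; summing over any finite superset is what
  makes additivity of \<open>lin\<close> a termwise identity.\<close>

lemma lin_superset:
  assumes "finite S" "keys a \<subseteq> S"
  shows "lin u a = (\<Sum>x\<in>S. scl (lookup a x) (u x))"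
  unfolding lin_def by (rule sum.mono_neutral_left) (use assms in \<open>auto simp: in_keys_iff\<close>)

lemma lin_add: "lin u (a + b) = lin u a + lin u b"
proof -
  have "keys (a + b) \<subseteq> keys a \<union> keys b" by (rule Poly_Mapping.keys_add)
  then show ?thesis
    by (simp add: lin_superset[of "keys a \<union> keys b"] lookup_add pm.scale_left_distrib sum.distrib)
qed

lemma lin_zero [simp]: "lin u 0 = 0"
  by (simp add: lin_def)

lemma lin_scl: "lin u (scl c a) = scl c (lin u a)"
  using keys_scl[of c a] by (simp add: lin_superset[of "keys a"] pm.scale_sum_right)

lemma lin_diff: "lin u (a - b) = lin u a - lin u b"
  by (metis add_diff_cancel_left' diff_add_cancel lin_add add.commute)

lemma lin_sum: "lin u (\<Sum>i\<in>I. a i) = (\<Sum>i\<in>I. lin u (a i))"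
  by (induction I rule: infinite_finite_induct) (auto simp: lin_add)

lemma lin_single [simp]: "lin u (single x c) = scl c (u x)"
  by (simp add: lin_def)

lemma lin_expand: "lin (\<lambda>x. single x 1) a = a"
  by (rule poly_mapping_eqI)
     (simp add: lin_def lookup_sum lookup_single when_def sum.delta not_in_keys_iff_lookup_eq_zero
       in_keys_iff if_distrib [of "\<lambda>z. _ * z"] cong: if_cong)

lemma lin_cong: "(\<And>x. x \<in> keys a \<Longrightarrow> u x = w x) \<Longrightarrow> lin u a = lin w a"
  by (simp add: lin_def)

lemma lin_lin: "lin u (lin w a) = lin (\<lambda>x. lin u (w x)) a"
  by (simp add: lin_def[of w] lin_def[of "\<lambda>x. lin u (w x)"] lin_sum lin_scl)

lemma lin_fun_add: "lin (\<lambda>x. u x + w x) a = lin u a + lin w a"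
  by (simp add: lin_def pm.scale_right_distrib sum.distrib)

lemma lin_fun_scl: "lin (\<lambda>x. scl c (u x)) a = scl c (lin u a)"
  by (simp add: lin_def pm.scale_sum_right mult.commute)

lemma keys_lin: "(\<And>x. x \<in> keys a \<Longrightarrow> keys (u x) \<subseteq> X) \<Longrightarrow> keys (lin u a) \<subseteq> X"
  unfolding lin_def using keys_sum[of "\<lambda>x. scl (lookup a x) (u x)" "keys a"] keys_scl by fastforce

lemma lookup_lin: "lookup (lin u a) y = (\<Sum>x\<in>keys a. lookup a x * lookup (u x) y)"
  by (simp add: lin_def lookup_sum)

text \<open>The bilinear extension of \<open>f\<close>. According to the choice of \<open>f\<close>
  it is the product of the group algebra, the action on a permutation module, or the map from pairs
  to an amalgamated product.\<close>

definition conv :: "('a \<Rightarrow> 'b \<Rightarrow> 'c) \<Rightarrow> ('a \<Rightarrow>\<^sub>0 'k::field) \<Rightarrow> ('b \<Rightarrow>\<^sub>0 'k) \<Rightarrow> ('c \<Rightarrow>\<^sub>0 'k)" where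
  "conv f a b = lin (\<lambda>x. lin (\<lambda>y. single (f x y) 1) b) a"

lemma conv_eq: "conv f a b = (\<Sum>x\<in>keys a. \<Sum>y\<in>keys b. single (f x y) (lookup a x * lookup b y))"
  by (simp add: conv_def lin_def pm.scale_sum_right)

lemma conv_add_left: "conv f (a + a') b = conv f a b + conv f a' b"
  by (simp add: conv_def lin_add)

lemma conv_add_right: "conv f a (b + b') = conv f a b + conv f a b'"
  by (simp add: conv_def lin_add lin_fun_add)

lemma conv_scl_left: "conv f (scl c a) b = scl c (conv f a b)"
  by (simp add: conv_def lin_scl)

lemma conv_zero [simp]: "conv f 0 b = 0" "conv f a 0 = 0"
  by (simp_all add: conv_eq)

lemma conv_single_left: "conv f (single x c) b = scl c (lin (\<lambda>y. single (f x y) 1) b)"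
  by (simp add: conv_def)

lemma conv_single [simp]: "conv f (single x c) (single y d) = single (f x y) (c * d)"
  by (simp add: conv_def)

text \<open>Four different maps are allowed so that this one identity covers associativity of the
  algebra, the module law and the equivariance of maps between permutation modules.\<close>

lemma conv_assoc:
  assumes "\<And>x y z. x \<in> keys a \<Longrightarrow> y \<in> keys b \<Longrightarrow> z \<in> keys c \<Longrightarrow> f (g x y) z = f' x (g' y z)"
  shows "conv f (conv g a b) c = conv f' a (conv g' b c)"
  unfolding conv_def using assms by (auto simp: lin_lin intro!: lin_cong)

lemma conv_unit:
  assumes "\<And>y. y \<in> keys b \<Longrightarrow> f e y = y"
  shows "conv f (single e 1) b = b"
proof -
  have "lin (\<lambda>y. single (f e y) 1) b = lin (\<lambda>y. single y 1) b"
    by (rule lin_cong) (simp add: assms)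
  then show ?thesis by (simp add: conv_single_left lin_expand)
qed

lemma conv_unit_right:
  assumes "\<And>x. x \<in> keys a \<Longrightarrow> f x e = x"
  shows "conv f a (single e 1) = a"
proof -
  have "lin (\<lambda>x. single (f x e) 1) a = lin (\<lambda>x. single x 1) a"
    by (rule lin_cong) (simp add: assms)
  then show ?thesis by (simp add: conv_def lin_expand)
qed

lemma keys_conv:
  assumes "\<And>x y. x \<in> keys a \<Longrightarrow> y \<in> keys b \<Longrightarrow> f x y \<in> Z"
  shows "keys (conv f a b) \<subseteq> Z"
  unfolding conv_def by (intro keys_lin) (auto simp: assms)

text \<open>Equivariance is tested on a group element and a basis vector only; linearity extends it
  to the whole algebra.\<close>

lemma lin_conv:
  assumes "\<And>x y. x \<in> keys a \<Longrightarrow> y \<in> keys b \<Longrightarrow> u (f x y) = conv f' (single x 1) (u y)"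
  shows "lin u (conv f a b) = conv f' a (lin u b)"
proof -
  have "lin u (conv f a b) = lin (\<lambda>x. lin (\<lambda>y. u (f x y)) b) a"
    by (simp add: conv_def lin_lin)
  also have "\<dots> = lin (\<lambda>x. lin (\<lambda>y. lin (\<lambda>z. single (f' x z) 1) (u y)) b) a"
    using assms by (intro lin_cong) (simp add: conv_single_left)
  also have "\<dots> = conv f' a (lin u b)"
    by (simp add: conv_def lin_lin)
  finally show ?thesis .
qed

section \<open>Group algebras and permutation representations\<close>

text \<open>The module k X. With \<open>X\<close> the group itself and \<open>act\<close> its
  multiplication it is the regular module. No action laws are built in; they come from
  \<open>group_set\<close>.\<close>

definition perm_rep ::
  "('g \<Rightarrow> 'x \<Rightarrow> 'x) \<Rightarrow> 'x set \<Rightarrow> ('g \<Rightarrow>\<^sub>0 'k::field, 'x \<Rightarrow>\<^sub>0 'k) module" where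
  "perm_rep act X = \<lparr>carrier = {v. keys v \<subseteq> X}, mult = undefined, one = undefined, zero = 0,
     add = (+), smult = conv act\<rparr>"

locale group_set = group G for G :: "'a monoid" (structure) +
  fixes act :: "'a \<Rightarrow> 'x \<Rightarrow> 'x" and X :: "'x set"
  assumes act_closed: "g \<in> carrier G \<Longrightarrow> x \<in> X \<Longrightarrow> act g x \<in> X"
    and act_one: "x \<in> X \<Longrightarrow> act \<one> x = x"
    and act_mult: "g \<in> carrier G \<Longrightarrow> h \<in> carrier G \<Longrightarrow> x \<in> X \<Longrightarrow> act (g \<otimes> h) x = act g (act h x)"

lemma group_algebra_simps:
  "carrier (group_algebra G) = {a. keys a \<subseteq> carrier G}"
  "mult (group_algebra G) = conv (mult G)"
  "one (group_algebra G) = single (one G) 1"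
  "zero (group_algebra G) = 0"
  "add (group_algebra G) = (+)"
  by (simp_all add: group_algebra_def conv_eq fun_eq_iff)

lemma perm_rep_simps:
  "carrier (perm_rep act X) = {v. keys v \<subseteq> X}" "zero (perm_rep act X) = 0"
  "add (perm_rep act X) = (+)" "smult (perm_rep act X) = conv act"
  by (simp_all add: perm_rep_def)

lemma abelian_group_perm_rep:
  "abelian_group (perm_rep act X :: ('g \<Rightarrow>\<^sub>0 'k::field, 'x \<Rightarrow>\<^sub>0 'k) module)"
proof (rule abelian_groupI)
  fix x :: "'x \<Rightarrow>\<^sub>0 'k"
  assume "x \<in> carrier (perm_rep act X)"
  then show "\<exists>y\<in>carrier (perm_rep act X). y \<oplus>\<^bsub>perm_rep act X\<^esub> x = \<zero>\<^bsub>perm_rep act X\<^esub>"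
    by (intro bexI[of _ "- x"]) (auto simp: perm_rep_simps)
qed (auto simp: perm_rep_simps keys_addI add_ac)

lemma ring_group_algebra:
  assumes "group G"
  shows "ring (group_algebra G :: ('g \<Rightarrow>\<^sub>0 'k::field) ring)"
proof -
  interpret group G by fact
  show ?thesis
  proof (rule ringI)
    show "abelian_group (group_algebra G :: ('g \<Rightarrow>\<^sub>0 'k) ring)"
    proof (rule abelian_groupI)
      fix x :: "'g \<Rightarrow>\<^sub>0 'k"
      assume "x \<in> carrier (group_algebra G)"
      then show "\<exists>y\<in>carrier (group_algebra G). y \<oplus>\<^bsub>group_algebra G\<^esub> x = \<zero>\<^bsub>group_algebra G\<^esub>"
        by (intro bexI[of _ "- x"]) (auto simp: group_algebra_simps)
    qed (auto simp: group_algebra_simps keys_addI add_ac)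
    show "monoid (group_algebra G :: ('g \<Rightarrow>\<^sub>0 'k) ring)"
    proof (rule monoidI)
      fix x y z :: "'g \<Rightarrow>\<^sub>0 'k"
      assume x: "x \<in> carrier (group_algebra G)" and y: "y \<in> carrier (group_algebra G)"
        and z: "z \<in> carrier (group_algebra G)"
      show "x \<otimes>\<^bsub>group_algebra G\<^esub> y \<in> carrier (group_algebra G)"
        using x y by (auto simp: group_algebra_simps intro!: keys_conv)
      show "x \<otimes>\<^bsub>group_algebra G\<^esub> y \<otimes>\<^bsub>group_algebra G\<^esub> z = x \<otimes>\<^bsub>group_algebra G\<^esub> (y \<otimes>\<^bsub>group_algebra G\<^esub> z)"
        using x y z by (auto simp: group_algebra_simps subset_eq m_assoc intro!: conv_assoc)
    next
      fix x :: "'g \<Rightarrow>\<^sub>0 'k" assume x: "x \<in> carrier (group_algebra G)"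
      show "\<one>\<^bsub>group_algebra G\<^esub> \<otimes>\<^bsub>group_algebra G\<^esub> x = x"
        using x by (auto simp: group_algebra_simps subset_eq intro!: conv_unit)
      show "x \<otimes>\<^bsub>group_algebra G\<^esub> \<one>\<^bsub>group_algebra G\<^esub> = x"
        using x by (auto simp: group_algebra_simps subset_eq intro!: conv_unit_right)
    qed (auto simp: group_algebra_simps)
  qed (auto simp: group_algebra_simps conv_add_left conv_add_right)
qed

lemma (in group_set) left_module_perm_rep:
  "left_module (group_algebra G :: ('a \<Rightarrow>\<^sub>0 'k::field) ring) (perm_rep act X)"
proof -
  interpret R: ring "group_algebra G :: ('a \<Rightarrow>\<^sub>0 'k) ring"
    by (rule ring_group_algebra) (rule is_group)
  interpret M: abelian_group "perm_rep act X :: ('a \<Rightarrow>\<^sub>0 'k, 'x \<Rightarrow>\<^sub>0 'k) module"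
    by (rule abelian_group_perm_rep)
  show ?thesis
  proof
    fix a b :: "'a \<Rightarrow>\<^sub>0 'k" and x y :: "'x \<Rightarrow>\<^sub>0 'k"
    assume a: "a \<in> carrier (group_algebra G)" and b: "b \<in> carrier (group_algebra G)"
      and x: "x \<in> carrier (perm_rep act X)"
    show "(a \<otimes>\<^bsub>group_algebra G\<^esub> b) \<odot>\<^bsub>perm_rep act X\<^esub> x = a \<odot>\<^bsub>perm_rep act X\<^esub> (b \<odot>\<^bsub>perm_rep act X\<^esub> x)"
      using a b x by (auto simp: group_algebra_simps perm_rep_simps subset_eq act_mult intro!: conv_assoc)
  next
    fix a :: "'a \<Rightarrow>\<^sub>0 'k" and x :: "'x \<Rightarrow>\<^sub>0 'k"
    assume a: "a \<in> carrier (group_algebra G)" and x: "x \<in> carrier (perm_rep act X)"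
    show "a \<odot>\<^bsub>perm_rep act X\<^esub> x \<in> carrier (perm_rep act X)"
      using a x by (auto simp: group_algebra_simps perm_rep_simps intro!: keys_conv act_closed)
  next
    fix x :: "'x \<Rightarrow>\<^sub>0 'k"
    assume x: "x \<in> carrier (perm_rep act X)"
    show "\<one>\<^bsub>group_algebra G\<^esub> \<odot>\<^bsub>perm_rep act X\<^esub> x = x"
      using x by (auto simp: group_algebra_simps perm_rep_simps subset_eq act_one intro!: conv_unit)
  qed (auto simp: group_algebra_simps perm_rep_simps conv_add_left conv_add_right)
qed

section \<open>Images and isomorphisms of modules\<close>

text \<open>\<open>M\<close> is only a record here: its laws are inherited from \<open>N\<close>
  along the surjection \<open>p\<close>. In this way quotients and tensor products become modules
  without a direct check of the axioms.\<close>

lemma left_module_image: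
  assumes "left_module R N" and img: "p ` carrier N = carrier M"
    and z: "p \<zero>\<^bsub>N\<^esub> = \<zero>\<^bsub>M\<^esub>"
    and add: "\<And>x y. x \<in> carrier N \<Longrightarrow> y \<in> carrier N \<Longrightarrow> p (x \<oplus>\<^bsub>N\<^esub> y) = p x \<oplus>\<^bsub>M\<^esub> p y"
    and sm: "\<And>a x. a \<in> carrier R \<Longrightarrow> x \<in> carrier N \<Longrightarrow> p (a \<odot>\<^bsub>N\<^esub> x) = a \<odot>\<^bsub>M\<^esub> p x"
  shows "left_module R M"
proof -
  interpret N: left_module R N by fact
  have ex: "\<And>x. x \<in> carrier M \<Longrightarrow> \<exists>x'\<in>carrier N. x = p x'" using img by auto
  have cl: "\<And>x. x \<in> carrier N \<Longrightarrow> p x \<in> carrier M" using img by auto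
  have addR: "\<And>x y. x \<in> carrier N \<Longrightarrow> y \<in> carrier N \<Longrightarrow> p x \<oplus>\<^bsub>M\<^esub> p y = p (x \<oplus>\<^bsub>N\<^esub> y)"
    by (simp add: add)
  have smR: "\<And>a x. a \<in> carrier R \<Longrightarrow> x \<in> carrier N \<Longrightarrow> a \<odot>\<^bsub>M\<^esub> p x = p (a \<odot>\<^bsub>N\<^esub> x)"
    by (simp add: sm)
  interpret M: abelian_group M
  proof (rule abelian_groupI)
    fix x y z assume "x \<in> carrier M" "y \<in> carrier M" "z \<in> carrier M"
    then show "x \<oplus>\<^bsub>M\<^esub> y \<oplus>\<^bsub>M\<^esub> z = x \<oplus>\<^bsub>M\<^esub> (y \<oplus>\<^bsub>M\<^esub> z)"
      by (auto dest!: ex simp: addR N.M.a_assoc)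
  next
    fix x y assume "x \<in> carrier M" "y \<in> carrier M"
    then show "x \<oplus>\<^bsub>M\<^esub> y \<in> carrier M" by (auto dest!: ex simp: addR cl)
  next
    fix x y assume "x \<in> carrier M" "y \<in> carrier M"
    then show "x \<oplus>\<^bsub>M\<^esub> y = y \<oplus>\<^bsub>M\<^esub> x" by (auto dest!: ex simp: addR N.M.a_comm)
  next
    show "\<zero>\<^bsub>M\<^esub> \<in> carrier M" by (metis cl z N.M.zero_closed)
  next
    fix x assume "x \<in> carrier M"
    then show "\<zero>\<^bsub>M\<^esub> \<oplus>\<^bsub>M\<^esub> x = x" by (auto dest!: ex simp: addR z[symmetric])
  next
    fix x assume "x \<in> carrier M"
    then obtain x' where x': "x' \<in> carrier N" "x = p x'" using ex by blast
    then have "p (\<ominus>\<^bsub>N\<^esub> x') \<oplus>\<^bsub>M\<^esub> x = \<zero>\<^bsub>M\<^esub>" by (simp add: addR z N.M.l_neg)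
    then show "\<exists>y\<in>carrier M. y \<oplus>\<^bsub>M\<^esub> x = \<zero>\<^bsub>M\<^esub>" using cl N.M.a_inv_closed x'(1) by blast
  qed
  show ?thesis
  proof
    fix a x assume "a \<in> carrier R" "x \<in> carrier M"
    then show "a \<odot>\<^bsub>M\<^esub> x \<in> carrier M" by (auto dest!: ex simp: smR cl N.smult_closed)
  next
    fix a b x assume "a \<in> carrier R" "b \<in> carrier R" "x \<in> carrier M"
    then show "(a \<oplus>\<^bsub>R\<^esub> b) \<odot>\<^bsub>M\<^esub> x = a \<odot>\<^bsub>M\<^esub> x \<oplus>\<^bsub>M\<^esub> b \<odot>\<^bsub>M\<^esub> x"
      by (auto dest!: ex simp: smR addR N.smult_closed N.smult_l_distr)
  next
    fix a x y assume "a \<in> carrier R" "x \<in> carrier M" "y \<in> carrier M"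
    then show "a \<odot>\<^bsub>M\<^esub> (x \<oplus>\<^bsub>M\<^esub> y) = a \<odot>\<^bsub>M\<^esub> x \<oplus>\<^bsub>M\<^esub> a \<odot>\<^bsub>M\<^esub> y"
      by (auto dest!: ex simp: smR addR N.smult_closed N.smult_r_distr)
  next
    fix a b x assume "a \<in> carrier R" "b \<in> carrier R" "x \<in> carrier M"
    then show "(a \<otimes>\<^bsub>R\<^esub> b) \<odot>\<^bsub>M\<^esub> x = a \<odot>\<^bsub>M\<^esub> (b \<odot>\<^bsub>M\<^esub> x)"
      by (auto dest!: ex simp: smR N.smult_closed N.smult_assoc)
  next
    fix x assume "x \<in> carrier M"
    then show "\<one>\<^bsub>R\<^esub> \<odot>\<^bsub>M\<^esub> x = x"
      by (auto dest!: ex simp: smR N.smult_one)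
  qed
qed

text \<open>Here \<open>A\<close> only carries the operations: it is the free abelian group in the application to
  tensor products, which is not a module over the group algebra.\<close>

lemma module_isomorphic_common_cover:
  assumes N: "left_module R N"
    and p: "p ` A = carrier M" and p': "p' ` A = carrier N"
    and zA: "zA \<in> A" and z: "p zA = \<zero>\<^bsub>M\<^esub>" and z': "p' zA = \<zero>\<^bsub>N\<^esub>"
    and addA: "\<And>x y. x \<in> A \<Longrightarrow> y \<in> A \<Longrightarrow> addA x y \<in> A"
    and smA: "\<And>a x. a \<in> carrier R \<Longrightarrow> x \<in> A \<Longrightarrow> smA a x \<in> A"
    and add: "\<And>x y. x \<in> A \<Longrightarrow> y \<in> A \<Longrightarrow> p (addA x y) = p x \<oplus>\<^bsub>M\<^esub> p y"
    and add': "\<And>x y. x \<in> A \<Longrightarrow> y \<in> A \<Longrightarrow> p' (addA x y) = p' x \<oplus>\<^bsub>N\<^esub> p' y"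
    and sm: "\<And>a x. a \<in> carrier R \<Longrightarrow> x \<in> A \<Longrightarrow> p (smA a x) = a \<odot>\<^bsub>M\<^esub> p x"
    and sm': "\<And>a x. a \<in> carrier R \<Longrightarrow> x \<in> A \<Longrightarrow> p' (smA a x) = a \<odot>\<^bsub>N\<^esub> p' x"
    and ker: "\<And>x y. x \<in> A \<Longrightarrow> y \<in> A \<Longrightarrow> p x = p y \<longleftrightarrow> p' x = p' y"
  shows "module_isomorphic R M N"
proof -
  define f where "f m = p' (inv_into A p m)" for m
  define g where "g n = p (inv_into A p' n)" for n
  have inv: "inv_into A p (p x) \<in> A" "p (inv_into A p (p x)) = p x" if "x \<in> A" for x
    using that by (auto intro: inv_into_into f_inv_into_f)
  have inv': "inv_into A p' (p' x) \<in> A" "p' (inv_into A p' (p' x)) = p' x" if "x \<in> A" for x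
    using that by (auto intro: inv_into_into f_inv_into_f)
  \<comment> \<open>The hypothesis \<open>ker\<close> makes the choice of a preimage
    irrelevant.\<close>
  have f: "f (p x) = p' x" if "x \<in> A" for x
    unfolding f_def using that ker[OF inv(1)[OF that] that] inv by simp
  have g: "g (p' x) = p x" if "x \<in> A" for x
    unfolding g_def using that ker[OF inv'(1)[OF that] that] inv' by simp
  have exM: "\<And>x. x \<in> carrier M \<Longrightarrow> \<exists>x'\<in>A. x = p x'" using p by auto
  have exN: "\<And>x. x \<in> carrier N \<Longrightarrow> \<exists>x'\<in>A. x = p' x'" using p' by auto
  \<comment> \<open>Only \<open>N\<close> is known to be a module; its laws are moved to
    \<open>M\<close> by the inverse map \<open>g\<close>.\<close>
  have M: "left_module R M"
  proof (rule left_module_image[OF N, of g])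
    show "g ` carrier N = carrier M" unfolding p[symmetric] p'[symmetric] by (auto simp: g image_iff)
    show "g \<zero>\<^bsub>N\<^esub> = \<zero>\<^bsub>M\<^esub>" using g[OF zA] z z' by simp
  next
    fix x y assume "x \<in> carrier N" "y \<in> carrier N"
    then show "g (x \<oplus>\<^bsub>N\<^esub> y) = g x \<oplus>\<^bsub>M\<^esub> g y"
      by (auto dest!: exN simp: add'[symmetric] add addA g)
  next
    fix a x assume "a \<in> carrier R" "x \<in> carrier N"
    then show "g (a \<odot>\<^bsub>N\<^esub> x) = a \<odot>\<^bsub>M\<^esub> g x"
      by (auto dest!: exN simp: sm'[symmetric] sm smA g)
  qed
  have "bij_betw f (carrier M) (carrier N)"
  proof (rule bij_betwI[of f _ _ g])
    show "f \<in> carrier M \<rightarrow> carrier N" "g \<in> carrier N \<rightarrow> carrier M"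
      by (auto dest!: exM exN simp: f g) (use p p' in auto)
    show "\<And>x. x \<in> carrier M \<Longrightarrow> g (f x) = x" "\<And>y. y \<in> carrier N \<Longrightarrow> f (g y) = y"
      by (auto dest!: exM exN simp: f g)
  qed
  moreover have "f (x \<oplus>\<^bsub>M\<^esub> y) = f x \<oplus>\<^bsub>N\<^esub> f y" if "x \<in> carrier M" "y \<in> carrier M" for x y
    using that by (auto dest!: exM simp: add[symmetric] add' addA f)
  moreover have "f (a \<odot>\<^bsub>M\<^esub> x) = a \<odot>\<^bsub>N\<^esub> f x" if "a \<in> carrier R" "x \<in> carrier M" for a x
    using that by (auto dest!: exM simp: sm[symmetric] sm' smA f)
  ultimately show ?thesis unfolding module_isomorphic_def using M N by blast
qed

lemma module_isomorphic_common_module: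
  assumes A: "left_module R A"
    and p: "p ` carrier A = carrier M" and p': "p' ` carrier A = carrier N"
    and z: "p \<zero>\<^bsub>A\<^esub> = \<zero>\<^bsub>M\<^esub>" and z': "p' \<zero>\<^bsub>A\<^esub> = \<zero>\<^bsub>N\<^esub>"
    and add: "\<And>x y. x \<in> carrier A \<Longrightarrow> y \<in> carrier A \<Longrightarrow> p (x \<oplus>\<^bsub>A\<^esub> y) = p x \<oplus>\<^bsub>M\<^esub> p y"
    and add': "\<And>x y. x \<in> carrier A \<Longrightarrow> y \<in> carrier A \<Longrightarrow> p' (x \<oplus>\<^bsub>A\<^esub> y) = p' x \<oplus>\<^bsub>N\<^esub> p' y"
    and sm: "\<And>a x. a \<in> carrier R \<Longrightarrow> x \<in> carrier A \<Longrightarrow> p (a \<odot>\<^bsub>A\<^esub> x) = a \<odot>\<^bsub>M\<^esub> p x"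
    and sm': "\<And>a x. a \<in> carrier R \<Longrightarrow> x \<in> carrier A \<Longrightarrow> p' (a \<odot>\<^bsub>A\<^esub> x) = a \<odot>\<^bsub>N\<^esub> p' x"
    and ker: "\<And>x y. x \<in> carrier A \<Longrightarrow> y \<in> carrier A \<Longrightarrow> p x = p y \<longleftrightarrow> p' x = p' y"
  shows "module_isomorphic R M N"
proof -
  interpret A: left_module R A by fact
  have N: "left_module R N"
    by (rule left_module_image[OF A p' z']) (auto simp: add' sm')
  show ?thesis
    by (rule module_isomorphic_common_cover[OF N p p' _ z z', where addA="add A" and smA="smult A"])
       (auto simp: add add' sm sm' ker A.smult_closed)
qed

lemma module_isomorphic_zero:
  assumes M: "left_module R M" and N: "left_module R N"
    and f: "bij_betw f (carrier M) (carrier N)"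
     "\<And>x y. x\<in>carrier M \<Longrightarrow> y\<in>carrier M \<Longrightarrow> f (x \<oplus>\<^bsub>M\<^esub> y) = f x \<oplus>\<^bsub>N\<^esub> f y"
  shows "f \<zero>\<^bsub>M\<^esub> = \<zero>\<^bsub>N\<^esub>"
proof -
  interpret M: left_module R M by fact
  interpret N: left_module R N by fact
  show ?thesis
    using f(2)[of "\<zero>\<^bsub>M\<^esub>" "\<zero>\<^bsub>M\<^esub>"] f(1) bij_betwE[OF f(1)] by (simp add: N.M.add.r_cancel_one')
qed

text \<open>\<open>M\<close> covers both modules: \<open>N\<close> by \<open>f\<close>, and itself
  by the identity.\<close>

lemma module_isomorphic_sym: "module_isomorphic R M N \<Longrightarrow> module_isomorphic R N M"
proof -
  assume "module_isomorphic R M N"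
  then obtain f where M: "left_module R M" and N: "left_module R N"
    and f: "bij_betw f (carrier M) (carrier N)"
     "\<And>x y. x\<in>carrier M \<Longrightarrow> y\<in>carrier M \<Longrightarrow> f (x \<oplus>\<^bsub>M\<^esub> y) = f x \<oplus>\<^bsub>N\<^esub> f y"
     "\<And>a x. a\<in>carrier R \<Longrightarrow> x\<in>carrier M \<Longrightarrow> f (a \<odot>\<^bsub>M\<^esub> x) = a \<odot>\<^bsub>N\<^esub> f x"
    unfolding module_isomorphic_def by blast
  interpret M: left_module R M by fact
  have z: "f \<zero>\<^bsub>M\<^esub> = \<zero>\<^bsub>N\<^esub>"
    by (rule module_isomorphic_zero[OF M N f(1,2)])
  show ?thesis
    by (rule module_isomorphic_common_module[where A=M and p=f and p'=id])
       (use f M z in \<open>auto simp: bij_betw_def inj_on_def\<close>)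
qed

lemma module_isomorphic_trans:
  assumes "module_isomorphic R M N" "module_isomorphic R N K"
  shows "module_isomorphic R M K"
proof -
  obtain f where M: "left_module R M" and N: "left_module R N"
    and f: "bij_betw f (carrier M) (carrier N)"
     "\<And>x y. x\<in>carrier M \<Longrightarrow> y\<in>carrier M \<Longrightarrow> f (x \<oplus>\<^bsub>M\<^esub> y) = f x \<oplus>\<^bsub>N\<^esub> f y"
     "\<And>a x. a\<in>carrier R \<Longrightarrow> x\<in>carrier M \<Longrightarrow> f (a \<odot>\<^bsub>M\<^esub> x) = a \<odot>\<^bsub>N\<^esub> f x"
    using assms unfolding module_isomorphic_def by blast
  obtain g where K: "left_module R K"
    and g: "bij_betw g (carrier N) (carrier K)"
     "\<And>x y. x\<in>carrier N \<Longrightarrow> y\<in>carrier N \<Longrightarrow> g (x \<oplus>\<^bsub>N\<^esub> y) = g x \<oplus>\<^bsub>K\<^esub> g y"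
     "\<And>a x. a\<in>carrier R \<Longrightarrow> x\<in>carrier N \<Longrightarrow> g (a \<odot>\<^bsub>N\<^esub> x) = a \<odot>\<^bsub>K\<^esub> g x"
    using assms unfolding module_isomorphic_def by blast
  have "bij_betw (g \<circ> f) (carrier M) (carrier K)" using f g by (auto intro: bij_betw_trans)
  moreover have "\<And>x. x \<in> carrier M \<Longrightarrow> f x \<in> carrier N" using f bij_betwE by blast
  ultimately show ?thesis unfolding module_isomorphic_def using M K f g
    by (intro conjI exI[of _ "g \<circ> f"]) auto
qed

text \<open>Only the action of single elements \<open>a\<close> has to be additive, as needed for tensor products.\<close>

locale quotient_by = M?: abelian_group M for M :: "('r, 'm) module" (structure) +
  fixes H :: "'m set" and S :: "'r set"
  assumes sub: "subgroup H (add_monoid M)"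
    and act_closed: "a \<in> S \<Longrightarrow> x \<in> carrier M \<Longrightarrow> a \<odot> x \<in> carrier M"
    and act_add: "a \<in> S \<Longrightarrow> x \<in> carrier M \<Longrightarrow> y \<in> carrier M \<Longrightarrow> a \<odot> (x \<oplus> y) = a \<odot> x \<oplus> a \<odot> y"
    and act_H: "a \<in> S \<Longrightarrow> x \<in> H \<Longrightarrow> a \<odot> x \<in> H"
begin

sublocale Q: abelian_subgroup H M
  by (intro abelian_subgroupI3 additive_subgroup.intro sub M.abelian_group_axioms)

lemma quotient_carrier: "carrier (quotient_module M H) = (\<lambda>x. H +> x) ` carrier M"
  by (auto simp: quotient_module_def A_RCOSETS_defs a_r_coset_def)

lemma quotient_zero: "\<zero>\<^bsub>quotient_module M H\<^esub> = H +> \<zero>"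
  using M.a_coset_join2[OF M.zero_closed sub] subgroup.one_closed[OF sub]
  by (simp add: quotient_module_def)

lemma quotient_add:
  "x \<in> carrier M \<Longrightarrow> y \<in> carrier M \<Longrightarrow> (H +> x) \<oplus>\<^bsub>quotient_module M H\<^esub> (H +> y) = H +> (x \<oplus> y)"
  by (simp add: quotient_module_def Q.a_rcos_sum)

lemma coset_eq_iff:
  assumes "x \<in> carrier M" "y \<in> carrier M"
  shows "H +> x = H +> y \<longleftrightarrow> x \<ominus> y \<in> H"
proof
  assume "H +> x = H +> y"
  then have "x \<in> H +> y" using Q.a_rcos_self[OF assms(1)] by simp
  then obtain h where "h \<in> H" "x = h \<oplus> y" by (auto simp: a_r_coset_def')
  then show "x \<ominus> y \<in> H"
    using assms Q.a_subset by (auto simp: M.minus_eq M.a_assoc M.r_neg subset_eq)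
next
  assume *: "x \<ominus> y \<in> H"
  have "x = (x \<ominus> y) \<oplus> y" using assms by (simp add: M.minus_eq M.a_assoc M.l_neg)
  then have "x \<in> H +> y" using * unfolding a_r_coset_def' by blast
  then show "H +> x = H +> y" using assms M.a_repr_independence sub by metis
qed

text \<open>The definition adds \<open>H\<close> to the whole set of multiples of a coset; the extra
  multiples of elements of \<open>H\<close> are absorbed because \<open>H\<close> is stable under
  \<open>a\<close>.\<close>

lemma quotient_smult:
  assumes a: "a \<in> S" and x: "x \<in> carrier M"
  shows "a \<odot>\<^bsub>quotient_module M H\<^esub> (H +> x) = H +> (a \<odot> x)"
proof -
  have HM: "\<And>h. h \<in> H \<Longrightarrow> h \<in> carrier M" using Q.a_subset by auto
  have *: "h \<oplus> a \<odot> (h' \<oplus> x) = (h \<oplus> a \<odot> h') \<oplus> a \<odot> x" if "h \<in> H" "h' \<in> H" for h h'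
    using that a x by (simp add: act_add act_closed HM M.a_assoc)
  have H: "h \<oplus> a \<odot> h' \<in> H" if "h \<in> H" "h' \<in> H" for h h'
    using that a by (simp add: act_H)
  have z: "a \<odot> \<zero> = \<zero>"
    using act_add[OF a M.zero_closed M.zero_closed] act_closed[OF a M.zero_closed]
    by (simp add: M.add.r_cancel_one')
  have eq: "a \<odot>\<^bsub>quotient_module M H\<^esub> (H +> x) = {h \<oplus> a \<odot> (h' \<oplus> x) | h h'. h \<in> H \<and> h' \<in> H}"
    unfolding quotient_module_def a_r_coset_def' set_add_def' by auto
  show ?thesis
  proof (intro equalityI subsetI)
    fix u assume "u \<in> a \<odot>\<^bsub>quotient_module M H\<^esub> (H +> x)"
    then obtain h h' where h: "h \<in> H" "h' \<in> H" "u = h \<oplus> a \<odot> (h' \<oplus> x)" unfolding eq by auto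
    then have "u = (h \<oplus> a \<odot> h') \<oplus> a \<odot> x" using * by simp
    then show "u \<in> H +> a \<odot> x" using H[OF h(1,2)] unfolding a_r_coset_def' by blast
  next
    fix u assume "u \<in> H +> a \<odot> x"
    then obtain h where h: "h \<in> H" "u = h \<oplus> a \<odot> x" unfolding a_r_coset_def' by blast
    then have "u = h \<oplus> a \<odot> (\<zero> \<oplus> x)" using x by simp
    then show "u \<in> a \<odot>\<^bsub>quotient_module M H\<^esub> (H +> x)" unfolding eq using h Q.zero_closed by blast
  qed
qed

end

section \<open>Tensor products with permutation representations\<close>

text \<open>The additive map out of the free abelian group with values \<open>u\<close> on the
  generators; integer multiplicities enter the field through \<open>of_int\<close>.\<close>

definition frag_lin :: "('a \<Rightarrow> 'b \<Rightarrow>\<^sub>0 'k::field) \<Rightarrow> ('a \<Rightarrow>\<^sub>0 int) \<Rightarrow> ('b \<Rightarrow>\<^sub>0 'k)" where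
  "frag_lin u c = (\<Sum>i\<in>keys c. scl (of_int (lookup c i)) (u i))"

lemma frag_lin_superset:
  assumes "finite S" "keys c \<subseteq> S"
  shows "frag_lin u c = (\<Sum>x\<in>S. scl (of_int (lookup c x)) (u x))"
  unfolding frag_lin_def by (rule sum.mono_neutral_left) (use assms in \<open>auto simp: in_keys_iff\<close>)

lemma frag_lin_add: "frag_lin u (a + b) = frag_lin u a + frag_lin u b"
proof -
  have "keys (a + b) \<subseteq> keys a \<union> keys b" by (rule Poly_Mapping.keys_add)
  then show ?thesis
    by (simp add: frag_lin_superset[of "keys a \<union> keys b"] lookup_add pm.scale_left_distrib sum.distrib)
qed

lemma frag_lin_zero [simp]: "frag_lin u 0 = 0"
  by (simp add: frag_lin_def)

lemma frag_lin_diff: "frag_lin u (a - b) = frag_lin u a - frag_lin u b"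
  by (metis add_diff_cancel_right' diff_add_cancel frag_lin_add)

lemma frag_lin_uminus: "frag_lin u (- a) = - frag_lin u a"
  using frag_lin_diff[of u 0 a] by simp

lemma frag_lin_of [simp]: "frag_lin u (frag_of i) = u i"
  by (simp add: frag_lin_def keys_frag_of)

lemma frag_lin_sum: "frag_lin u (\<Sum>i\<in>I. a i) = (\<Sum>i\<in>I. frag_lin u (a i))"
  by (induction I rule: infinite_finite_induct) (auto simp: frag_lin_add)

lemma linear_ext_eq: "linear_ext f a = lin (\<lambda>x. single (f x) 1) a"
  by (simp add: linear_ext_def lin_def)

lemma regular_module_eq:
  "regular_module (group_algebra G) = perm_rep (mult G) (carrier G)"
  by (simp add: regular_module_def perm_rep_def group_algebra_simps)

text \<open>\<open>q\<close> presents \<open>Z\<close> as the amalgamated product of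
  \<open>G\<close> and \<open>X\<close> over \<open>H\<close>: by \<open>q_bal\<close> and
  \<open>q_eq\<close> its fibres are exactly the classes of (g \<rho>(h), x) ~ (g, h x). The module
  \<open>N\<close> is only isomorphic to k X by \<open>\<phi>\<close>, because in the application it
  is itself a tensor product.\<close>

locale tensor_perm = G?: group G + H?: group H + X?: group_set H actX X +
    N?: left_module "group_algebra H" N
  for G :: "'g monoid" (structure) and H :: "'h monoid" and actX :: "'h \<Rightarrow> 'x \<Rightarrow> 'x" and X
    and N :: "('h \<Rightarrow>\<^sub>0 'k::field, 'n) module" +
  fixes \<phi> :: "'n \<Rightarrow> 'x \<Rightarrow>\<^sub>0 'k" and \<rho> :: "'h \<Rightarrow> 'g"
    and act :: "('g \<Rightarrow>\<^sub>0 'k) \<Rightarrow> ('h \<Rightarrow>\<^sub>0 'k) \<Rightarrow> ('g \<Rightarrow>\<^sub>0 'k)"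
    and actZ :: "'g \<Rightarrow> 'z \<Rightarrow> 'z" and Z :: "'z set" and q :: "'g \<Rightarrow> 'x \<Rightarrow> 'z"
  assumes phi_bij: "bij_betw \<phi> (carrier N) {v. keys v \<subseteq> X}"
    and phi_add: "\<And>x y. x \<in> carrier N \<Longrightarrow> y \<in> carrier N \<Longrightarrow> \<phi> (x \<oplus>\<^bsub>N\<^esub> y) = \<phi> x + \<phi> y"
    and phi_smult: "\<And>a y. keys a \<subseteq> carrier H \<Longrightarrow> y \<in> carrier N \<Longrightarrow> \<phi> (a \<odot>\<^bsub>N\<^esub> y) = conv actX a (\<phi> y)"
    and rho_closed: "\<And>h. h \<in> carrier H \<Longrightarrow> \<rho> h \<in> carrier G"
    and rho_one: "\<rho> \<one>\<^bsub>H\<^esub> = \<one>"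
    and act_eq: "\<And>a b. keys a \<subseteq> carrier G \<Longrightarrow> keys b \<subseteq> carrier H \<Longrightarrow> act a b = conv (\<otimes>) a (linear_ext \<rho> b)"
    and q_closed: "\<And>g x. g \<in> carrier G \<Longrightarrow> x \<in> X \<Longrightarrow> q g x \<in> Z"
    and q_surj: "\<And>z. z \<in> Z \<Longrightarrow> \<exists>g\<in>carrier G. \<exists>x\<in>X. z = q g x"
    and q_mult: "\<And>g g' x. g \<in> carrier G \<Longrightarrow> g' \<in> carrier G \<Longrightarrow> x \<in> X \<Longrightarrow> q (g \<otimes> g') x = actZ g (q g' x)"
    and q_bal: "\<And>g h x. g \<in> carrier G \<Longrightarrow> h \<in> carrier H \<Longrightarrow> x \<in> X \<Longrightarrow> q (g \<otimes> \<rho> h) x = q g (actX h x)"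
    and q_eq: "\<And>g g' x x'. g \<in> carrier G \<Longrightarrow> g' \<in> carrier G \<Longrightarrow> x \<in> X \<Longrightarrow> x' \<in> X \<Longrightarrow>
        q g x = q g' x' \<Longrightarrow> \<exists>h\<in>carrier H. g = g' \<otimes> \<rho> h \<and> x' = actX h x"
begin

text \<open>\<open>actZ\<close> is not assumed to be an action: surjectivity of \<open>q\<close> and
  \<open>q_mult\<close> carry the laws over from left multiplication on \<open>G\<close>.\<close>

lemma group_set_Z: "group_set G actZ Z"
proof
  fix g z assume g: "g \<in> carrier G" and "z \<in> Z"
  then obtain g' x where z: "g' \<in> carrier G" "x \<in> X" "z = q g' x" using q_surj by blast
  then show "actZ g z \<in> Z"
    using q_mult[OF g z(1,2)] q_closed[of "g \<otimes> g'" x] g by simp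
next
  fix z assume "z \<in> Z"
  then obtain g' x where z: "g' \<in> carrier G" "x \<in> X" "z = q g' x" using q_surj by blast
  then show "actZ \<one> z = z" using q_mult[OF G.one_closed z(1,2)] by simp
next
  fix g h z assume g: "g \<in> carrier G" and h: "h \<in> carrier G" and "z \<in> Z"
  then obtain g' x where z: "g' \<in> carrier G" "x \<in> X" "z = q g' x" using q_surj by blast
  then show "actZ (g \<otimes> h) z = actZ g (actZ h z)"
    using q_mult[OF h z(1,2)] q_mult[OF g _ z(2), of "h \<otimes> g'"] q_mult[OF _ z(1,2), of "g \<otimes> h"] g h
    by (simp add: G.m_assoc)
qed

section \<open>The free abelian group on pairs and its relations\<close>

definition "F = free_Abelian_group ({a :: 'g \<Rightarrow>\<^sub>0 'k. keys a \<subseteq> carrier G} \<times> carrier N)"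

definition "T = tensor_relations (regular_module (group_algebra G)) act (group_algebra H) N"

definition "Rel = generate F T"

lemma T_cases:
  assumes "t \<in> T"
  obtains (1) x y z where "keys x \<subseteq> carrier G" "keys y \<subseteq> carrier G" "z \<in> carrier N"
       "t = frag_of (x + y, z) - frag_of (x, z) - frag_of (y, z)"
    | (2) x y z where "keys x \<subseteq> carrier G" "y \<in> carrier N" "z \<in> carrier N"
       "t = frag_of (x, y \<oplus>\<^bsub>N\<^esub> z) - frag_of (x, y) - frag_of (x, z)"
    | (3) x a y where "keys x \<subseteq> carrier G" "keys a \<subseteq> carrier H" "y \<in> carrier N"
       "t = frag_of (act x a, y) - frag_of (x, a \<odot>\<^bsub>N\<^esub> y)"
  using assms unfolding T_def tensor_relations_def
  by (auto simp: regular_module_eq perm_rep_simps group_algebra_simps)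

lemma T_I:
  "keys x \<subseteq> carrier G \<Longrightarrow> keys x' \<subseteq> carrier G \<Longrightarrow> z \<in> carrier N \<Longrightarrow>
     frag_of (x + x', z) - frag_of (x, z) - frag_of (x', z) \<in> T"
  "keys x \<subseteq> carrier G \<Longrightarrow> y \<in> carrier N \<Longrightarrow> z \<in> carrier N \<Longrightarrow>
     frag_of (x, y \<oplus>\<^bsub>N\<^esub> z) - frag_of (x, y) - frag_of (x, z) \<in> T"
  "keys x \<subseteq> carrier G \<Longrightarrow> keys a \<subseteq> carrier H \<Longrightarrow> y \<in> carrier N \<Longrightarrow>
     frag_of (act x a, y) - frag_of (x, a \<odot>\<^bsub>N\<^esub> y) \<in> T"
  unfolding T_def tensor_relations_def
  by (auto simp: regular_module_eq perm_rep_simps group_algebra_simps)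

lemma keys_linear_ext: "keys b \<subseteq> carrier H \<Longrightarrow> keys (linear_ext \<rho> b) \<subseteq> carrier G"
  unfolding linear_ext_eq by (rule keys_lin) (auto simp: rho_closed)

lemma keys_mult: "keys a \<subseteq> carrier G \<Longrightarrow> keys b \<subseteq> carrier G \<Longrightarrow> keys (conv (\<otimes>) a b) \<subseteq> carrier G"
  by (rule keys_conv) auto

lemma keys_act: "keys a \<subseteq> carrier G \<Longrightarrow> keys b \<subseteq> carrier H \<Longrightarrow> keys (act a b) \<subseteq> carrier G"
  by (simp add: act_eq keys_mult keys_linear_ext)

lemma smult_N_closed: "keys a \<subseteq> carrier H \<Longrightarrow> y \<in> carrier N \<Longrightarrow> a \<odot>\<^bsub>N\<^esub> y \<in> carrier N"
  using N.smult_closed by (simp add: group_algebra_simps)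

lemma keys_diffI: "keys a \<subseteq> S \<Longrightarrow> keys b \<subseteq> S \<Longrightarrow> keys (a - b) \<subseteq> S"
  using keys_diff[of a b] by auto

lemma T_closed: "T \<subseteq> carrier F"
proof
  fix t assume "t \<in> T"
  then show "t \<in> carrier F"
  proof (cases rule: T_cases)
    case (1 x y z)
    then show ?thesis unfolding F_def carrier_free_Abelian_group_iff 1(4)
      by (intro keys_diffI) (simp_all add: keys_frag_of keys_addI)
  next
    case (2 x y z)
    then show ?thesis unfolding F_def carrier_free_Abelian_group_iff 2(4)
      by (intro keys_diffI) (simp_all add: keys_frag_of)
  next
    case (3 x a y)
    then show ?thesis unfolding F_def carrier_free_Abelian_group_iff 3(4)
      by (intro keys_diffI) (simp_all add: keys_frag_of keys_act smult_N_closed)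
  qed
qed

lemma F_group: "group F"
  by (simp add: F_def)

lemma Rel_subgroup: "subgroup Rel F"
  unfolding Rel_def by (rule group.generate_is_subgroup[OF F_group T_closed])

lemma Rel_T: "t \<in> T \<Longrightarrow> t \<in> Rel"
  unfolding Rel_def by (rule generate.incl)

lemma Rel_add: "a \<in> Rel \<Longrightarrow> b \<in> Rel \<Longrightarrow> a + b \<in> Rel"
  using subgroup.m_closed[OF Rel_subgroup] by (simp add: F_def)

lemma Rel_zero: "0 \<in> Rel"
  using subgroup.one_closed[OF Rel_subgroup] by (simp add: F_def)

lemma Rel_uminus: "a \<in> Rel \<Longrightarrow> - a \<in> Rel"
  using subgroup.m_inv_closed[OF Rel_subgroup, of a] subgroup.mem_carrier[OF Rel_subgroup, of a]
  by (simp add: F_def)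

lemma Rel_diff: "a \<in> Rel \<Longrightarrow> b \<in> Rel \<Longrightarrow> a - b \<in> Rel"
  using Rel_add[of a "- b"] Rel_uminus[of b] by simp

lemma Rel_trans: "a - b \<in> Rel \<Longrightarrow> b - c \<in> Rel \<Longrightarrow> a - c \<in> Rel"
  using Rel_add[of "a - b" "b - c"] by simp

lemma Rel_sum: "(\<And>i. i \<in> I \<Longrightarrow> a i - b i \<in> Rel) \<Longrightarrow> sum a I - sum b I \<in> Rel"
proof (induction I rule: infinite_finite_induct)
  case (insert x I)
  then have "(a x - b x) + (sum a I - sum b I) \<in> Rel" by (intro Rel_add) auto
  then show ?case using insert by (simp add: algebra_simps)
qed (auto simp: Rel_zero)

lemma Rel_induct [consumes 1, case_names zero T add uminus]:
  assumes "r \<in> Rel" "P 0" "\<And>t. t \<in> T \<Longrightarrow> P t" "\<And>a b. P a \<Longrightarrow> P b \<Longrightarrow> P (a + b)" "\<And>a. P a \<Longrightarrow> P (- a)"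
  shows "P r"
  using assms(1) unfolding Rel_def
proof (induction r rule: generate.induct)
  case (inv h)
  then have "inv\<^bsub>F\<^esub> h = - h" using T_closed by (auto simp: F_def)
  then show ?case using assms inv by metis
qed (use assms in \<open>auto simp: F_def\<close>)

text \<open>The additive map to k Z that takes a generator (a, y) to its image under the bilinear
  extension of \<open>q\<close>. Its kernel will turn out to be \<open>Rel\<close>.\<close>

definition "ev = frag_lin (\<lambda>(a, y). conv q a (\<phi> y))"

lemma ev_simps [simp]: "ev 0 = 0" "ev (c + c') = ev c + ev c'" "ev (c - c') = ev c - ev c'"
  "ev (- c) = - ev c" "ev (frag_of (a, y)) = conv q a (\<phi> y)"
  by (simp_all add: ev_def frag_lin_add frag_lin_diff frag_lin_uminus)

lemma phi_keys: "y \<in> carrier N \<Longrightarrow> keys (\<phi> y) \<subseteq> X"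
  using bij_betwE[OF phi_bij] by auto

lemma ev_act:
  assumes "keys x \<subseteq> carrier G" "keys a \<subseteq> carrier H" "y \<in> carrier N"
  shows "conv q (act x a) (\<phi> y) = conv q x (\<phi> (a \<odot>\<^bsub>N\<^esub> y))"
proof -
  have "conv q (act x a) (\<phi> y) =
      lin (\<lambda>g. lin (\<lambda>h. lin (\<lambda>z. single (q (g \<otimes> \<rho> h) z) 1) (\<phi> y)) a) x"
    using assms by (simp add: act_eq linear_ext_eq conv_def lin_lin)
  also have "\<dots> = lin (\<lambda>g. lin (\<lambda>h. lin (\<lambda>z. single (q g (actX h z)) 1) (\<phi> y)) a) x"
    using assms phi_keys[OF assms(3)] by (intro lin_cong) (auto simp: q_bal subset_eq)
  also have "\<dots> = conv q x (\<phi> (a \<odot>\<^bsub>N\<^esub> y))"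
    using assms by (simp add: phi_smult conv_def lin_lin)
  finally show ?thesis .
qed

lemma ev_Rel: "r \<in> Rel \<Longrightarrow> ev r = 0"
proof (induction rule: Rel_induct)
  case (T t)
  then show ?case
    by (cases rule: T_cases) (auto simp: conv_add_left conv_add_right phi_add ev_act)
qed auto

definition "\<eta> = inv_into (carrier N) \<phi>"

lemma eta: "keys v \<subseteq> X \<Longrightarrow> \<eta> v \<in> carrier N" "keys v \<subseteq> X \<Longrightarrow> \<phi> (\<eta> v) = v"
  "y \<in> carrier N \<Longrightarrow> \<eta> (\<phi> y) = y"
  using phi_bij by (auto simp: \<eta>_def bij_betw_def inv_into_into f_inv_into_f)

lemma eta_add: "keys v \<subseteq> X \<Longrightarrow> keys w \<subseteq> X \<Longrightarrow> \<eta> (v + w) = \<eta> v \<oplus>\<^bsub>N\<^esub> \<eta> w"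
  using eta(3)[of "\<eta> v \<oplus>\<^bsub>N\<^esub> \<eta> w"] by (simp add: eta phi_add)

lemma eta_smult: "keys a \<subseteq> carrier H \<Longrightarrow> keys v \<subseteq> X \<Longrightarrow> a \<odot>\<^bsub>N\<^esub> \<eta> v = \<eta> (conv actX a v)"
  using eta(3)[of "a \<odot>\<^bsub>N\<^esub> \<eta> v"] by (simp add: eta phi_smult smult_N_closed)

text \<open>The additivity relation for 0 + 0 is the negative of this generator.\<close>

lemma Rel_zero_left: "y \<in> carrier N \<Longrightarrow> frag_of (0, y) \<in> Rel"
  using Rel_uminus[OF Rel_T[OF T_I(1)[of 0 0 y]]] by simp

lemma Rel_zero_right: "keys a \<subseteq> carrier G \<Longrightarrow> frag_of (a, \<eta> 0) \<in> Rel"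
  using Rel_uminus[OF Rel_T[OF T_I(2)[of a "\<eta> 0" "\<eta> 0"]]] eta(1)[of 0] eta_add[of 0 0] by simp

lemma Rel_sum_left:
  assumes "y \<in> carrier N" "finite I" "\<And>i. i \<in> I \<Longrightarrow> keys (a i) \<subseteq> carrier G"
  shows "frag_of (\<Sum>i\<in>I. a i, y) - (\<Sum>i\<in>I. frag_of (a i, y)) \<in> Rel"
  using assms(2,3)
proof (induction I)
  case (insert x I)
  have k: "keys (\<Sum>i\<in>I. a i) \<subseteq> carrier G" using insert keys_sum[of a I] by fastforce
  have "(frag_of (a x + (\<Sum>i\<in>I. a i), y) - frag_of (a x, y) - frag_of (\<Sum>i\<in>I. a i, y))
     + (frag_of (\<Sum>i\<in>I. a i, y) - (\<Sum>i\<in>I. frag_of (a i, y))) \<in> Rel"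
    using insert assms k by (intro Rel_add Rel_T[OF T_I(1)]) auto
  then show ?case using insert by (simp add: algebra_simps)
qed (simp add: Rel_zero_left assms)

lemma Rel_sum_right:
  assumes "keys a \<subseteq> carrier G" "finite I" "\<And>i. i \<in> I \<Longrightarrow> keys (v i) \<subseteq> X"
  shows "frag_of (a, \<eta> (\<Sum>i\<in>I. v i)) - (\<Sum>i\<in>I. frag_of (a, \<eta> (v i))) \<in> Rel"
  using assms(2,3)
proof (induction I)
  case (insert x I)
  have k: "keys (\<Sum>i\<in>I. v i) \<subseteq> X" using insert keys_sum[of v I] by fastforce
  have "(frag_of (a, \<eta> (v x) \<oplus>\<^bsub>N\<^esub> \<eta> (\<Sum>i\<in>I. v i)) - frag_of (a, \<eta> (v x)) - frag_of (a, \<eta> (\<Sum>i\<in>I. v i)))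
     + (frag_of (a, \<eta> (\<Sum>i\<in>I. v i)) - (\<Sum>i\<in>I. frag_of (a, \<eta> (v i)))) \<in> Rel"
    using insert assms k by (intro Rel_add Rel_T[OF T_I(2)]) (auto simp: eta)
  then show ?case using insert k by (simp add: algebra_simps eta_add)
qed (simp add: Rel_zero_right assms)

section \<open>Normal forms modulo the relations\<close>

definition "rep z = (SOME gx. fst gx \<in> carrier G \<and> snd gx \<in> X \<and> z = q (fst gx) (snd gx))"

lemma rep: "z \<in> Z \<Longrightarrow> fst (rep z) \<in> carrier G" "z \<in> Z \<Longrightarrow> snd (rep z) \<in> X"
  "z \<in> Z \<Longrightarrow> q (fst (rep z)) (snd (rep z)) = z"
proof -
  have "fst (rep z) \<in> carrier G \<and> snd (rep z) \<in> X \<and> z = q (fst (rep z)) (snd (rep z))" if "z \<in> Z"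
  proof -
    from q_surj[OF that] obtain g x where "g \<in> carrier G" "x \<in> X" "z = q g x" by blast
    then have "\<exists>gx. fst gx \<in> carrier G \<and> snd gx \<in> X \<and> z = q (fst gx) (snd gx)"
      by (intro exI[of _ "(g, x)"]) auto
    from someI_ex[OF this] show ?thesis unfolding rep_def by blast
  qed
  then show "z \<in> Z \<Longrightarrow> fst (rep z) \<in> carrier G" "z \<in> Z \<Longrightarrow> snd (rep z) \<in> X"
    "z \<in> Z \<Longrightarrow> q (fst (rep z)) (snd (rep z)) = z" by auto
qed

text \<open>A single generator standing for c z. The scalar sits in the left factor, so that
  additivity in \<open>c\<close> is itself one of the defining relations.\<close>

definition "normal_term z c = frag_of (single (fst (rep z)) c, \<eta> (single (snd (rep z)) 1))"

text \<open>By \<open>q_eq\<close>, the pair (g, x) differs from the chosen one by some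
  \<open>h\<close>, which a balancing relation moves across; a second balancing relation, with the
  multiple \<open>d\<close> of the unit of k H, moves the scalar to the left.\<close>

lemma Rel_pure:
  assumes g: "g \<in> carrier G" and x: "x \<in> X"
  shows "frag_of (single g c, \<eta> (single x d)) - normal_term (q g x) (c * d) \<in> Rel"
proof -
  define g' x' where g': "g' = fst (rep (q g x))" and x': "x' = snd (rep (q g x))"
  have c: "g' \<in> carrier G" "x' \<in> X" and eq: "q g x = q g' x'"
    using rep[OF q_closed[OF g x]] by (simp_all add: g' x')
  obtain h where h: "h \<in> carrier H" "g = g' \<otimes> \<rho> h" "x' = actX h x"
    using q_eq[OF g c(1) x c(2) eq] by blast
  have ks: "\<And>g c. g \<in> carrier G \<Longrightarrow> keys (single g c :: 'g \<Rightarrow>\<^sub>0 'k) \<subseteq> carrier G"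
     "\<And>g c. g \<in> carrier H \<Longrightarrow> keys (single g c :: 'h \<Rightarrow>\<^sub>0 'k) \<subseteq> carrier H"
     "\<And>g c. g \<in> X \<Longrightarrow> keys (single g c :: 'x \<Rightarrow>\<^sub>0 'k) \<subseteq> X" by auto
  have 1: "act (single g' c) (single h 1) = single g c"
    using c h by (simp add: act_eq linear_ext_eq ks)
  have 2: "single h 1 \<odot>\<^bsub>N\<^esub> \<eta> (single x d) = \<eta> (single x' d)"
    using h x by (simp add: eta_smult)
  have 3: "single \<one>\<^bsub>H\<^esub> d \<odot>\<^bsub>N\<^esub> \<eta> (single x' 1) = \<eta> (single x' d)"
    using c by (simp add: eta_smult X.act_one)
  have 4: "act (single g' c) (single \<one>\<^bsub>H\<^esub> d) = single g' (c * d)"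
    using c by (simp add: act_eq linear_ext_eq rho_one ks)
  have "frag_of (single g c, \<eta> (single x d)) - frag_of (single g' c, \<eta> (single x' d)) \<in> Rel"
    using T_I(3)[of "single g' c" "single h 1" "\<eta> (single x d)"] c h x
    by (intro Rel_T) (simp add: 1 2 eta)
  moreover have "frag_of (single g' (c * d), \<eta> (single x' 1)) - frag_of (single g' c, \<eta> (single x' d)) \<in> Rel"
    using T_I(3)[of "single g' c" "single \<one>\<^bsub>H\<^esub> d" "\<eta> (single x' 1)"] c
    by (intro Rel_T) (simp add: 3 4 eta)
  ultimately show ?thesis
    using Rel_trans Rel_uminus unfolding normal_term_def g'[symmetric] x'[symmetric]
    by (metis minus_diff_eq)
qed

definition "nf v = (\<Sum>z\<in>keys v. normal_term z (lookup v z))"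

lemma normal_term_zero: "z \<in> Z \<Longrightarrow> normal_term z 0 \<in> Rel"
  unfolding normal_term_def using Rel_zero_left eta(1) rep(2) by simp

lemma normal_term_add: "z \<in> Z \<Longrightarrow> normal_term z (c + d) - (normal_term z c + normal_term z d) \<in> Rel"
  unfolding normal_term_def
  using Rel_T[OF T_I(1)[of "single (fst (rep z)) c" "single (fst (rep z)) d" "\<eta> (single (snd (rep z)) 1)"]]
    rep[of z] eta(1)[of "single (snd (rep z)) 1"] by (simp add: single_add algebra_simps)

text \<open>A term with coefficient 0 is a relation but not the zero of the free group, so the range
  of summation may change only modulo \<open>Rel\<close>.\<close>

lemma nf_superset:
  assumes "finite S" "keys v \<subseteq> S" "S \<subseteq> Z"
  shows "nf v - (\<Sum>z\<in>S. normal_term z (lookup v z)) \<in> Rel"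
proof -
  have "nf v - (\<Sum>z\<in>S. normal_term z (lookup v z)) = - (\<Sum>z\<in>S - keys v. normal_term z (lookup v z))"
    unfolding nf_def using assms by (simp add: sum_diff)
  also have "\<dots> \<in> Rel"
  proof (rule Rel_uminus)
    have "(\<Sum>z\<in>S - keys v. normal_term z (lookup v z)) - (\<Sum>z\<in>S - keys v. 0) \<in> Rel"
      using assms normal_term_zero by (intro Rel_sum) (auto simp: in_keys_iff)
    then show "(\<Sum>z\<in>S - keys v. normal_term z (lookup v z)) \<in> Rel" by simp
  qed
  finally show ?thesis .
qed

lemma nf_add:
  assumes "keys v \<subseteq> Z" "keys w \<subseteq> Z"
  shows "nf (v + w) - (nf v + nf w) \<in> Rel"
proof -
  let ?S = "keys v \<union> keys w"
  have 1: "nf (v + w) - (\<Sum>z\<in>?S. normal_term z (lookup (v + w) z)) \<in> Rel"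
    using assms by (intro nf_superset) (auto simp: Poly_Mapping.keys_add)
  have 2: "(\<Sum>z\<in>?S. normal_term z (lookup (v + w) z)) -
      (\<Sum>z\<in>?S. normal_term z (lookup v z) + normal_term z (lookup w z)) \<in> Rel"
    using assms by (intro Rel_sum) (auto simp: lookup_add normal_term_add)
  have 3: "nf v - (\<Sum>z\<in>?S. normal_term z (lookup v z)) \<in> Rel"
      "nf w - (\<Sum>z\<in>?S. normal_term z (lookup w z)) \<in> Rel"
    using assms by (intro nf_superset; auto)+
  show ?thesis
    using Rel_diff[OF Rel_trans[OF 1 2] Rel_add[OF 3]] by (simp add: sum.distrib algebra_simps)
qed

lemma nf_zero [simp]: "nf 0 = 0" by (simp add: nf_def)

lemma nf_single: "z \<in> Z \<Longrightarrow> nf (single z c) - normal_term z c \<in> Rel"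
  by (cases "c = 0") (auto simp: nf_def normal_term_zero Rel_uminus Rel_zero)

lemma nf_sum:
  assumes "finite I" "\<And>i. i \<in> I \<Longrightarrow> keys (v i) \<subseteq> Z"
  shows "nf (\<Sum>i\<in>I. v i) - (\<Sum>i\<in>I. nf (v i)) \<in> Rel"
  using assms
proof (induction I)
  case (insert x I)
  have k: "keys (\<Sum>i\<in>I. v i) \<subseteq> Z" using insert keys_sum[of v I] by fastforce
  have "(nf (v x + (\<Sum>i\<in>I. v i)) - (nf (v x) + nf (\<Sum>i\<in>I. v i))) + (nf (\<Sum>i\<in>I. v i) - (\<Sum>i\<in>I. nf (v i))) \<in> Rel"
    using insert k by (intro Rel_add nf_add) auto
  then show ?case using insert by (simp add: algebra_simps)
qed (simp add: Rel_zero)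

lemma nf_diff:
  assumes "keys v \<subseteq> Z" "keys w \<subseteq> Z"
  shows "nf (v - w) - (nf v - nf w) \<in> Rel"
  using Rel_uminus[OF nf_add[of "v - w" w]] keys_diffI[OF assms] assms by (simp add: algebra_simps)

lemma sum_single: "(\<Sum>x\<in>keys a. single x (lookup a x)) = a" for a :: "'y \<Rightarrow>\<^sub>0 'k"
  using lin_expand[of a] by (simp add: lin_def)

text \<open>Both arguments are expanded into multiples of basis elements (1, 2), each pure generator
  is replaced by its normal form (3), and the normal forms are collected again (4, 5), always modulo
  \<open>Rel\<close>.\<close>

lemma Rel_generator:
  assumes a: "keys a \<subseteq> carrier G" and y: "y \<in> carrier N"
  shows "frag_of (a, y) - nf (conv q a (\<phi> y)) \<in> Rel"
proof -
  define v where "v = \<phi> y"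
  have v: "keys v \<subseteq> X" "y = \<eta> v" using y by (auto simp: v_def eta dest: phi_keys)
  have "frag_of (\<Sum>g\<in>keys a. single g (lookup a g), y) - (\<Sum>g\<in>keys a. frag_of (single g (lookup a g), y)) \<in> Rel"
    using a y by (intro Rel_sum_left) auto
  then have 1: "frag_of (a, y) - (\<Sum>g\<in>keys a. frag_of (single g (lookup a g), y)) \<in> Rel"
    by (simp add: sum_single)
  have "frag_of (single g c, \<eta> (\<Sum>x\<in>keys v. single x (lookup v x))) -
       (\<Sum>x\<in>keys v. frag_of (single g c, \<eta> (single x (lookup v x)))) \<in> Rel" if "g \<in> carrier G" for g c
    using that v by (intro Rel_sum_right) auto
  then have 2: "(\<Sum>g\<in>keys a. frag_of (single g (lookup a g), y)) -
       (\<Sum>g\<in>keys a. \<Sum>x\<in>keys v. frag_of (single g (lookup a g), \<eta> (single x (lookup v x)))) \<in> Rel"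
    using a by (intro Rel_sum) (auto simp: sum_single v(2))
  have 3: "(\<Sum>g\<in>keys a. \<Sum>x\<in>keys v. frag_of (single g (lookup a g), \<eta> (single x (lookup v x)))) -
     (\<Sum>g\<in>keys a. \<Sum>x\<in>keys v. nf (single (q g x) (lookup a g * lookup v x))) \<in> Rel"
  proof (intro Rel_sum)
    fix g x assume "g \<in> keys a" "x \<in> keys v"
    then have "g \<in> carrier G" "x \<in> X" using a v by auto
    then show "frag_of (single g (lookup a g), \<eta> (single x (lookup v x))) -
         nf (single (q g x) (lookup a g * lookup v x)) \<in> Rel"
      using Rel_diff[OF Rel_pure nf_single[OF q_closed]]
      by (metis (no_types, lifting) diff_diff_eq2 diff_add_cancel)
  qed
  have 4: "(\<Sum>g\<in>keys a. nf (\<Sum>x\<in>keys v. single (q g x) (lookup a g * lookup v x))) -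
     (\<Sum>g\<in>keys a. \<Sum>x\<in>keys v. nf (single (q g x) (lookup a g * lookup v x))) \<in> Rel"
    using a v by (intro Rel_sum nf_sum) (auto simp: q_closed subset_eq)
  have 5: "nf (conv q a v) - (\<Sum>g\<in>keys a. nf (\<Sum>x\<in>keys v. single (q g x) (lookup a g * lookup v x))) \<in> Rel"
    unfolding conv_eq
  proof (intro nf_sum)
    fix g assume "g \<in> keys a"
    then show "keys (\<Sum>x\<in>keys v. single (q g x) (lookup a g * lookup v x)) \<subseteq> Z"
      using a v keys_sum[of "\<lambda>x. single (q g x) (lookup a g * lookup v x)" "keys v"]
      by (fastforce simp: q_closed subset_eq split: if_splits)
  qed simp
  show ?thesis
    using Rel_diff[OF Rel_trans[OF 1 Rel_trans[OF 2 3]] Rel_trans[OF 5 4]] by (simp add: v_def)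
qed

lemma F_induct [consumes 1, case_names zero diff gen]:
  assumes "c \<in> carrier F" "P 0"
    "\<And>x y. x \<in> carrier F \<Longrightarrow> y \<in> carrier F \<Longrightarrow> P x \<Longrightarrow> P y \<Longrightarrow> P (x - y)"
    "\<And>a y. keys a \<subseteq> carrier G \<Longrightarrow> y \<in> carrier N \<Longrightarrow> P (frag_of (a, y))"
  shows "P c"
  by (rule free_Abelian_group_induct[of c "{a. keys a \<subseteq> carrier G} \<times> carrier N"])
     (use assms in \<open>auto simp: F_def\<close>)

lemma keys_ev: "c \<in> carrier F \<Longrightarrow> keys (ev c) \<subseteq> Z"
proof (induction rule: F_induct)
  case (gen a y)
  then show ?case using phi_keys[of y] by (auto intro!: keys_conv q_closed)
qed (simp_all add: keys_diffI)

text \<open>This bounds the kernel of \<open>ev\<close> from above: an element with image 0 has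
  normal form 0 and is therefore a relation.\<close>

lemma Rel_nf: "c \<in> carrier F \<Longrightarrow> c - nf (ev c) \<in> Rel"
proof (induction rule: F_induct)
  case (diff x y)
  have "nf (ev x - ev y) - (nf (ev x) - nf (ev y)) \<in> Rel"
    using diff keys_ev by (intro nf_diff) auto
  from Rel_diff[OF Rel_diff[OF diff(3,4)] this] show ?case by simp
qed (simp_all add: Rel_zero Rel_generator)

lemma ev_eq_iff:
  assumes "c \<in> carrier F" "c' \<in> carrier F"
  shows "ev c = ev c' \<longleftrightarrow> c - c' \<in> Rel"
proof
  assume "ev c = ev c'"
  then show "c - c' \<in> Rel" using Rel_diff[OF Rel_nf[OF assms(1)] Rel_nf[OF assms(2)]] by simp
next
  assume "c - c' \<in> Rel"
  then show "ev c = ev c'" using ev_Rel by fastforce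
qed

text \<open>The free abelian group, with \<open>s\<close> multiplying the left factors. This is
  additive for each \<open>s\<close> but not in \<open>s\<close>, so only the quotient is a
  module.\<close>

definition F0 :: "('g \<Rightarrow>\<^sub>0 'k, ('g \<Rightarrow>\<^sub>0 'k) \<times> 'n \<Rightarrow>\<^sub>0 int) module" where
  "F0 = \<lparr>carrier = carrier F, mult = undefined, one = undefined, zero = \<one>\<^bsub>F\<^esub>,
   add = (\<otimes>\<^bsub>F\<^esub>), smult = (\<lambda>s :: 'g \<Rightarrow>\<^sub>0 'k. frag_extend (\<lambda>(x, y). frag_of (conv (\<otimes>) s x, y)))\<rparr>"

lemma tensor_product_eq:
  "tensor_product (regular_module (group_algebra G)) act (group_algebra H) N = quotient_module F0 Rel"
  unfolding tensor_product_def F0_def Rel_def F_def T_def Let_def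
  by (simp add: regular_module_eq perm_rep_simps group_algebra_simps)

lemma F0_simps: "carrier F0 = carrier F" "zero F0 = 0" "add F0 = (+)"
  "smult F0 s = frag_extend (\<lambda>(x, y). frag_of (conv (\<otimes>) s x, y))"
  by (simp_all add: F0_def F_def fun_eq_iff)

lemma a_inv_F0:
  assumes c: "c \<in> carrier F"
  shows "inv\<^bsub>add_monoid F0\<^esub> c = - c"
proof -
  have "inv\<^bsub>add_monoid F0\<^esub> c = inv\<^bsub>F\<^esub> c"
    by (simp add: m_inv_def F0_simps) (simp add: F_def)
  then show ?thesis using c by (simp add: F_def)
qed

lemma abelian_group_F0: "abelian_group F0"
proof (rule abelian_groupI)
  fix x assume "x \<in> carrier F0"
  then show "\<exists>y\<in>carrier F0. y \<oplus>\<^bsub>F0\<^esub> x = \<zero>\<^bsub>F0\<^esub>"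
    by (intro bexI[of _ "- x"]) (auto simp: F0_simps F_def)
qed (simp_all add: F0_simps(1-3) add_ac, simp_all add: F_def keys_addI)

lemma Rel_subgroup_F0: "subgroup Rel (add_monoid F0)"
proof
  show "inv\<^bsub>add_monoid F0\<^esub> x \<in> Rel" if "x \<in> Rel" for x
    using that subgroup.mem_carrier[OF Rel_subgroup] by (simp only: a_inv_F0 Rel_uminus)
qed (use subgroup.mem_carrier[OF Rel_subgroup] in \<open>auto simp: F0_simps(1-3) Rel_zero Rel_add\<close>)

lemma smult_F0_closed:
  assumes "keys s \<subseteq> carrier G" "c \<in> carrier F"
  shows "smult F0 s c \<in> carrier F"
proof -
  have "keys (frag_extend (\<lambda>(x, y). frag_of (conv (\<otimes>) s x, y)) c) \<subseteq>
    (\<Union>i\<in>keys c. keys ((\<lambda>(x, y). frag_of (conv (\<otimes>) s x, y)) i))" by (rule keys_frag_extend)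
  also have "\<dots> \<subseteq> {a. keys a \<subseteq> carrier G} \<times> carrier N"
    using assms keys_mult by (fastforce simp: F_def keys_frag_of)
  finally show ?thesis by (simp add: F0_simps F_def)
qed

text \<open>The bimodule law s (x a) = (s x) a turns a balancing relation into another one; the
  additivity relations are preserved because the left factor is multiplied linearly.\<close>

lemma smult_F0_T:
  assumes s: "keys s \<subseteq> carrier G" and t: "t \<in> T"
  shows "smult F0 s t \<in> T"
  using t
proof (cases rule: T_cases)
  case (1 x y z)
  then show ?thesis using T_I(1)[of "conv (\<otimes>) s x" "conv (\<otimes>) s y" z] s
    by (simp add: F0_simps frag_extend_diff conv_add_right keys_mult)
next
  case (2 x y z)
  then show ?thesis using T_I(2)[of "conv (\<otimes>) s x" y z] s
    by (simp add: F0_simps frag_extend_diff keys_mult)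
next
  case (3 x a y)
  have "conv (\<otimes>) s (act x a) = act (conv (\<otimes>) s x) a"
    using 3 s keys_linear_ext[OF 3(2)]
    by (simp add: act_eq keys_mult) (rule conv_assoc[symmetric], auto simp: subset_eq G.m_assoc)
  then show ?thesis using T_I(3)[of "conv (\<otimes>) s x" a y] 3 s
    by (simp add: F0_simps frag_extend_diff keys_mult)
qed

lemma smult_F0_Rel:
  assumes s: "keys s \<subseteq> carrier G"
  shows "r \<in> Rel \<Longrightarrow> smult F0 s r \<in> Rel"
proof (induction rule: Rel_induct)
  case (T t)
  then show ?case using smult_F0_T[OF s] Rel_T by blast
qed (auto simp: F0_simps frag_extend_add frag_extend_minus Rel_zero intro: Rel_add Rel_uminus)

lemma ev_smult:
  assumes s: "keys s \<subseteq> carrier G" and c: "c \<in> carrier F"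
  shows "ev (smult F0 s c) = conv actZ s (ev c)"
  using c
proof (induction rule: F_induct)
  case (diff x y)
  have "conv actZ s (ev x - ev y) + conv actZ s (ev y) = conv actZ s (ev x)"
    unfolding conv_add_right[symmetric] by simp
  then have "conv actZ s (ev x - ev y) = conv actZ s (ev x) - conv actZ s (ev y)"
    by (simp add: algebra_simps)
  then show ?case using diff by (simp add: F0_simps frag_extend_diff)
next
  case (gen a y)
  have "conv q (conv (\<otimes>) s a) (\<phi> y) = conv actZ s (conv q a (\<phi> y))"
    using gen s phi_keys[of y] by (intro conv_assoc) (auto simp: q_mult subset_eq)
  then show ?case by (simp add: F0_simps)
qed (simp add: F0_simps)

text \<open>The free abelian group covers both sides, by the coset map and by \<open>ev\<close>, and
  \<open>ev_eq_iff\<close> says that the two maps have the same fibres.\<close>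

theorem tensor_iso:
  "module_isomorphic (group_algebra G)
     (tensor_product (regular_module (group_algebra G)) act (group_algebra H) N) (perm_rep actZ Z)"
proof -
  interpret F0: abelian_group F0 by (rule abelian_group_F0)
  interpret Q: quotient_by F0 Rel "{s :: 'g \<Rightarrow>\<^sub>0 'k. keys s \<subseteq> carrier G}"
  proof (intro quotient_by.intro quotient_by_axioms.intro abelian_group_F0 Rel_subgroup_F0)
    fix s :: "'g \<Rightarrow>\<^sub>0 'k" and x y
    assume s: "s \<in> {s. keys s \<subseteq> carrier G}"
    show "x \<in> carrier F0 \<Longrightarrow> smult F0 s x \<in> carrier F0" "x \<in> Rel \<Longrightarrow> smult F0 s x \<in> Rel"
      using s by (simp_all add: F0_simps(1) smult_F0_closed smult_F0_Rel)
    show "smult F0 s (x \<oplus>\<^bsub>F0\<^esub> y) = smult F0 s x \<oplus>\<^bsub>F0\<^esub> smult F0 s y"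
      by (simp add: F0_simps frag_extend_add)
  qed
  have inv: "a_inv F0 c = - c" if "c \<in> carrier F" for c
    using that unfolding a_inv_def by (rule a_inv_F0)
  have Z: "left_module (group_algebra G :: ('g \<Rightarrow>\<^sub>0 'k) ring) (perm_rep actZ Z)"
    by (rule group_set.left_module_perm_rep[OF group_set_Z])
  show ?thesis unfolding tensor_product_eq
  proof (rule module_isomorphic_common_cover[OF Z, where A="carrier F0" and p="\<lambda>c. Rel +>\<^bsub>F0\<^esub> c" and p'=ev
        and zA="\<zero>\<^bsub>F0\<^esub>" and addA="add F0" and smA="smult F0"])
    show "(\<lambda>c. Rel +>\<^bsub>F0\<^esub> c) ` carrier F0 = carrier (quotient_module F0 Rel)"
      by (simp add: Q.quotient_carrier)
    show "ev ` carrier F0 = carrier (perm_rep actZ Z)"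
    proof
      show "ev ` carrier F0 \<subseteq> carrier (perm_rep actZ Z)"
        using keys_ev by (auto simp: F0_simps perm_rep_simps)
      show "carrier (perm_rep actZ Z) \<subseteq> ev ` carrier F0"
      proof
        fix v :: "'z \<Rightarrow>\<^sub>0 'k" assume "v \<in> carrier (perm_rep actZ Z)"
        then have v: "keys v \<subseteq> Z" by (simp add: perm_rep_simps)
        have "ev (nf v) = (\<Sum>z\<in>keys v. single z (lookup v z))"
          unfolding nf_def ev_def frag_lin_sum normal_term_def using v
          by (intro sum.cong) (auto simp: eta rep subset_eq)
        then have "ev (nf v) = v" by (simp add: sum_single)
        moreover have "nf v \<in> carrier F"
          unfolding nf_def normal_term_def F_def using v
          by (intro sum_closed_free_Abelian_group) (auto simp: keys_frag_of eta rep subset_eq split: if_splits)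
        ultimately show "v \<in> ev ` carrier F0" by (metis F0_simps(1) image_eqI)
      qed
    qed
    show "Rel +>\<^bsub>F0\<^esub> x = Rel +>\<^bsub>F0\<^esub> y \<longleftrightarrow> ev x = ev y" if "x \<in> carrier F0" "y \<in> carrier F0" for x y
      using that by (simp add: Q.coset_eq_iff ev_eq_iff F0_simps a_minus_def inv)
  qed (auto simp: Q.quotient_zero Q.quotient_add Q.quotient_smult group_algebra_simps perm_rep_simps
         F0_simps(1,2,3) smult_F0_closed ev_smult, simp_all add: F_def keys_addI)
qed

end

section \<open>Induction of the trivial module\<close>

lemma conv_const:
  "conv (\<lambda>_ _. e) a (single x c) = single e ((\<Sum>h\<in>keys a. lookup a h) * c)"
proof -
  have "conv (\<lambda>_ _. e) a (single x c) = (\<Sum>h\<in>keys a. single e (lookup a h * c))"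
    by (cases "c = 0") (simp_all add: conv_eq)
  also have "\<dots> = single e (\<Sum>h\<in>keys a. lookup a h * c)"
    by (rule poly_mapping_eqI) (simp add: lookup_sum lookup_single when_def)
  finally show ?thesis by (simp add: sum_distrib_right)
qed

lemma trivial_module_iso:
  assumes "group H"
  shows "left_module (group_algebra H :: ('h \<Rightarrow>\<^sub>0 'k::field) ring) trivial_module"
    "bij_betw (single ()) (carrier (trivial_module :: ('h \<Rightarrow>\<^sub>0 'k, 'k) module)) {v. keys v \<subseteq> {()}}"
proof -
  interpret group H by fact
  interpret X: group_set H "\<lambda>_ _. ()" "{()}" by unfold_locales auto
  show "bij_betw (single ()) (carrier (trivial_module :: ('h \<Rightarrow>\<^sub>0 'k, 'k) module)) {v. keys v \<subseteq> {()}}"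
    by (rule bij_betwI[of _ _ _ "\<lambda>v. lookup v ()"])
       (auto simp: trivial_module_def lookup_single intro!: poly_mapping_eqI)
  show "left_module (group_algebra H :: ('h \<Rightarrow>\<^sub>0 'k) ring) trivial_module"
  proof (rule left_module_image[OF X.left_module_perm_rep, of "\<lambda>v. lookup v ()"])
    show "(\<lambda>v. lookup v ()) ` carrier (perm_rep (\<lambda>_ _. ()) {()}) =
       carrier (trivial_module :: ('h \<Rightarrow>\<^sub>0 'k, 'k) module)"
      by (auto simp: perm_rep_simps trivial_module_def intro!: image_eqI[of _ _ "single () _"])
  next
    fix a :: "'h \<Rightarrow>\<^sub>0 'k" and v :: "unit \<Rightarrow>\<^sub>0 'k"
    have "v = single () (lookup v ())" by (rule poly_mapping_eqI) (auto simp: lookup_single)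
    then have "conv (\<lambda>_ _. ()) a v = conv (\<lambda>_ _. ()) a (single () (lookup v ()))" by simp
    then show "lookup (a \<odot>\<^bsub>perm_rep (\<lambda>_ _. ()) {()}\<^esub> v) () = a \<odot>\<^bsub>trivial_module\<^esub> lookup v ()"
      unfolding conv_const by (simp add: perm_rep_simps trivial_module_def)
  qed (auto simp: perm_rep_simps trivial_module_def lookup_add)
qed

text \<open>The case of a one-point set in \<open>tensor_perm\<close>: the amalgamated product is
  then G / H, realized as the orbit of \<open>z0\<close>, and \<open>q\<close> takes g to g
  z0.\<close>

lemma (in group_set) permutation_module_iso:
  assumes z0: "z0 \<in> X" and trans: "\<And>z. z \<in> X \<Longrightarrow> \<exists>g\<in>carrier G. z = act g z0"
    and stab: "H = {g \<in> carrier G. act g z0 = z0}"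
  shows "module_isomorphic (group_algebra G :: ('a \<Rightarrow>\<^sub>0 'k::field) ring)
     (permutation_module G H) (perm_rep act X)"
proof -
  have inv: "act (inv g) (act g z0) = z0" if "g \<in> carrier G" for g
    using that z0 by (simp add: act_mult[symmetric] act_one)
  have sub: "subgroup H G"
  proof
    fix x assume "x \<in> H"
    then show "inv x \<in> H" using stab inv[of x] by auto
  qed (use z0 act_one act_mult in \<open>auto simp: stab\<close>)
  let ?H = "G\<lparr>carrier := H\<rparr>"
  have gH: "group ?H" by (rule subgroup.subgroup_is_group[OF sub is_group])
  interpret T: left_module "group_algebra ?H :: ('a \<Rightarrow>\<^sub>0 'k) ring" "trivial_module :: ('a \<Rightarrow>\<^sub>0 'k, 'k) module"
    by (rule trivial_module_iso(1)[OF gH])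
  interpret X: group_set ?H "\<lambda>_ _. ()" "{()}"
    by (intro group_set.intro gH) (unfold_locales, auto)
  interpret tensor_perm G ?H "\<lambda>_ _. ()" "{()}" "trivial_module :: ('a \<Rightarrow>\<^sub>0 'k, 'k) module" "single ()"
    "\<lambda>h. h" "(\<otimes>\<^bsub>group_algebra G\<^esub>)" act X "\<lambda>g _. act g z0"
  proof
    show "bij_betw (single ()) (carrier (trivial_module :: ('a \<Rightarrow>\<^sub>0 'k, 'k) module)) {v. keys v \<subseteq> {()}}"
      by (rule trivial_module_iso(2)[OF gH])
    show "single () (a \<odot>\<^bsub>trivial_module\<^esub> y) = conv (\<lambda>_ _. ()) a (single () y)" for a :: "'a \<Rightarrow>\<^sub>0 'k" and y
      by (simp add: conv_const trivial_module_def)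
    show "a \<otimes>\<^bsub>group_algebra G\<^esub> b = conv (\<otimes>) a (linear_ext (\<lambda>h. h) b)" for a b :: "'a \<Rightarrow>\<^sub>0 'k"
      by (simp add: group_algebra_simps linear_ext_eq lin_expand)
    fix g g' assume g: "g \<in> carrier G" "g' \<in> carrier G" and eq: "act g z0 = act g' z0"
    have "act (inv g' \<otimes> g) z0 = z0" using g z0 inv[of g'] eq by (simp add: act_mult)
    then have "inv g' \<otimes> g \<in> H" using g stab by auto
    moreover have "g = g' \<otimes> (inv g' \<otimes> g)" using g by (simp add: m_assoc[symmetric])
    ultimately show "\<exists>h\<in>carrier ?H. g = g' \<otimes> h \<and> x' = ()" if "x \<in> {()}" "x' \<in> {()}" for x x' :: unit
      using that by auto
  qed (use z0 trans stab act_mult act_closed in \<open>auto simp: trivial_module_def single_add\<close>)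
  show ?thesis unfolding permutation_module_def by (rule tensor_iso)
qed

section \<open>Direct sums\<close>

definition restr :: "'i \<Rightarrow> ('i \<times> 'x \<Rightarrow>\<^sub>0 'k::field) \<Rightarrow> ('x \<Rightarrow>\<^sub>0 'k)" where
  "restr i v = lin (\<lambda>(j, x). if j = i then single x 1 else 0) v"

lemma lookup_restr [simp]: "lookup (restr i v) x = lookup v (i, x)"
proof -
  have "lookup (restr i v) x = (\<Sum>p\<in>keys v. if p = (i, x) then lookup v p else 0)"
    unfolding restr_def lookup_lin
    by (rule sum.cong) (auto simp: lookup_single when_def split: prod.splits if_splits)
  also have "\<dots> = lookup v (i, x)" by (simp add: sum.delta in_keys_iff)
  finally show ?thesis .
qed

lemma restr_add: "restr i (v + w) = restr i v + restr i w"
  by (simp add: restr_def lin_add)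

lemma restr_conv:
  fixes act :: "'g \<Rightarrow> 'x \<Rightarrow> 'x"
  shows "restr i (conv (\<lambda>g (j, x). (j, act g x)) a v) = conv act a (restr i v)"
  unfolding restr_def
  by (rule lin_conv) (auto simp: conv_single_left)

lemma direct_sum_perm_rep_iso:
  fixes act :: "'g \<Rightarrow> 'x \<Rightarrow> 'x" and G :: "'g monoid"
  assumes I: "finite I" and X: "\<And>i. i \<in> I \<Longrightarrow> group_set G act (X i)" and G: "group G"
    and M: "\<And>i. i \<in> I \<Longrightarrow> module_isomorphic (group_algebra G :: ('g \<Rightarrow>\<^sub>0 'k::field) ring) (M i) (perm_rep act (X i))"
  shows "module_isomorphic (group_algebra G :: ('g \<Rightarrow>\<^sub>0 'k) ring)
     (perm_rep (\<lambda>g (i, x). (i, act g x)) (Sigma I X)) (direct_sum I M)"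
proof -
  let ?R = "group_algebra G :: ('g \<Rightarrow>\<^sub>0 'k) ring"
  let ?V = "perm_rep (\<lambda>g (i, x). (i, act g x)) (Sigma I X) :: ('g \<Rightarrow>\<^sub>0 'k, 'a \<times> 'x \<Rightarrow>\<^sub>0 'k) module"
  have "\<exists>f. bij_betw f (carrier (perm_rep act (X i))) (carrier (M i)) \<and>
      (\<forall>x\<in>carrier (perm_rep act (X i)). \<forall>y\<in>carrier (perm_rep act (X i)). f (x + y) = f x \<oplus>\<^bsub>M i\<^esub> f y) \<and>
      (\<forall>a\<in>carrier ?R. \<forall>x\<in>carrier (perm_rep act (X i)). f (conv act a x) = a \<odot>\<^bsub>M i\<^esub> f x)" if "i \<in> I" for i
    using module_isomorphic_sym[OF M[OF that]] unfolding module_isomorphic_def by (simp add: perm_rep_simps)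
  then have "\<exists>f. \<forall>i\<in>I. bij_betw (f i) (carrier (perm_rep act (X i))) (carrier (M i)) \<and>
      (\<forall>x\<in>carrier (perm_rep act (X i)). \<forall>y\<in>carrier (perm_rep act (X i)). f i (x + y) = f i x \<oplus>\<^bsub>M i\<^esub> f i y) \<and>
      (\<forall>a\<in>carrier ?R. \<forall>x\<in>carrier (perm_rep act (X i)). f i (conv act a x) = a \<odot>\<^bsub>M i\<^esub> f i x)"
    by (intro bchoice) blast
  then obtain f where F: "\<forall>i\<in>I. bij_betw (f i) (carrier (perm_rep act (X i))) (carrier (M i)) \<and>
      (\<forall>x\<in>carrier (perm_rep act (X i)). \<forall>y\<in>carrier (perm_rep act (X i)). f i (x + y) = f i x \<oplus>\<^bsub>M i\<^esub> f i y) \<and>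
      (\<forall>a\<in>carrier ?R. \<forall>x\<in>carrier (perm_rep act (X i)). f i (conv act a x) = a \<odot>\<^bsub>M i\<^esub> f i x)" ..
  then have f: "\<And>i. i \<in> I \<Longrightarrow> bij_betw (f i) {v. keys v \<subseteq> X i} (carrier (M i))"
    and fadd: "\<And>i x y. i \<in> I \<Longrightarrow> keys x \<subseteq> X i \<Longrightarrow> keys y \<subseteq> X i \<Longrightarrow> f i (x + y) = f i x \<oplus>\<^bsub>M i\<^esub> f i y"
    and fsm: "\<And>i a x. i \<in> I \<Longrightarrow> keys a \<subseteq> carrier G \<Longrightarrow> keys x \<subseteq> X i \<Longrightarrow> f i (conv act a x) = a \<odot>\<^bsub>M i\<^esub> f i x"
    by (auto simp: perm_rep_simps group_algebra_simps)
  have fz: "f i 0 = \<zero>\<^bsub>M i\<^esub>" if "i \<in> I" for i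
  proof -
    have "left_module ?R (M i)" "left_module ?R (perm_rep act (X i))"
      using M[OF that] unfolding module_isomorphic_def by auto
    from module_isomorphic_zero[OF this(2,1), of "f i"] f fadd that show ?thesis by (simp add: perm_rep_simps)
  qed
  have fc: "f i x \<in> carrier (M i)" if "i \<in> I" "keys x \<subseteq> X i" for i x
    using bij_betwE[OF f[OF that(1)]] that(2) by simp
  have kr: "keys (restr i v) \<subseteq> X i" if "keys v \<subseteq> Sigma I X" for i v
    using that by (auto simp: in_keys_iff subset_eq)
  interpret Z: group_set G "\<lambda>g (i, x). (i, act g x)" "Sigma I X"
  proof (intro group_set.intro G group_set_axioms.intro)
  qed (auto simp: group_set.act_closed[OF X] group_set.act_one[OF X] group_set.act_mult[OF X])
  define p where "p v = (\<lambda>i\<in>I. f i (restr i v))" for v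
  show ?thesis
  proof (rule module_isomorphic_common_module[OF Z.left_module_perm_rep, where p=id and p'=p])
    show "p ` carrier ?V = carrier (direct_sum I M)"
    proof
      show "p ` carrier ?V \<subseteq> carrier (direct_sum I M)"
        using I by (simp add: p_def perm_rep_simps direct_sum_def image_subset_iff fc kr)
      show "carrier (direct_sum I M) \<subseteq> p ` carrier ?V"
      proof
        fix y assume y: "y \<in> carrier (direct_sum I M)"
        define w where "w i = inv_into {v. keys v \<subseteq> X i} (f i) (y i)" for i
        have w: "keys (w i) \<subseteq> X i" "f i (w i) = y i" if "i \<in> I" for i
        proof -
          have "y i \<in> f i ` {v. keys v \<subseteq> X i}"
            using y that f[OF that] by (auto simp: direct_sum_def bij_betw_def)
          from inv_into_into[OF this] f_inv_into_f[OF this] show "keys (w i) \<subseteq> X i" "f i (w i) = y i"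
            unfolding w_def by auto
        qed
        \<comment> \<open>The preimage is assembled from the preimages \<open>w i\<close>, each
          placed in its own summand; finiteness of \<open>I\<close> makes the sum
          meaningful.\<close>
        define v where "v = (\<Sum>i\<in>I. lin (\<lambda>x. single (i, x) 1) (w i))"
        have lv: "lookup (lin (\<lambda>x. single (j, x) (1::'k)) u) (i, x) = (if i = j then lookup u x else 0)"
          for j i :: 'a and x :: 'x and u
        proof -
          have "lookup (lin (\<lambda>x. single (j, x) (1::'k)) u) (i, x) =
            (\<Sum>x'\<in>keys u. if x' = x then (if i = j then lookup u x else 0) else 0)"
            unfolding lookup_lin by (rule sum.cong) (auto simp: lookup_single when_def)
          then show ?thesis by (simp add: in_keys_iff)
        qed
        have lw: "lookup v (i, x) = (if i \<in> I then lookup (w i) x else 0)" for i x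
          unfolding v_def lookup_sum lv using I by simp
        have "keys v \<subseteq> Sigma I X"
          using w by (auto simp: in_keys_iff lw subset_eq split: if_splits)
        moreover have "restr i v = w i" if "i \<in> I" for i
          using that by (intro poly_mapping_eqI) (simp add: lw)
        ultimately show "y \<in> p ` carrier ?V"
          using y w by (intro image_eqI[of _ _ v])
            (auto simp: p_def perm_rep_simps direct_sum_def PiE_def extensional_def fun_eq_iff)
      qed
    qed
    show "id x = id y \<longleftrightarrow> p x = p y" if "x \<in> carrier ?V" "y \<in> carrier ?V" for x y
    proof
      assume eq: "p x = p y"
      have k: "keys x \<subseteq> Sigma I X" "keys y \<subseteq> Sigma I X" using that by (auto simp: perm_rep_simps)
      have r: "restr i x = restr i y" if "i \<in> I" for i
        using f[OF that] fun_cong[OF eq, of i] that kr[OF k(1)] kr[OF k(2)]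
        by (auto simp: p_def bij_betw_def inj_on_def)
      show "id x = id y"
      proof (simp, rule poly_mapping_eqI)
        fix t :: "'a \<times> 'x"
        show "lookup x t = lookup y t"
        proof (cases "fst t \<in> I")
          case True
          then show ?thesis using arg_cong[OF r, of "fst t" "\<lambda>u. lookup u (snd t)"] by simp
        next
          case False
          then have "t \<notin> keys x" "t \<notin> keys y" using k by auto
          then show ?thesis by (simp add: in_keys_iff)
        qed
      qed
    qed simp
    show "p \<zero>\<^bsub>?V\<^esub> = \<zero>\<^bsub>direct_sum I M\<^esub>"
      by (auto simp: p_def direct_sum_def perm_rep_simps restr_def fz fun_eq_iff)
    show "p (x \<oplus>\<^bsub>?V\<^esub> y) = p x \<oplus>\<^bsub>direct_sum I M\<^esub> p y" if "x \<in> carrier ?V" "y \<in> carrier ?V" for x y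
      using that by (simp add: p_def direct_sum_def perm_rep_simps restr_add fadd kr fun_eq_iff)
    show "p (a \<odot>\<^bsub>?V\<^esub> x) = a \<odot>\<^bsub>direct_sum I M\<^esub> p x" if "a \<in> carrier ?R" "x \<in> carrier ?V" for a x
      using that by (simp add: p_def direct_sum_def perm_rep_simps restr_conv fsm kr fun_eq_iff group_algebra_simps)
  qed auto
qed

section \<open>Submodules and filtrations\<close>

lemma left_module_submodule:
  assumes "left_module R M" "submodule N R M"
  shows "left_module R (M\<lparr>carrier := N\<rparr>)"
proof -
  interpret M: left_module R M by fact
  interpret N: submodule N R M by fact
  have sub: "\<And>x. x \<in> N \<Longrightarrow> x \<in> carrier M" using N.subset by auto
  have cl: "\<And>x y. x \<in> N \<Longrightarrow> y \<in> N \<Longrightarrow> x \<oplus>\<^bsub>M\<^esub> y \<in> N" using N.m_closed by simp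
  have z: "\<zero>\<^bsub>M\<^esub> \<in> N" using N.one_closed by simp
  have i: "\<And>x. x \<in> N \<Longrightarrow> \<ominus>\<^bsub>M\<^esub> x \<in> N" using N.m_inv_closed by (simp add: a_inv_def)
  interpret N': abelian_group "M\<lparr>carrier := N\<rparr>"
  proof (rule abelian_groupI)
    fix x assume "x \<in> carrier (M\<lparr>carrier := N\<rparr>)"
    then show "\<exists>y\<in>carrier (M\<lparr>carrier := N\<rparr>). y \<oplus>\<^bsub>M\<lparr>carrier := N\<rparr>\<^esub> x = \<zero>\<^bsub>M\<lparr>carrier := N\<rparr>\<^esub>"
      using i sub by (intro bexI[of _ "\<ominus>\<^bsub>M\<^esub> x"]) (auto simp: M.M.l_neg)
  next
    fix x y assume "x \<in> carrier (M\<lparr>carrier := N\<rparr>)" "y \<in> carrier (M\<lparr>carrier := N\<rparr>)"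
    then have "x \<in> carrier M" "y \<in> carrier M" using sub by simp_all
    then show "x \<oplus>\<^bsub>M\<lparr>carrier := N\<rparr>\<^esub> y = y \<oplus>\<^bsub>M\<lparr>carrier := N\<rparr>\<^esub> x"
      using M.M.a_comm by simp
  qed (simp_all add: sub cl z M.M.a_assoc)
  show ?thesis
    by (intro left_module.intro M.R.ring_axioms N'.abelian_group_axioms left_module_axioms.intro)
       (use sub in \<open>auto simp: M.smult_l_distr M.smult_r_distr M.smult_assoc M.smult_one\<close>)
qed

lemma submodule_restrict:
  assumes M: "left_module R M" and N: "submodule N R M" and K: "submodule K R M" and sub: "K \<subseteq> N"
  shows "submodule K R (M\<lparr>carrier := N\<rparr>)"
proof -
  interpret M: left_module R M by fact
  interpret N: left_module R "M\<lparr>carrier := N\<rparr>" by (rule left_module_submodule[OF M N])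
  interpret K: submodule K R M by fact
  \<comment> \<open>Negation is taken in the record with carrier \<open>N\<close>, so it has to be
    identified with the one of \<open>M\<close>.\<close>
  have inv: "inv\<^bsub>add_monoid (M\<lparr>carrier := N\<rparr>)\<^esub> x \<in> K" if "x \<in> K" for x
  proof -
    have x: "x \<in> N" "x \<in> carrier M" "\<ominus>\<^bsub>M\<^esub> x \<in> K"
      using that sub K.subset K.m_inv_closed by (auto simp: a_inv_def)
    have "\<ominus>\<^bsub>M\<lparr>carrier := N\<rparr>\<^esub> x = \<ominus>\<^bsub>M\<^esub> x"
      using N.M.minus_equality[of "\<ominus>\<^bsub>M\<^esub> x" x] x sub by (auto simp: M.M.l_neg)
    then show ?thesis using x by (simp add: a_inv_def)
  qed
  show ?thesis
    using K.m_closed K.one_closed inv sub K.smult_closed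
    by (intro submodule.intro subgroup.intro submodule_axioms.intro) auto
qed

lemma quotient_by_submodule:
  assumes M: "left_module R M" and H: "submodule H R M"
  shows "quotient_by M H (carrier R)"
proof -
  interpret M: left_module R M by fact
  interpret H: submodule H R M by fact
  show ?thesis
    by (intro quotient_by.intro quotient_by_axioms.intro M.M.abelian_group_axioms H.subgroup_axioms)
       (auto simp: M.smult_closed M.smult_r_distr)
qed

text \<open>The first isomorphism theorem, with the kernel given through the fibres of
  \<open>p'\<close>.\<close>

lemma module_isomorphic_quotient:
  assumes A: "left_module R A" and H: "submodule H R A"
    and p': "p' ` carrier A = carrier N" and z': "p' \<zero>\<^bsub>A\<^esub> = \<zero>\<^bsub>N\<^esub>"
    and add': "\<And>x y. x \<in> carrier A \<Longrightarrow> y \<in> carrier A \<Longrightarrow> p' (x \<oplus>\<^bsub>A\<^esub> y) = p' x \<oplus>\<^bsub>N\<^esub> p' y"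
    and sm': "\<And>a x. a \<in> carrier R \<Longrightarrow> x \<in> carrier A \<Longrightarrow> p' (a \<odot>\<^bsub>A\<^esub> x) = a \<odot>\<^bsub>N\<^esub> p' x"
    and ker: "\<And>x y. x \<in> carrier A \<Longrightarrow> y \<in> carrier A \<Longrightarrow> x \<ominus>\<^bsub>A\<^esub> y \<in> H \<longleftrightarrow> p' x = p' y"
  shows "module_isomorphic R (quotient_module A H) N"
proof -
  interpret Q: quotient_by A H "carrier R" by (rule quotient_by_submodule[OF A H])
  show ?thesis
    by (rule module_isomorphic_common_module[OF A, where p="\<lambda>x. H +>\<^bsub>A\<^esub> x" and p'=p'])
       (auto simp: Q.quotient_carrier Q.quotient_zero Q.quotient_add Q.quotient_smult Q.coset_eq_iff p' z' add' sm' ker)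
qed

text \<open>The chain is moved by the isomorphism. Its layers change as records, so each new layer
  is shown isomorphic to the old one, and transitivity leads to the given class of modules.\<close>

lemma has_filtration_by_iso:
  assumes V: "has_filtration_by R V C" and iso: "module_isomorphic R V M"
  shows "has_filtration_by R M C"
proof -
  obtain s N where N0: "N 0 = {\<zero>\<^bsub>V\<^esub>}" and Ns: "N s = carrier V"
    and subm: "\<And>i. i \<le> s \<Longrightarrow> submodule (N i) R V"
    and mono: "\<And>i. i < s \<Longrightarrow> N i \<subseteq> N (Suc i)"
    and q: "\<And>i. i < s \<Longrightarrow> \<exists>D\<in>C. module_isomorphic R (quotient_module (V\<lparr>carrier := N (Suc i)\<rparr>) (N i)) D"
    using V unfolding has_filtration_by_def by metis
  obtain f where LV: "left_module R V" and LM: "left_module R M"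
    and f: "bij_betw f (carrier V) (carrier M)"
     "\<And>x y. x\<in>carrier V \<Longrightarrow> y\<in>carrier V \<Longrightarrow> f (x \<oplus>\<^bsub>V\<^esub> y) = f x \<oplus>\<^bsub>M\<^esub> f y"
     "\<And>a x. a\<in>carrier R \<Longrightarrow> x\<in>carrier V \<Longrightarrow> f (a \<odot>\<^bsub>V\<^esub> x) = a \<odot>\<^bsub>M\<^esub> f x"
    using iso unfolding module_isomorphic_def by blast
  interpret V: left_module R V by fact
  interpret M: left_module R M by fact
  have z: "f \<zero>\<^bsub>V\<^esub> = \<zero>\<^bsub>M\<^esub>" by (rule module_isomorphic_zero[OF LV LM f(1,2)])
  have fc: "\<And>x. x \<in> carrier V \<Longrightarrow> f x \<in> carrier M" using f(1) bij_betwE by blast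
  have neg: "f (\<ominus>\<^bsub>V\<^esub> x) = \<ominus>\<^bsub>M\<^esub> f x" if "x \<in> carrier V" for x
  proof -
    have "f (\<ominus>\<^bsub>V\<^esub> x) \<oplus>\<^bsub>M\<^esub> f x = \<zero>\<^bsub>M\<^esub>"
      using f(2)[of "\<ominus>\<^bsub>V\<^esub> x" x] that z by (simp add: V.M.l_neg)
    then show ?thesis using M.M.minus_equality[of "f (\<ominus>\<^bsub>V\<^esub> x)" "f x"] that fc by simp
  qed
  have subs: "N i \<subseteq> carrier V" if "i \<le> s" for i
    using subgroup.subset[OF submodule.axioms(1)[OF subm[OF that]]] by simp
  have subm': "submodule (f ` N i) R M" if "i \<le> s" for i
  proof -
    interpret N: submodule "N i" R V by (rule subm[OF that])
    have inc: "\<And>x. x \<in> N i \<Longrightarrow> x \<in> carrier V" using subs[OF that] by auto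
    show ?thesis
    proof (intro submodule.intro subgroup.intro submodule_axioms.intro)
      show "f ` N i \<subseteq> carrier (add_monoid M)" using inc fc by auto
      show "\<one>\<^bsub>add_monoid M\<^esub> \<in> f ` N i" using z N.one_closed by (auto intro!: image_eqI[of _ _ "\<zero>\<^bsub>V\<^esub>"])
      fix x assume "x \<in> f ` N i"
      then obtain x' where x': "x = f x'" "x' \<in> N i" by auto
      have "\<ominus>\<^bsub>M\<^esub> x = f (\<ominus>\<^bsub>V\<^esub> x')" using x' inc neg by simp
      then show "inv\<^bsub>add_monoid M\<^esub> x \<in> f ` N i" using x'(2) N.m_inv_closed by (auto simp: a_inv_def)
      fix a assume "a \<in> carrier R"
      then show "a \<odot>\<^bsub>M\<^esub> x \<in> f ` N i" using x' inc f(3)[of a x'] by (metis N.smult_closed image_eqI)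
    next
      fix x y assume "x \<in> f ` N i" "y \<in> f ` N i"
      then obtain x' y' where x': "x = f x'" "x' \<in> N i" "y = f y'" "y' \<in> N i" by auto
      then have "x \<oplus>\<^bsub>M\<^esub> y = f (x' \<oplus>\<^bsub>V\<^esub> y')" using f(2) inc by simp
      then show "x \<otimes>\<^bsub>add_monoid M\<^esub> y \<in> f ` N i" using x' N.m_closed by auto
    qed
  qed
  have "\<exists>D\<in>C. module_isomorphic R (quotient_module (M\<lparr>carrier := f ` N (Suc i)\<rparr>) (f ` N i)) D" if i: "i < s" for i
  proof -
    let ?A = "V\<lparr>carrier := N (Suc i)\<rparr>" and ?B = "M\<lparr>carrier := f ` N (Suc i)\<rparr>"
    have S: "submodule (N i) R V" "submodule (N (Suc i)) R V" "submodule (f ` N i) R M" "submodule (f ` N (Suc i)) R M"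
      using subm subm' i by auto
    have A: "left_module R ?A" and B: "left_module R ?B"
      using S LV LM left_module_submodule by blast+
    have SA: "submodule (N i) R ?A" and SB: "submodule (f ` N i) R ?B"
      using submodule_restrict[OF LV S(2,1) mono[OF i]] submodule_restrict[OF LM S(4,3)] mono[OF i] by auto
    interpret B: left_module R ?B by (rule B)
    interpret A: left_module R ?A by (rule A)
    interpret Q: quotient_by ?B "f ` N i" "carrier R" by (rule quotient_by_submodule[OF B SB])
    have inc: "\<And>x. x \<in> N (Suc i) \<Longrightarrow> x \<in> carrier V" "\<And>x. x \<in> N i \<Longrightarrow> x \<in> carrier V"
      using subs[of i] subs[of "Suc i"] i by auto
    have fm: "f (x \<ominus>\<^bsub>?A\<^esub> y) = f x \<ominus>\<^bsub>?B\<^esub> f y" if "x \<in> N (Suc i)" "y \<in> N (Suc i)" for x y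
    proof -
      have d: "x \<ominus>\<^bsub>?A\<^esub> y \<in> N (Suc i)" using A.M.minus_closed[of x y] that by simp
      have "(x \<ominus>\<^bsub>?A\<^esub> y) \<oplus>\<^bsub>V\<^esub> y = x"
        using A.M.minus_eq[of x y] A.M.a_assoc[of x "\<ominus>\<^bsub>?A\<^esub> y" y] A.M.l_neg[of y] A.M.a_inv_closed[of y]
          A.M.r_zero[of x] that by simp
      then have "f (x \<ominus>\<^bsub>?A\<^esub> y) \<oplus>\<^bsub>?B\<^esub> f y = f x" using f(2)[of "x \<ominus>\<^bsub>?A\<^esub> y" y] d that inc by simp
      then show ?thesis
        using B.M.minus_eq[of "f x" "f y"] B.M.a_assoc[of "f (x \<ominus>\<^bsub>?A\<^esub> y)" "f y" "\<ominus>\<^bsub>?B\<^esub> f y"]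
          B.M.r_neg[of "f y"] B.M.a_inv_closed[of "f y"] d that B.M.r_zero[of "f (x \<ominus>\<^bsub>?A\<^esub> y)"] by simp
    qed
    have inj: "f x \<in> f ` N i \<longleftrightarrow> x \<in> N i" if "x \<in> N (Suc i)" for x
      using that inc f(1) by (auto simp: bij_betw_def inj_on_def)
    have "module_isomorphic R (quotient_module ?A (N i)) (quotient_module ?B (f ` N i))"
    proof (rule module_isomorphic_quotient[OF A SA, where p'="\<lambda>x. f ` N i +>\<^bsub>?B\<^esub> f x"])
      show "(\<lambda>x. f ` N i +>\<^bsub>?B\<^esub> f x) ` carrier ?A = carrier (quotient_module ?B (f ` N i))"
        by (simp add: Q.quotient_carrier image_image)
      show "f ` N i +>\<^bsub>?B\<^esub> f \<zero>\<^bsub>?A\<^esub> = \<zero>\<^bsub>quotient_module ?B (f ` N i)\<^esub>"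
        by (simp add: Q.quotient_zero z)
      show "f ` N i +>\<^bsub>?B\<^esub> f (x \<oplus>\<^bsub>?A\<^esub> y) =
          (f ` N i +>\<^bsub>?B\<^esub> f x) \<oplus>\<^bsub>quotient_module ?B (f ` N i)\<^esub> (f ` N i +>\<^bsub>?B\<^esub> f y)"
        if "x \<in> carrier ?A" "y \<in> carrier ?A" for x y
        using that inc by (subst Q.quotient_add) (auto simp: f(2))
      show "f ` N i +>\<^bsub>?B\<^esub> f (a \<odot>\<^bsub>?A\<^esub> x) = a \<odot>\<^bsub>quotient_module ?B (f ` N i)\<^esub> (f ` N i +>\<^bsub>?B\<^esub> f x)"
        if "a \<in> carrier R" "x \<in> carrier ?A" for a x
        using that inc by (subst Q.quotient_smult) (auto simp: f(3))
      show "x \<ominus>\<^bsub>?A\<^esub> y \<in> N i \<longleftrightarrow> f ` N i +>\<^bsub>?B\<^esub> f x = f ` N i +>\<^bsub>?B\<^esub> f y"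
        if "x \<in> carrier ?A" "y \<in> carrier ?A" for x y
        using that inj[of "x \<ominus>\<^bsub>?A\<^esub> y"] fm[of x y] A.M.minus_closed[of x y] by (simp add: Q.coset_eq_iff)
    qed
    then show ?thesis using q[OF i] module_isomorphic_sym module_isomorphic_trans by blast
  qed
  then show ?thesis unfolding has_filtration_by_def
    using N0 Ns z mono subm' f(1)
    by (intro exI[of _ s] exI[of _ "\<lambda>i. f ` N i"]) (auto simp: bij_betw_def image_mono)
qed

text \<open>A vector outside the span would enlarge the independent family to an independent set
  with more than card X elements, the number of coordinates.\<close>

lemma span_by_card:
  fixes b :: "'i \<Rightarrow> 'x \<Rightarrow>\<^sub>0 'k::field"
  assumes X: "finite X" and I: "finite I" and b: "\<And>i. i \<in> I \<Longrightarrow> keys (b i) \<subseteq> X"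
    and ind: "\<And>c. (\<Sum>i\<in>I. scl (c i) (b i)) = 0 \<Longrightarrow> \<forall>i\<in>I. c i = 0"
    and card: "card X \<le> card I" and x: "keys x \<subseteq> X"
  shows "\<exists>c. x = (\<Sum>i\<in>I. scl (c i) (b i))"
proof -
  have inj: "inj_on b I"
  proof (rule inj_onI, rule ccontr)
    fix i j assume ij: "i \<in> I" "j \<in> I" "b i = b j" "i \<noteq> j"
    \<comment> \<open>Equal members of the family would satisfy a relation with coefficients 1 and
      -1; hence the family can be treated as a set.\<close>
    define c :: "'i \<Rightarrow> 'k" where "c k = (if k = i then 1 else if k = j then - 1 else 0)" for k
    have "(\<Sum>k\<in>I. scl (c k) (b k)) = (\<Sum>k\<in>{i, j}. scl (c k) (b k))"
      using ij I by (intro sum.mono_neutral_right) (auto simp: c_def)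
    also have "\<dots> = 0" using ij by (simp add: c_def)
    finally show False using ind[of c] ij(1) by (auto simp: c_def)
  qed
  have sp: "v \<in> pm.span ((\<lambda>x. single x (1::'k)) ` X)" if "keys v \<subseteq> X" for v :: "'x \<Rightarrow>\<^sub>0 'k"
  proof -
    have "v = (\<Sum>x\<in>keys v. scl (lookup v x) (single x 1))"
      using lin_expand[of v] by (simp add: lin_def)
    also have "\<dots> \<in> pm.span ((\<lambda>x. single x (1::'k)) ` X)"
      using that by (intro pm.span_sum pm.span_scale pm.span_base) auto
    finally show ?thesis .
  qed
  have indep: "pm.independent (b ` I)"
  proof
    assume "pm.dependent (b ` I)"
    then obtain u where u: "\<exists>v\<in>b ` I. u v \<noteq> 0" "(\<Sum>v\<in>b ` I. scl (u v) v) = 0"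
      using pm.dependent_finite[of "b ` I"] I by auto
    then have "(\<Sum>i\<in>I. scl (u (b i)) (b i)) = 0" by (simp add: sum.reindex[OF inj])
    from ind[OF this] u(1) show False by auto
  qed
  have "x \<in> pm.span (b ` I)"
  proof (rule ccontr)
    assume nx: "x \<notin> pm.span (b ` I)"
    then have "pm.independent (insert x (b ` I))" using indep by (rule pm.independent_insertI)
    moreover have "insert x (b ` I) \<subseteq> pm.span ((\<lambda>x. single x (1::'k)) ` X)"
      using sp x b by auto
    ultimately have "card (insert x (b ` I)) \<le> card ((\<lambda>x. single x (1::'k)) ` X)"
      using pm.independent_span_bound[of "(\<lambda>x. single x (1::'k)) ` X" "insert x (b ` I)"] X by auto
    also have "\<dots> \<le> card X" using X by (rule card_image_le)
    finally have "card (insert x (b ` I)) \<le> card X" .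
    moreover have "x \<notin> b ` I" using nx pm.span_base[of x "b ` I"] by blast
    ultimately show False using I card card_image[OF inj] by simp
  qed
  then obtain u where "x = (\<Sum>v\<in>b ` I. scl (u v) v)"
    using pm.span_finite[of "b ` I"] I by auto
  then show ?thesis by (intro exI[of _ "\<lambda>i. u (b i)"]) (simp add: sum.reindex[OF inj])
qed

lemma (in group_set) submodule_perm_repI:
  fixes N :: "('x \<Rightarrow>\<^sub>0 'k::field) set"
  assumes "\<And>x. x \<in> N \<Longrightarrow> keys x \<subseteq> X" "0 \<in> N" "\<And>x y. x \<in> N \<Longrightarrow> y \<in> N \<Longrightarrow> x + y \<in> N"
    and sm: "\<And>a x. keys a \<subseteq> carrier G \<Longrightarrow> x \<in> N \<Longrightarrow> conv act a x \<in> N"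
  shows "submodule N (group_algebra G) (perm_rep act X)"
proof -
  interpret V: left_module "group_algebra G :: ('a \<Rightarrow>\<^sub>0 'k) ring" "perm_rep act X" by (rule left_module_perm_rep)
  have inv: "inv\<^bsub>add_monoid (perm_rep act X :: ('a \<Rightarrow>\<^sub>0 'k, _) module)\<^esub> x \<in> N" if "x \<in> N" for x
  proof -
    have k: "keys x \<subseteq> X" using assms(1) that by auto
    have "conv act (single \<one> 1) x = x" using k by (intro conv_unit act_one) auto
    \<comment> \<open>Negation is the action of -1 times the unit, so closure under the algebra
      provides inverses.\<close>
    then have e: "conv act (single \<one> (- 1)) x = - x"
      using conv_scl_left[of act "-1" "single \<one> 1" x] by (simp add: poly_mapping_eqI)
    have "\<ominus>\<^bsub>perm_rep act X :: ('a \<Rightarrow>\<^sub>0 'k, _) module\<^esub> x = - x"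
      using k by (intro V.M.minus_equality) (auto simp: perm_rep_simps)
    then show ?thesis using sm[of "single \<one> (- 1)" x] that e by (simp add: a_inv_def)
  qed
  show ?thesis
    using assms inv
    by (intro submodule.intro subgroup.intro submodule_axioms.intro)
       (auto simp: perm_rep_simps group_algebra_simps)
qed

section \<open>Chains of sums of images\<close>

lemma keys_sclI: "keys v \<subseteq> X \<Longrightarrow> keys (scl c v) \<subseteq> X"
  using keys_scl by (rule order_trans)

lemma keys_sumI: "(\<And>i. i \<in> I \<Longrightarrow> keys (v i) \<subseteq> X) \<Longrightarrow> keys (sum v I) \<subseteq> X"
  by (rule order_trans[OF keys_sum]) blast

text \<open>The submodules \<open>N i\<close> are the sums of the images of the first \<open>i\<close> homomorphisms \<open>\<theta> j\<close>. The
  containments \<open>triangular\<close> bound the layers of this chain from below; as the dimensions add up to at least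
  \<open>card X\<close>, the layers are exactly \<open>U j / D j\<close> and the chain exhausts the module.\<close>

locale layered = V?: group_set G act X
  for G :: "'g monoid" (structure) and act :: "'g \<Rightarrow> 'x \<Rightarrow> 'x" and X +
  fixes s :: nat and uact :: "nat \<Rightarrow> 'g \<Rightarrow> 'y \<Rightarrow> 'y" and U :: "nat \<Rightarrow> 'y set"
    and \<theta> :: "nat \<Rightarrow> 'y \<Rightarrow> 'x \<Rightarrow>\<^sub>0 'k::field" and D :: "nat \<Rightarrow> ('y \<Rightarrow>\<^sub>0 'k) set"
    and W :: "nat \<Rightarrow> 'w set" and u :: "nat \<Rightarrow> 'w \<Rightarrow> 'y \<Rightarrow>\<^sub>0 'k"
  assumes fin_X: "finite X"
    and U_set: "j < s \<Longrightarrow> group_set G (uact j) (U j)"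
    and theta_keys: "j < s \<Longrightarrow> y \<in> U j \<Longrightarrow> keys (\<theta> j y) \<subseteq> X"
    and theta_act: "j < s \<Longrightarrow> g \<in> carrier G \<Longrightarrow> y \<in> U j \<Longrightarrow>
        \<theta> j (uact j g y) = conv act (single g 1) (\<theta> j y)"
    and D_diff: "j < s \<Longrightarrow> m \<in> D j \<Longrightarrow> m' \<in> D j \<Longrightarrow> m - m' \<in> D j"
    and fin_W: "j < s \<Longrightarrow> finite (W j)"
    and u_keys: "j < s \<Longrightarrow> w \<in> W j \<Longrightarrow> keys (u j w) \<subseteq> U j"
    and u_indep: "j < s \<Longrightarrow> (\<Sum>w\<in>W j. scl (c w) (u j w)) \<in> D j \<Longrightarrow> w \<in> W j \<Longrightarrow> c w = 0"
    and card_le: "card X \<le> (\<Sum>j<s. card (W j))"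
begin

definition N :: "nat \<Rightarrow> ('x \<Rightarrow>\<^sub>0 'k) set" where
  "N i = {(\<Sum>j<i. lin (\<theta> j) (m j)) | m. \<forall>j<i. keys (m j) \<subseteq> U j}"

lemma N_I: "(\<And>j. j < i \<Longrightarrow> keys (m j) \<subseteq> U j) \<Longrightarrow> (\<Sum>j<i. lin (\<theta> j) (m j)) \<in> N i"
  unfolding N_def by blast

lemma N_0: "N 0 = {0}"
  by (auto simp: N_def)

lemma N_zero: "0 \<in> N i"
  using N_I[of i "\<lambda>_. 0"] by simp

lemma N_add:
  assumes "x \<in> N i" "y \<in> N i"
  shows "x + y \<in> N i"
proof -
  obtain m m' where m: "\<forall>j<i. keys (m j) \<subseteq> U j" "x = (\<Sum>j<i. lin (\<theta> j) (m j))"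
    "\<forall>j<i. keys (m' j) \<subseteq> U j" "y = (\<Sum>j<i. lin (\<theta> j) (m' j))"
    using assms unfolding N_def by auto
  then have "x + y = (\<Sum>j<i. lin (\<theta> j) (m j + m' j))" by (simp add: lin_add sum.distrib)
  also have "\<dots> \<in> N i" using m by (intro N_I keys_addI) auto
  finally show ?thesis .
qed

lemma N_scl:
  assumes "x \<in> N i"
  shows "scl c x \<in> N i"
proof -
  obtain m where m: "\<forall>j<i. keys (m j) \<subseteq> U j" "x = (\<Sum>j<i. lin (\<theta> j) (m j))"
    using assms unfolding N_def by auto
  then have "scl c x = (\<Sum>j<i. lin (\<theta> j) (scl c (m j)))" by (simp add: lin_scl pm.scale_sum_right)
  also have "\<dots> \<in> N i" using m by (intro N_I keys_sclI) simp
  finally show ?thesis .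
qed

lemma N_diff: "x \<in> N i \<Longrightarrow> y \<in> N i \<Longrightarrow> x - y \<in> N i"
  using N_add[of x i "scl (-1) y"] N_scl[of y i "-1"] by simp

lemma N_conv:
  assumes "i \<le> s" "keys a \<subseteq> carrier G" "x \<in> N i"
  shows "conv act a x \<in> N i"
proof -
  obtain m where m: "\<forall>j<i. keys (m j) \<subseteq> U j" "x = (\<Sum>j<i. lin (\<theta> j) (m j))"
    using assms unfolding N_def by auto
  have "conv act a (sum f {..<i}) = (\<Sum>j<i. conv act a (f j))" for f
    by (induction i) (simp_all add: conv_add_right)
  then have "conv act a x = (\<Sum>j<i. conv act a (lin (\<theta> j) (m j)))" using m by simp
  also have "\<dots> = (\<Sum>j<i. lin (\<theta> j) (conv (uact j) a (m j)))"
  proof (intro sum.cong refl)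
    fix j assume j: "j \<in> {..<i}"
    then have "\<And>g y. g \<in> keys a \<Longrightarrow> y \<in> keys (m j) \<Longrightarrow> \<theta> j (uact j g y) = conv act (single g 1) (\<theta> j y)"
      using assms m theta_act by (meson lessThan_iff less_le_trans subsetD)
    then show "conv act a (lin (\<theta> j) (m j)) = lin (\<theta> j) (conv (uact j) a (m j))"
      by (rule lin_conv[symmetric])
  qed
  also have "\<dots> \<in> N i"
  proof (intro N_I keys_conv)
    fix j g y assume "j < i" "g \<in> keys a" "y \<in> keys (m j)"
    then have "j < s" "g \<in> carrier G" "y \<in> U j" using assms m by auto
    then show "uact j g y \<in> U j" using group_set.act_closed[OF U_set] by blast
  qed
  finally show ?thesis .
qed

lemma N_keys: "i \<le> s \<Longrightarrow> x \<in> N i \<Longrightarrow> keys x \<subseteq> X"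
proof -
  assume i: "i \<le> s" and "x \<in> N i"
  then obtain m where m: "\<forall>j<i. keys (m j) \<subseteq> U j" "x = (\<Sum>j<i. lin (\<theta> j) (m j))"
    unfolding N_def by auto
  have "keys (lin (\<theta> j) (m j)) \<subseteq> X" if "j < i" for j
    using that i m by (intro keys_lin theta_keys) auto
  then show ?thesis unfolding m(2) by (intro keys_sumI) simp
qed

lemma N_Suc: "x \<in> N (Suc i) \<longleftrightarrow> (\<exists>y m. y \<in> N i \<and> keys m \<subseteq> U i \<and> x = y + lin (\<theta> i) m)"
proof
  assume "x \<in> N (Suc i)"
  then obtain m where m: "\<forall>j<Suc i. keys (m j) \<subseteq> U j" "x = (\<Sum>j<Suc i. lin (\<theta> j) (m j))"
    unfolding N_def by auto
  then show "\<exists>y m. y \<in> N i \<and> keys m \<subseteq> U i \<and> x = y + lin (\<theta> i) m"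
    using N_I[of i m] by auto
next
  assume "\<exists>y m. y \<in> N i \<and> keys m \<subseteq> U i \<and> x = y + lin (\<theta> i) m"
  then obtain m m' where m: "\<forall>j<i. keys (m j) \<subseteq> U j" "keys m' \<subseteq> U i"
      "x = (\<Sum>j<i. lin (\<theta> j) (m j)) + lin (\<theta> i) m'"
    unfolding N_def by auto
  have "x = (\<Sum>j<Suc i. lin (\<theta> j) ((m(i := m')) j))" using m by simp
  also have "\<dots> \<in> N (Suc i)" using m by (intro N_I) (auto simp: less_Suc_eq)
  finally show "x \<in> N (Suc i)" .
qed

lemma N_mono: "i \<le> j \<Longrightarrow> N i \<subseteq> N j"
proof (induction j rule: dec_induct)
  case (step j)
  have "N j \<subseteq> N (Suc j)"
  proof
    fix x assume "x \<in> N j"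
    then show "x \<in> N (Suc j)" unfolding N_Suc by (intro exI[of _ x] exI[of _ 0]) auto
  qed
  with step show ?case by blast
qed simp

lemma submodule_N: "i \<le> s \<Longrightarrow> submodule (N i) (group_algebra G) (perm_rep act X)"
  by (rule V.submodule_perm_repI) (use N_keys N_zero N_add N_conv in auto)

end

text \<open>The assumption \<open>triangular\<close> refers to \<open>N\<close>, which is defined
  from the data of \<open>layered\<close>; hence a second locale.\<close>

locale layered_triangular = layered G act X s uact U \<theta> D W u
  for G :: "'g monoid" (structure) and act :: "'g \<Rightarrow> 'x \<Rightarrow> 'x" and X
    and s :: nat and uact :: "nat \<Rightarrow> 'g \<Rightarrow> 'y \<Rightarrow> 'y" and U :: "nat \<Rightarrow> 'y set"
    and \<theta> :: "nat \<Rightarrow> 'y \<Rightarrow> 'x \<Rightarrow>\<^sub>0 'k::field" and D :: "nat \<Rightarrow> ('y \<Rightarrow>\<^sub>0 'k) set"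
    and W :: "nat \<Rightarrow> 'w set" and u :: "nat \<Rightarrow> 'w \<Rightarrow> 'y \<Rightarrow>\<^sub>0 'k" +
  assumes triangular: "j < s \<Longrightarrow> keys m \<subseteq> U j \<Longrightarrow> lin (\<theta> j) m \<in> N j \<Longrightarrow> m \<in> D j"
begin

definition "b j w = lin (\<theta> j) (u j w)"

lemma part_sum: "(\<Sum>w\<in>W j. scl (c w) (b j w)) = lin (\<theta> j) (\<Sum>w\<in>W j. scl (c w) (u j w))"
  by (simp add: b_def lin_sum lin_scl)

lemma keys_part: "j < s \<Longrightarrow> keys (\<Sum>w\<in>W j. scl (c w) (u j w)) \<subseteq> U j"
  by (intro keys_sumI keys_sclI u_keys)

text \<open>Peeling off from the top: the whole sum and its part below layer \<open>k\<close> lie in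
  \<open>N k\<close>, hence so does the summand of layer \<open>k\<close>. Then
  \<open>triangular\<close> and \<open>u_indep\<close> make its coefficients vanish, and the number
  of layers drops.\<close>

lemma coeff_vanish:
  assumes "i \<le> k" "k \<le> s" "(\<Sum>j<k. \<Sum>w\<in>W j. scl (c j w) (b j w)) \<in> N i" "i \<le> j" "j < k" "w \<in> W j"
  shows "c j w = 0"
  using assms
proof (induction k arbitrary: j w rule: dec_induct)
  case (step k)
  have k: "k < s" using step by simp
  have lower: "(\<Sum>j<k. \<Sum>w\<in>W j. scl (c j w) (b j w)) \<in> N k"
    unfolding part_sum using k by (intro N_I keys_part) simp
  have "(\<Sum>j<Suc k. \<Sum>w\<in>W j. scl (c j w) (b j w)) \<in> N k"
    using step(5) N_mono[OF step(1)] by blast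
  from N_diff[OF this lower] have "lin (\<theta> k) (\<Sum>w\<in>W k. scl (c k w) (u k w)) \<in> N k"
    by (simp add: part_sum)
  then have "(\<Sum>w\<in>W k. scl (c k w) (u k w)) \<in> D k"
    by (rule triangular[OF k keys_part[OF k]])
  then have z: "\<And>w. w \<in> W k \<Longrightarrow> c k w = 0" using u_indep[OF k] by blast
  show ?case
  proof (cases "j = k")
    case False
    have "(\<Sum>j<k. \<Sum>w\<in>W j. scl (c j w) (b j w)) \<in> N i" using step(5) by (simp add: z)
    then show ?thesis using step False by simp
  qed (use z step in auto)
next
  case base
  then show ?case by linarith
qed

text \<open>For i = 0, \<open>coeff_vanish\<close> says that all \<open>b j w\<close> together are
  independent; \<open>card_le\<close> then makes them a basis.\<close>

lemma spanning:
  assumes "keys x \<subseteq> X"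
  shows "\<exists>c. x = (\<Sum>j<s. \<Sum>w\<in>W j. scl (c j w) (b j w))"
proof -
  let ?I = "Sigma {..<s} W"
  have sum: "(\<Sum>p\<in>?I. scl (c p) (case_prod b p)) = (\<Sum>j<s. \<Sum>w\<in>W j. scl (c (j, w)) (b j w))" for c
    using fin_W by (subst sum.Sigma) (auto simp: case_prod_unfold)
  have "\<exists>c. x = (\<Sum>p\<in>?I. scl (c p) (case_prod b p))"
  proof (rule span_by_card[OF fin_X])
    show "finite ?I" using fin_W by auto
    show "keys (case_prod b p) \<subseteq> X" if pI: "p \<in> ?I" for p
    proof -
      obtain j w where p: "p = (j, w)" "j < s" "w \<in> W j" using pI by (cases p) simp
      have "keys (b j w) \<subseteq> X"
        unfolding b_def using u_keys[OF p(2,3)] by (intro keys_lin theta_keys[OF p(2)]) auto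
      then show ?thesis by (simp add: p)
    qed
    show "card X \<le> card ?I" using card_le fin_W by simp
    show "\<forall>p\<in>?I. c p = 0" if "(\<Sum>p\<in>?I. scl (c p) (case_prod b p)) = 0" for c
      using coeff_vanish[of 0 s "\<lambda>j w. c (j, w)"] that unfolding sum by (auto simp: N_0)
  qed (rule assms)
  then show ?thesis unfolding sum by (auto intro: exI[of _ "\<lambda>j w. _ (j, w)"])
qed

lemma N_top: "N s = {v. keys v \<subseteq> X}"
proof
  show "{v. keys v \<subseteq> X} \<subseteq> N s"
  proof
    fix x :: "'x \<Rightarrow>\<^sub>0 'k" assume "x \<in> {v. keys v \<subseteq> X}"
    then obtain c where "x = (\<Sum>j<s. \<Sum>w\<in>W j. scl (c j w) (b j w))" using spanning by auto
    then show "x \<in> N s" using N_I[of s "\<lambda>j. \<Sum>w\<in>W j. scl (c j w) (u j w)"] keys_part by (simp add: part_sum)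
  qed
qed (use N_keys in auto)

text \<open>The converse of \<open>triangular\<close>, where the count of dimensions enters.
  Expanded in the basis \<open>b\<close>, the element has no part above layer \<open>i\<close>. Its
  part in layer \<open>i\<close> comes from a combination \<open>?m\<close> for which
  \<open>triangular\<close> puts m - ?m into \<open>D i\<close>; so \<open>?m\<close> itself lies in
  \<open>D i\<close>, and \<open>u_indep\<close> makes its coefficients vanish.\<close>

lemma D_imp_N:
  assumes i: "i < s" and m: "keys m \<subseteq> U i" "m \<in> D i"
  shows "lin (\<theta> i) m \<in> N i"
proof -
  let ?x = "lin (\<theta> i) m"
  have kx: "keys ?x \<subseteq> X" using m by (intro keys_lin theta_keys[OF i]) auto
  have xS: "?x \<in> N (Suc i)" unfolding N_Suc using m N_zero by force
  obtain c where c: "?x = (\<Sum>j<s. \<Sum>w\<in>W j. scl (c j w) (b j w))" using spanning[OF kx] by auto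
  have z: "\<And>j w. Suc i \<le> j \<Longrightarrow> j < s \<Longrightarrow> w \<in> W j \<Longrightarrow> c j w = 0"
    using coeff_vanish[of "Suc i" s c] xS c i by auto
  have "(\<Sum>j<s. \<Sum>w\<in>W j. scl (c j w) (b j w)) = (\<Sum>j<Suc i. \<Sum>w\<in>W j. scl (c j w) (b j w))"
    using i z by (intro sum.mono_neutral_right) auto
  then have x: "?x = (\<Sum>j<i. \<Sum>w\<in>W j. scl (c j w) (b j w)) + lin (\<theta> i) (\<Sum>w\<in>W i. scl (c i w) (u i w))"
    using c by (simp add: part_sum)
  have low: "(\<Sum>j<i. \<Sum>w\<in>W j. scl (c j w) (b j w)) \<in> N i"
    unfolding part_sum using i by (intro N_I keys_part) simp
  let ?m = "\<Sum>w\<in>W i. scl (c i w) (u i w)"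
  have "lin (\<theta> i) (m - ?m) \<in> N i" using low x by (simp add: lin_diff algebra_simps)
  moreover have "keys (m - ?m) \<subseteq> U i" using keys_diff[of m ?m] m keys_part[OF i] by blast
  ultimately have "m - ?m \<in> D i" using triangular[OF i] by blast
  from D_diff[OF i m(2) this] have "?m \<in> D i" by simp
  then have "\<And>w. w \<in> W i \<Longrightarrow> c i w = 0" using u_indep[OF i] by blast
  then show ?thesis using x low by simp
qed

text \<open>Both modules are quotients of k (U i) with kernel \<open>D i\<close>: the layer through
  \<open>\<theta> i\<close>, the module \<open>C\<close> through \<open>B\<close>.\<close>

lemma layer_iso:
  assumes i: "i < s"
    and B: "B ` {m. keys m \<subseteq> U i} = carrier C"
    and Badd: "\<And>m m'. keys m \<subseteq> U i \<Longrightarrow> keys m' \<subseteq> U i \<Longrightarrow> B (m + m') = B m \<oplus>\<^bsub>C\<^esub> B m'"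
    and Bz: "B 0 = \<zero>\<^bsub>C\<^esub>"
    and Bsm: "\<And>a m. keys a \<subseteq> carrier G \<Longrightarrow> keys m \<subseteq> U i \<Longrightarrow> B (conv (uact i) a m) = a \<odot>\<^bsub>C\<^esub> B m"
    and Bker: "\<And>m m'. keys m \<subseteq> U i \<Longrightarrow> keys m' \<subseteq> U i \<Longrightarrow> B m = B m' \<longleftrightarrow> m - m' \<in> D i"
  shows "module_isomorphic (group_algebra G)
    (quotient_module ((perm_rep act X)\<lparr>carrier := N (Suc i)\<rparr>) (N i)) C"
proof -
  let ?V = "perm_rep act X :: ('g \<Rightarrow>\<^sub>0 'k, 'x \<Rightarrow>\<^sub>0 'k) module"
  let ?A = "?V\<lparr>carrier := N (Suc i)\<rparr>" and ?U = "perm_rep (uact i) (U i) :: ('g \<Rightarrow>\<^sub>0 'k, 'y \<Rightarrow>\<^sub>0 'k) module"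
  have V: "left_module (group_algebra G) ?V" by (rule V.left_module_perm_rep)
  have S: "submodule (N i) (group_algebra G) ?V" "submodule (N (Suc i)) (group_algebra G) ?V"
    using submodule_N i by simp_all
  have A: "left_module (group_algebra G) ?A" by (rule left_module_submodule[OF V S(2)])
  have SA: "submodule (N i) (group_algebra G) ?A"
    by (rule submodule_restrict[OF V S(2,1) N_mono]) simp
  interpret A: left_module "group_algebra G" ?A by (rule A)
  interpret Q: quotient_by ?A "N i" "carrier (group_algebra G :: ('g \<Rightarrow>\<^sub>0 'k) ring)"
    by (rule quotient_by_submodule[OF A SA])
  interpret U: group_set G "uact i" "U i" by (rule U_set[OF i])
  have minus: "x \<ominus>\<^bsub>?A\<^esub> y = x - y" if "x \<in> N (Suc i)" "y \<in> N (Suc i)" for x y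
  proof -
    have "- y \<in> N (Suc i)" using N_diff[OF N_zero that(2)] by simp
    then have "\<ominus>\<^bsub>?A\<^esub> y = - y" using that by (intro A.M.minus_equality) (auto simp: perm_rep_simps)
    then show ?thesis by (simp add: a_minus_def perm_rep_simps)
  qed
  have thN: "lin (\<theta> i) m \<in> N (Suc i)" if "keys m \<subseteq> U i" for m
    unfolding N_Suc using that N_zero by force
  define p where "p m = N i +>\<^bsub>?A\<^esub> lin (\<theta> i) m" for m
  have peq: "p m = p m' \<longleftrightarrow> m - m' \<in> D i" if "keys m \<subseteq> U i" "keys m' \<subseteq> U i" for m m'
  proof -
    have k: "keys (m - m') \<subseteq> U i" using keys_diff[of m m'] that by blast
    have "p m = p m' \<longleftrightarrow> lin (\<theta> i) (m - m') \<in> N i"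
      unfolding p_def using that thN by (subst Q.coset_eq_iff) (auto simp: minus lin_diff)
    then show ?thesis using triangular[OF i k] D_imp_N[OF i k] by blast
  qed
  show ?thesis
  proof (rule module_isomorphic_common_module[OF U.left_module_perm_rep, where p=p and p'=B])
    show "p ` carrier ?U = carrier (quotient_module ?A (N i))"
    proof
      show "p ` carrier ?U \<subseteq> carrier (quotient_module ?A (N i))"
        using thN by (auto simp: p_def Q.quotient_carrier perm_rep_simps)
      show "carrier (quotient_module ?A (N i)) \<subseteq> p ` carrier ?U"
      proof
        fix Y assume "Y \<in> carrier (quotient_module ?A (N i))"
        then obtain x where x: "x \<in> N (Suc i)" "Y = N i +>\<^bsub>?A\<^esub> x" by (auto simp: Q.quotient_carrier)
        then obtain y m where y: "y \<in> N i" "keys m \<subseteq> U i" "x = y + lin (\<theta> i) m" unfolding N_Suc by auto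
        have "Y = p m" unfolding p_def x(2) using y x thN[OF y(2)] by (subst Q.coset_eq_iff) (auto simp: minus)
        then show "Y \<in> p ` carrier ?U" using y by (auto simp: perm_rep_simps)
      qed
    qed
    show "p \<zero>\<^bsub>?U\<^esub> = \<zero>\<^bsub>quotient_module ?A (N i)\<^esub>"
      by (simp add: p_def perm_rep_simps) (simp add: Q.quotient_zero[unfolded perm_rep_simps] perm_rep_simps)
    show "p (x \<oplus>\<^bsub>?U\<^esub> y) = p x \<oplus>\<^bsub>quotient_module ?A (N i)\<^esub> p y" if "x \<in> carrier ?U" "y \<in> carrier ?U" for x y
      unfolding p_def using that thN by (subst Q.quotient_add) (auto simp: perm_rep_simps lin_add)
    show "p (a \<odot>\<^bsub>?U\<^esub> x) = a \<odot>\<^bsub>quotient_module ?A (N i)\<^esub> p x"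
      if "a \<in> carrier (group_algebra G)" "x \<in> carrier ?U" for a x
    proof -
      have "lin (\<theta> i) (conv (uact i) a x) = conv act a (lin (\<theta> i) x)"
        using that theta_act[OF i] by (intro lin_conv) (auto simp: perm_rep_simps group_algebra_simps)
      then show ?thesis
        unfolding p_def using that thN by (subst Q.quotient_smult) (auto simp: perm_rep_simps)
    qed
    show "p x = p y \<longleftrightarrow> B x = B y" if "x \<in> carrier ?U" "y \<in> carrier ?U" for x y
      using that by (simp add: peq Bker perm_rep_simps)
  qed (use B Bz in \<open>auto simp: perm_rep_simps group_algebra_simps Badd Bsm\<close>)
qed

theorem has_filtration:
  assumes "\<And>i. i < s \<Longrightarrow> \<exists>C\<in>\<C>. module_isomorphic (group_algebra G)
    (quotient_module ((perm_rep act X)\<lparr>carrier := N (Suc i)\<rparr>) (N i)) C"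
  shows "has_filtration_by (group_algebra G) (perm_rep act X) \<C>"
  unfolding has_filtration_by_def
  using assms submodule_N
  by (intro exI[of _ s] exI[of _ N]) (simp add: N_0 N_top perm_rep_simps N_mono)

end

section \<open>Counting semistandard tableaux\<close>

definition ptn :: "(nat \<Rightarrow> nat) \<Rightarrow> bool" where
  "ptn \<mu> \<longleftrightarrow> antimono \<mu> \<and> finite {i. \<mu> i \<noteq> 0}"

definition psize :: "(nat \<Rightarrow> nat) \<Rightarrow> nat" where
  "psize \<mu> = (\<Sum>i | \<mu> i \<noteq> 0. \<mu> i)"

lemma psize_eq: "finite S \<Longrightarrow> {i. \<mu> i \<noteq> 0} \<subseteq> S \<Longrightarrow> psize \<mu> = sum \<mu> S"
  unfolding psize_def by (rule sum.mono_neutral_left) auto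

text \<open>A partition is a function with infinitely many zero rows, so a box may open a new row.
  The result need not be decreasing; that condition is added in \<open>up\<close>.\<close>

definition add_box :: "(nat \<Rightarrow> nat) \<Rightarrow> nat \<Rightarrow> nat \<Rightarrow> nat" where
  "add_box \<mu> i = \<mu>(i := Suc (\<mu> i))"

lemma add_box_finite: "finite {i. \<mu> i \<noteq> 0} \<Longrightarrow> finite {j. add_box \<mu> i j \<noteq> 0}"
  by (rule finite_subset[of _ "insert i {i. \<mu> i \<noteq> 0}"]) (auto simp: add_box_def)

lemma psize_add_box:
  assumes "finite {i. \<mu> i \<noteq> 0}"
  shows "psize (add_box \<mu> i) = Suc (psize \<mu>)"
proof -
  let ?S = "insert i {i. \<mu> i \<noteq> 0}"
  have "psize (add_box \<mu> i) = sum (add_box \<mu> i) ?S"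
    using assms by (intro psize_eq) (auto simp: add_box_def)
  also have "\<dots> = Suc (\<mu> i) + sum \<mu> (?S - {i})"
    using assms by (subst sum.remove[of _ i]) (auto simp: add_box_def intro!: sum.cong)
  also have "\<dots> = Suc (sum \<mu> ?S)"
    using assms by (subst sum.remove[of ?S i \<mu>]) auto
  also have "sum \<mu> ?S = psize \<mu>" using assms by (intro psize_eq[symmetric]) auto
  finally show ?thesis .
qed

lemma inj_add_box: "inj (add_box \<mu>)"
proof (rule injI)
  fix i j assume "add_box \<mu> i = add_box \<mu> j"
  then have "add_box \<mu> i i = add_box \<mu> j i" by simp
  then show "i = j" by (simp add: add_box_def split: if_splits)
qed

text \<open>The interlacing \<mu> 0 \<ge> \<alpha> 0 \<ge> \<mu> 1 \<ge> \<alpha> 1 \<ge> ... says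
  that the boxes of \<mu> outside \<alpha> form a horizontal strip.\<close>

definition interl :: "(nat \<Rightarrow> nat) \<Rightarrow> (nat \<Rightarrow> nat) \<Rightarrow> bool" where
  "interl \<mu> \<alpha> \<longleftrightarrow> (\<forall>i. \<alpha> i \<le> \<mu> i \<and> \<mu> (Suc i) \<le> \<alpha> i)"

lemma interl_support:
  assumes "interl \<mu> \<alpha>"
  shows "{i. \<alpha> i \<noteq> 0} \<subseteq> {i. \<mu> i \<noteq> 0}"
proof
  fix j assume "j \<in> {i. \<alpha> i \<noteq> 0}"
  moreover have "\<alpha> j \<le> \<mu> j" using assms by (simp add: interl_def)
  ultimately show "j \<in> {i. \<mu> i \<noteq> 0}" by simp
qed

lemma interl_finite: "interl \<mu> \<alpha> \<Longrightarrow> finite {i. \<mu> i \<noteq> 0} \<Longrightarrow> finite {i. \<alpha> i \<noteq> 0}"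
  using interl_support finite_subset by metis

lemma interl_ptn_lower: "interl \<mu> \<alpha> \<Longrightarrow> ptn \<mu> \<Longrightarrow> ptn \<alpha>"
  unfolding ptn_def using interl_finite
  by (auto simp: interl_def antimono_iff_le_Suc intro: order_trans)

lemma interl_antimono_upper: "interl \<mu> \<alpha> \<Longrightarrow> antimono \<mu>"
  by (auto simp: interl_def antimono_iff_le_Suc intro: order_trans)

definition strips :: "(nat \<Rightarrow> nat) \<Rightarrow> nat \<Rightarrow> (nat \<Rightarrow> nat) set" where
  "strips \<mu> m = {\<alpha>. interl \<mu> \<alpha> \<and> psize \<mu> = psize \<alpha> + m}"

definition Par :: "nat \<Rightarrow> (nat \<Rightarrow> nat) set" where
  "Par n = {\<mu>. ptn \<mu> \<and> psize \<mu> = n}"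

lemma Par_bounds:
  assumes "\<mu> \<in> Par n"
  shows "\<mu> i \<le> n" "i \<ge> n \<Longrightarrow> \<mu> i = 0"
proof -
  have \<mu>: "antimono \<mu>" "finite {i. \<mu> i \<noteq> 0}" "psize \<mu> = n" using assms by (auto simp: Par_def ptn_def)
  show "\<mu> i \<le> n"
    using member_le_sum[of i "{i. \<mu> i \<noteq> 0}" \<mu>] \<mu>(2,3) unfolding psize_def by (cases "\<mu> i = 0") auto
  show "\<mu> i = 0" if "i \<ge> n"
  proof (rule ccontr)
    assume "\<mu> i \<noteq> 0"
    then have "\<And>j. j \<le> i \<Longrightarrow> \<mu> j \<ge> 1" using antimonoD[OF \<mu>(1)] by (metis One_nat_def Suc_leI le_zero_eq neq0_conv)
    then have "(\<Sum>j\<le>i. 1) \<le> (\<Sum>j\<le>i. \<mu> j)" by (intro sum_mono) auto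
    also have "\<dots> \<le> (\<Sum>j\<in>{..i} \<union> {i. \<mu> i \<noteq> 0}. \<mu> j)" using \<mu> by (intro sum_mono2) auto
    also have "\<dots> = n" using psize_eq[of "{..i} \<union> {i. \<mu> i \<noteq> 0}" \<mu>] \<mu> by auto
    finally show False using that by simp
  qed
qed

lemma finite_Par: "finite (Par n)"
proof (rule finite_subset)
  show "Par n \<subseteq> {\<mu>. \<forall>i. (i \<in> {..<n} \<longrightarrow> \<mu> i \<in> {..n}) \<and> (i \<notin> {..<n} \<longrightarrow> \<mu> i = 0)}"
    using Par_bounds by auto
qed (intro finite_set_of_finite_funs; simp)

lemma strips_subset: "ptn \<mu> \<Longrightarrow> strips \<mu> m \<subseteq> Par (psize \<mu> - m)"
  by (auto simp: strips_def Par_def intro: interl_ptn_lower)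

lemma finite_strips: "ptn \<mu> \<Longrightarrow> finite (strips \<mu> m)"
  using finite_subset[OF strips_subset finite_Par] .

text \<open>The Kostka number for the content \<nu>, computed by removing the horizontal strip of
  the largest letter. The letters are 0, ..., r - 1, so only the values of \<nu> below
  \<open>r\<close> enter.\<close>

fun kostka :: "nat \<Rightarrow> (nat \<Rightarrow> nat) \<Rightarrow> (nat \<Rightarrow> nat) \<Rightarrow> nat" where
  "kostka 0 \<nu> \<mu> = (if \<mu> = (\<lambda>_. 0) then 1 else 0)"
| "kostka (Suc r) \<nu> \<mu> = (\<Sum>\<alpha>\<in>strips \<mu> (\<nu> r). kostka r \<nu> \<alpha>)"

lemma kostka_cong: "(\<And>a. a < r \<Longrightarrow> \<nu> a = \<nu>' a) \<Longrightarrow> kostka r \<nu> \<mu> = kostka r \<nu>' \<mu>"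
  by (induction r arbitrary: \<mu>) (auto intro!: sum.cong)

definition up :: "(nat \<Rightarrow> nat) \<Rightarrow> (nat \<Rightarrow> nat) set" where
  "up \<mu> = {\<eta>. ptn \<eta> \<and> (\<exists>i. \<eta> = add_box \<mu> i)}"

lemma finite_up: "ptn \<mu> \<Longrightarrow> finite (up \<mu>)"
proof (rule finite_subset)
  assume "ptn \<mu>"
  then show "up \<mu> \<subseteq> Par (Suc (psize \<mu>))"
    using psize_add_box by (auto simp: up_def Par_def ptn_def)
qed (rule finite_Par)

text \<open>The commutation rule of Young's lattice for horizontal strips, in terms of the rows in which
  boxes may be added or removed.\<close>

lemma card_interl_rows:
  assumes mu: "ptn \<mu>" and al: "ptn \<alpha>"
  shows "card {i. interl (add_box \<mu> i) \<alpha>} =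
    card {i. \<alpha> i > 0 \<and> interl \<mu> (\<alpha>(i := \<alpha> i - 1))} + (if interl \<mu> \<alpha> then 1 else 0)"
proof (cases "interl \<mu> \<alpha>")
  case True
  let ?B = "{i. \<alpha> i > \<mu> (Suc i)}"
  have "{i. \<alpha> i > 0 \<and> interl \<mu> (\<alpha>(i := \<alpha> i - 1))} = ?B"
  proof (intro equalityI subsetI)
    fix i assume "i \<in> {i. \<alpha> i > 0 \<and> interl \<mu> (\<alpha>(i := \<alpha> i - 1))}"
    then have "\<alpha> i > 0" "\<mu> (Suc i) \<le> (\<alpha>(i := \<alpha> i - 1)) i" by (auto simp only: interl_def)
    then show "i \<in> ?B" by simp
  next
    fix i assume i: "i \<in> ?B"
    have "(\<alpha>(i := \<alpha> i - 1)) j \<le> \<mu> j \<and> \<mu> (Suc j) \<le> (\<alpha>(i := \<alpha> i - 1)) j" for j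
    proof -
      have "\<alpha> j \<le> \<mu> j \<and> \<mu> (Suc j) \<le> \<alpha> j" using True by (simp add: interl_def)
      then show ?thesis using i by auto
    qed
    then show "i \<in> {i. \<alpha> i > 0 \<and> interl \<mu> (\<alpha>(i := \<alpha> i - 1))}" using i by (auto simp: interl_def)
  qed
  \<comment> \<open>A box can be put into row 0, or into row i + 1 for each row i of \<alpha> that
    can lose a box; row 0 accounts for the additional 1.\<close>
  moreover have "{i. interl (add_box \<mu> i) \<alpha>} = insert 0 (Suc ` ?B)"
  proof (intro equalityI subsetI)
    fix i assume "i \<in> {i. interl (add_box \<mu> i) \<alpha>}"
    then have i: "\<And>j. add_box \<mu> i (Suc j) \<le> \<alpha> j" unfolding interl_def by blast
    show "i \<in> insert 0 (Suc ` ?B)"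
    proof (cases i)
      case (Suc k)
      then have "\<alpha> k > \<mu> (Suc k)" using i[of k] by (auto simp: add_box_def)
      then show ?thesis using Suc by auto
    qed simp
  next
    fix i assume "i \<in> insert 0 (Suc ` ?B)"
    then show "i \<in> {i. interl (add_box \<mu> i) \<alpha>}"
      using True unfolding interl_def add_box_def fun_upd_def by (auto simp: le_Suc_eq)
  qed
  moreover have "finite ?B" by (rule finite_subset[of _ "{i. \<alpha> i \<noteq> 0}"]) (use al in \<open>auto simp: ptn_def\<close>)
  moreover have "card (insert 0 (Suc ` ?B)) = Suc (card ?B)" if "finite ?B"
    using that by (subst card_insert_disjoint) (auto simp: card_image)
  ultimately show ?thesis using True by simp
next
  case False
  \<comment> \<open>If \<mu> and \<alpha> do not interlace, either condition forces the same single
    defect: row \<open>i\<close> of \<alpha> exceeds that of \<mu> by one box.\<close>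
  have "interl (add_box \<mu> i) \<alpha> \<longleftrightarrow> \<alpha> i > 0 \<and> interl \<mu> (\<alpha>(i := \<alpha> i - 1))" for i
  proof
    assume *: "interl (add_box \<mu> i) \<alpha>"
    then have 1: "\<And>j. \<alpha> j \<le> add_box \<mu> i j" "\<And>j. add_box \<mu> i (Suc j) \<le> \<alpha> j" by (auto simp: interl_def)
    have low: "\<mu> (Suc j) \<le> \<alpha> j" for j using 1(2)[of j] by (auto simp: add_box_def split: if_splits)
    have hi: "\<alpha> j \<le> \<mu> j" if "j \<noteq> i" for j using 1(1)[of j] that by (auto simp: add_box_def)
    have ai: "\<alpha> i = Suc (\<mu> i)"
    proof (rule ccontr)
      assume "\<alpha> i \<noteq> Suc (\<mu> i)"
      then have "\<alpha> i \<le> \<mu> i" using 1(1)[of i] by (simp add: add_box_def)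
      then have "interl \<mu> \<alpha>" unfolding interl_def using low hi by metis
      then show False using False by simp
    qed
    moreover have "\<mu> (Suc i) \<le> \<mu> i" using mu by (auto simp: ptn_def intro: antimonoD)
    ultimately show "\<alpha> i > 0 \<and> interl \<mu> (\<alpha>(i := \<alpha> i - 1))"
      unfolding interl_def
    proof (intro conjI allI)
      fix j
      show "(\<alpha>(i := \<alpha> i - 1)) j \<le> \<mu> j" using hi[of j] ai by simp
      show "\<mu> (Suc j) \<le> (\<alpha>(i := \<alpha> i - 1)) j"
        using low[of j] ai \<open>\<mu> (Suc i) \<le> \<mu> i\<close> by (cases "j = i") auto
    qed simp
  next
    assume "\<alpha> i > 0 \<and> interl \<mu> (\<alpha>(i := \<alpha> i - 1))"
    then have pos: "\<alpha> i > 0" and 1: "\<And>j. (\<alpha>(i := \<alpha> i - 1)) j \<le> \<mu> j" "\<And>j. \<mu> (Suc j) \<le> (\<alpha>(i := \<alpha> i - 1)) j"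
      by (auto simp: interl_def)
    have low: "\<mu> (Suc j) \<le> \<alpha> j" for j using 1(2)[of j] by (auto split: if_splits)
    have hi: "\<alpha> j \<le> \<mu> j" if "j \<noteq> i" for j using 1(1)[of j] that by auto
    have ai: "\<alpha> i = Suc (\<mu> i)"
    proof (rule ccontr)
      assume "\<alpha> i \<noteq> Suc (\<mu> i)"
      then have "\<alpha> i \<le> \<mu> i" using 1(1)[of i] by simp
      then have "interl \<mu> \<alpha>" unfolding interl_def using low hi by metis
      then show False using False by simp
    qed
    moreover have "\<alpha> (Suc j) \<le> \<alpha> j" for j using al by (auto simp: ptn_def intro: antimonoD)
    ultimately show "interl (add_box \<mu> i) \<alpha>"
      unfolding interl_def add_box_def using low hi by (auto simp: le_SucI) (metis)
  qed
  then show ?thesis using False by simp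
qed

text \<open>Interlacing with \<alpha> already makes a candidate above \<mu> decreasing, so counting
  partitions amounts to counting rows.\<close>

lemma card_up_interl:
  assumes "ptn \<mu>" "ptn \<alpha>"
  shows "card {\<eta> \<in> up \<mu>. interl \<eta> \<alpha>} = card {\<kappa>. interl \<mu> \<kappa> \<and> \<alpha> \<in> up \<kappa>} + (if interl \<mu> \<alpha> then 1 else 0)"
proof -
  have "{\<eta> \<in> up \<mu>. interl \<eta> \<alpha>} = add_box \<mu> ` {i. interl (add_box \<mu> i) \<alpha>}"
    using assms add_box_finite by (auto simp: up_def ptn_def dest: interl_antimono_upper)
  then have 1: "card {\<eta> \<in> up \<mu>. interl \<eta> \<alpha>} = card {i. interl (add_box \<mu> i) \<alpha>}"
    using inj_add_box by (metis card_image inj_on_subset subset_UNIV)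
  have "{\<kappa>. interl \<mu> \<kappa> \<and> \<alpha> \<in> up \<kappa>} = (\<lambda>i. \<alpha>(i := \<alpha> i - 1)) ` {i. \<alpha> i > 0 \<and> interl \<mu> (\<alpha>(i := \<alpha> i - 1))}"
  proof (intro equalityI subsetI)
    fix \<kappa> assume "\<kappa> \<in> {\<kappa>. interl \<mu> \<kappa> \<and> \<alpha> \<in> up \<kappa>}"
    then obtain i where i: "interl \<mu> \<kappa>" "\<alpha> = add_box \<kappa> i" by (auto simp: up_def)
    then have "\<kappa> = \<alpha>(i := \<alpha> i - 1)" "\<alpha> i > 0" by (auto simp: add_box_def)
    then show "\<kappa> \<in> (\<lambda>i. \<alpha>(i := \<alpha> i - 1)) ` {i. \<alpha> i > 0 \<and> interl \<mu> (\<alpha>(i := \<alpha> i - 1))}" using i by blast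
  next
    fix \<kappa> assume "\<kappa> \<in> (\<lambda>i. \<alpha>(i := \<alpha> i - 1)) ` {i. \<alpha> i > 0 \<and> interl \<mu> (\<alpha>(i := \<alpha> i - 1))}"
    then obtain i where i: "\<alpha> i > 0" "interl \<mu> \<kappa>" "\<kappa> = \<alpha>(i := \<alpha> i - 1)" by auto
    then have "\<alpha> = add_box \<kappa> i" by (auto simp: add_box_def)
    then show "\<kappa> \<in> {\<kappa>. interl \<mu> \<kappa> \<and> \<alpha> \<in> up \<kappa>}" using i assms by (auto simp: up_def)
  qed
  moreover have "inj_on (\<lambda>i. \<alpha>(i := \<alpha> i - 1)) {i. \<alpha> i > 0 \<and> interl \<mu> (\<alpha>(i := \<alpha> i - 1))}"
    
  proof (rule inj_onI)
    fix i j assume i: "i \<in> {i. \<alpha> i > 0 \<and> interl \<mu> (\<alpha>(i := \<alpha> i - 1))}"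
      and "\<alpha>(i := \<alpha> i - 1) = \<alpha>(j := \<alpha> j - 1)"
    then have "(\<alpha>(i := \<alpha> i - 1)) i = (\<alpha>(j := \<alpha> j - 1)) i" by simp
    then show "i = j" using i by (simp split: if_splits)
  qed
  ultimately have "card {\<kappa>. interl \<mu> \<kappa> \<and> \<alpha> \<in> up \<kappa>} = card {i. \<alpha> i > 0 \<and> interl \<mu> (\<alpha>(i := \<alpha> i - 1))}"
    by (simp add: card_image)
  then show ?thesis using 1 card_interl_rows[OF assms] by simp
qed

text \<open>For symmetric functions this evaluates the pairing of h_\<nu> with p_1 s_\<mu>: the
  adjoint of multiplication by p_1 is a derivation that takes h_m to h_(m-1). Here it is an
  induction on \<open>r\<close>, driven by the commutation of adding a box with removing the strip
  of the largest letter.\<close>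

lemma sum_kostka_up:
  assumes "ptn \<mu>"
  shows "(\<Sum>\<eta>\<in>up \<mu>. kostka r \<nu> \<eta>) = (\<Sum>a | a < r \<and> \<nu> a > 0. kostka r (\<nu>(a := \<nu> a - 1)) \<mu>)"
  using assms
proof (induction r arbitrary: \<nu> \<mu>)
  case 0
  have "\<eta> \<noteq> (\<lambda>_. 0)" if "\<eta> \<in> up \<mu>" for \<eta> using that by (auto simp: up_def add_box_def fun_eq_iff)
  then show ?case by simp
next
  case (Suc r)
  define m where "m = \<nu> r"
  define Q where "Q = {\<alpha>. ptn \<alpha> \<and> psize \<alpha> + m = Suc (psize \<mu>)}"
  have fQ: "finite Q" by (rule finite_subset[OF _ finite_Par[of "Suc (psize \<mu>) - m"]]) (auto simp: Q_def Par_def)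
  have pu: "psize \<eta> = Suc (psize \<kappa>)" "ptn \<eta>" if "\<eta> \<in> up \<kappa>" "ptn \<kappa>" for \<kappa> \<eta>
    using that psize_add_box by (auto simp: up_def ptn_def)
  have "(\<Sum>\<eta>\<in>up \<mu>. kostka (Suc r) \<nu> \<eta>) = (\<Sum>\<eta>\<in>up \<mu>. \<Sum>\<alpha>\<in>{\<alpha>\<in>Q. interl \<eta> \<alpha>}. kostka r \<nu> \<alpha>)"
    using Suc.prems pu by (auto intro!: sum.cong simp: strips_def Q_def m_def dest: interl_ptn_lower)
  also have "\<dots> = (\<Sum>\<alpha>\<in>Q. \<Sum>\<eta>\<in>{\<eta>\<in>up \<mu>. interl \<eta> \<alpha>}. kostka r \<nu> \<alpha>)"
    by (rule sum.swap_restrict[OF finite_up[OF Suc.prems] fQ])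
  also have "\<dots> = (\<Sum>\<alpha>\<in>Q. card {\<kappa>. interl \<mu> \<kappa> \<and> \<alpha> \<in> up \<kappa>} * kostka r \<nu> \<alpha>) + (\<Sum>\<alpha>\<in>Q. if interl \<mu> \<alpha> then kostka r \<nu> \<alpha> else 0)"
    unfolding sum.distrib[symmetric]
    by (intro sum.cong refl) (auto simp: Q_def card_up_interl Suc.prems)
  also have "(\<Sum>\<alpha>\<in>Q. if interl \<mu> \<alpha> then kostka r \<nu> \<alpha> else 0) = (\<Sum>\<alpha>\<in>{\<alpha>\<in>Q. interl \<mu> \<alpha>}. kostka r \<nu> \<alpha>)"
    using fQ by (simp add: sum.inter_filter)
  \<comment> \<open>The extra 1 of the commutation rule produces the summand a = r. For m = 0 it is
    absent, since \<alpha> would have more boxes than \<mu>.\<close>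
  also have "\<dots> = (if m > 0 then kostka (Suc r) (\<nu>(r := m - 1)) \<mu> else 0)"
  proof (cases "m > 0")
    case True
    have "{\<alpha>\<in>Q. interl \<mu> \<alpha>} = strips \<mu> (m - 1)"
      using True Suc.prems by (auto simp: Q_def strips_def dest: interl_ptn_lower)
    then show ?thesis using True by (auto intro!: sum.cong kostka_cong)
  next
    case False
    have "psize \<alpha> \<le> psize \<mu>" if "interl \<mu> \<alpha>" for \<alpha>
    proof -
      have f: "finite {i. \<mu> i \<noteq> 0}" using Suc.prems by (simp add: ptn_def)
      have "psize \<alpha> = sum \<alpha> {i. \<mu> i \<noteq> 0}"
        using f interl_support[OF that] by (intro psize_eq)
      also have "\<dots> \<le> psize \<mu>" unfolding psize_def using that by (intro sum_mono) (auto simp: interl_def)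
      finally show ?thesis .
    qed
    then have "{\<alpha>\<in>Q. interl \<mu> \<alpha>} = {}" using False by (fastforce simp: Q_def)
    then show ?thesis using False by (simp only: sum.empty if_False)
  qed
  also have "(\<Sum>\<alpha>\<in>Q. card {\<kappa>. interl \<mu> \<kappa> \<and> \<alpha> \<in> up \<kappa>} * kostka r \<nu> \<alpha>) = (\<Sum>\<alpha>\<in>Q. \<Sum>\<kappa>\<in>{\<kappa>\<in>strips \<mu> m. \<alpha> \<in> up \<kappa>}. kostka r \<nu> \<alpha>)"
  proof (intro sum.cong refl)
    fix \<alpha> assume a: "\<alpha> \<in> Q"
    have "{\<kappa>. interl \<mu> \<kappa> \<and> \<alpha> \<in> up \<kappa>} = {\<kappa>\<in>strips \<mu> m. \<alpha> \<in> up \<kappa>}"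
      using a pu Suc.prems by (auto simp: Q_def strips_def dest: interl_ptn_lower)
    then show "card {\<kappa>. interl \<mu> \<kappa> \<and> \<alpha> \<in> up \<kappa>} * kostka r \<nu> \<alpha> = (\<Sum>\<kappa>\<in>{\<kappa>\<in>strips \<mu> m. \<alpha> \<in> up \<kappa>}. kostka r \<nu> \<alpha>)" by simp
  qed
  also have "\<dots> = (\<Sum>\<kappa>\<in>strips \<mu> m. \<Sum>\<alpha>\<in>{\<alpha>\<in>Q. \<alpha> \<in> up \<kappa>}. kostka r \<nu> \<alpha>)"
    by (rule sum.swap_restrict[OF fQ finite_strips[OF Suc.prems]])
  also have "\<dots> = (\<Sum>\<kappa>\<in>strips \<mu> m. \<Sum>\<alpha>\<in>up \<kappa>. kostka r \<nu> \<alpha>)"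
    using pu Suc.prems by (intro sum.cong refl) (auto simp: Q_def strips_def dest: interl_ptn_lower)
  also have "\<dots> = (\<Sum>\<kappa>\<in>strips \<mu> m. \<Sum>a | a < r \<and> \<nu> a > 0. kostka r (\<nu>(a := \<nu> a - 1)) \<kappa>)"
    using Suc.prems by (intro sum.cong refl Suc.IH) (auto simp: strips_def dest: interl_ptn_lower)
  also have "\<dots> = (\<Sum>a | a < r \<and> \<nu> a > 0. kostka (Suc r) (\<nu>(a := \<nu> a - 1)) \<mu>)"
    by (subst sum.swap) (auto intro!: sum.cong simp: m_def)
  also have "\<dots> + (if m > 0 then kostka (Suc r) (\<nu>(r := m - 1)) \<mu> else 0) =
      (\<Sum>a | a < Suc r \<and> \<nu> a > 0. kostka (Suc r) (\<nu>(a := \<nu> a - 1)) \<mu>)"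
  proof (cases "m > 0")
    case True
    have "{a. a < Suc r \<and> \<nu> a > 0} = insert r {a. a < r \<and> \<nu> a > 0}" using True by (auto simp: m_def)
    then show ?thesis using True by (simp add: m_def)
  next
    case False
    have "{a. a < Suc r \<and> \<nu> a > 0} = {a. a < r \<and> \<nu> a > 0}" using False by (auto simp: m_def less_Suc_eq)
    then show ?thesis using False by simp
  qed
  finally show ?case .
qed

section \<open>Words against pairs of tableaux\<close>

definition words :: "nat \<Rightarrow> nat \<Rightarrow> (nat \<Rightarrow> nat) \<Rightarrow> (nat \<Rightarrow> nat) set" where
  "words n r \<nu> = {f. (\<forall>b. b \<notin> {1..n} \<longrightarrow> f b = 0) \<and> (\<forall>b\<in>{1..n}. f b < r) \<and>
     (\<forall>a<r. card {b\<in>{1..n}. f b = a} = \<nu> a)}"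

lemma finite_words: "finite (words n r \<nu>)"
proof (rule finite_subset)
  show "words n r \<nu> \<subseteq> {f. \<forall>b. (b \<in> {1..n} \<longrightarrow> f b \<in> {..<r}) \<and> (b \<notin> {1..n} \<longrightarrow> f b = 0)}"
    by (auto simp: words_def)
qed (intro finite_set_of_finite_funs; simp)

text \<open>The last letter \<open>a\<close> is split off and overwritten by 0, the value of words
  outside their range; the pair of both determines the word.\<close>

lemma card_words_Suc:
  "card (words (Suc n) r \<nu>) \<le> (\<Sum>a | a < r \<and> \<nu> a > 0. card (words n r (\<nu>(a := \<nu> a - 1))))"
proof -
  let ?S = "Sigma {a. a < r \<and> \<nu> a > 0} (\<lambda>a. words n r (\<nu>(a := \<nu> a - 1)))"
  let ?g = "\<lambda>f. (f (Suc n), f(Suc n := (0::nat)))"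
  have "?g f \<in> ?S" if f: "f \<in> words (Suc n) r \<nu>" for f
  proof -
    let ?a = "f (Suc n)"
    have c: "card {b\<in>{1..Suc n}. f b = a} = \<nu> a" if "a < r" for a using f that by (auto simp: words_def)
    have eq: "{b\<in>{1..Suc n}. f b = a} = (if a = ?a then insert (Suc n) {b\<in>{1..n}. f b = a} else {b\<in>{1..n}. f b = a})" for a
      by (auto simp: le_Suc_eq)
    have a: "?a < r" using f by (auto simp: words_def)
    have 1: "card {b\<in>{1..n}. f b = a} = (\<nu>(?a := \<nu> ?a - 1)) a" if "a < r" for a
      using c[OF that] unfolding eq by (auto split: if_splits)
    have "\<nu> ?a > 0" using c[OF a] unfolding eq by auto
    moreover have "{b\<in>{1..n}. (f(Suc n := 0)) b = a} = {b\<in>{1..n}. f b = a}" for a by auto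
    ultimately show ?thesis using f a 1 by (auto simp: words_def)
  qed
  then have "card (words (Suc n) r \<nu>) \<le> card ?S"
  proof (intro card_inj_on_le[of ?g])
    show "inj_on ?g (words (Suc n) r \<nu>)"
    proof (rule inj_onI)
      fix f h assume "?g f = ?g h"
      then have "f(Suc n := f (Suc n)) = h(Suc n := h (Suc n))"
        by (metis Pair_inject fun_upd_upd)
      then show "f = h" by simp
    qed
    show "finite ?S" by (intro finite_SigmaI finite_words) simp
  qed auto
  then show ?thesis by (simp add: finite_words)
qed

text \<open>A single box is a horizontal strip of size 1, so growth of a shape by boxes is the
  recursion of \<open>kostka\<close> for the content that is constantly 1.\<close>

lemma up_strips: "\<kappa> \<in> Par n \<Longrightarrow> \<eta> \<in> up \<kappa> \<Longrightarrow> \<eta> \<in> Par (Suc n) \<and> \<kappa> \<in> strips \<eta> 1"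
proof -
  assume k: "\<kappa> \<in> Par n" and l: "\<eta> \<in> up \<kappa>"
  then obtain i where i: "\<eta> = add_box \<kappa> i" and pk: "ptn \<kappa>" "psize \<kappa> = n" and pl: "ptn \<eta>"
    by (auto simp: up_def Par_def)
  have s: "psize \<eta> = Suc n" using psize_add_box pk by (auto simp: i ptn_def)
  have ak: "\<And>j. \<kappa> (Suc j) \<le> \<kappa> j" and al: "\<And>j. \<eta> (Suc j) \<le> \<eta> j"
    using pk pl by (auto simp: ptn_def antimono_iff_le_Suc)
  have "\<eta> (Suc j) \<le> \<kappa> j" for j
    using ak[of j] al[of j] unfolding i add_box_def by (auto split: if_splits)
  moreover have "\<kappa> j \<le> \<eta> j" for j by (simp add: i add_box_def)
  ultimately show ?thesis using s pk pl by (auto simp: Par_def strips_def interl_def)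
qed

text \<open>The inequality behind the Robinson-Schensted-Knuth correspondence. After removal of the
  last letter of the word, \<open>sum_kostka_up\<close> converts the sum over that letter into a sum
  over boxes added to the shape; exchanging the two sums adds the box to the standard
  tableau.\<close>

theorem card_words_le:
  "card (words n r \<nu>) \<le> (\<Sum>\<mu>\<in>Par n. kostka n (\<lambda>_. 1) \<mu> * kostka r \<nu> \<mu>)"
proof (induction n arbitrary: \<nu>)
  case 0
  have P: "Par 0 = {\<lambda>_. 0}" using Par_bounds(1)[of _ 0] by (auto simp: Par_def ptn_def psize_def antimono_def)
  show ?case
  proof (cases "\<forall>a<r. \<nu> a = 0")
    case True
    have "strips (\<lambda>_. 0) 0 = {\<lambda>_. 0}" by (auto simp: strips_def interl_def psize_def)
    then have "kostka r \<nu> (\<lambda>_. 0) = 1" using True by (induction r) auto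
    moreover have "words 0 r \<nu> \<subseteq> {\<lambda>_. 0}" by (auto simp: words_def)
    ultimately show ?thesis unfolding P using card_mono[of "{\<lambda>_. 0::nat}" "words 0 r \<nu>"] by simp
  next
    case False
    then have "words 0 r \<nu> = {}" by (auto simp: words_def)
    then show ?thesis by simp
  qed
next
  case (Suc n)
  have "card (words (Suc n) r \<nu>) \<le> (\<Sum>a | a < r \<and> \<nu> a > 0. card (words n r (\<nu>(a := \<nu> a - 1))))"
    by (rule card_words_Suc)
  also have "\<dots> \<le> (\<Sum>a | a < r \<and> \<nu> a > 0. \<Sum>\<mu>\<in>Par n. kostka n (\<lambda>_. 1) \<mu> * kostka r (\<nu>(a := \<nu> a - 1)) \<mu>)"
    by (intro sum_mono Suc.IH)
  also have "\<dots> = (\<Sum>\<mu>\<in>Par n. kostka n (\<lambda>_. 1) \<mu> * (\<Sum>\<eta>\<in>up \<mu>. kostka r \<nu> \<eta>))"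
    by (subst sum.swap, intro sum.cong refl) (auto simp: sum_kostka_up Par_def sum_distrib_left)
  also have "\<dots> = (\<Sum>\<mu>\<in>Par n. \<Sum>\<eta>\<in>{\<eta>\<in>Par (Suc n). \<eta> \<in> up \<mu>}. kostka n (\<lambda>_. 1) \<mu> * kostka r \<nu> \<eta>)"
    unfolding sum_distrib_left using up_strips by (intro sum.cong refl) auto
  also have "\<dots> = (\<Sum>\<eta>\<in>Par (Suc n). \<Sum>\<mu>\<in>{\<mu>\<in>Par n. \<eta> \<in> up \<mu>}. kostka n (\<lambda>_. 1) \<mu> * kostka r \<nu> \<eta>)"
    by (rule sum.swap_restrict[OF finite_Par finite_Par])
  also have "\<dots> \<le> (\<Sum>\<eta>\<in>Par (Suc n). \<Sum>\<mu>\<in>strips \<eta> 1. kostka n (\<lambda>_. 1) \<mu> * kostka r \<nu> \<eta>)"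
    using up_strips finite_strips by (intro sum_mono sum_mono2) (auto simp: Par_def)
  also have "\<dots> = (\<Sum>\<eta>\<in>Par (Suc n). kostka (Suc n) (\<lambda>_. 1) \<eta> * kostka r \<nu> \<eta>)"
    by (simp add: sum_distrib_right)
  finally show ?case .
qed

section \<open>Semistandard tableaux as fillings\<close>

definition diag :: "(nat \<Rightarrow> nat) \<Rightarrow> (nat \<times> nat) set" where
  "diag \<mu> = {(i, j). j < \<mu> i}"

lemma diag_Sigma: "diag \<mu> = Sigma {i. \<mu> i \<noteq> 0} (\<lambda>i. {..<\<mu> i})"
  by (auto simp: diag_def)

lemma finite_diag: "ptn \<mu> \<Longrightarrow> finite (diag \<mu>)"
  unfolding diag_Sigma by (auto simp: ptn_def)

lemma card_diag: "ptn \<mu> \<Longrightarrow> card (diag \<mu>) = psize \<mu>"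
  unfolding diag_Sigma psize_def by (simp add: ptn_def)

definition sst :: "nat \<Rightarrow> (nat \<Rightarrow> nat) \<Rightarrow> (nat \<Rightarrow> nat) \<Rightarrow> (nat \<times> nat \<Rightarrow> nat) set" where
  "sst r \<nu> \<mu> = {T. (\<forall>x. x \<notin> diag \<mu> \<longrightarrow> T x = 0) \<and> (\<forall>x\<in>diag \<mu>. T x < r) \<and>
     (\<forall>i j j'. j \<le> j' \<longrightarrow> j' < \<mu> i \<longrightarrow> T (i, j) \<le> T (i, j')) \<and>
     (\<forall>i i' j. i < i' \<longrightarrow> j < \<mu> i' \<longrightarrow> T (i, j) < T (i', j)) \<and>
     (\<forall>a<r. card {x\<in>diag \<mu>. T x = a} = \<nu> a)}"

lemma finite_sst: "ptn \<mu> \<Longrightarrow> finite (sst r \<nu> \<mu>)"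
proof (rule finite_subset)
  show "sst r \<nu> \<mu> \<subseteq> {T. \<forall>x. (x \<in> diag \<mu> \<longrightarrow> T x \<in> {..<r}) \<and> (x \<notin> diag \<mu> \<longrightarrow> T x = 0)}"
    by (auto simp: sst_def)
  assume "ptn \<mu>"
  then show "finite {T. \<forall>x. (x \<in> diag \<mu> \<longrightarrow> T x \<in> {..<r}) \<and> (x \<notin> diag \<mu> \<longrightarrow> T x = 0)}"
    by (intro finite_set_of_finite_funs finite_diag) auto
qed

text \<open>The letter \<open>r\<close> is written into the strip outside \<alpha>. Distinct data
  give distinct fillings, as \<alpha> is recovered as the set of boxes with entry below
  \<open>r\<close>.\<close>

lemma kostka_le_card_sst: "ptn \<mu> \<Longrightarrow> kostka r \<nu> \<mu> \<le> card (sst r \<nu> \<mu>)"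
proof (induction r arbitrary: \<mu>)
  case 0
  show ?case
  proof (cases "\<mu> = (\<lambda>_. 0)")
    case True
    then have "(\<lambda>_. 0) \<in> sst 0 \<nu> \<mu>" by (auto simp: sst_def diag_def)
    then show ?thesis using True finite_sst[OF 0, of 0 \<nu>] by (auto simp: Suc_le_eq card_gt_0_iff)
  qed simp
next
  case (Suc r)
  define ext where "ext \<alpha> T = (\<lambda>(i, j). if j < \<alpha> i then T (i, j) else if j < \<mu> i then r else (0::nat))"
    for \<alpha> and T :: "nat \<times> nat \<Rightarrow> nat"
  let ?S = "Sigma (strips \<mu> (\<nu> r)) (\<lambda>\<alpha>. sst r \<nu> \<alpha>)"
  have p: "ptn \<alpha>" "\<And>i. \<alpha> i \<le> \<mu> i" "\<And>i. \<mu> (Suc i) \<le> \<alpha> i" "psize \<mu> = psize \<alpha> + \<nu> r"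
    if "\<alpha> \<in> strips \<mu> (\<nu> r)" for \<alpha>
    using that Suc.prems interl_ptn_lower by (auto simp: strips_def interl_def)
  have "kostka (Suc r) \<nu> \<mu> \<le> (\<Sum>\<alpha>\<in>strips \<mu> (\<nu> r). card (sst r \<nu> \<alpha>))"
    using p by (auto intro!: sum_mono Suc.IH)
  also have "\<dots> = card ?S"
    using p finite_strips[OF Suc.prems] by (simp add: finite_sst)
  also have "\<dots> \<le> card (sst (Suc r) \<nu> \<mu>)"
  proof (rule card_inj_on_le[of "\<lambda>(\<alpha>, T). ext \<alpha> T"])
    show "inj_on (\<lambda>(\<alpha>, T). ext \<alpha> T) ?S"
    proof (rule inj_onI, clarify)
      fix \<alpha> T \<beta> T' assume a: "\<alpha> \<in> strips \<mu> (\<nu> r)" and T: "T \<in> sst r \<nu> \<alpha>"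
        and b: "\<beta> \<in> strips \<mu> (\<nu> r)" and T': "T' \<in> sst r \<nu> \<beta>" and eq: "ext \<alpha> T = ext \<beta> T'"
      have char: "j < \<alpha> i \<longleftrightarrow> j < \<mu> i \<and> ext \<alpha> T (i, j) < r" if "\<alpha> \<in> strips \<mu> (\<nu> r)" "T \<in> sst r \<nu> \<alpha>" for \<alpha> T i j
        using p(2)[OF that(1), of i] that(2) by (auto simp: ext_def sst_def diag_def)
      have "j < \<alpha> i \<longleftrightarrow> j < \<beta> i" for i j using char[OF a T] char[OF b T'] eq by simp
      then have ab: "\<alpha> = \<beta>" by (intro ext) (metis linorder_neqE_nat less_irrefl)
      moreover have "T x = T' x" for x
      proof (cases "x \<in> diag \<alpha>")
        case True
        then show ?thesis using fun_cong[OF eq, of x] ab by (auto simp: ext_def diag_def split: prod.splits)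
      next
        case False
        moreover have "T x = 0" if "x \<notin> diag \<alpha>" for x using T that unfolding sst_def by blast
        moreover have "T' x = 0" if "x \<notin> diag \<beta>" for x using T' that unfolding sst_def by blast
        ultimately show ?thesis using ab by simp
      qed
      ultimately show "\<alpha> = \<beta> \<and> T = T'" by auto
    qed
    show "(\<lambda>(\<alpha>, T). ext \<alpha> T) ` ?S \<subseteq> sst (Suc r) \<nu> \<mu>"
    proof clarify
      fix \<alpha> T assume a: "\<alpha> \<in> strips \<mu> (\<nu> r)" and T: "T \<in> sst r \<nu> \<alpha>"
      note pa = p[OF a]
      have am: "\<And>i j. i \<le> j \<Longrightarrow> \<alpha> j \<le> \<alpha> i" using pa(1) by (auto simp: ptn_def antimono_def)
      have Tr: "\<And>i j. j < \<alpha> i \<Longrightarrow> T (i, j) < r" using T by (auto simp: sst_def diag_def)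
      have rows: "ext \<alpha> T (i, j) \<le> ext \<alpha> T (i, j')" if "j \<le> j'" "j' < \<mu> i" for i j j'
        using that T Tr[of j i] by (auto simp: ext_def sst_def less_imp_le)
      \<comment> \<open>A box that lies above another box of \<mu> belongs to \<alpha> by
        interlacing, so no column contains \<open>r\<close> twice.\<close>
      have cols: "ext \<alpha> T (i, j) < ext \<alpha> T (i', j)" if "i < i'" "j < \<mu> i'" for i i' j
      proof -
        have "j < \<mu> (Suc (i' - 1))" using that by simp
        then have "j < \<alpha> (i' - 1)" using pa(3)[of "i' - 1"] by linarith
        moreover have "i \<le> i' - 1" using that by linarith
        ultimately have j: "j < \<alpha> i" using am[of i "i' - 1"] by linarith
        show ?thesis
        proof (cases "j < \<alpha> i'")
          case True
          then show ?thesis using j T that by (auto simp: ext_def sst_def)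
        next
          case False
          then show ?thesis using j Tr[OF j] that by (auto simp: ext_def)
        qed
      qed
      have dsub: "diag \<alpha> \<subseteq> diag \<mu>" using pa(2) less_le_trans by (fastforce simp: diag_def)
      have cont: "card {x\<in>diag \<mu>. ext \<alpha> T x = b} = \<nu> b" if "b < Suc r" for b
      proof (cases "b = r")
        case True
        have "{x\<in>diag \<mu>. ext \<alpha> T x = r} = diag \<mu> - diag \<alpha>"
          using Tr by (fastforce simp: ext_def diag_def)
        then show ?thesis
          using dsub pa card_diag[OF pa(1)] card_diag[OF Suc.prems] finite_diag[OF pa(1)] True
          by (simp add: card_Diff_subset)
      next
        case False
        then have "{x\<in>diag \<mu>. ext \<alpha> T x = b} = {x\<in>diag \<alpha>. T x = b}"
          using dsub by (auto simp: ext_def diag_def split: if_splits)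
        then show ?thesis using T that False by (auto simp: sst_def)
      qed
      have vals: "ext \<alpha> T (i, j) < Suc r" "j \<ge> \<mu> i \<Longrightarrow> ext \<alpha> T (i, j) = 0" for i j
        using Tr[of j i] pa(2)[of i] by (auto simp: ext_def)
      show "ext \<alpha> T \<in> sst (Suc r) \<nu> \<mu>"
        unfolding sst_def using rows cols cont vals by (auto simp: diag_def)
    qed
  qed (rule finite_sst[OF Suc.prems])
  finally show ?case .
qed

section \<open>Row symmetrizers against column antisymmetrizers\<close>

text \<open>A tableau on the letters \<open>A\<close> is represented by the functions \<open>R\<close> and \<open>C\<close> that give the row and
  the column of a letter.\<close>

abbreviation pinv :: "('a \<Rightarrow> 'b) \<Rightarrow> 'b \<Rightarrow> 'a" where
  "pinv \<equiv> inv_into UNIV"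

definition col_stab :: "'a set \<Rightarrow> ('a \<Rightarrow> nat) \<Rightarrow> ('a \<Rightarrow> 'a) set" where
  "col_stab A C = {\<sigma>. \<sigma> permutes A \<and> (\<forall>a\<in>A. C (\<sigma> a) = C a)}"

lemma finite_col_stab: "finite A \<Longrightarrow> finite (col_stab A C)"
  by (rule finite_subset[OF _ finite_permutations]) (auto simp: col_stab_def)

lemma col_stab_id: "id \<in> col_stab A C"
  by (simp add: col_stab_def permutes_id)

lemma col_stab_comp: "\<sigma> \<in> col_stab A C \<Longrightarrow> \<tau> \<in> col_stab A C \<Longrightarrow> \<sigma> \<circ> \<tau> \<in> col_stab A C"
  by (auto simp: col_stab_def permutes_compose permutes_in_image)

lemma col_stab_inv:
  assumes "\<sigma> \<in> col_stab A C"
  shows "pinv \<sigma> \<in> col_stab A C"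
proof -
  have s: "\<sigma> permutes A" "\<And>a. a \<in> A \<Longrightarrow> C (\<sigma> a) = C a" using assms by (auto simp: col_stab_def)
  have "C (pinv \<sigma> a) = C a" if "a \<in> A" for a
    using s(2)[of "pinv \<sigma> a"] permutes_in_image[OF permutes_inv[OF s(1)], of a] that permutes_inverses[OF s(1)] by auto
  then show ?thesis using permutes_inv[OF s(1)] by (simp add: col_stab_def)
qed

lemma sum_col_stab_comp:
  assumes "\<tau> \<in> col_stab A C"
  shows "(\<Sum>\<sigma>\<in>col_stab A C. h (\<sigma> \<circ> \<tau>)) = (\<Sum>\<sigma>\<in>col_stab A C. h \<sigma>)"
proof (rule sum.reindex_bij_witness[of _ "\<lambda>\<sigma>. \<sigma> \<circ> pinv \<tau>" "\<lambda>\<sigma>. \<sigma> \<circ> \<tau>"])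
  have t: "\<tau> permutes A" using assms by (simp add: col_stab_def)
  fix \<sigma> :: "'a \<Rightarrow> 'a"
  show "\<sigma> \<circ> \<tau> \<circ> pinv \<tau> = \<sigma>" "\<sigma> \<circ> pinv \<tau> \<circ> \<tau> = \<sigma>"
    using permutes_inv_o[OF t] by (simp_all add: o_assoc[symmetric])
  assume "\<sigma> \<in> col_stab A C"
  then show "\<sigma> \<circ> \<tau> \<in> col_stab A C" "\<sigma> \<circ> pinv \<tau> \<in> col_stab A C"
    using assms col_stab_comp col_stab_inv by blast+
qed auto

lemma sign_compose_permutes:
  "finite A \<Longrightarrow> \<sigma> permutes A \<Longrightarrow> \<tau> permutes A \<Longrightarrow> sign (\<sigma> \<circ> \<tau>) = sign \<sigma> * sign \<tau>"
  by (rule sign_compose) (auto intro: permutation_permutes[THEN iffD2])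

text \<open>Composition with the transposition of \<open>a\<close> and \<open>b\<close> flips the
  sign and fixes \<open>h\<close>, so the sum equals its own negative. This forces 0 because the
  values are integers; hence such sums are reduced to the field only afterwards.\<close>

lemma sum_sign_cancel:
  assumes A: "finite A" and ab: "a \<in> A" "b \<in> A" "a \<noteq> b" "C a = C b"
    and h: "\<And>\<sigma>. h (\<sigma> \<circ> transpose a b) = h \<sigma>"
  shows "(\<Sum>\<sigma>\<in>col_stab A C. sign \<sigma> * h \<sigma>) = (0::int)"
proof -
  let ?\<tau> = "transpose a b"
  have p: "?\<tau> permutes A" using ab by (simp add: permutes_swap_id)
  have t: "?\<tau> \<in> col_stab A C" using p ab by (auto simp: col_stab_def transpose_def)
  have "(\<Sum>\<sigma>\<in>col_stab A C. sign \<sigma> * h \<sigma>) = (\<Sum>\<sigma>\<in>col_stab A C. sign (\<sigma> \<circ> ?\<tau>) * h (\<sigma> \<circ> ?\<tau>))"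
    by (rule sum_col_stab_comp[OF t, symmetric])
  also have "\<dots> = (\<Sum>\<sigma>\<in>col_stab A C. - (sign \<sigma> * h \<sigma>))"
  proof (intro sum.cong refl)
    fix \<sigma> assume "\<sigma> \<in> col_stab A C"
    then have "sign (\<sigma> \<circ> ?\<tau>) = sign \<sigma> * sign ?\<tau>" using p A by (intro sign_compose_permutes) (auto simp: col_stab_def)
    then show "sign (\<sigma> \<circ> ?\<tau>) * h (\<sigma> \<circ> ?\<tau>) = - (sign \<sigma> * h \<sigma>)" using ab by (simp add: h sign_swap_id)
  qed
  also have "\<dots> = - (\<Sum>\<sigma>\<in>col_stab A C. sign \<sigma> * h \<sigma>)" by (rule sum_negf)
  finally show ?thesis by simp
qed

text \<open>The elements of \<open>E\<close> that are at least card E are as many as the numbers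
  below card E that are missing from \<open>E\<close>, and each of the former exceeds each of the
  latter.\<close>

lemma sum_ge_initial_segment:
  fixes E :: "nat set"
  assumes E: "finite E"
  shows "\<Sum>{..<card E} \<le> \<Sum>E" "\<Sum>E = \<Sum>{..<card E} \<Longrightarrow> E = {..<card E}"
proof -
  let ?c = "card E"
  let ?D = "E - {..<?c}" and ?M = "{..<?c} - E"
  have c: "card ?D = card ?M"
    using card_Diff_subset_Int[of E "{..<?c}"] card_Diff_subset_Int[of "{..<?c}" E] E by (simp add: Int_commute)
  have s: "\<Sum>E = \<Sum>(E \<inter> {..<?c}) + \<Sum>?D" "\<Sum>{..<?c} = \<Sum>(E \<inter> {..<?c}) + \<Sum>?M"
    using sum.Int_Diff[of E "\<lambda>x. x" "{..<?c}"] sum.Int_Diff[of "{..<?c}" "\<lambda>x. x" E] E by (simp_all add: Int_commute)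
  have d: "card ?D * ?c \<le> \<Sum>?D" using sum_bounded_below[of ?D ?c "\<lambda>x. x"] by simp
  have m: "\<Sum>?M + card ?M \<le> card ?M * ?c"
  proof -
    have "\<Sum>?M + card ?M = (\<Sum>x\<in>?M. x + 1)" by (simp add: sum_Suc)
    also have "\<dots> \<le> card ?M * ?c" using sum_bounded_above[of ?M "\<lambda>x. x + 1" ?c] by (simp add: Suc_le_eq)
    finally show ?thesis .
  qed
  show "\<Sum>{..<?c} \<le> \<Sum>E" using s d m c by simp
  assume "\<Sum>E = \<Sum>{..<?c}"
  moreover have "card ?M * ?c \<le> \<Sum>?D" using d c by simp
  ultimately have "card ?M = 0" using s m by linarith
  moreover have "card ?D = 0" using calculation c by (rule trans[rotated])
  ultimately have "?M = {}" "?D = {}" using E by (metis card_0_eq finite_Diff finite_lessThan)+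
  then show "E = {..<?c}" by blast
qed

text \<open>Column by column: injectivity makes the values of \<rho> in a column distinct, while
  those of \<open>R\<close> fill an initial segment, which has the least sum among all sets of that
  size.\<close>

lemma row_sum_minimal:
  assumes A: "finite A" and lam: "ptn \<mu>"
    and inj: "inj_on (\<lambda>a. (R a, C a)) A" and im: "(\<lambda>a. (R a, C a)) ` A = diag \<mu>"
    and inj': "inj_on (\<lambda>a. (\<rho> a, C a)) A"
  shows "sum R A \<le> sum \<rho> A" "sum \<rho> A = sum R A \<Longrightarrow> (\<lambda>a. (\<rho> a, C a)) ` A = diag \<mu>"
proof -
  define J where "J = C ` A"
  define B where "B j = {a\<in>A. C a = j}" for j
  have fin: "finite J" "\<And>j. finite (B j)" using A by (auto simp: J_def B_def)
  have iR: "inj_on R (B j)" and ir: "inj_on \<rho> (B j)" for j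
    using inj inj' by (auto simp: inj_on_def B_def)
  have RB: "R ` B j = {i. j < \<mu> i}" for j
  proof -
    have "i \<in> R ` B j \<longleftrightarrow> (i, j) \<in> (\<lambda>a. (R a, C a)) ` A" for i by (auto simp: B_def)
    then show ?thesis unfolding im by (auto simp: diag_def)
  qed
  have seg: "\<exists>c. R ` B j = {..<c}" for j
  proof -
    have f: "finite {i. j < \<mu> i}" using fin(2)[of j] RB[of j] by (metis finite_imageI)
    have dn: "\<And>i k. k \<le> i \<Longrightarrow> j < \<mu> i \<Longrightarrow> j < \<mu> k" using lam by (auto simp: ptn_def dest: antimonoD less_le_trans)
    show ?thesis
    proof (cases "{i. j < \<mu> i} = {}")
      case True
      then show ?thesis using RB[of j] by (intro exI[of _ 0]) simp
    next
      case False
      have "{i. j < \<mu> i} = {..<Suc (Max {i. j < \<mu> i})}"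
      proof (intro equalityI subsetI)
        fix i assume "i \<in> {..<Suc (Max {i. j < \<mu> i})}"
        then show "i \<in> {i. j < \<mu> i}" using Max_in[OF f False] dn[of i "Max {i. j < \<mu> i}"] by simp
      qed (use f in \<open>auto simp: less_Suc_eq_le\<close>)
      then show ?thesis using RB[of j] by auto
    qed
  qed
  have RB': "R ` B j = {..<card (B j)}" for j
    using seg[of j] card_image[OF iR, of j] by (metis card_lessThan)
  have cr: "card (\<rho> ` B j) = card (B j)" for j by (rule card_image[OF ir])
  have le: "sum R (B j) \<le> sum \<rho> (B j)" and eq: "sum \<rho> (B j) = sum R (B j) \<Longrightarrow> \<rho> ` B j = R ` B j" for j
    using sum_ge_initial_segment[of "\<rho> ` B j"] fin(2)[of j] RB'[of j] cr[of j]
      sum.reindex[OF iR[of j], of "\<lambda>x. x"] sum.reindex[OF ir[of j], of "\<lambda>x. x"] by (simp_all add: comp_def)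
  have tot: "sum f A = (\<Sum>j\<in>J. sum f (B j))" for f :: "'a \<Rightarrow> nat"
    unfolding J_def B_def by (rule sum.image_gen[OF A])
  show "sum R A \<le> sum \<rho> A" unfolding tot by (rule sum_mono) (rule le)
  assume "sum \<rho> A = sum R A"
  then have "sum \<rho> (B j) = sum R (B j)" if "j \<in> J" for j
    unfolding tot using sum_mono_inv[of "\<lambda>j. sum R (B j)" J "\<lambda>j. sum \<rho> (B j)" j] le that fin(1) by simp
  then have "\<rho> ` B j = R ` B j" if "j \<in> J" for j using eq that by blast
  moreover have "B j = {}" if "j \<notin> J" for j using that by (auto simp: B_def J_def)
  ultimately have "\<rho> ` B j = R ` B j" for j by (cases "j \<in> J") auto
  moreover have "(i, j) \<in> (\<lambda>a. (f a, C a)) ` A \<longleftrightarrow> i \<in> f ` B j" for i j and f :: "'a \<Rightarrow> nat"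
    by (auto simp: B_def)
  ultimately show "(\<lambda>a. (\<rho> a, C a)) ` A = diag \<mu>" unfolding im[symmetric] by (simp add: set_eq_iff)
qed

text \<open>A rearrangement inequality: as long as \<open>\<sigma>\<close> is not the identity, some transposition within a
  column increases the sum.\<close>

lemma rearrangement_strict:
  assumes A: "finite A" and inj: "inj_on (\<lambda>a. (R a, C a)) A"
    and F: "\<And>a b. a \<in> A \<Longrightarrow> b \<in> A \<Longrightarrow> C a = C b \<Longrightarrow> R a < R b \<Longrightarrow> F a < (F b :: nat)"
    and s: "\<sigma> \<in> col_stab A C" "\<sigma> \<noteq> id"
  shows "(\<Sum>a\<in>A. R a * F (\<sigma> a)) < (\<Sum>a\<in>A. R a * F a)"
proof -
  define v where "v \<sigma> = (\<Sum>a\<in>A. R a * F (\<sigma> a))" for \<sigma>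
  have step: "\<exists>\<tau>\<in>col_stab A C. v \<sigma> < v \<tau>" if s: "\<sigma> \<in> col_stab A C" "\<sigma> \<noteq> id" for \<sigma>
  proof -
    have p: "\<sigma> permutes A" and cs: "\<And>a. a \<in> A \<Longrightarrow> C (\<sigma> a) = C a" using s by (auto simp: col_stab_def)
    let ?M = "{a\<in>A. \<sigma> a \<noteq> a}"
    have "?M \<noteq> {}" using s(2) p by (auto simp: permutes_def fun_eq_iff)
    \<comment> \<open>Among the letters moved by \<sigma>, \<open>c\<close> lies in a topmost row.
      Both its preimage \<open>d\<close> and its image then lie strictly lower in the same column,
      and exchanging the values of \<sigma> at \<open>c\<close> and \<open>d\<close> increases the
      sum.\<close>
    then obtain c where c: "c \<in> ?M" and min: "\<And>d. d \<in> ?M \<Longrightarrow> R c \<le> R d"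
    proof -
      have "finite (R ` ?M)" "R ` ?M \<noteq> {}" using A \<open>?M \<noteq> {}\<close> by auto
      from ex_min_if_finite[OF this] obtain m where "m \<in> R ` ?M" "\<not> (\<exists>x\<in>R ` ?M. x < m)" by blast
      then obtain c where c: "c \<in> ?M" "\<not> (\<exists>x\<in>R ` ?M. x < R c)" by blast
      then have "R c \<le> R d" if "d \<in> ?M" for d using that by (meson image_eqI not_less)
      with c(1) show thesis using that by blast
    qed
    have cA: "c \<in> A" "\<sigma> c \<noteq> c" using c by auto
    have lt: "R c < R d" if "d \<in> A" "\<sigma> d \<noteq> d" "C d = C c" "d \<noteq> c" for d
      using min[of d] that cA(1) inj by (auto simp: inj_on_def le_less)
    define d where "d = pinv \<sigma> c"
    have sd: "\<sigma> d = c" using permutes_inverses[OF p] by (simp add: d_def)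
    have dA: "d \<in> A" using sd cA p by (metis permutes_in_image)
    have dc: "d \<noteq> c" using sd cA by auto
    have Cd: "C d = C c" using cs[OF dA] sd by simp
    have scA: "\<sigma> c \<in> A" using cA p by (simp add: permutes_in_image)
    have ssc: "\<sigma> (\<sigma> c) \<noteq> \<sigma> c" using cA permutes_inj[OF p] by (auto dest: injD)
    have r1: "R c < R d" using lt[OF dA _ Cd dc] sd dc by simp
    have r2: "R c < R (\<sigma> c)" using lt[OF scA ssc] cs[OF cA(1)] cA by simp
    have f: "F c < F (\<sigma> c)" using F[OF cA(1) scA] cs[OF cA(1)] r2 by simp
    let ?\<tau> = "\<sigma> \<circ> transpose c d"
    have t: "transpose c d \<in> col_stab A C"
      using cA dA Cd by (auto simp: col_stab_def permutes_swap_id transpose_def)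
    have v: "v \<sigma>' = R c * F (\<sigma>' c) + R d * F (\<sigma>' d) + (\<Sum>a\<in>A - {c, d}. R a * F (\<sigma>' a))" for \<sigma>'
    proof -
      have "A = insert c (insert d (A - {c, d}))" using cA dA by auto
      then have "v \<sigma>' = (\<Sum>a\<in>insert c (insert d (A - {c, d})). R a * F (\<sigma>' a))" by (simp add: v_def)
      then show ?thesis using A dc by simp
    qed
    have "R c * F (\<sigma> c) + R d * F c < R c * F c + R d * F (\<sigma> c)"
    proof -
      obtain x y where "R d = R c + x" "F (\<sigma> c) = F c + y" "x > 0" "y > 0"
        using r1 f by (metis less_imp_add_positive)
      then show ?thesis by (simp add: algebra_simps)
    qed
    moreover have "(\<Sum>a\<in>A - {c, d}. R a * F (?\<tau> a)) = (\<Sum>a\<in>A - {c, d}. R a * F (\<sigma> a))"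
      by (intro sum.cong) (auto simp: transpose_def)
    ultimately have "v \<sigma> < v ?\<tau>" unfolding v using sd by simp
    then show ?thesis using col_stab_comp[OF s(1) t] by blast
  qed
  have fin: "finite (v ` col_stab A C)" using finite_col_stab[OF A] by simp
  have ne: "v ` col_stab A C \<noteq> {}" using s by auto
  obtain m where m: "m \<in> col_stab A C" "v m = Max (v ` col_stab A C)" using Max_in[OF fin ne] by auto
  have "m = id"
  proof (rule ccontr)
    assume "m \<noteq> id"
    from step[OF m(1) this] m(2) Max_ge[OF fin] show False by (metis image_eqI not_less)
  qed
  moreover obtain \<tau> where "\<tau> \<in> col_stab A C" "v \<sigma> < v \<tau>" using step[OF s] by blast
  ultimately have "v \<sigma> < v id" using m Max_ge[OF fin, of "v \<tau>"] by auto
  then show ?thesis by (simp add: v_def)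
qed

text \<open>The words \<open>f\<close> in the row symmetrization of \<open>T\<close> for the tabloid
  with row function \<rho>: row by row, the multisets of values agree.\<close>

definition compat :: "'a set \<Rightarrow> (nat \<Rightarrow> nat) \<Rightarrow> (nat \<times> nat \<Rightarrow> nat) \<Rightarrow> ('a \<Rightarrow> nat) \<Rightarrow> ('a \<Rightarrow> nat) \<Rightarrow> bool" where
  "compat A \<mu> T \<rho> f \<longleftrightarrow> (\<forall>i v. card {a\<in>A. \<rho> a = i \<and> f a = v} = card {x\<in>diag \<mu>. fst x = i \<and> T x = v})"

lemma compat_permute:
  assumes "\<tau> permutes A"
  shows "compat A \<mu> T (\<rho> \<circ> \<tau>) (f \<circ> \<tau>) \<longleftrightarrow> compat A \<mu> T \<rho> f"
proof -
  have "card {a\<in>A. \<rho> (\<tau> a) = i \<and> f (\<tau> a) = v} = card {a\<in>A. \<rho> a = i \<and> f a = v}" for i v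
  proof (rule bij_betw_same_card[of \<tau>])
    show "bij_betw \<tau> {a\<in>A. \<rho> (\<tau> a) = i \<and> f (\<tau> a) = v} {a\<in>A. \<rho> a = i \<and> f a = v}"
      by (rule bij_betwI[of _ _ _ "pinv \<tau>"])
         (auto simp: permutes_in_image[OF assms] permutes_in_image[OF permutes_inv[OF assms]] permutes_inverses[OF assms])
  qed
  then show ?thesis by (simp add: compat_def)
qed

lemma compat_cong:
  assumes "\<And>a. a \<in> A \<Longrightarrow> \<rho> a = \<rho>' a" "\<And>a. a \<in> A \<Longrightarrow> f a = f' a"
  shows "compat A \<mu> T \<rho> f \<longleftrightarrow> compat A \<mu> T \<rho>' f'"
proof -
  have "{a\<in>A. \<rho> a = i \<and> f a = v} = {a\<in>A. \<rho>' a = i \<and> f' a = v}" for i v using assms by auto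
  then show ?thesis by (simp add: compat_def)
qed

text \<open>The statistic of the rearrangement inequality. It depends only on the multisets of
  entries in the rows, hence can be computed from any compatible word.\<close>

definition key :: "(nat \<Rightarrow> nat) \<Rightarrow> (nat \<times> nat \<Rightarrow> nat) \<Rightarrow> nat" where
  "key \<mu> T = (\<Sum>x\<in>diag \<mu>. fst x * T x)"

lemma sum_by_fibers:
  fixes g :: "'b \<Rightarrow> nat"
  assumes "finite A" "finite B" "\<And>a. a \<in> A \<Longrightarrow> h a \<in> B"
  shows "(\<Sum>a\<in>A. g (h a)) = (\<Sum>b\<in>B. card {a\<in>A. h a = b} * g b)"
proof -
  have "(\<Sum>a\<in>A. g (h a)) = (\<Sum>b\<in>h ` A. \<Sum>a\<in>{a\<in>A. h a = b}. g (h a))" by (rule sum.image_gen[OF assms(1)])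
  also have "\<dots> = (\<Sum>b\<in>h ` A. card {a\<in>A. h a = b} * g b)" by (intro sum.cong refl) simp
  also have "\<dots> = (\<Sum>b\<in>B. card {a\<in>A. h a = b} * g b)"
  proof (rule sum.mono_neutral_left[OF assms(2)])
    show "\<forall>b\<in>B - h ` A. card {a\<in>A. h a = b} * g b = 0"
    proof
      fix b assume "b \<in> B - h ` A"
      then have "{a\<in>A. h a = b} = {}" by auto
      then show "card {a\<in>A. h a = b} * g b = 0" by (simp only: card.empty mult_0)
    qed
  qed (use assms in auto)
  finally show ?thesis .
qed

lemma compat_sums:
  assumes A: "finite A" and mu: "ptn \<mu>" and c: "compat A \<mu> T \<rho> f"
  shows "(\<Sum>a\<in>A. g (\<rho> a) (f a)) = (\<Sum>x\<in>diag \<mu>. (g (fst x) (T x) :: nat))"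
proof -
  let ?B = "(\<lambda>a. (\<rho> a, f a)) ` A \<union> (\<lambda>x. (fst x, T x)) ` diag \<mu>"
  have fB: "finite ?B" using A finite_diag[OF mu] by simp
  have "(\<Sum>a\<in>A. g (\<rho> a) (f a)) = (\<Sum>b\<in>?B. card {a\<in>A. (\<rho> a, f a) = b} * g (fst b) (snd b))"
    using sum_by_fibers[OF A fB, of "\<lambda>a. (\<rho> a, f a)" "\<lambda>b. g (fst b) (snd b)"] by simp
  also have "\<dots> = (\<Sum>b\<in>?B. card {x\<in>diag \<mu>. (fst x, T x) = b} * g (fst b) (snd b))"
    using c by (intro sum.cong refl) (auto simp: compat_def prod_eq_iff)
  also have "\<dots> = (\<Sum>x\<in>diag \<mu>. g (fst x) (T x))"
    using sum_by_fibers[OF finite_diag[OF mu] fB, of "\<lambda>x. (fst x, T x)" "\<lambda>b. g (fst b) (snd b)"] by simp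
  finally show ?thesis .
qed

text \<open>In a weakly increasing sequence the places with value at most \<open>v\<close> form an
  initial segment, whose length is determined by the multiplicities.\<close>

lemma sorted_eqI:
  fixes f g :: "nat \<Rightarrow> nat"
  assumes f: "\<And>j j'. j \<le> j' \<Longrightarrow> j' < m \<Longrightarrow> f j \<le> f j'" and g: "\<And>j j'. j \<le> j' \<Longrightarrow> j' < m \<Longrightarrow> g j \<le> g j'"
    and c: "\<And>v. card {j. j < m \<and> f j = v} = card {j. j < m \<and> g j = v}" and j: "j < m"
  shows "f j = g j"
proof -
  have seg: "{j. j < m \<and> f j \<le> v} = {..<card {j. j < m \<and> f j \<le> v}}"
    if f: "\<And>j j'. j \<le> j' \<Longrightarrow> j' < m \<Longrightarrow> f j \<le> f j'" for f :: "nat \<Rightarrow> nat" and v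
  proof -
    let ?S = "{j. j < m \<and> f j \<le> v}"
    have dn: "\<And>i k. k \<le> i \<Longrightarrow> i \<in> ?S \<Longrightarrow> k \<in> ?S" using f by (auto intro: order_trans)
    have fS: "finite ?S" by simp
    show ?thesis
    proof (cases "?S = {}")
      case False
      have "?S = {..<Suc (Max ?S)}"
      proof (intro equalityI subsetI)
        fix i assume "i \<in> {..<Suc (Max ?S)}"
        then show "i \<in> ?S" using dn[of i "Max ?S"] Max_in[OF fS False] by simp
      next
        fix i assume "i \<in> ?S"
        then show "i \<in> {..<Suc (Max ?S)}" using Max_ge[OF fS] by (simp add: less_Suc_eq_le)
      qed
      then show ?thesis by (metis card_lessThan)
    next
      case True
      then show ?thesis by (simp only: card.empty lessThan_0)
    qed
  qed
  have cnt: "card {j. j < m \<and> f j \<le> v} = (\<Sum>w\<le>v. card {j. j < m \<and> f j = w})" for f :: "nat \<Rightarrow> nat" and v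
  proof -
    have "{j. j < m \<and> f j \<le> v} = (\<Union>w\<in>{..v}. {j. j < m \<and> f j = w})" by auto
    then show ?thesis by (simp only:) (rule card_UN_disjoint; auto)
  qed
  have "{j. j < m \<and> f j \<le> v} = {j. j < m \<and> g j \<le> v}" for v
    using seg[where f=f and v=v, OF f] seg[where f=g and v=v, OF g] cnt[where f=f and v=v] cnt[where f=g and v=v] c by simp
  then have "f j \<le> v \<longleftrightarrow> g j \<le> v" for v using j by blast
  then show ?thesis by (metis order_antisym order_refl)
qed

lemma sst_eqI:
  assumes T: "T \<in> sst r \<nu> \<mu>" and S: "S \<in> sst r \<nu>' \<mu>"
    and c: "\<And>i v. card {x\<in>diag \<mu>. fst x = i \<and> T x = v} = card {x\<in>diag \<mu>. fst x = i \<and> S x = v}"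
  shows "T = S"
proof
  fix x :: "nat \<times> nat"
  obtain i j where x: "x = (i, j)" by (cases x)
  show "T x = S x"
  proof (cases "j < \<mu> i")
    case True
    have e: "card {x\<in>diag \<mu>. fst x = i \<and> U x = v} = card {j. j < \<mu> i \<and> U (i, j) = v}" for U :: "nat \<times> nat \<Rightarrow> nat" and v
      by (rule bij_betw_same_card[of snd], rule bij_betwI[of _ _ _ "\<lambda>j. (i, j)"]) (auto simp: diag_def)
    have "T (i, j) = S (i, j)"
      by (rule sorted_eqI[of "\<mu> i" "\<lambda>j. T (i, j)" "\<lambda>j. S (i, j)"])
         (use T S True c[of i] e in \<open>auto simp: sst_def\<close>)
    then show ?thesis by (simp add: x)
  next
    case False
    then show ?thesis using T S by (auto simp: x sst_def diag_def)
  qed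
qed

section \<open>Pairings of row and column sums\<close>

definition row_weight :: "(nat \<Rightarrow> nat) \<Rightarrow> nat" where
  "row_weight \<mu> = (\<Sum>x\<in>diag \<mu>. fst x)"

definition is_tab :: "'a set \<Rightarrow> (nat \<Rightarrow> nat) \<Rightarrow> ('a \<Rightarrow> nat) \<Rightarrow> ('a \<Rightarrow> nat) \<Rightarrow> bool" where
  "is_tab A \<mu> R C \<longleftrightarrow> bij_betw (\<lambda>a. (R a, C a)) A (diag \<mu>)"

lemma is_tab_sum: "is_tab A \<mu> R C \<Longrightarrow> sum R A = row_weight \<mu>"
  unfolding row_weight_def is_tab_def using sum.reindex_bij_betw[of "\<lambda>a. (R a, C a)" A "diag \<mu>" fst] by simp

lemma bij_betw_restrict_pred: "bij_betw f A D \<Longrightarrow> bij_betw f {a\<in>A. Q (f a)} {x\<in>D. Q x}"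
  by (auto simp: bij_betw_def inj_on_def)

lemma is_tab_row_card:
  assumes "is_tab A \<mu> R C"
  shows "card {a\<in>A. R a = i} = \<mu> i"
proof -
  have "bij_betw (\<lambda>a. (R a, C a)) {a\<in>A. R a = i} {x\<in>diag \<mu>. fst x = i}"
    using bij_betw_restrict_pred[of _ A "diag \<mu>" "\<lambda>x. fst x = i"] assms unfolding is_tab_def by fastforce
  then have "card {a\<in>A. R a = i} = card {x\<in>diag \<mu>. fst x = i}" by (rule bij_betw_same_card)
  also have "{x\<in>diag \<mu>. fst x = i} = (\<lambda>j. (i, j)) ` {..<\<mu> i}" by (auto simp: diag_def)
  also have "card \<dots> = \<mu> i" by (subst card_image) (auto intro: inj_onI)
  finally show ?thesis .
qed

text \<open>The pairing, before reduction to the field, of the column antisymmetrization of the word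
  \<open>F\<close> with the row symmetrization of \<open>T\<close> at the tabloid with row function
  \<rho>.\<close>

definition row_col_sum ::
  "'a set \<Rightarrow> (nat \<Rightarrow> nat) \<Rightarrow> (nat \<times> nat \<Rightarrow> nat) \<Rightarrow> ('a \<Rightarrow> nat) \<Rightarrow> ('a \<Rightarrow> nat) \<Rightarrow> ('a \<Rightarrow> nat) \<Rightarrow> int" where
  "row_col_sum A \<mu> T \<rho> C F = (\<Sum>\<sigma>\<in>col_stab A C. sign \<sigma> * (if compat A \<mu> T \<rho> (F \<circ> \<sigma>) then 1 else 0))"

text \<open>The coefficient, as an integer, of the tabloid with row function \<rho> in the
  polytabloid of the tableau given by \<open>R\<close> and \<open>C\<close>.\<close>

definition tabloid_sum :: "'a set \<Rightarrow> ('a \<Rightarrow> nat) \<Rightarrow> ('a \<Rightarrow> nat) \<Rightarrow> ('a \<Rightarrow> nat) \<Rightarrow> int" where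
  "tabloid_sum A \<rho> R C = (\<Sum>\<sigma>\<in>col_stab A C. sign \<sigma> * (if \<forall>a\<in>A. R (\<sigma> a) = \<rho> a then 1 else 0))"

text \<open>Two letters of the same column that \<rho> puts into the same row could be exchanged
  without affecting compatibility, and \<open>sum_sign_cancel\<close> would apply.\<close>

lemma row_col_sum_inj:
  assumes A: "finite A" and nz: "row_col_sum A \<mu> T \<rho> C F \<noteq> 0"
  shows "inj_on (\<lambda>a. (\<rho> a, C a)) A"
proof (rule inj_onI, rule ccontr)
  fix a b assume ab: "a \<in> A" "b \<in> A" "(\<rho> a, C a) = (\<rho> b, C b)" "a \<noteq> b"
  let ?\<tau> = "transpose a b"
  have t: "?\<tau> permutes A" using ab by (simp add: permutes_swap_id)
  have r: "\<rho> \<circ> ?\<tau> = \<rho>" using ab by (auto simp: fun_eq_iff transpose_def)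
  have "compat A \<mu> T \<rho> (F \<circ> (\<sigma> \<circ> ?\<tau>)) \<longleftrightarrow> compat A \<mu> T \<rho> (F \<circ> \<sigma>)" for \<sigma>
    using compat_permute[OF t, of \<mu> T \<rho> "F \<circ> \<sigma>"] by (simp add: r o_assoc)
  then have "row_col_sum A \<mu> T \<rho> C F = 0"
    unfolding row_col_sum_def using ab by (intro sum_sign_cancel[OF A ab(1,2,4)]) auto
  then show False using nz by simp
qed

text \<open>A nonzero pairing makes the pairs (\<rho> a, C a) distinct, so
  \<open>row_sum_minimal\<close> compares the row sums. In the case of equality \<rho> and
  \<open>C\<close> form a tableau of shape \<open>l\<close> themselves, and the row lengths can be
  read off from \<rho>.\<close>

lemma row_col_sum_shape:
  assumes A: "finite A" and l: "ptn l" and s: "is_tab A \<mu> \<rho> C'" and t: "is_tab A l R C"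
    and nz: "row_col_sum A \<mu> T \<rho> C F \<noteq> 0"
  shows "row_weight l \<le> row_weight \<mu>" "row_weight \<mu> = row_weight l \<Longrightarrow> \<mu> = l"
proof -
  have inj: "inj_on (\<lambda>a. (\<rho> a, C a)) A" by (rule row_col_sum_inj[OF A nz])
  note rm = row_sum_minimal[OF A l _ _ inj, of R]
  have b: "inj_on (\<lambda>a. (R a, C a)) A" "(\<lambda>a. (R a, C a)) ` A = diag l"
    using t by (auto simp: is_tab_def bij_betw_def)
  show "row_weight l \<le> row_weight \<mu>" using rm(1)[OF b] is_tab_sum[OF s] is_tab_sum[OF t] by simp
  assume "row_weight \<mu> = row_weight l"
  then have "(\<lambda>a. (\<rho> a, C a)) ` A = diag l" using rm(2)[OF b] is_tab_sum[OF s] is_tab_sum[OF t] by simp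
  then have "is_tab A l \<rho> C" using inj by (simp add: is_tab_def bij_betw_def)
  then have "\<mu> i = l i" for i using is_tab_row_card[OF s] is_tab_row_card by metis
  then show "\<mu> = l" by blast
qed

text \<open>If two letters share their \<rho>-row and their column, both sides vanish. Otherwise
  \<rho> arises from \<open>R\<close> by a single column permutation \<open>\<sigma>0\<close>;
  substituting it in the sum leaves its sign, which is the only term of \<open>tabloid_sum\<close>.
  This factorization turns pairings with images of tabloids into pairings with polytabloids.\<close>

lemma row_col_sum_same_shape:
  assumes A: "finite A" and mu: "ptn \<mu>" and s: "is_tab A \<mu> \<rho> C'" and t: "is_tab A \<mu> R C"
  shows "row_col_sum A \<mu> T \<rho> C F = row_col_sum A \<mu> T R C F * tabloid_sum A \<rho> R C"
proof -
  have b: "inj_on (\<lambda>a. (R a, C a)) A" "(\<lambda>a. (R a, C a)) ` A = diag \<mu>"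
    using t by (auto simp: is_tab_def bij_betw_def)
  show ?thesis
  proof (cases "inj_on (\<lambda>a. (\<rho> a, C a)) A")
    case False
    then have "row_col_sum A \<mu> T \<rho> C F = 0" using row_col_sum_inj[OF A] by blast
    moreover obtain a c where ac: "a \<in> A" "c \<in> A" "\<rho> a = \<rho> c" "C a = C c" "a \<noteq> c"
      using False by (auto simp: inj_on_def)
    have "\<not> (\<forall>a\<in>A. R (\<sigma> a) = \<rho> a)" if s: "\<sigma> \<in> col_stab A C" for \<sigma>
    proof
      assume r: "\<forall>a\<in>A. R (\<sigma> a) = \<rho> a"
      have p: "\<sigma> permutes A" "\<And>a. a \<in> A \<Longrightarrow> C (\<sigma> a) = C a" using s by (auto simp: col_stab_def)
      have "\<sigma> a = \<sigma> c"
        using b(1) ac r p permutes_in_image[OF p(1)] by (auto simp: inj_on_def)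
      then show False using ac permutes_inj[OF p(1)] by (auto dest: injD)
    qed
    then have "tabloid_sum A \<rho> R C = 0" unfolding tabloid_sum_def by (intro sum.neutral) auto
    ultimately show ?thesis by simp
  next
    case True
    have im: "(\<lambda>a. (\<rho> a, C a)) ` A = diag \<mu>"
      using row_sum_minimal(2)[OF A mu b True] is_tab_sum[OF s] is_tab_sum[OF t] by simp
    \<comment> \<open>The letter of the given tableau in row \<rho> a and in the column of
      \<open>a\<close>.\<close>
    define \<sigma>0 where "\<sigma>0 a = (if a \<in> A then inv_into A (\<lambda>a. (R a, C a)) (\<rho> a, C a) else a)" for a
    have in0: "(\<rho> a, C a) \<in> (\<lambda>a. (R a, C a)) ` A" if "a \<in> A" for a using that im b(2) by blast
    have s0: "\<sigma>0 a \<in> A" "R (\<sigma>0 a) = \<rho> a" "C (\<sigma>0 a) = C a" if "a \<in> A" for a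
      using inv_into_into[OF in0[OF that]] f_inv_into_f[OF in0[OF that]] that by (auto simp: \<sigma>0_def)
    have "inj_on \<sigma>0 A"
    proof (rule inj_onI)
      fix a c assume "a \<in> A" "c \<in> A" "\<sigma>0 a = \<sigma>0 c"
      then have "(\<rho> a, C a) = (\<rho> c, C c)" using s0 by metis
      then show "a = c" using True \<open>a \<in> A\<close> \<open>c \<in> A\<close> by (auto simp: inj_on_def)
    qed
    then have "bij_betw \<sigma>0 A A"
      using endo_inj_surj[OF A, of \<sigma>0] s0(1) by (auto simp: bij_betw_def)
    then have p0: "\<sigma>0 permutes A" by (rule bij_imp_permutes) (simp add: \<sigma>0_def)
    have st0: "\<sigma>0 \<in> col_stab A C" using p0 s0 by (simp add: col_stab_def)
    have sg: "sign (\<sigma> \<circ> \<sigma>0) = sign \<sigma> * sign \<sigma>0" if "\<sigma> \<in> col_stab A C" for \<sigma>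
      using sign_compose_permutes[OF A _ p0] that by (auto simp: col_stab_def)
    have "row_col_sum A \<mu> T \<rho> C F =
       (\<Sum>\<sigma>\<in>col_stab A C. sign (\<sigma> \<circ> \<sigma>0) * (if compat A \<mu> T \<rho> (F \<circ> (\<sigma> \<circ> \<sigma>0)) then 1 else 0))"
      unfolding row_col_sum_def by (rule sum_col_stab_comp[OF st0, symmetric])
    also have "\<dots> = (\<Sum>\<sigma>\<in>col_stab A C. sign \<sigma> * (if compat A \<mu> T R (F \<circ> \<sigma>) then 1 else 0) * sign \<sigma>0)"
    proof (intro sum.cong refl)
      fix \<sigma> assume s: "\<sigma> \<in> col_stab A C"
      have "compat A \<mu> T \<rho> (F \<circ> (\<sigma> \<circ> \<sigma>0)) \<longleftrightarrow> compat A \<mu> T (R \<circ> \<sigma>0) (F \<circ> \<sigma> \<circ> \<sigma>0)"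
        using s0 by (intro compat_cong) auto
      also have "\<dots> \<longleftrightarrow> compat A \<mu> T R (F \<circ> \<sigma>)" by (rule compat_permute[OF p0])
      finally show "sign (\<sigma> \<circ> \<sigma>0) * (if compat A \<mu> T \<rho> (F \<circ> (\<sigma> \<circ> \<sigma>0)) then 1 else 0) =
         sign \<sigma> * (if compat A \<mu> T R (F \<circ> \<sigma>) then 1 else 0) * sign \<sigma>0"
        using sg[OF s] by simp
    qed
    also have "\<dots> = row_col_sum A \<mu> T R C F * sign \<sigma>0"
      by (simp add: row_col_sum_def sum_distrib_right)
    also have "sign \<sigma>0 = tabloid_sum A \<rho> R C"
    proof -
      have iff: "(\<forall>a\<in>A. R (\<sigma> a) = \<rho> a) \<longleftrightarrow> \<sigma> = \<sigma>0" if s: "\<sigma> \<in> col_stab A C" for \<sigma>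
      proof
        assume r: "\<forall>a\<in>A. R (\<sigma> a) = \<rho> a"
        have p: "\<sigma> permutes A" "\<And>a. a \<in> A \<Longrightarrow> C (\<sigma> a) = C a" using s by (auto simp: col_stab_def)
        show "\<sigma> = \<sigma>0"
        proof
          fix a
          show "\<sigma> a = \<sigma>0 a"
          proof (cases "a \<in> A")
            case True
            then have "(R (\<sigma> a), C (\<sigma> a)) = (R (\<sigma>0 a), C (\<sigma>0 a))" using r p(2) s0 by simp
            then show ?thesis using b(1) True s0(1) permutes_in_image[OF p(1)] by (auto simp: inj_on_def)
          qed (use p(1) in \<open>auto simp: permutes_def \<sigma>0_def\<close>)
        qed
      qed (use s0 in auto)
      have "tabloid_sum A \<rho> R C = (\<Sum>\<sigma>\<in>col_stab A C. if \<sigma> = \<sigma>0 then sign \<sigma> else 0)"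
        unfolding tabloid_sum_def by (intro sum.cong refl) (simp add: iff)
      then show ?thesis using st0 finite_col_stab[OF A] by simp
    qed
    finally show ?thesis .
  qed
qed

text \<open>The columns of \<open>S\<close> increase strictly, so a nontrivial column permutation
  lowers the sum of row times entry; compatibility identifies the lowered sum with the key of
  \<open>T\<close>.\<close>

lemma compat_key:
  assumes A: "finite A" and t: "is_tab A \<mu> R C" and S: "S \<in> sst r \<nu> \<mu>" and mu: "ptn \<mu>"
    and s: "\<sigma> \<in> col_stab A C" "\<sigma> \<noteq> id" and c: "compat A \<mu> T R ((\<lambda>a. S (R a, C a)) \<circ> \<sigma>)"
  shows "key \<mu> T < key \<mu> S"
proof -
  let ?F = "\<lambda>a. S (R a, C a)"
  have b: "bij_betw (\<lambda>a. (R a, C a)) A (diag \<mu>)" using t by (simp add: is_tab_def)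
  have F: "?F a < ?F b" if "a \<in> A" "b \<in> A" "C a = C b" "R a < R b" for a b
  proof -
    have "(R b, C b) \<in> diag \<mu>" using bij_betwE[OF b] that(2) by blast
    then have "C b < \<mu> (R b)" by (simp add: diag_def)
    moreover have "\<forall>i i' j. i < i' \<longrightarrow> j < \<mu> i' \<longrightarrow> S (i, j) < S (i', j)" using S by (simp add: sst_def)
    ultimately show ?thesis using that(3,4) by simp
  qed
  have "key \<mu> T = (\<Sum>a\<in>A. R a * (?F \<circ> \<sigma>) a)"
    unfolding key_def by (rule compat_sums[OF A mu c, symmetric])
  also have "\<dots> < (\<Sum>a\<in>A. R a * ?F a)"
    unfolding o_apply using rearrangement_strict[OF A _ F s] b by (auto simp: bij_betw_def)
  also have "\<dots> = key \<mu> S"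
    unfolding key_def using sum.reindex_bij_betw[OF b, of "\<lambda>x. fst x * S x"] by simp
  finally show ?thesis .
qed

lemma compat_tab:
  assumes t: "is_tab A \<mu> R C"
  shows "card {a\<in>A. R a = i \<and> S (R a, C a) = v} = card {x\<in>diag \<mu>. fst x = i \<and> S x = v}"
proof (rule bij_betw_same_card)
  show "bij_betw (\<lambda>a. (R a, C a)) {a\<in>A. R a = i \<and> S (R a, C a) = v} {x\<in>diag \<mu>. fst x = i \<and> S x = v}"
    using bij_betw_restrict_pred[of _ A "diag \<mu>" "\<lambda>x. fst x = i \<and> S x = v"] t unfolding is_tab_def by fastforce
qed

text \<open>By \<open>compat_key\<close> only the identity can contribute, and it does so for T = S.
  For another tableau of no smaller key even the identity fails, since a semistandard tableau is
  determined by the contents of its rows.\<close>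

lemma row_col_sum_diag:
  assumes A: "finite A" and t: "is_tab A \<mu> R C" and S: "S \<in> sst r \<nu> \<mu>" and mu: "ptn \<mu>"
    and F: "\<And>a. a \<in> A \<Longrightarrow> F a = S (R a, C a)"
  shows "row_col_sum A \<mu> S R C F = 1"
    "T \<in> sst r' \<nu>' \<mu> \<Longrightarrow> T \<noteq> S \<Longrightarrow> key \<mu> S \<le> key \<mu> T \<Longrightarrow> row_col_sum A \<mu> T R C F = 0"
proof -
  let ?F = "\<lambda>a. S (R a, C a)"
  have cF: "compat A \<mu> T R (F \<circ> \<sigma>) \<longleftrightarrow> compat A \<mu> T R (?F \<circ> \<sigma>)" if "\<sigma> \<in> col_stab A C" for T \<sigma>
    using that F by (intro compat_cong) (auto simp: col_stab_def permutes_in_image)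
  have n: "\<sigma> = id" if "\<sigma> \<in> col_stab A C" "compat A \<mu> T R (F \<circ> \<sigma>)" "key \<mu> S \<le> key \<mu> T" for \<sigma> T
    using compat_key[OF A t S mu that(1) _, of T] that cF[OF that(1)] by (meson not_less)
  have "compat A \<mu> S R ?F" unfolding compat_def by (intro allI compat_tab[OF t])
  then have "compat A \<mu> S R (F \<circ> id)" using cF[OF col_stab_id] by simp
  then have "row_col_sum A \<mu> S R C F = (\<Sum>\<sigma>\<in>col_stab A C. if \<sigma> = id then 1 else 0)"
    unfolding row_col_sum_def using n[of _ S] by (intro sum.cong refl) (auto simp: sign_id)
  then show "row_col_sum A \<mu> S R C F = 1" using finite_col_stab[OF A] col_stab_id by simp
  assume T: "T \<in> sst r' \<nu>' \<mu>" "T \<noteq> S" "key \<mu> S \<le> key \<mu> T"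
  have "\<not> compat A \<mu> T R (F \<circ> \<sigma>)" if s: "\<sigma> \<in> col_stab A C" for \<sigma>
  proof
    assume c: "compat A \<mu> T R (F \<circ> \<sigma>)"
    have "compat A \<mu> T R ?F" using c n[OF s c T(3)] cF[OF s] by simp
    then have "card {x\<in>diag \<mu>. fst x = i \<and> T x = v} = card {x\<in>diag \<mu>. fst x = i \<and> S x = v}" for i v
      unfolding compat_def using compat_tab[OF t, of i S v] by simp
    then have eq: "card {x\<in>diag \<mu>. fst x = i \<and> T x = v} = card {x\<in>diag \<mu>. fst x = i \<and> S x = v}" for i v .
    \<comment> \<open>The two tableaux may have different alphabets and contents; each is given its
      true content over a common alphabet.\<close>
    have 1: "T \<in> sst (max r r') (\<lambda>v. card {x\<in>diag \<mu>. T x = v}) \<mu>"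
      using T(1) by (auto simp: sst_def less_max_iff_disj)
    have 2: "S \<in> sst (max r r') (\<lambda>v. card {x\<in>diag \<mu>. S x = v}) \<mu>"
      using S by (auto simp: sst_def less_max_iff_disj)
    have "T = S" by (rule sst_eqI[OF 1 2 eq])
    then show False using T(2) by simp
  qed
  then show "row_col_sum A \<mu> T R C F = 0" unfolding row_col_sum_def by (intro sum.neutral) auto
qed

section \<open>Tableaux, tabloids and symmetric groups\<close>

lemma symmetric_group_simps:
  "carrier (symmetric_group n) = {\<sigma>. \<sigma> permutes {1..n}}"
  "x \<otimes>\<^bsub>symmetric_group n\<^esub> y = y \<circ> x" "\<one>\<^bsub>symmetric_group n\<^esub> = id"
  by (simp_all add: symmetric_group_def)

lemma group_symmetric_group: "group (symmetric_group n)"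
proof (rule groupI)
  fix x assume "x \<in> carrier (symmetric_group n)"
  then show "\<exists>y\<in>carrier (symmetric_group n). y \<otimes>\<^bsub>symmetric_group n\<^esub> x = \<one>\<^bsub>symmetric_group n\<^esub>"
    by (intro bexI[of _ "pinv x"]) (auto simp: symmetric_group_simps permutes_inv permutes_inv_o)
qed (auto simp: symmetric_group_simps permutes_compose permutes_id o_assoc)

lemma inv_symmetric_group:
  assumes "\<sigma> permutes {1..n}"
  shows "inv\<^bsub>symmetric_group n\<^esub> \<sigma> = pinv \<sigma>"
  by (rule group.inv_equality[OF group_symmetric_group])
     (use assms in \<open>auto simp: symmetric_group_simps permutes_inv permutes_inv_o\<close>)

section \<open>Partitions as lists and as functions\<close>

definition part_fun :: "nat list \<Rightarrow> nat \<Rightarrow> nat" where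
  "part_fun \<mu> i = (if i < length \<mu> then \<mu> ! i else 0)"

lemma young_diagram_eq: "young_diagram \<mu> = diag (part_fun \<mu>)"
  by (auto simp: young_diagram_def diag_def part_fun_def split: if_splits)

definition part_list :: "(nat \<Rightarrow> nat) \<Rightarrow> nat list" where
  "part_list \<mu> = map \<mu> [0..<card {i. \<mu> i \<noteq> 0}]"

lemma ptn_support:
  assumes "ptn \<mu>"
  shows "{i. \<mu> i \<noteq> 0} = {..<card {i. \<mu> i \<noteq> 0}}"
proof (cases "{i. \<mu> i \<noteq> 0} = {}")
  case False
  have f: "finite {i. \<mu> i \<noteq> 0}" using assms by (simp add: ptn_def)
  have "{i. \<mu> i \<noteq> 0} = {..<Suc (Max {i. \<mu> i \<noteq> 0})}"
  proof (intro equalityI subsetI)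
    fix i assume "i \<in> {..<Suc (Max {i. \<mu> i \<noteq> 0})}"
    then have "\<mu> (Max {i. \<mu> i \<noteq> 0}) \<le> \<mu> i" using assms by (auto simp: ptn_def intro: antimonoD)
    then show "i \<in> {i. \<mu> i \<noteq> 0}" using Max_in[OF f False] by simp
  next
    fix i assume "i \<in> {i. \<mu> i \<noteq> 0}"
    then show "i \<in> {..<Suc (Max {i. \<mu> i \<noteq> 0})}" using Max_ge[OF f] by (simp only: lessThan_iff less_Suc_eq_le)
  qed
  then show ?thesis by (metis card_lessThan)
next
  case True
  then show ?thesis by (simp only: card.empty lessThan_0)
qed

lemma part_fun_part_list: "ptn \<mu> \<Longrightarrow> part_fun (part_list \<mu>) = \<mu>"
  using ptn_support[of \<mu>] by (fastforce simp: part_fun_def part_list_def fun_eq_iff)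

lemma is_partition_part_list:
  assumes "\<mu> \<in> Par n"
  shows "is_partition (part_list \<mu>) n"
proof -
  let ?c = "card {i. \<mu> i \<noteq> 0}"
  have p: "ptn \<mu>" "psize \<mu> = n" using assms by (auto simp: Par_def)
  have nz: "\<mu> j \<noteq> 0" if "j < ?c" for j
  proof -
    have "j \<in> {i. \<mu> i \<noteq> 0}" by (rule equalityD2[OF ptn_support[OF p(1)], THEN subsetD]) (use that in simp)
    then show ?thesis by simp
  qed
  have "\<mu> j \<le> \<mu> i" if "i \<le> j" for i j using p(1) that by (auto simp: ptn_def dest: antimonoD)
  then have "sorted_wrt (\<ge>) (part_list \<mu>)"
    unfolding part_list_def sorted_wrt_iff_nth_less by simp
  moreover have "0 \<notin> set (part_list \<mu>)"
  proof
    assume "0 \<in> set (part_list \<mu>)"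
    then obtain j where "j < ?c" "\<mu> j = 0" by (auto simp: part_list_def)
    then show False using nz by blast
  qed
  moreover have "sum_list (part_list \<mu>) = psize \<mu>"
  proof -
    have "sum_list (part_list \<mu>) = sum \<mu> {..<?c}"
      by (simp add: part_list_def interv_sum_list_conv_sum_set_nat atLeast0LessThan)
    then show ?thesis unfolding psize_def ptn_support[OF p(1), symmetric] by simp
  qed
  ultimately show ?thesis using p by (simp add: is_partition_def)
qed

section \<open>Rows and columns of tableaux and tabloids\<close>

definition trow :: "nat list \<Rightarrow> (nat \<times> nat \<Rightarrow> nat) \<Rightarrow> nat \<Rightarrow> nat" where
  "trow \<mu> t a = fst (inv_into (young_diagram \<mu>) t a)"

definition tcol :: "nat list \<Rightarrow> (nat \<times> nat \<Rightarrow> nat) \<Rightarrow> nat \<Rightarrow> nat" where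
  "tcol \<mu> t a = snd (inv_into (young_diagram \<mu>) t a)"

definition tact :: "nat list \<Rightarrow> (nat \<Rightarrow> nat) \<Rightarrow> (nat \<times> nat \<Rightarrow> nat) \<Rightarrow> (nat \<times> nat \<Rightarrow> nat)" where
  "tact \<mu> \<sigma> t = (\<lambda>x\<in>young_diagram \<mu>. pinv \<sigma> (t x))"

definition tabloids :: "nat list \<Rightarrow> (nat \<times> nat \<Rightarrow> nat) set set" where
  "tabloids \<mu> = tabloid \<mu> ` tableaux \<mu>"

definition tabloid_row :: "nat list \<Rightarrow> (nat \<times> nat \<Rightarrow> nat) set \<Rightarrow> nat \<Rightarrow> nat" where
  "tabloid_row \<mu> X = trow \<mu> (SOME t. t \<in> tableaux \<mu> \<and> X = tabloid \<mu> t)"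

lemma tabloid_module_eq: "tabloid_module \<mu> = perm_rep (tabloid_act \<mu>) (tabloids \<mu>)"
  by (simp add: tabloid_module_def perm_rep_def tabloids_def conv_eq fun_eq_iff)

context
  fixes \<mu> :: "nat list" and n :: nat
  assumes n: "sum_list \<mu> = n"
begin

lemma tab_inv:
  assumes t: "t \<in> tableaux \<mu>"
  shows "a \<in> {1..n} \<Longrightarrow> (trow \<mu> t a, tcol \<mu> t a) \<in> young_diagram \<mu>"
    "a \<in> {1..n} \<Longrightarrow> t (trow \<mu> t a, tcol \<mu> t a) = a"
    "x \<in> young_diagram \<mu> \<Longrightarrow> trow \<mu> t (t x) = fst x"
    "x \<in> young_diagram \<mu> \<Longrightarrow> tcol \<mu> t (t x) = snd x"
    "x \<in> young_diagram \<mu> \<Longrightarrow> t x \<in> {1..n}"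
proof -
  have b: "bij_betw t (young_diagram \<mu>) {1..n}" using t by (simp add: tableaux_def n)
  then show "a \<in> {1..n} \<Longrightarrow> (trow \<mu> t a, tcol \<mu> t a) \<in> young_diagram \<mu>"
    "a \<in> {1..n} \<Longrightarrow> t (trow \<mu> t a, tcol \<mu> t a) = a"
    unfolding trow_def tcol_def by (auto simp: bij_betw_def inv_into_into f_inv_into_f)
  show "x \<in> young_diagram \<mu> \<Longrightarrow> trow \<mu> t (t x) = fst x" "x \<in> young_diagram \<mu> \<Longrightarrow> tcol \<mu> t (t x) = snd x"
    "x \<in> young_diagram \<mu> \<Longrightarrow> t x \<in> {1..n}"
    using b unfolding trow_def tcol_def by (auto simp: bij_betw_def)
qed

lemma is_tab_tableau:
  assumes t: "t \<in> tableaux \<mu>"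
  shows "is_tab {1..n} (part_fun \<mu>) (trow \<mu> t) (tcol \<mu> t)"
  unfolding is_tab_def young_diagram_eq[symmetric]
  by (rule bij_betwI[of _ _ _ t]) (use tab_inv[OF t] in auto)

lemma tab_image:
  assumes t: "t \<in> tableaux \<mu>"
  shows "t ` {x \<in> young_diagram \<mu>. Q x} = {a\<in>{1..n}. Q (trow \<mu> t a, tcol \<mu> t a)}"
proof (intro equalityI subsetI)
  fix a assume "a \<in> t ` {x \<in> young_diagram \<mu>. Q x}"
  then obtain x where x: "x \<in> young_diagram \<mu>" "Q x" "a = t x" by blast
  then show "a \<in> {a\<in>{1..n}. Q (trow \<mu> t a, tcol \<mu> t a)}"
    using tab_inv(3,4,5)[OF t x(1)] by simp
next
  fix a assume "a \<in> {a\<in>{1..n}. Q (trow \<mu> t a, tcol \<mu> t a)}"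
  then have a: "a \<in> {1..n}" "Q (trow \<mu> t a, tcol \<mu> t a)" by auto
  then show "a \<in> t ` {x \<in> young_diagram \<mu>. Q x}"
    using tab_inv(1,2)[OF t a(1)] by (intro image_eqI[of _ _ "(trow \<mu> t a, tcol \<mu> t a)"]) auto
qed

lemma row_entries_eq: "t \<in> tableaux \<mu> \<Longrightarrow> row_entries \<mu> t i = {a\<in>{1..n}. trow \<mu> t a = i}"
  unfolding row_entries_def by (simp add: tab_image)

lemma column_stabilizer_eq:
  assumes t: "t \<in> tableaux \<mu>"
  shows "column_stabilizer \<mu> t = col_stab {1..n} (tcol \<mu> t)"
proof -
  have ce: "column_entries \<mu> t j = {a\<in>{1..n}. tcol \<mu> t a = j}" for j
    unfolding column_entries_def by (simp add: tab_image t)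
  have "(\<forall>j. \<sigma> ` column_entries \<mu> t j = column_entries \<mu> t j) \<longleftrightarrow> (\<forall>a\<in>{1..n}. tcol \<mu> t (\<sigma> a) = tcol \<mu> t a)"
    if p: "\<sigma> permutes {1..n}" for \<sigma>
  proof
    assume "\<forall>j. \<sigma> ` column_entries \<mu> t j = column_entries \<mu> t j"
    then show "\<forall>a\<in>{1..n}. tcol \<mu> t (\<sigma> a) = tcol \<mu> t a" unfolding ce by blast
  next
    assume c: "\<forall>a\<in>{1..n}. tcol \<mu> t (\<sigma> a) = tcol \<mu> t a"
    show "\<forall>j. \<sigma> ` column_entries \<mu> t j = column_entries \<mu> t j"
    proof
      fix j
      have "\<sigma> ` column_entries \<mu> t j \<subseteq> column_entries \<mu> t j"
        unfolding ce using c permutes_in_image[OF p] by auto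
      moreover have "finite (column_entries \<mu> t j)" unfolding ce by simp
      moreover have "inj_on \<sigma> (column_entries \<mu> t j)" using permutes_inj[OF p] by (rule inj_on_subset) simp
      ultimately show "\<sigma> ` column_entries \<mu> t j = column_entries \<mu> t j" by (simp add: endo_inj_surj)
    qed
  qed
  then show ?thesis unfolding column_stabilizer_def col_stab_def n by auto
qed

lemma tabloid_iff:
  assumes "t \<in> tableaux \<mu>"
  shows "s \<in> tabloid \<mu> t \<longleftrightarrow> s \<in> tableaux \<mu> \<and> (\<forall>a\<in>{1..n}. trow \<mu> s a = trow \<mu> t a)"
proof -
  have "(\<forall>i. row_entries \<mu> s i = row_entries \<mu> t i) \<longleftrightarrow> (\<forall>a\<in>{1..n}. trow \<mu> s a = trow \<mu> t a)"
    if "s \<in> tableaux \<mu>"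
    unfolding row_entries_eq[OF that] row_entries_eq[OF assms] by (auto simp only: set_eq_iff mem_Collect_eq)
  then show ?thesis unfolding tabloid_def by auto
qed

lemma tabloid_eq_iff:
  assumes "t \<in> tableaux \<mu>" "s \<in> tableaux \<mu>"
  shows "tabloid \<mu> s = tabloid \<mu> t \<longleftrightarrow> (\<forall>a\<in>{1..n}. trow \<mu> s a = trow \<mu> t a)"
proof
  assume "tabloid \<mu> s = tabloid \<mu> t"
  then have "s \<in> tabloid \<mu> t" using tabloid_iff[OF assms(2)] assms by blast
  then show "\<forall>a\<in>{1..n}. trow \<mu> s a = trow \<mu> t a" using tabloid_iff[OF assms(1)] by blast
next
  assume "\<forall>a\<in>{1..n}. trow \<mu> s a = trow \<mu> t a"
  then show "tabloid \<mu> s = tabloid \<mu> t"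
    by (intro Set.set_eqI) (simp add: tabloid_iff[OF assms(1)] tabloid_iff[OF assms(2)])
qed

text \<open>Entries are moved by the inverse, so row and column functions are precomposed with
  \<sigma>; this matches the action on words.\<close>

lemma tact:
  assumes t: "t \<in> tableaux \<mu>" and s: "\<sigma> permutes {1..n}"
  shows "tact \<mu> \<sigma> t \<in> tableaux \<mu>" "a \<in> {1..n} \<Longrightarrow> trow \<mu> (tact \<mu> \<sigma> t) a = trow \<mu> t (\<sigma> a)"
    "a \<in> {1..n} \<Longrightarrow> tcol \<mu> (tact \<mu> \<sigma> t) a = tcol \<mu> t (\<sigma> a)"
proof -
  have b: "bij_betw t (young_diagram \<mu>) {1..n}" using t by (simp add: tableaux_def n)
  have "bij_betw (pinv \<sigma> \<circ> t) (young_diagram \<mu>) {1..n}"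
    using b permutes_imp_bij[OF permutes_inv[OF s]] by (rule bij_betw_trans)
  then have "bij_betw (tact \<mu> \<sigma> t) (young_diagram \<mu>) {1..n}"
    by (rule bij_betw_cong[THEN iffD1, rotated]) (simp add: tact_def)
  then show tt: "tact \<mu> \<sigma> t \<in> tableaux \<mu>" by (simp add: tableaux_def n tact_def)
  assume a: "a \<in> {1..n}"
  then have sa: "\<sigma> a \<in> {1..n}" using permutes_in_image[OF s] by simp
  let ?x = "(trow \<mu> t (\<sigma> a), tcol \<mu> t (\<sigma> a))"
  have x: "?x \<in> young_diagram \<mu>" by (rule tab_inv(1)[OF t sa])
  have "tact \<mu> \<sigma> t ?x = a" using x tab_inv(2)[OF t sa] permutes_inverses[OF s] by (simp add: tact_def)
  then show "trow \<mu> (tact \<mu> \<sigma> t) a = trow \<mu> t (\<sigma> a)" "tcol \<mu> (tact \<mu> \<sigma> t) a = tcol \<mu> t (\<sigma> a)"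
    using tab_inv(3,4)[OF tt x] by auto
qed

lemma tact_tact: "t \<in> tableaux \<mu> \<Longrightarrow> \<sigma> permutes {1..n} \<Longrightarrow> \<tau> permutes {1..n} \<Longrightarrow>
    tact \<mu> \<sigma> (tact \<mu> \<tau> t) = tact \<mu> (\<tau> \<circ> \<sigma>) t"
  by (auto simp: tact_def fun_eq_iff restrict_def o_inv_distrib permutes_bij)

lemma tact_id: "t \<in> tableaux \<mu> \<Longrightarrow> tact \<mu> id t = t"
  by (auto simp: tact_def tableaux_def extensional_restrict)

lemma tabloid_act_eq: "\<sigma> permutes {1..n} \<Longrightarrow> tabloid_act \<mu> \<sigma> X = tact \<mu> \<sigma> ` X"
  by (simp add: tabloid_act_def tact_def n inv_symmetric_group)

lemma tabloid_act_tabloid: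
  assumes t: "t \<in> tableaux \<mu>" and s: "\<sigma> permutes {1..n}"
  shows "tabloid_act \<mu> \<sigma> (tabloid \<mu> t) = tabloid \<mu> (tact \<mu> \<sigma> t)"
  unfolding tabloid_act_eq[OF s]
proof (intro equalityI subsetI)
  fix u assume "u \<in> tact \<mu> \<sigma> ` tabloid \<mu> t"
  then obtain s' where "u = tact \<mu> \<sigma> s'" "s' \<in> tableaux \<mu>" "\<forall>a\<in>{1..n}. trow \<mu> s' a = trow \<mu> t a"
    using tabloid_iff[OF t] by auto
  then show "u \<in> tabloid \<mu> (tact \<mu> \<sigma> t)"
    using tabloid_iff[OF tact(1)[OF t s]] tact[OF _ s] t permutes_in_image[OF s] by simp
next
  fix u assume "u \<in> tabloid \<mu> (tact \<mu> \<sigma> t)"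
  then have u: "u \<in> tableaux \<mu>" "\<forall>a\<in>{1..n}. trow \<mu> u a = trow \<mu> t (\<sigma> a)"
    using tabloid_iff[OF tact(1)[OF t s]] tact(2)[OF t s] by auto
  have i: "pinv \<sigma> permutes {1..n}" by (rule permutes_inv[OF s])
  have "tact \<mu> (pinv \<sigma>) u \<in> tabloid \<mu> t"
    using tabloid_iff[OF t] tact[OF u(1) i] u(2) permutes_in_image[OF i] permutes_inverses[OF s] by simp
  moreover have "u = tact \<mu> \<sigma> (tact \<mu> (pinv \<sigma>) u)"
    using tact_tact[OF u(1) s i] tact_id[OF u(1)] permutes_inv_o[OF s] by simp
  ultimately show "u \<in> tact \<mu> \<sigma> ` tabloid \<mu> t" by blast
qed

lemma group_set_tabloids: "group_set (symmetric_group n) (tabloid_act \<mu>) (tabloids \<mu>)"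
proof (intro group_set.intro group_symmetric_group group_set_axioms.intro)
  fix g x assume "g \<in> carrier (symmetric_group n)" "x \<in> tabloids \<mu>"
  then show "tabloid_act \<mu> g x \<in> tabloids \<mu>"
    by (auto simp: symmetric_group_simps tabloids_def tabloid_act_tabloid tact)
next
  fix x assume "x \<in> tabloids \<mu>"
  then show "tabloid_act \<mu> \<one>\<^bsub>symmetric_group n\<^esub> x = x"
    by (auto simp: symmetric_group_simps tabloids_def tabloid_act_tabloid permutes_id tact_id)
next
  fix g h x assume "g \<in> carrier (symmetric_group n)" "h \<in> carrier (symmetric_group n)" "x \<in> tabloids \<mu>"
  then show "tabloid_act \<mu> (g \<otimes>\<^bsub>symmetric_group n\<^esub> h) x = tabloid_act \<mu> g (tabloid_act \<mu> h x)"
    by (auto simp: symmetric_group_simps tabloids_def tabloid_act_tabloid tact tact_tact permutes_compose)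
qed

lemma tabloid_row:
  assumes t: "t \<in> tableaux \<mu>" and a: "a \<in> {1..n}"
  shows "tabloid_row \<mu> (tabloid \<mu> t) a = trow \<mu> t a"
proof -
  let ?s = "SOME s. s \<in> tableaux \<mu> \<and> tabloid \<mu> t = tabloid \<mu> s"
  have "?s \<in> tableaux \<mu> \<and> tabloid \<mu> t = tabloid \<mu> ?s" by (rule someI[of _ t]) (use t in simp)
  then have "trow \<mu> t a = trow \<mu> ?s a" using tabloid_eq_iff[of ?s t] t a by blast
  then show ?thesis by (simp add: tabloid_row_def)
qed

end

section \<open>Specht modules and their duals\<close>

definition pr :: "('x \<Rightarrow>\<^sub>0 'k::field) \<Rightarrow> ('x \<Rightarrow>\<^sub>0 'k) \<Rightarrow> 'k" where
  "pr m y = (\<Sum>x\<in>keys m. lookup m x * lookup y x)"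

lemma pr_superset: "finite S \<Longrightarrow> keys m \<subseteq> S \<Longrightarrow> pr m y = (\<Sum>x\<in>S. lookup m x * lookup y x)"
  unfolding pr_def by (rule sum.mono_neutral_left) (auto simp: in_keys_iff)

lemma pr_commute: "pr m y = pr y m"
  using pr_superset[of "keys m \<union> keys y" m y] pr_superset[of "keys m \<union> keys y" y m]
  by (simp add: mult.commute)

lemma pr_add_right: "pr m (y + z) = pr m y + pr m z"
  by (simp add: pr_def lookup_add algebra_simps sum.distrib)

lemma pr_scl_right: "pr m (scl c y) = c * pr m y"
  by (simp add: pr_def sum_distrib_left algebra_simps)

lemma pr_zero_right [simp]: "pr m 0 = 0"
  by (simp add: pr_def)

lemma pr_add_left: "pr (m + m') y = pr m y + pr m' y"
  by (metis pr_add_right pr_commute)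

lemma pr_scl_left: "pr (scl c m) y = c * pr m y"
  by (metis pr_scl_right pr_commute)

lemma pr_zero_left [simp]: "pr 0 y = 0"
  by (simp add: pr_def)

lemma pr_diff_left: "pr (m - m') y = pr m y - pr m' y"
  using pr_add_left[of "m - m'" m' y] by simp

lemma pr_single_left [simp]: "pr (single x c) y = c * lookup y x"
  by (simp add: pr_def)

lemma pr_sum_left: "pr (\<Sum>i\<in>I. m i) y = (\<Sum>i\<in>I. pr (m i) y)"
  by (induction I rule: infinite_finite_induct) (auto simp: pr_add_left)

lemma pr_sum_right: "pr y (\<Sum>i\<in>I. m i) = (\<Sum>i\<in>I. pr y (m i))"
  by (induction I rule: infinite_finite_induct) (auto simp: pr_add_right)

lemma pr_lin_left: "pr (lin u a) y = (\<Sum>x\<in>keys a. lookup a x * pr (u x) y)"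
  by (simp add: lin_def pr_sum_left pr_scl_left)

text \<open>Induction over the coordinates: the induction hypothesis applies to the subspace where
  the coordinate \<open>x\<close> vanishes, and one vector with coordinate 1 there fixes the
  coefficient at \<open>x\<close>. The restriction of the form to \<open>S\<close> is never
  involved; it may be degenerate.\<close>

lemma functional_representable:
  assumes "finite X" "\<And>y. y \<in> S \<Longrightarrow> keys y \<subseteq> X"
    and "\<And>y z. y \<in> S \<Longrightarrow> z \<in> S \<Longrightarrow> y + z \<in> S" "\<And>c y. y \<in> S \<Longrightarrow> scl c y \<in> S"
    and "\<And>y z. y \<in> S \<Longrightarrow> z \<in> S \<Longrightarrow> f (y + z) = f y + f z" "\<And>c y. y \<in> S \<Longrightarrow> f (scl c y) = c * f y"
  shows "\<exists>m. keys m \<subseteq> X \<and> (\<forall>y\<in>S. f y = pr m (y :: 'x \<Rightarrow>\<^sub>0 'k::field))"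
  using assms
proof (induction X arbitrary: S rule: finite_induct)
  case empty
  have "f y = 0" if "y \<in> S" for y
    using empty(1)[OF that] empty(5)[of y 0] that by simp
  then show ?case using empty(1) by (intro exI[of _ 0]) simp
next
  case (insert x X)
  let ?S = "{y\<in>S. lookup y x = 0}"
  have "\<exists>m. keys m \<subseteq> X \<and> (\<forall>y\<in>?S. f y = pr m y)"
  proof (rule insert.IH)
    show "keys y \<subseteq> X" if "y \<in> ?S" for y using that insert.prems(1)[of y] by (auto simp: in_keys_iff)
  qed (use insert.prems in \<open>auto simp: lookup_add\<close>)
  then obtain m where m: "keys m \<subseteq> X" "\<And>y. y \<in> S \<Longrightarrow> lookup y x = 0 \<Longrightarrow> f y = pr m y" by auto
  show ?case
  proof (cases "\<forall>y\<in>S. lookup y x = 0")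
    case True
    then show ?thesis using m by blast
  next
    case False
    then obtain y1 where y1: "y1 \<in> S" "lookup y1 x \<noteq> 0" by auto
    define y0 where "y0 = scl (inverse (lookup y1 x)) y1"
    have y0: "y0 \<in> S" "lookup y0 x = 1" using y1 insert.prems(3) by (simp_all add: y0_def)
    \<comment> \<open>Chosen so that the two functionals agree on \<open>y0\<close>; the added
      multiple of \<open>x\<close> does not disturb vectors whose coordinate at \<open>x\<close> is
      0.\<close>
    define m' where "m' = m + single x (f y0 - pr m y0)"
    have "f y = pr m' y" if y: "y \<in> S" for y
    proof -
      let ?z = "y + scl (- lookup y x) y0"
      have z: "?z \<in> S" by (intro insert.prems(2,3) y y0)
      have z0: "lookup ?z x = 0" unfolding lookup_add lookup_scl using y0 by simp
      have "f ?z = f y + (- lookup y x) * f y0"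
        using insert.prems(4)[OF y insert.prems(3)[OF y0(1)]] insert.prems(5)[OF y0(1)] by (simp only:)
      moreover have "pr m ?z = pr m y + (- lookup y x) * pr m y0"
        by (simp only: pr_add_right pr_scl_right)
      ultimately have "f y + (- lookup y x) * f y0 = pr m y + (- lookup y x) * pr m y0"
        using m(2)[OF z z0] by (simp only:)
      then show ?thesis by (simp add: m'_def pr_add_left algebra_simps)
    qed
    moreover have "keys m' \<subseteq> insert x X" unfolding m'_def using m(1) by (intro keys_addI) auto
    ultimately show ?thesis by blast
  qed
qed

context group_set
begin

lemma act_inv:
  assumes "g \<in> carrier G" "x \<in> X"
  shows "act (inv g) (act g x) = x" "act g (act (inv g) x) = x"
  using assms act_mult[of "inv g" g x] act_mult[of g "inv g" x] by (simp_all add: act_one)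

lemma lookup_conv_single:
  assumes g: "g \<in> carrier G" and y: "keys y \<subseteq> X" and x: "x \<in> X"
  shows "lookup (conv act (single g 1) y) x = lookup y (act (inv g) x)"
proof -
  have iff: "act g z = x \<longleftrightarrow> z = act (inv g) x" if "z \<in> X" for z
    using act_inv[OF g that] act_inv[OF g x] by auto
  have "lookup (conv act (single g 1) y) x = (\<Sum>z\<in>keys y. lookup y z * (if act g z = x then 1 else 0))"
    by (simp add: conv_single_left lookup_lin lookup_single when_def)
  also have "\<dots> = (\<Sum>z\<in>keys y. if z = act (inv g) x then lookup y z else 0)"
    using y iff by (intro sum.cong) auto
  also have "\<dots> = lookup y (act (inv g) x)" by (simp add: in_keys_iff)
  finally show ?thesis .
qed

text \<open>Invariance of the form: the adjoint of a group element is its inverse, as in the action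
  on the dual module.\<close>

lemma pr_conv_left:
  assumes a: "keys a \<subseteq> carrier G" and m: "keys m \<subseteq> X" and y: "keys y \<subseteq> X"
  shows "pr (conv act a m) y = (\<Sum>g\<in>keys a. lookup a g * pr m (conv act (single (inv g) 1) y))"
proof -
  have "pr (conv act a m) y = (\<Sum>g\<in>keys a. lookup a g * (\<Sum>x\<in>keys m. lookup m x * lookup y (act g x)))"
    by (simp add: conv_def pr_lin_left)
  also have "\<dots> = (\<Sum>g\<in>keys a. lookup a g * pr m (conv act (single (inv g) 1) y))"
    unfolding pr_def
  proof (intro sum.cong refl arg_cong2[where f="(*)"])
    fix g x assume "g \<in> keys a" "x \<in> keys m"
    then have "g \<in> carrier G" "x \<in> X" using a m by auto
    then show "lookup y (act g x) = lookup (conv act (single (inv g) 1) y) x"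
      using lookup_conv_single[of "inv g" y x] y by simp
  qed
  finally show ?thesis .
qed

lemma keys_conv_act: "keys a \<subseteq> carrier G \<Longrightarrow> keys m \<subseteq> X \<Longrightarrow> keys (conv act a m) \<subseteq> X"
  by (rule keys_conv) (auto intro: act_closed)

lemma conv_single_one: "keys m \<subseteq> X \<Longrightarrow> conv act (single \<one> c) m = scl c m"
proof -
  assume m: "keys m \<subseteq> X"
  have "conv act (single \<one> c) m = scl c (conv act (single \<one> 1) m)"
    using conv_scl_left[of act c "single \<one> 1" m] by simp
  also have "conv act (single \<one> 1) m = m" using m by (intro conv_unit act_one) auto
  finally show ?thesis .
qed

end

text \<open>The parameter \<open>kk\<close> fixes the field of scalars, which the shape itself does
  not mention.\<close>

locale partition_shape =
  fixes \<mu> :: "nat list" and n :: nat and kk :: "'k::field itself"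
  assumes part: "is_partition \<mu> n"
begin

lemma sum_n: "sum_list \<mu> = n"
  using part by (simp add: is_partition_def)

abbreviation "tabs \<equiv> tabloids \<mu>"

sublocale group_set "symmetric_group n" "tabloid_act \<mu>" tabs
  by (rule group_set_tabloids[OF sum_n])

definition specht :: "((nat \<times> nat \<Rightarrow> nat) set \<Rightarrow>\<^sub>0 'k) set" where
  "specht = carrier (specht_module \<mu>)"

lemma tabloid_module: "tabloid_module \<mu> = perm_rep (tabloid_act \<mu>) tabs"
  by (rule tabloid_module_eq)

lemma specht_eq: "specht = \<Inter>{N. submodule N (group_algebra (symmetric_group n) :: (_ \<Rightarrow>\<^sub>0 'k) ring)
    (perm_rep (tabloid_act \<mu>) tabs) \<and> polytabloid \<mu> ` tableaux \<mu> \<subseteq> N}"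
  unfolding specht_def specht_module_def by (simp add: sum_n tabloid_module)

lemma finite_tableaux: "finite (tableaux \<mu>)"
proof -
  have f: "finite (young_diagram \<mu>)"
    unfolding young_diagram_eq
    by (rule finite_subset[of _ "Sigma {..<length \<mu>} (\<lambda>i. {..<\<mu> ! i})"]) (auto simp: diag_def part_fun_def split: if_splits)
  have "tableaux \<mu> \<subseteq> young_diagram \<mu> \<rightarrow>\<^sub>E {1..n}"
    by (auto simp: tableaux_def sum_n bij_betw_def PiE_def)
  moreover have "finite (young_diagram \<mu> \<rightarrow>\<^sub>E {1..n})" using f by (intro finite_PiE) auto
  ultimately show ?thesis by (rule finite_subset)
qed

lemma finite_tabs: "finite tabs"
  unfolding tabloids_def using finite_tableaux by simp

lemma polytabloid_eq:
  "t \<in> tableaux \<mu> \<Longrightarrow> polytabloid \<mu> t =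
    (\<Sum>\<sigma>\<in>col_stab {1..n} (tcol \<mu> t). single (tabloid \<mu> (tact \<mu> \<sigma> t)) (of_int (sign \<sigma>)))"
  unfolding polytabloid_def column_stabilizer_eq[OF sum_n]
  by (intro sum.cong refl) (auto simp: col_stab_def tabloid_act_tabloid[OF sum_n])

lemma keys_polytabloid: "t \<in> tableaux \<mu> \<Longrightarrow> keys (polytabloid \<mu> t) \<subseteq> tabs"
  unfolding polytabloid_eq
  by (intro keys_sumI) (auto simp: col_stab_def tabloids_def intro!: imageI tact(1)[OF sum_n])

lemma submodule_all: "submodule {m. keys m \<subseteq> tabs} (group_algebra (symmetric_group n) :: (_ \<Rightarrow>\<^sub>0 'k) ring)
    (perm_rep (tabloid_act \<mu>) tabs)"
  by (rule submodule_perm_repI) (simp_all add: keys_addI keys_conv_act)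

lemma specht_keys: "y \<in> specht \<Longrightarrow> keys y \<subseteq> tabs"
  using submodule_all keys_polytabloid unfolding specht_eq by blast

lemma specht_least:
  assumes "submodule N (group_algebra (symmetric_group n) :: (_ \<Rightarrow>\<^sub>0 'k) ring) (perm_rep (tabloid_act \<mu>) tabs)"
    and "\<And>t. t \<in> tableaux \<mu> \<Longrightarrow> polytabloid \<mu> t \<in> N"
  shows "specht \<subseteq> N"
  using assms unfolding specht_eq by blast

lemma polytabloid_specht: "t \<in> tableaux \<mu> \<Longrightarrow> polytabloid \<mu> t \<in> specht"
  unfolding specht_eq by blast

lemma specht_add:
  assumes "y \<in> specht" "z \<in> specht"
  shows "y + z \<in> specht"
  unfolding specht_eq
proof (rule InterI, clarify)
  fix N :: "((nat \<times> nat \<Rightarrow> nat) set \<Rightarrow>\<^sub>0 'k) set"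
  assume N: "submodule N (group_algebra (symmetric_group n) :: (_ \<Rightarrow>\<^sub>0 'k) ring) (perm_rep (tabloid_act \<mu>) tabs)"
    "polytabloid \<mu> ` tableaux \<mu> \<subseteq> N"
  then have "y \<in> N" "z \<in> N" using assms unfolding specht_eq by auto
  then show "y + z \<in> N"
    using subgroup.m_closed[OF submodule.axioms(1)[OF N(1)]] by (simp add: perm_rep_simps)
qed

lemma specht_conv:
  assumes "y \<in> specht" "keys a \<subseteq> carrier (symmetric_group n)"
  shows "conv (tabloid_act \<mu>) a y \<in> specht"
  unfolding specht_eq
proof (rule InterI, clarify)
  fix N :: "((nat \<times> nat \<Rightarrow> nat) set \<Rightarrow>\<^sub>0 'k) set"
  assume N: "submodule N (group_algebra (symmetric_group n) :: (_ \<Rightarrow>\<^sub>0 'k) ring) (perm_rep (tabloid_act \<mu>) tabs)"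
    "polytabloid \<mu> ` tableaux \<mu> \<subseteq> N"
  then have "y \<in> N" using assms unfolding specht_eq by auto
  then show "conv (tabloid_act \<mu>) a y \<in> N"
    using submodule.smult_closed[OF N(1), of a y] assms(2) by (simp add: perm_rep_simps group_algebra_simps)
qed

lemma specht_scl: "y \<in> specht \<Longrightarrow> scl c y \<in> specht"
  using specht_conv[of y "single \<one>\<^bsub>symmetric_group n\<^esub> c"] conv_single_one[of y c] specht_keys[of y]
  by (simp split: if_splits)

section \<open>The orthogonal complement and the dual\<close>

definition specht_perp :: "((nat \<times> nat \<Rightarrow> nat) set \<Rightarrow>\<^sub>0 'k) set" where
  "specht_perp = {m. keys m \<subseteq> tabs \<and> (\<forall>y\<in>specht. pr m y = 0)}"

text \<open>The vectors orthogonal to all of the stable set \<open>K\<close> form a submodule by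
  invariance of the form; as it contains the polytabloids, it contains the Specht module.\<close>

lemma specht_perpI:
  assumes K: "\<And>m. m \<in> K \<Longrightarrow> keys m \<subseteq> tabs"
    "\<And>m a. m \<in> K \<Longrightarrow> keys a \<subseteq> carrier (symmetric_group n) \<Longrightarrow> conv (tabloid_act \<mu>) a m \<in> K"
    "\<And>m t. m \<in> K \<Longrightarrow> t \<in> tableaux \<mu> \<Longrightarrow> pr m (polytabloid \<mu> t) = 0"
  shows "K \<subseteq> specht_perp"
proof -
  let ?N = "{y :: (nat \<times> nat \<Rightarrow> nat) set \<Rightarrow>\<^sub>0 'k. keys y \<subseteq> tabs \<and> (\<forall>m\<in>K. pr m y = 0)}"
  have "submodule ?N (group_algebra (symmetric_group n) :: (_ \<Rightarrow>\<^sub>0 'k) ring) (perm_rep (tabloid_act \<mu>) tabs)"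
  proof (rule submodule_perm_repI)
    fix a :: "(nat \<Rightarrow> nat) \<Rightarrow>\<^sub>0 'k" and y :: "(nat \<times> nat \<Rightarrow> nat) set \<Rightarrow>\<^sub>0 'k"
    assume a: "keys a \<subseteq> carrier (symmetric_group n)" and y: "y \<in> ?N"
    have "pr m (conv (tabloid_act \<mu>) a y) = 0" if m: "m \<in> K" for m
    proof -
      have "pr m (conv (tabloid_act \<mu>) a y) =
          (\<Sum>g\<in>keys a. lookup a g * pr y (conv (tabloid_act \<mu>) (single (inv\<^bsub>symmetric_group n\<^esub> g) 1) m))"
        using pr_conv_left[OF a _ K(1)[OF m], of y] y by (simp add: pr_commute)
      also have "\<dots> = 0"
      proof (rule sum.neutral, rule ballI)
        fix g assume g: "g \<in> keys a"
        have "conv (tabloid_act \<mu>) (single (inv\<^bsub>symmetric_group n\<^esub> g) 1) m \<in> K"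
          using g a by (intro K(2)[OF m]) auto
        then have "pr y (conv (tabloid_act \<mu>) (single (inv\<^bsub>symmetric_group n\<^esub> g) 1) m) = 0"
          using y by (subst pr_commute) simp
        then show "lookup a g * pr y (conv (tabloid_act \<mu>) (single (inv\<^bsub>symmetric_group n\<^esub> g) 1) m) = 0" by simp
      qed
      finally show ?thesis .
    qed
    then show "conv (tabloid_act \<mu>) a y \<in> ?N" using y keys_conv_act[OF a] by simp
  qed (simp_all add: pr_add_right keys_addI)
  then have "specht \<subseteq> ?N" using K(3) keys_polytabloid by (intro specht_least) auto
  then show ?thesis using K(1) unfolding specht_perp_def by blast
qed

definition to_dual :: "((nat \<times> nat \<Rightarrow> nat) set \<Rightarrow>\<^sub>0 'k) \<Rightarrow> ((nat \<times> nat \<Rightarrow> nat) set \<Rightarrow>\<^sub>0 'k) \<Rightarrow> 'k" where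
  "to_dual m = (\<lambda>y\<in>specht. pr m y)"

abbreviation "dual \<equiv> dual_module (symmetric_group n)
  (specht_module \<mu> :: ((nat \<Rightarrow> nat) \<Rightarrow>\<^sub>0 'k, (nat \<times> nat \<Rightarrow> nat) set \<Rightarrow>\<^sub>0 'k) module)"

lemma specht_module_simps:
  "carrier (specht_module \<mu>) = specht"
  "add (specht_module \<mu> :: ((nat \<Rightarrow> nat) \<Rightarrow>\<^sub>0 'k, _) module) = (+)"
  "smult (specht_module \<mu> :: ((nat \<Rightarrow> nat) \<Rightarrow>\<^sub>0 'k, _) module) = conv (tabloid_act \<mu>)"
  by (simp add: specht_def) (simp_all add: specht_module_def tabloid_module perm_rep_simps)

lemma dual_in: "dual_module (symmetric_group n)
  (specht_module \<mu> :: ((nat \<Rightarrow> nat) \<Rightarrow>\<^sub>0 'k, (nat \<times> nat \<Rightarrow> nat) set \<Rightarrow>\<^sub>0 'k) module) \<in> dual_specht_modules n"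
  using part unfolding dual_specht_modules_def by blast

text \<open>Surjectivity is \<open>functional_representable\<close>: every functional on the Specht
  module is the pairing with some vector of the tabloid module.\<close>

lemma to_dual_image: "to_dual ` {m. keys m \<subseteq> tabs} = carrier dual"
proof (intro equalityI subsetI)
  fix f assume "f \<in> to_dual ` {m. keys m \<subseteq> tabs}"
  then obtain m where m: "f = to_dual m" by blast
  show "f \<in> carrier dual"
    unfolding dual_module_def m to_dual_def specht_module_simps
    by (auto simp: specht_add pr_add_right conv_single_one specht_keys specht_scl pr_scl_right)
next
  fix f assume "f \<in> carrier dual"
  then have f: "f \<in> extensional specht" "\<And>y z. y \<in> specht \<Longrightarrow> z \<in> specht \<Longrightarrow> f (y + z) = f y + f z"
    "\<And>c y. y \<in> specht \<Longrightarrow> f (conv (tabloid_act \<mu>) (single \<one>\<^bsub>symmetric_group n\<^esub> c) y) = c * f y"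
    unfolding dual_module_def by (auto simp: specht_module_simps)
  have fs: "f (scl c y) = c * f y" if "y \<in> specht" for c y
    using f(3)[OF that, of c] conv_single_one[OF specht_keys[OF that], of c] by simp
  have "\<exists>m. keys m \<subseteq> tabs \<and> (\<forall>y\<in>specht. f y = pr m y)"
    by (rule functional_representable[OF finite_tabs specht_keys]) (simp_all add: f fs specht_add specht_scl)
  then obtain m where m: "keys m \<subseteq> tabs" "\<forall>y\<in>specht. f y = pr m y" by blast
  have "f = to_dual m"
    using f(1) m(2) by (auto simp: to_dual_def extensional_def fun_eq_iff)
  then show "f \<in> to_dual ` {m. keys m \<subseteq> tabs}" using m by blast
qed

lemma to_dual_add: "to_dual (m + m') = to_dual m \<oplus>\<^bsub>dual\<^esub> to_dual m'"
  unfolding dual_module_def to_dual_def by (auto simp: specht_module_simps pr_add_left fun_eq_iff)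

lemma to_dual_zero: "to_dual 0 = \<zero>\<^bsub>dual\<^esub>"
  unfolding dual_module_def to_dual_def by (auto simp: specht_module_simps fun_eq_iff)

lemma to_dual_conv:
  assumes a: "keys a \<subseteq> carrier (symmetric_group n)" and m: "keys m \<subseteq> tabs"
  shows "to_dual (conv (tabloid_act \<mu>) a m) = a \<odot>\<^bsub>dual\<^esub> to_dual m"
proof
  fix y
  show "to_dual (conv (tabloid_act \<mu>) a m) y = (a \<odot>\<^bsub>dual\<^esub> to_dual m) y"
  proof (cases "y \<in> specht")
    case True
    have "conv (tabloid_act \<mu>) (single (inv\<^bsub>symmetric_group n\<^esub> g) 1) y \<in> specht" if "g \<in> keys a" for g
      using True a that by (intro specht_conv) auto
    then show ?thesis
      unfolding dual_module_def to_dual_def using True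
      by (simp add: specht_module_simps pr_conv_left[OF a m specht_keys])
  qed (simp add: dual_module_def to_dual_def specht_module_simps)
qed

lemma to_dual_eq: "keys m \<subseteq> tabs \<Longrightarrow> keys m' \<subseteq> tabs \<Longrightarrow> to_dual m = to_dual m' \<longleftrightarrow> m - m' \<in> specht_perp"
proof -
  assume k: "keys m \<subseteq> tabs" "keys m' \<subseteq> tabs"
  have "keys (m - m') \<subseteq> tabs" using keys_diff[of m m'] k by blast
  then have "m - m' \<in> specht_perp \<longleftrightarrow> (\<forall>y\<in>specht. pr m y = pr m' y)"
    by (simp add: specht_perp_def pr_diff_left)
  also have "\<dots> \<longleftrightarrow> to_dual m = to_dual m'" by (auto simp: to_dual_def fun_eq_iff)
  finally show ?thesis by simp
qed

lemma pr_polytabloid: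
  fixes m :: "(nat \<times> nat \<Rightarrow> nat) set \<Rightarrow>\<^sub>0 'k"
  assumes t: "t \<in> tableaux \<mu>" and m: "keys m \<subseteq> tabs"
  shows "pr m (polytabloid \<mu> t) =
    (\<Sum>X\<in>keys m. lookup m X * of_int (tabloid_sum {1..n} (tabloid_row \<mu> X) (trow \<mu> t) (tcol \<mu> t)))"
  unfolding pr_def
proof (intro sum.cong refl arg_cong2[where f="(*)"])
  fix X assume "X \<in> keys m"
  then obtain s where s: "s \<in> tableaux \<mu>" "X = tabloid \<mu> s" using m by (auto simp: tabloids_def)
  have "lookup (polytabloid \<mu> t) X =
      (\<Sum>\<sigma>\<in>col_stab {1..n} (tcol \<mu> t). if tabloid \<mu> (tact \<mu> \<sigma> t) = X then of_int (sign \<sigma>) else (0::'k))"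
    unfolding polytabloid_eq[OF t] by (simp add: lookup_sum lookup_single when_def)
  also have "\<dots> = (\<Sum>\<sigma>\<in>col_stab {1..n} (tcol \<mu> t).
      of_int (sign \<sigma> * (if \<forall>a\<in>{1..n}. trow \<mu> t (\<sigma> a) = tabloid_row \<mu> X a then 1 else 0)))"
  proof (intro sum.cong refl)
    fix \<sigma> assume "\<sigma> \<in> col_stab {1..n} (tcol \<mu> t)"
    then have p: "\<sigma> permutes {1..n}" by (simp add: col_stab_def)
    have "tabloid \<mu> (tact \<mu> \<sigma> t) = X \<longleftrightarrow> (\<forall>a\<in>{1..n}. trow \<mu> t (\<sigma> a) = tabloid_row \<mu> X a)"
      unfolding s(2) tabloid_eq_iff[OF sum_n s(1) tact(1)[OF sum_n t p]]
      by (simp add: tact(2)[OF sum_n t p] tabloid_row[OF sum_n s(1)])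
    then show "(if tabloid \<mu> (tact \<mu> \<sigma> t) = X then of_int (sign \<sigma>) else (0::'k)) =
      of_int (sign \<sigma> * (if \<forall>a\<in>{1..n}. trow \<mu> t (\<sigma> a) = tabloid_row \<mu> X a then 1 else 0))" by simp
  qed
  also have "\<dots> = of_int (tabloid_sum {1..n} (tabloid_row \<mu> X) (trow \<mu> t) (tcol \<mu> t))"
    by (simp only: tabloid_sum_def of_int_sum)
  finally show "lookup (polytabloid \<mu> t) X = (of_int (tabloid_sum {1..n} (tabloid_row \<mu> X) (trow \<mu> t) (tcol \<mu> t)) :: 'k)" .
qed

text \<open>Entries of semistandard fillings start at 0, those of tableaux at 1; hence the
  shift.\<close>

definition std_tab :: "(nat \<times> nat \<Rightarrow> nat) \<Rightarrow> (nat \<times> nat \<Rightarrow> nat)" where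
  "std_tab w = (\<lambda>x\<in>young_diagram \<mu>. Suc (w x))"

lemma std_tab:
  assumes w: "w \<in> sst n (\<lambda>_. 1) (part_fun \<mu>)"
  shows "std_tab w \<in> tableaux \<mu>"
    "a \<in> {1..n} \<Longrightarrow> w (trow \<mu> (std_tab w) a, tcol \<mu> (std_tab w) a) = a - 1"
proof -
  let ?D = "young_diagram \<mu>"
  have c: "card {x\<in>?D. w x = a} = 1" if "a < n" for a
    using w that by (auto simp: sst_def young_diagram_eq)
  have lt: "w x < n" if "x \<in> ?D" for x using w that by (auto simp: sst_def young_diagram_eq)
  have "inj_on w ?D"
  proof (rule inj_onI)
    fix x y assume xy: "x \<in> ?D" "y \<in> ?D" "w x = w y"
    obtain z where "{x'\<in>?D. w x' = w x} = {z}" using c[OF lt[OF xy(1)]] by (auto simp: card_1_singleton_iff)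
    moreover have "x \<in> {x'\<in>?D. w x' = w x}" "y \<in> {x'\<in>?D. w x' = w x}" using xy by auto
    ultimately show "x = y" by (metis singletonD)
  qed
  moreover have "w ` ?D = {..<n}"
  proof
    show "{..<n} \<subseteq> w ` ?D"
    proof
      fix a assume "a \<in> {..<n}"
      then have "{x\<in>?D. w x = a} \<noteq> {}" using c[of a] by (metis card.empty lessThan_iff zero_neq_one)
      then show "a \<in> w ` ?D" by auto
    qed
  qed (use lt in auto)
  ultimately have b: "bij_betw w ?D {..<n}" by (simp add: bij_betw_def)
  have "bij_betw Suc {..<n} {1..n}"
    by (rule bij_betwI[of _ _ _ "\<lambda>a. a - 1"]) auto
  then have "bij_betw (Suc \<circ> w) ?D {1..n}" using b by (rule bij_betw_trans[rotated])
  then have "bij_betw (std_tab w) ?D {1..n}"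
    by (rule bij_betw_cong[THEN iffD1, rotated]) (simp add: std_tab_def)
  then show t: "std_tab w \<in> tableaux \<mu>" by (simp add: tableaux_def sum_n std_tab_def)
  show "w (trow \<mu> (std_tab w) a, tcol \<mu> (std_tab w) a) = a - 1" if "a \<in> {1..n}"
  proof -
    obtain x where x: "x = (trow \<mu> (std_tab w) a, tcol \<mu> (std_tab w) a)" by blast
    have "x \<in> ?D" "std_tab w x = a" using tab_inv(1,2)[OF sum_n t that] unfolding x by auto
    then have "Suc (w x) = a" by (simp add: std_tab_def)
    then show ?thesis unfolding x by simp
  qed
qed

text \<open>The evaluation \<open>row_col_sum_diag\<close> is reused with T = w and the word a - 1.
  As \<open>w\<close> has distinct entries, compatibility with \<open>w\<close> determines the row
  of every letter, so \<open>row_col_sum\<close> becomes \<open>tabloid_sum\<close> after inversion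
  of the column permutations.\<close>

lemma tabloid_sum_std:
  assumes w: "w \<in> sst n (\<lambda>_. 1) (part_fun \<mu>)" and v: "v \<in> sst n (\<lambda>_. 1) (part_fun \<mu>)" and mu: "ptn (part_fun \<mu>)"
  shows "v = w \<Longrightarrow> tabloid_sum {1..n} (trow \<mu> (std_tab w)) (trow \<mu> (std_tab v)) (tcol \<mu> (std_tab v)) = 1"
    "v \<noteq> w \<Longrightarrow> key (part_fun \<mu>) v \<le> key (part_fun \<mu>) w \<Longrightarrow>
       tabloid_sum {1..n} (trow \<mu> (std_tab w)) (trow \<mu> (std_tab v)) (tcol \<mu> (std_tab v)) = 0"
proof -
  let ?A = "{1..n}" and ?\<rho> = "trow \<mu> (std_tab w)" and ?R = "trow \<mu> (std_tab v)" and ?C = "tcol \<mu> (std_tab v)"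
  let ?F = "\<lambda>a::nat. a - 1"
  note tv = is_tab_tableau[OF sum_n std_tab(1)[OF v]] and tw = is_tab_tableau[OF sum_n std_tab(1)[OF w]]
  have cw: "compat ?A (part_fun \<mu>) w ?\<rho> ?F"
  proof -
    have "compat ?A (part_fun \<mu>) w ?\<rho> (\<lambda>a. w (?\<rho> a, tcol \<mu> (std_tab w) a))"
      unfolding compat_def by (intro allI compat_tab[OF tw])
    then show ?thesis
      by (rule compat_cong[THEN iffD1, rotated 2]) (simp_all add: std_tab(2)[OF w])
  qed
  have iff: "compat ?A (part_fun \<mu>) w ?R (?F \<circ> \<sigma>) \<longleftrightarrow> (\<forall>a\<in>?A. ?R (pinv \<sigma> a) = ?\<rho> a)"
    if s: "\<sigma> \<in> col_stab ?A ?C" for \<sigma>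
  proof -
    have p: "\<sigma> permutes ?A" using s by (simp add: col_stab_def)
    have "compat ?A (part_fun \<mu>) w ?R (?F \<circ> \<sigma>) \<longleftrightarrow> compat ?A (part_fun \<mu>) w (?R \<circ> pinv \<sigma>) ?F"
      using compat_permute[OF permutes_inv[OF p], of "part_fun \<mu>" w ?R "?F \<circ> \<sigma>"] permutes_inv_o[OF p]
      by (simp add: o_assoc[symmetric])
    also have "\<dots> \<longleftrightarrow> (\<forall>a\<in>?A. ?R (pinv \<sigma> a) = ?\<rho> a)"
    proof
      assume c: "compat ?A (part_fun \<mu>) w (?R \<circ> pinv \<sigma>) ?F"
      show "\<forall>a\<in>?A. ?R (pinv \<sigma> a) = ?\<rho> a"
      proof
        fix a assume a: "a \<in> ?A"
        have "{b\<in>?A. ?\<rho> b = ?\<rho> a \<and> ?F b = ?F a} = {a}" using a by auto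
        then have "card {b\<in>?A. (?R \<circ> pinv \<sigma>) b = ?\<rho> a \<and> ?F b = ?F a} = 1"
          using c cw unfolding compat_def by (metis card_1_singleton_iff One_nat_def)
        then obtain b where "{b\<in>?A. (?R \<circ> pinv \<sigma>) b = ?\<rho> a \<and> ?F b = ?F a} = {b}" by (auto simp: card_1_singleton_iff)
        then have "b \<in> ?A" "?R (pinv \<sigma> b) = ?\<rho> a" "?F b = ?F a" by auto
        then show "?R (pinv \<sigma> a) = ?\<rho> a" using a by (metis One_nat_def Suc_pred atLeastAtMost_iff less_eq_Suc_le)
      qed
    next
      assume "\<forall>a\<in>?A. ?R (pinv \<sigma> a) = ?\<rho> a"
      then show "compat ?A (part_fun \<mu>) w (?R \<circ> pinv \<sigma>) ?F"
        using cw by (intro compat_cong[THEN iffD1, OF _ _ cw]) auto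
    qed
    finally show ?thesis .
  qed
  have "row_col_sum ?A (part_fun \<mu>) w ?R ?C ?F =
      (\<Sum>\<sigma>\<in>col_stab ?A ?C. sign (pinv \<sigma>) * (if \<forall>a\<in>?A. ?R (pinv \<sigma> a) = ?\<rho> a then 1 else 0))"
    unfolding row_col_sum_def
  proof (intro sum.cong refl arg_cong2[where f="(*)"])
    fix \<sigma> assume s: "\<sigma> \<in> col_stab ?A ?C"
    then have "permutation \<sigma>" by (auto simp: col_stab_def intro: permutation_permutes[THEN iffD2])
    then show "sign \<sigma> = sign (pinv \<sigma>)" by (simp add: sign_inverse)
    show "(if compat ?A (part_fun \<mu>) w ?R (?F \<circ> \<sigma>) then 1 else 0) = (if \<forall>a\<in>?A. ?R (pinv \<sigma> a) = ?\<rho> a then 1 else 0 :: int)"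
      by (simp only: iff[OF s])
  qed
  also have "\<dots> = tabloid_sum ?A ?\<rho> ?R ?C"
    unfolding tabloid_sum_def
  proof (rule sum.reindex_bij_witness[of _ pinv pinv])
    fix \<sigma> assume s: "\<sigma> \<in> col_stab ?A ?C"
    then have "bij \<sigma>" by (auto simp: col_stab_def intro: permutes_bij)
    then show "pinv (pinv \<sigma>) = \<sigma>" by (rule inv_inv_eq)
    then show "pinv (pinv \<sigma>) = \<sigma>" .
    show "pinv \<sigma> \<in> col_stab ?A ?C" by (rule col_stab_inv[OF s])
    then show "pinv \<sigma> \<in> col_stab ?A ?C" .
  qed simp
  finally have eq: "tabloid_sum ?A ?\<rho> ?R ?C = row_col_sum ?A (part_fun \<mu>) w ?R ?C ?F" by simp
  have F: "?F a = v (?R a, ?C a)" if "a \<in> ?A" for a using std_tab(2)[OF v that] by simp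
  show "v = w \<Longrightarrow> tabloid_sum ?A ?\<rho> ?R ?C = 1"
    unfolding eq using row_col_sum_diag(1)[OF _ tv v mu F] by simp
  show "v \<noteq> w \<Longrightarrow> key (part_fun \<mu>) v \<le> key (part_fun \<mu>) w \<Longrightarrow> tabloid_sum ?A ?\<rho> ?R ?C = 0"
    unfolding eq using row_col_sum_diag(2)[OF _ tv v mu F w] by simp
qed

text \<open>Among the tableaux with nonzero coefficient let \<open>v\<close> have the least key;
  pairing with the polytabloid of \<open>v\<close> isolates its coefficient. Thus the dual Specht
  module has at least as many dimensions as there are standard tableaux.\<close>

lemma std_independent:
  assumes mu: "ptn (part_fun \<mu>)"
    and c: "(\<Sum>w\<in>sst n (\<lambda>_. 1) (part_fun \<mu>). scl (c w) (single (tabloid \<mu> (std_tab w)) 1)) \<in> specht_perp"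
    and w0: "w0 \<in> sst n (\<lambda>_. 1) (part_fun \<mu>)"
  shows "c w0 = 0"
proof (rule ccontr)
  let ?W = "sst n (\<lambda>_. 1) (part_fun \<mu>)" and ?key = "key (part_fun \<mu>)"
  assume nz: "c w0 \<noteq> 0"
  have f: "finite ?W" by (rule finite_sst[OF mu])
  define v where "v = arg_min_on ?key {w\<in>?W. c w \<noteq> 0}"
  have v: "v \<in> ?W" "c v \<noteq> 0" and min: "\<And>w. w \<in> ?W \<Longrightarrow> c w \<noteq> 0 \<Longrightarrow> ?key v \<le> ?key w"
    using arg_min_if_finite(1)[of "{w\<in>?W. c w \<noteq> 0}" ?key] arg_min_least[of "{w\<in>?W. c w \<noteq> 0}" _ ?key] f nz w0
    unfolding v_def by auto
  let ?q = "\<lambda>w. tabloid_sum {1..n} (trow \<mu> (std_tab w)) (trow \<mu> (std_tab v)) (tcol \<mu> (std_tab v))"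
  have pr1: "pr (single (tabloid \<mu> (std_tab w)) (1::'k)) (polytabloid \<mu> (std_tab v)) = of_int (?q w)" if w: "w \<in> ?W" for w
  proof -
    have "pr (single (tabloid \<mu> (std_tab w)) (1::'k)) (polytabloid \<mu> (std_tab v)) =
      of_int (tabloid_sum {1..n} (tabloid_row \<mu> (tabloid \<mu> (std_tab w))) (trow \<mu> (std_tab v)) (tcol \<mu> (std_tab v)))"
      using std_tab(1)[OF w] by (subst pr_polytabloid[OF std_tab(1)[OF v(1)]]) (auto simp: tabloids_def)
    also have "tabloid_sum {1..n} (tabloid_row \<mu> (tabloid \<mu> (std_tab w))) (trow \<mu> (std_tab v)) (tcol \<mu> (std_tab v)) = ?q w"
      unfolding tabloid_sum_def by (intro sum.cong refl) (simp add: tabloid_row[OF sum_n std_tab(1)[OF w]])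
    finally show ?thesis .
  qed
  have "0 = pr (\<Sum>w\<in>?W. scl (c w) (single (tabloid \<mu> (std_tab w)) 1)) (polytabloid \<mu> (std_tab v))"
    using c polytabloid_specht[OF std_tab(1)[OF v(1)]] by (simp add: specht_perp_def)
  also have "\<dots> = (\<Sum>w\<in>?W. c w * of_int (?q w))"
    unfolding pr_sum_left pr_scl_left by (intro sum.cong refl) (simp only: pr1)
  also have "\<dots> = (\<Sum>w\<in>?W. if w = v then c w else 0)"
  proof (intro sum.cong refl)
    fix w assume w: "w \<in> ?W"
    show "c w * of_int (?q w) = (if w = v then c w else 0)"
    proof (cases "w = v")
      case True
      then show ?thesis using tabloid_sum_std(1)[OF w v(1) mu] by simp
    next
      case False
      then show ?thesis using tabloid_sum_std(2)[OF w v(1) mu] min[OF w] by (cases "c w = 0") auto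
    qed
  qed
  also have "\<dots> = c v" using f v by simp
  finally show False using v by simp
qed

end

section \<open>The filtration of a sum of Young permutation modules\<close>

lemma permute_card:
  assumes "\<sigma> permutes A"
  shows "card {a\<in>A. Q (\<sigma> a)} = card {a\<in>A. Q a}"
  by (rule bij_betw_same_card[OF bij_betw_restrict_pred[OF permutes_imp_bij[OF assms]]])

lemma words_closed:
  assumes f: "f \<in> words n r \<nu>" and g: "g permutes {1..n}"
  shows "f \<circ> g \<in> words n r \<nu>"
proof -
  have "(f \<circ> g) b = 0" if "b \<notin> {1..n}" for b
    using f that g by (simp add: words_def permutes_not_in)
  moreover have "(f \<circ> g) b < r" if "b \<in> {1..n}" for b
    using f that permutes_in_image[OF g, of b] by (simp add: words_def)
  moreover have "card {b\<in>{1..n}. (f \<circ> g) b = a} = \<nu> a" if "a < r" for a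
    using f that permute_card[OF g, of "\<lambda>b. f b = a"] by (simp add: words_def)
  ultimately show ?thesis unfolding words_def by blast
qed

lemma group_set_words: "group_set (symmetric_group n) (\<lambda>g f. f \<circ> g) (words n r \<nu>)"
  by (intro group_set.intro group_symmetric_group group_set_axioms.intro)
     (simp_all add: symmetric_group_simps words_closed o_assoc)

definition tab_word :: "nat \<Rightarrow> nat list \<Rightarrow> (nat \<times> nat \<Rightarrow> nat) \<Rightarrow> (nat \<times> nat \<Rightarrow> nat) \<Rightarrow> nat \<Rightarrow> nat" where
  "tab_word n \<mu> S t a = (if a \<in> {1..n} then S (trow \<mu> t a, tcol \<mu> t a) else 0)"

locale word_rep =
  fixes n :: nat and I :: "nat set" and r :: "nat \<Rightarrow> nat" and \<nu> :: "nat \<Rightarrow> nat \<Rightarrow> nat" and kk :: "'k::field itself"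
  assumes fin_I: "finite I"
begin

definition "Z = Sigma I (\<lambda>i. words n (r i) (\<nu> i))"

definition actZ :: "(nat \<Rightarrow> nat) \<Rightarrow> nat \<times> (nat \<Rightarrow> nat) \<Rightarrow> nat \<times> (nat \<Rightarrow> nat)" where
  "actZ g = (\<lambda>(i, f). (i, f \<circ> g))"

sublocale Z: group_set "symmetric_group n" actZ Z
  by (intro group_set.intro group_symmetric_group group_set_axioms.intro)
     (auto simp: symmetric_group_simps words_closed o_assoc Z_def actZ_def)

lemma finite_Z: "finite Z"
  unfolding Z_def using fin_I by (intro finite_SigmaI finite_words)

text \<open>The row symmetrization of \<open>T\<close>, given on the tabloid \<open>X\<close> as the
  sum of all words of the \<open>i\<close>-th summand that have the row contents of
  \<open>T\<close>.\<close>

definition \<theta> :: "nat \<Rightarrow> (nat \<Rightarrow> nat) \<Rightarrow> (nat \<times> nat \<Rightarrow> nat) \<Rightarrow> (nat \<times> nat \<Rightarrow> nat) set \<Rightarrow> nat \<times> (nat \<Rightarrow> nat) \<Rightarrow>\<^sub>0 'k" where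
  "\<theta> i l T X = (\<Sum>f\<in>{f\<in>words n (r i) (\<nu> i). compat {1..n} l T (tabloid_row (part_list l) X) f}. single (i, f) 1)"

lemma keys_theta: "i \<in> I \<Longrightarrow> keys (\<theta> i l T X) \<subseteq> Z"
  unfolding \<theta>_def by (intro keys_sumI) (auto simp: Z_def)

lemma lookup_theta:
  assumes "f \<in> words n (r i) (\<nu> i)"
  shows "lookup (\<theta> i' l T X) (i, f) =
    (if i = i' \<and> compat {1..n} l T (tabloid_row (part_list l) X) f then 1 else 0)"
proof -
  have "lookup (\<theta> i' l T X) (i, f) =
    (\<Sum>f'\<in>{f\<in>words n (r i') (\<nu> i'). compat {1..n} l T (tabloid_row (part_list l) X) f}.
      if f' = f then (if i = i' then 1 else 0) else 0)"
    unfolding \<theta>_def lookup_sum by (intro sum.cong refl) (auto simp: lookup_single when_def)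
  also have "\<dots> = (if i = i' \<and> compat {1..n} l T (tabloid_row (part_list l) X) f then 1 else 0)"
    using assms finite_words by (auto simp: sum.delta)
  finally show ?thesis .
qed

lemma theta_act:
  assumes l: "l \<in> Par n" and g: "g \<in> carrier (symmetric_group n)" and X: "X \<in> tabloids (part_list l)"
  shows "\<theta> i l T (tabloid_act (part_list l) g X) = conv actZ (single g 1) (\<theta> i l T X)"
proof -
  have n: "sum_list (part_list l) = n" using is_partition_part_list[OF l] by (simp add: is_partition_def)
  have p: "g permutes {1..n}" using g by (simp add: symmetric_group_simps)
  obtain t where t: "t \<in> tableaux (part_list l)" "X = tabloid (part_list l) t" using X by (auto simp: tabloids_def)
  have row: "tabloid_row (part_list l) (tabloid_act (part_list l) g X) a = tabloid_row (part_list l) X (g a)"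
    if "a \<in> {1..n}" for a
    using that permutes_in_image[OF p, of a]
    by (simp add: t(2) tabloid_act_tabloid[OF n t(1) p] tabloid_row[OF n] tact[OF n t(1) p] t(1))
  have c: "compat {1..n} l T (tabloid_row (part_list l) (tabloid_act (part_list l) g X)) (f \<circ> g) \<longleftrightarrow>
     compat {1..n} l T (tabloid_row (part_list l) X) f" for f
  proof -
    have "compat {1..n} l T (tabloid_row (part_list l) (tabloid_act (part_list l) g X)) (f \<circ> g) \<longleftrightarrow>
       compat {1..n} l T (tabloid_row (part_list l) X \<circ> g) (f \<circ> g)"
      by (rule compat_cong) (simp_all add: row)
    then show ?thesis unfolding compat_permute[OF p] .
  qed
  let ?F = "\<lambda>X. {f\<in>words n (r i) (\<nu> i). compat {1..n} l T (tabloid_row (part_list l) X) f}"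
  have gg: "h \<circ> pinv g \<circ> g = h" "h \<circ> g \<circ> pinv g = h" for h :: "nat \<Rightarrow> nat"
    using permutes_inv_o[OF p] by (simp_all add: o_assoc[symmetric])
  have "\<theta> i l T (tabloid_act (part_list l) g X) = (\<Sum>f\<in>?F X. single (i, f \<circ> g) 1)"
    unfolding \<theta>_def
  proof (rule sum.reindex_bij_witness[of _ "\<lambda>f. f \<circ> g" "\<lambda>f. f \<circ> pinv g"])
    fix f assume "f \<in> ?F (tabloid_act (part_list l) g X)"
    then show "f \<circ> pinv g \<in> ?F X"
      using c[of "f \<circ> pinv g"] gg(1)[of f] words_closed[OF _ permutes_inv[OF p]] by simp
  next
    fix f assume "f \<in> ?F X"
    then show "f \<circ> g \<in> ?F (tabloid_act (part_list l) g X)" using c words_closed[OF _ p] by simp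
  qed (simp_all add: gg)
  also have "\<dots> = conv actZ (single g 1) (\<theta> i l T X)"
    unfolding \<theta>_def conv_single_left by (simp add: lin_sum actZ_def)
  finally show ?thesis .
qed

text \<open>The column antisymmetrization of the word that \<open>S\<close> induces on
  \<open>t\<close>; through \<open>pr\<close> it serves as a test functional on words.\<close>

definition ell :: "nat \<Rightarrow> (nat \<Rightarrow> nat) \<Rightarrow> (nat \<times> nat \<Rightarrow> nat) \<Rightarrow> (nat \<times> nat \<Rightarrow> nat) \<Rightarrow> nat \<times> (nat \<Rightarrow> nat) \<Rightarrow>\<^sub>0 'k" where
  "ell i l S t = (\<Sum>\<sigma>\<in>col_stab {1..n} (tcol (part_list l) t).
     single (i, tab_word n (part_list l) S t \<circ> \<sigma>) (of_int (sign \<sigma>)))"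

lemma tab_word_words:
  assumes l: "l \<in> Par n" and S: "S \<in> sst q \<kappa> l" and t: "t \<in> tableaux (part_list l)"
  shows "tab_word n (part_list l) S t \<in> words n q \<kappa>"
proof -
  have n: "sum_list (part_list l) = n" using is_partition_part_list[OF l] by (simp add: is_partition_def)
  have pf: "part_fun (part_list l) = l" using l by (simp add: Par_def part_fun_part_list)
  have it: "is_tab {1..n} l (trow (part_list l) t) (tcol (part_list l) t)"
    using is_tab_tableau[OF n t] by (simp add: pf)
  then have b: "bij_betw (\<lambda>a. (trow (part_list l) t a, tcol (part_list l) t a)) {1..n} (diag l)"
    by (simp add: is_tab_def)
  have "card {b\<in>{1..n}. tab_word n (part_list l) S t b = a} = \<kappa> a" if "a < q" for a
  proof -
    have "{b\<in>{1..n}. tab_word n (part_list l) S t b = a} = {b\<in>{1..n}. S (trow (part_list l) t b, tcol (part_list l) t b) = a}"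
      by (auto simp: tab_word_def)
    also have "card \<dots> = card {x\<in>diag l. S x = a}"
      by (rule bij_betw_same_card[OF bij_betw_restrict_pred[OF b]])
    finally show ?thesis using S that by (simp add: sst_def)
  qed
  moreover have "tab_word n (part_list l) S t b < q" if "b \<in> {1..n}" for b
    using bij_betwE[OF b] that S by (auto simp: tab_word_def sst_def)
  ultimately show ?thesis unfolding words_def by (auto simp: tab_word_def)
qed

lemma pr_ell_theta:
  assumes l: "l \<in> Par n" and S: "S \<in> sst (r i) (\<nu> i) l" and t: "t \<in> tableaux (part_list l)"
  shows "pr (ell i l S t) (\<theta> i' l' T X) = (if i = i' then of_int (row_col_sum {1..n} l' T
    (tabloid_row (part_list l') X) (tcol (part_list l) t) (tab_word n (part_list l) S t)) else 0)"
proof -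
  have "pr (ell i l S t) (\<theta> i' l' T X) = (\<Sum>\<sigma>\<in>col_stab {1..n} (tcol (part_list l) t).
      of_int (sign \<sigma>) * lookup (\<theta> i' l' T X) (i, tab_word n (part_list l) S t \<circ> \<sigma>))"
    by (simp add: ell_def pr_sum_left)
  also have "\<dots> = (\<Sum>\<sigma>\<in>col_stab {1..n} (tcol (part_list l) t).
      of_int (sign \<sigma> * (if i = i' \<and> compat {1..n} l' T (tabloid_row (part_list l') X) (tab_word n (part_list l) S t \<circ> \<sigma>) then 1 else 0)))"
  proof (intro sum.cong refl)
    fix \<sigma> assume "\<sigma> \<in> col_stab {1..n} (tcol (part_list l) t)"
    then have "tab_word n (part_list l) S t \<circ> \<sigma> \<in> words n (r i) (\<nu> i)"
      using words_closed[OF tab_word_words[OF l S t]] by (simp add: col_stab_def)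
    then show "of_int (sign \<sigma>) * lookup (\<theta> i' l' T X) (i, tab_word n (part_list l) S t \<circ> \<sigma>) =
      of_int (sign \<sigma> * (if i = i' \<and> compat {1..n} l' T (tabloid_row (part_list l') X) (tab_word n (part_list l) S t \<circ> \<sigma>) then 1 else 0))"
      by (simp add: lookup_theta)
  qed
  also have "\<dots> = (if i = i' then of_int (row_col_sum {1..n} l' T
    (tabloid_row (part_list l') X) (tcol (part_list l) t) (tab_word n (part_list l) S t)) else 0)"
    by (simp only: row_col_sum_def of_int_sum) (auto intro: sum.neutral)
  finally show ?thesis .
qed

lemma tab_facts:
  assumes l: "l \<in> Par n" and t: "t \<in> tableaux (part_list l)"
  shows "is_tab {1..n} l (trow (part_list l) t) (tcol (part_list l) t)"
    "is_tab {1..n} l (tabloid_row (part_list l) (tabloid (part_list l) t)) (tcol (part_list l) t)"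
proof -
  have n: "sum_list (part_list l) = n" using is_partition_part_list[OF l] by (simp add: is_partition_def)
  have pf: "part_fun (part_list l) = l" using l by (simp add: Par_def part_fun_part_list)
  show 1: "is_tab {1..n} l (trow (part_list l) t) (tcol (part_list l) t)"
    using is_tab_tableau[OF n t] by (simp add: pf)
  show "is_tab {1..n} l (tabloid_row (part_list l) (tabloid (part_list l) t)) (tcol (part_list l) t)"
    using 1 unfolding is_tab_def
    by (rule bij_betw_cong[THEN iffD1, rotated]) (simp add: tabloid_row[OF n t])
qed

text \<open>The factor of \<open>row_col_sum_same_shape\<close> that belongs to \<open>S\<close> is
  1. What remains is the coefficient of \<open>X\<close> in the polytabloid of \<open>t\<close>, so
  this functional tests images under \<theta> exactly as the polytabloid tests vectors of the
  tabloid module.\<close>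

lemma pr_ell_theta_same:
  assumes l: "l \<in> Par n" and S: "S \<in> sst (r i) (\<nu> i) l" and t: "t \<in> tableaux (part_list l)"
    and X: "X \<in> tabloids (part_list l)"
  shows "pr (ell i l S t) (\<theta> i l S X) =
    of_int (tabloid_sum {1..n} (tabloid_row (part_list l) X) (trow (part_list l) t) (tcol (part_list l) t))"
proof -
  have p: "ptn l" using l by (simp add: Par_def)
  obtain s where s: "s \<in> tableaux (part_list l)" "X = tabloid (part_list l) s" using X by (auto simp: tabloids_def)
  note it = tab_facts(1)[OF l t] and is' = tab_facts(2)[OF l s(1), folded s(2)]
  have "row_col_sum {1..n} l S (trow (part_list l) t) (tcol (part_list l) t) (tab_word n (part_list l) S t) = 1"
    by (rule row_col_sum_diag(1)[OF _ it S p]) (auto simp: tab_word_def)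
  then show ?thesis
    unfolding pr_ell_theta[OF l S t] using row_col_sum_same_shape[OF _ p is' it] by simp
qed

text \<open>Different summands \<open>i\<close> are orthogonal, different shapes are excluded by
  their row sums, and for equal shapes the order of the keys gives the vanishing case of
  \<open>row_col_sum_diag\<close>.\<close>

lemma pr_ell_theta_before:
  assumes l: "l \<in> Par n" and S: "S \<in> sst (r i) (\<nu> i) l" and t: "t \<in> tableaux (part_list l)"
    and l': "l' \<in> Par n" and T: "T \<in> sst (r i') (\<nu> i') l'" and X: "X \<in> tabloids (part_list l')"
    and ne: "(i', l', T) \<noteq> (i, l, S)"
    and before: "row_weight l' < row_weight l \<or> row_weight l' = row_weight l \<and> key l S \<le> key l' T"
  shows "pr (ell i l S t) (\<theta> i' l' T X) = 0"
proof (rule ccontr)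
  assume nz: "pr (ell i l S t) (\<theta> i' l' T X) \<noteq> 0"
  have p: "ptn l" "ptn l'" using l l' by (simp_all add: Par_def)
  obtain s where s: "s \<in> tableaux (part_list l')" "X = tabloid (part_list l') s" using X by (auto simp: tabloids_def)
  note it = tab_facts(1)[OF l t] and is' = tab_facts(2)[OF l' s(1), folded s(2)]
  have i: "i = i'" and rc: "row_col_sum {1..n} l' T (tabloid_row (part_list l') X) (tcol (part_list l) t) (tab_word n (part_list l) S t) \<noteq> 0"
    using nz unfolding pr_ell_theta[OF l S t] by (auto split: if_splits)
  note sh = row_col_sum_shape[OF _ p(1) is' it rc]
  have w: "row_weight l' = row_weight l" using sh(1) before by auto
  have ll: "l' = l" using sh(2) w by simp
  have "T \<noteq> S" "key l S \<le> key l T" using ne before i ll by auto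
  then have "row_col_sum {1..n} l T (trow (part_list l) t) (tcol (part_list l) t) (tab_word n (part_list l) S t) = 0"
    using T ll by (intro row_col_sum_diag(2)[OF _ it S p(1)]) (auto simp: tab_word_def)
  then show False using rc row_col_sum_same_shape[OF _ p(1) is'[unfolded ll] it] ll by simp
qed

section \<open>The enumeration of the layers and the filtration\<close>

definition "idx = Sigma I (\<lambda>i. Sigma (Par n) (\<lambda>l. sst (r i) (\<nu> i) l))"

lemma finite_idx: "finite idx"
  unfolding idx_def using fin_I by (intro finite_SigmaI finite_Par finite_sst) (auto simp: Par_def)

lemma card_Z: "card Z \<le> (\<Sum>c\<in>idx. card (sst n (\<lambda>_. 1) (fst (snd c))))"
proof -
  have "card Z = (\<Sum>i\<in>I. card (words n (r i) (\<nu> i)))"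
    unfolding Z_def using fin_I by (simp add: finite_words)
  also have "\<dots> \<le> (\<Sum>i\<in>I. \<Sum>l\<in>Par n. kostka n (\<lambda>_. 1) l * kostka (r i) (\<nu> i) l)"
    by (intro sum_mono card_words_le)
  also have "\<dots> \<le> (\<Sum>i\<in>I. \<Sum>l\<in>Par n. card (sst n (\<lambda>_. 1) l) * card (sst (r i) (\<nu> i) l))"
    by (intro sum_mono mult_mono kostka_le_card_sst) (auto simp: Par_def)
  also have "\<dots> = (\<Sum>i\<in>I. \<Sum>l\<in>Par n. \<Sum>T\<in>sst (r i) (\<nu> i) l. card (sst n (\<lambda>_. 1) l))"
    by (simp add: mult.commute)
  also have "\<dots> = (\<Sum>i\<in>I. \<Sum>c\<in>Sigma (Par n) (\<lambda>l. sst (r i) (\<nu> i) l). card (sst n (\<lambda>_. 1) (fst c)))"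
  proof (intro sum.cong refl)
    fix i
    have "\<forall>l\<in>Par n. finite (sst (r i) (\<nu> i) l)" by (intro ballI finite_sst) (simp add: Par_def)
    then show "(\<Sum>l\<in>Par n. \<Sum>T\<in>sst (r i) (\<nu> i) l. card (sst n (\<lambda>_. 1) l)) =
        (\<Sum>c\<in>Sigma (Par n) (\<lambda>l. sst (r i) (\<nu> i) l). card (sst n (\<lambda>_. 1) (fst c)))"
      by (subst sum.Sigma) (simp_all add: finite_Par split_def)
  qed
  also have "\<dots> = (\<Sum>c\<in>idx. card (sst n (\<lambda>_. 1) (fst (snd c))))"
  proof -
    have "finite (Sigma (Par n) (\<lambda>l. sst (r i) (\<nu> i) l))" for i
      by (intro finite_SigmaI finite_Par finite_sst) (simp add: Par_def)
    then show ?thesis unfolding idx_def by (subst sum.Sigma) (simp_all add: fin_I split_def)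
  qed
  finally show ?thesis .
qed

lemma ordered_enumeration:
  obtains ys where "distinct ys" "set ys = idx"
    "\<And>j k. j < k \<Longrightarrow> k < length ys \<Longrightarrow>
      row_weight (fst (snd (ys ! j))) < row_weight (fst (snd (ys ! k))) \<or>
      row_weight (fst (snd (ys ! j))) = row_weight (fst (snd (ys ! k))) \<and>
      key (fst (snd (ys ! k))) (snd (snd (ys ! k))) \<le> key (fst (snd (ys ! j))) (snd (snd (ys ! j)))"
proof -
  let ?key = "\<lambda>c :: nat \<times> (nat \<Rightarrow> nat) \<times> (nat \<times> nat \<Rightarrow> nat). key (fst (snd c)) (snd (snd c))"
  let ?rw = "\<lambda>c :: nat \<times> (nat \<Rightarrow> nat) \<times> (nat \<times> nat \<Rightarrow> nat). row_weight (fst (snd c))"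
  obtain B where B: "\<And>c. c \<in> idx \<Longrightarrow> ?key c < B"
  proof
    fix c assume "c \<in> idx"
    then show "?key c < Suc (Max (?key ` idx))" using finite_idx by (simp add: less_Suc_eq_le)
  qed
  \<comment> \<open>A lexicographic code: row weight first, then decreasing key. As all keys are
    below \<open>B\<close>, the second summand stays below \<open>B\<close>, the size of one step of
    the first.\<close>
  define ord where "ord c = ?rw c * B + (B - 1 - ?key c)" for c
  obtain xs where xs: "set xs = idx" "distinct xs" using finite_distinct_list[OF finite_idx] by blast
  define ys where "ys = sort_key ord xs"
  have ys: "distinct ys" "set ys = idx" "sorted (map ord ys)" using xs by (simp_all add: ys_def)
  show thesis
  proof (rule that[OF ys(1,2)])
    fix j k assume jk: "j < k" "k < length ys"
    have le: "ord (ys ! j) \<le> ord (ys ! k)" using sorted_nth_mono[OF ys(3), of j k] jk by simp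
    have in': "ys ! j \<in> idx" "ys ! k \<in> idx" using ys(2) jk by (metis nth_mem less_trans)+
    have lt: "?key (ys ! j) < B" "?key (ys ! k) < B" using B in' by blast+
    show "?rw (ys ! j) < ?rw (ys ! k) \<or> ?rw (ys ! j) = ?rw (ys ! k) \<and> ?key (ys ! k) \<le> ?key (ys ! j)"
    proof (cases "?rw (ys ! j)" "?rw (ys ! k)" rule: linorder_cases)
      case greater
      then have "(?rw (ys ! k) + 1) * B \<le> ?rw (ys ! j) * B" by (intro mult_right_mono) auto
      then have "ord (ys ! k) < ord (ys ! j)" unfolding ord_def using lt by (simp add: algebra_simps)
      then show ?thesis using le by simp
    next
      case equal
      then show ?thesis using le lt unfolding ord_def by auto
    qed simp
  qed
qed

theorem has_filtration_words:
  "has_filtration_by (group_algebra (symmetric_group n) :: (_ \<Rightarrow>\<^sub>0 'k) ring) (perm_rep actZ Z) (dual_specht_modules n)"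
proof -
  obtain ys where ys: "distinct ys" "set ys = idx"
    and ord: "\<And>j k. j < k \<Longrightarrow> k < length ys \<Longrightarrow>
      row_weight (fst (snd (ys ! j))) < row_weight (fst (snd (ys ! k))) \<or>
      row_weight (fst (snd (ys ! j))) = row_weight (fst (snd (ys ! k))) \<and>
      key (fst (snd (ys ! k))) (snd (snd (ys ! k))) \<le> key (fst (snd (ys ! j))) (snd (snd (ys ! j)))"
    using ordered_enumeration by blast
  define s where "s = length ys"
  define ii where "ii j = fst (ys ! j)" for j
  define ll where "ll j = fst (snd (ys ! j))" for j
  define TT where "TT j = snd (snd (ys ! j))" for j
  define pl where "pl j = part_list (ll j)" for j
  have ix: "ii j \<in> I" "ll j \<in> Par n" "TT j \<in> sst (r (ii j)) (\<nu> (ii j)) (ll j)" if "j < s" for j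
  proof -
    have "ys ! j \<in> idx" using ys(2) that nth_mem[of j ys] by (simp add: s_def)
    moreover obtain i l T where "ys ! j = (i, l, T)" by (cases "ys ! j")
    ultimately show "ii j \<in> I" "ll j \<in> Par n" "TT j \<in> sst (r (ii j)) (\<nu> (ii j)) (ll j)"
      by (simp_all add: idx_def ii_def ll_def TT_def)
  qed
  have ne: "(ii j, ll j, TT j) \<noteq> (ii k, ll k, TT k)" if "j < k" "k < s" for j k
    using that nth_eq_iff_index_eq[OF ys(1), of j k] by (auto simp: s_def ii_def ll_def TT_def prod_eq_iff)
  have part: "partition_shape (pl j) n" if "j < s" for j
    using is_partition_part_list[OF ix(2)[OF that]] by (simp add: partition_shape_def pl_def)
  have pf: "part_fun (pl j) = ll j" if "j < s" for j
    using ix(2)[OF that] by (simp add: pl_def Par_def part_fun_part_list)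
  have pt: "ptn (ll j)" if "j < s" for j using ix(2)[OF that] by (simp add: Par_def)
  let ?U = "\<lambda>j. tabloids (pl j)" and ?th = "\<lambda>j. \<theta> (ii j) (ll j) (TT j)"
  let ?D = "\<lambda>j. partition_shape.specht_perp (pl j) :: ((nat \<times> nat \<Rightarrow> nat) set \<Rightarrow>\<^sub>0 'k) set"
  let ?W = "\<lambda>j. sst n (\<lambda>_. 1) (ll j)"
  \<comment> \<open>Tabloids of standard tableaux; by \<open>std_independent\<close> they stay
    independent modulo the complement of the Specht module.\<close>
  let ?u = "\<lambda>j w. single (tabloid (pl j) (partition_shape.std_tab (pl j) w)) (1::'k)"
  interpret L: layered "symmetric_group n" actZ Z s "\<lambda>j. tabloid_act (pl j)" ?U ?th ?D ?W ?u
  proof (intro layered.intro Z.group_set_axioms layered_axioms.intro finite_Z)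
    fix j assume j: "j < s"
    interpret P: partition_shape "pl j" n "TYPE('k)" by (rule part[OF j])
    show "group_set (symmetric_group n) (tabloid_act (pl j)) (?U j)" by (rule P.group_set_axioms)
    show "keys (?th j y) \<subseteq> Z" for y by (rule keys_theta[OF ix(1)[OF j]])
    show "?th j (tabloid_act (pl j) g y) = conv actZ (single g 1) (?th j y)"
      if "g \<in> carrier (symmetric_group n)" "y \<in> ?U j" for g y
      using theta_act[OF ix(2)[OF j] that(1)] that(2) by (simp add: pl_def)
    show "m - m' \<in> ?D j" if "m \<in> ?D j" "m' \<in> ?D j" for m m'
      using that keys_diff[of m m'] unfolding P.specht_perp_def by (auto simp: pr_diff_left)
    show "finite (?W j)" by (rule finite_sst[OF pt[OF j]])
    show "keys (?u j w) \<subseteq> ?U j" if "w \<in> ?W j" for w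
      using P.std_tab(1)[of w] that by (simp add: pf[OF j] tabloids_def)
    show "c w = 0" if "(\<Sum>w\<in>?W j. scl (c w) (?u j w)) \<in> ?D j" "w \<in> ?W j" for c w
      using P.std_independent[of c w] that pt[OF j] by (simp add: pf[OF j])
  next
    have "card Z \<le> (\<Sum>c\<in>idx. card (sst n (\<lambda>_. 1) (fst (snd c))))" by (rule card_Z)
    also have "\<dots> = (\<Sum>j<s. card (?W j))"
      using sum.reindex_bij_betw[OF bij_betw_nth[OF ys(1) _ ys(2)[symmetric], of "{..<s}"],
         of "\<lambda>c. card (sst n (\<lambda>_. 1) (fst (snd c)))"] by (simp add: s_def ll_def)
    finally show "card Z \<le> (\<Sum>j<s. card (?W j))" .
  qed
  \<comment> \<open>The vectors with this property form a stable set, so by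
    \<open>specht_perpI\<close> orthogonality to polytabloids is enough. It follows by pairing with
    \<open>ell\<close>, which annihilates all earlier images.\<close>
  have tri: "m \<in> ?D j" if j: "j < s" and m: "keys m \<subseteq> ?U j" "lin (?th j) m \<in> L.N j" for j m
  proof -
    interpret P: partition_shape "pl j" n "TYPE('k)" by (rule part[OF j])
    let ?K = "{m. keys m \<subseteq> ?U j \<and> lin (?th j) m \<in> L.N j}"
    have "?K \<subseteq> P.specht_perp"
    proof (rule P.specht_perpI)
      fix m and a :: "(nat \<Rightarrow> nat) \<Rightarrow>\<^sub>0 'k" assume m: "m \<in> ?K" and a: "keys a \<subseteq> carrier (symmetric_group n)"
      have "lin (?th j) (conv (tabloid_act (pl j)) a m) = conv actZ a (lin (?th j) m)"
        using m a L.theta_act[OF j] by (intro lin_conv) (auto simp: subset_eq)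
      also have "\<dots> \<in> L.N j" using m a j by (intro L.N_conv) auto
      finally show "conv (tabloid_act (pl j)) a m \<in> ?K" using P.keys_conv_act[OF a] m by simp
    next
      fix m t assume m: "m \<in> ?K" and t: "t \<in> tableaux (pl j)"
      let ?e = "ell (ii j) (ll j) (TT j) t"
      have t': "t \<in> tableaux (part_list (ll j))" using t by (simp add: pl_def)
      note S = ix(2,3)[OF j]
      have pe: "pr ?e (lin u m') = (\<Sum>X\<in>keys m'. lookup m' X * pr ?e (u X))" for u and m' :: "(nat \<times> nat \<Rightarrow> nat) set \<Rightarrow>\<^sub>0 'k"
        using pr_lin_left[of u m' ?e] by (simp add: pr_commute)
      obtain mm where mm: "\<forall>k<j. keys (mm k) \<subseteq> ?U k" "lin (?th j) m = (\<Sum>k<j. lin (?th k) (mm k))"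
        using m unfolding L.N_def by blast
      have z: "pr ?e (lin (?th k) (mm k)) = 0" if k: "k < j" for k
      proof -
        have "pr ?e (?th k X) = 0" if "X \<in> keys (mm k)" for X
        proof (rule pr_ell_theta_before[OF S t'])
          have ks: "k < s" using k j by simp
          show "ll k \<in> Par n" "TT k \<in> sst (r (ii k)) (\<nu> (ii k)) (ll k)" using ix[OF ks] by auto
          show "X \<in> tabloids (part_list (ll k))" using mm(1) k that by (auto simp: pl_def)
          show "(ii k, ll k, TT k) \<noteq> (ii j, ll j, TT j)" by (rule ne[OF k j])
          show "row_weight (ll k) < row_weight (ll j) \<or>
             row_weight (ll k) = row_weight (ll j) \<and> key (ll j) (TT j) \<le> key (ll k) (TT k)"
            using ord[OF k] j by (simp add: s_def ll_def TT_def)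
        qed
        then show ?thesis unfolding pe by (intro sum.neutral) simp
      qed
      have "0 = pr ?e (lin (?th j) m)" unfolding mm(2) pr_sum_right by (rule sym, rule sum.neutral) (simp add: z)
      also have "\<dots> = (\<Sum>X\<in>keys m. lookup m X *
         of_int (tabloid_sum {1..n} (tabloid_row (pl j) X) (trow (pl j) t) (tcol (pl j) t)))"
        unfolding pe
      proof (intro sum.cong refl arg_cong2[where f="(*)"])
        fix X assume "X \<in> keys m"
        then have "X \<in> tabloids (part_list (ll j))" using m by (auto simp: pl_def)
        from pr_ell_theta_same[OF S t' this]
        show "pr ?e (?th j X) = of_int (tabloid_sum {1..n} (tabloid_row (pl j) X) (trow (pl j) t) (tcol (pl j) t))"
          by (simp add: pl_def)
      qed
      also have "\<dots> = pr m (polytabloid (pl j) t)"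
        using m by (intro P.pr_polytabloid[OF t, symmetric]) simp
      finally show "pr m (polytabloid (pl j) t) = 0" by simp
    qed simp
    then show ?thesis using m by blast
  qed
  interpret LT: layered_triangular "symmetric_group n" actZ Z s "\<lambda>j. tabloid_act (pl j)" ?U ?th ?D ?W ?u
    by (intro layered_triangular.intro L.layered_axioms layered_triangular_axioms.intro tri)
  show ?thesis
  proof (rule LT.has_filtration)
    fix j assume j: "j < s"
    interpret P: partition_shape "pl j" n "TYPE('k)" by (rule part[OF j])
    have "module_isomorphic (group_algebra (symmetric_group n))
       (quotient_module ((perm_rep actZ Z)\<lparr>carrier := L.N (Suc j)\<rparr>) (L.N j)) P.dual"
    proof (rule LT.layer_iso[OF j, where B=P.to_dual])
      show "P.to_dual ` {m. keys m \<subseteq> ?U j} = carrier P.dual" by (rule P.to_dual_image)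
    qed (auto simp: P.to_dual_add P.to_dual_zero P.to_dual_conv P.to_dual_eq)
    then show "\<exists>C\<in>dual_specht_modules n. module_isomorphic (group_algebra (symmetric_group n))
       (quotient_module ((perm_rep actZ Z)\<lparr>carrier := L.N (Suc j)\<rparr>) (L.N j)) C"
      using P.dual_in by blast
  qed
qed

end

section \<open>Partial diagrams and their stabilizers\<close>

text \<open>Bijections between the fibres over each value are glued.\<close>

lemma ex_bij_betw_fibers:
  assumes A: "finite A" and B: "finite B"
    and c: "\<And>c. card {a\<in>A. f a = c} = card {b\<in>B. g b = c}"
  shows "\<exists>h. bij_betw h A B \<and> (\<forall>a\<in>A. g (h a) = f a)"
proof -
  have "\<exists>h. bij_betw h {a\<in>A. f a = c} {b\<in>B. g b = c}" for c
    using c[of c] A B by (intro finite_same_card_bij) auto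
  then obtain h where h: "\<And>c. bij_betw (h c) {a\<in>A. f a = c} {b\<in>B. g b = c}" by metis
  have hh: "h (f a) a \<in> B" "g (h (f a) a) = f a" if "a \<in> A" for a
    using bij_betwE[OF h[of "f a"]] that by auto
  have "bij_betw (\<lambda>a. h (f a) a) A B"
    unfolding bij_betw_def
  proof
    show "inj_on (\<lambda>a. h (f a) a) A"
    proof (rule inj_onI)
      fix a b assume ab: "a \<in> A" "b \<in> A" "h (f a) a = h (f b) b"
      then have "f a = f b" using hh by metis
      then show "a = b" using ab h[of "f a"] by (auto simp: bij_betw_def inj_on_def)
    qed
    show "(\<lambda>a. h (f a) a) ` A = B"
    proof (intro equalityI subsetI)
      fix b assume "b \<in> B"
      then have "b \<in> h (g b) ` {a\<in>A. f a = g b}" using h[of "g b"] by (auto simp: bij_betw_def)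
      then obtain a where "a \<in> A" "f a = g b" "b = h (g b) a" by blast
      then show "b \<in> (\<lambda>a. h (f a) a) ` A" by (intro image_eqI[of _ _ a]) simp_all
    qed (use hh in auto)
  qed
  then show ?thesis using hh by blast
qed

lemma words_transitive:
  assumes f: "f \<in> words n r \<nu>" and g: "g \<in> words n r \<nu>"
  shows "\<exists>\<eta>. \<eta> permutes {1..n} \<and> f = g \<circ> \<eta>"
proof -
  have "card {a\<in>{1..n}. f a = c} = card {b\<in>{1..n}. g b = c}" for c
  proof (cases "c < r")
    case True
    then show ?thesis using f g by (simp add: words_def)
  next
    case False
    then have "{a\<in>{1..n}. f a = c} = {}" "{b\<in>{1..n}. g b = c} = {}" using f g by (auto simp: words_def)
    then show ?thesis by (simp only:)
  qed
  then obtain h where h: "bij_betw h {1..n} {1..n}" "\<forall>a\<in>{1..n}. g (h a) = f a"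
    using ex_bij_betw_fibers[of "{1..n}" "{1..n}" f g] by auto
  let ?\<eta> = "\<lambda>a. if a \<in> {1..n} then h a else a"
  have "bij_betw ?\<eta> {1..n} {1..n}" using h(1) by (rule bij_betw_cong[THEN iffD1, rotated]) simp
  then have "?\<eta> permutes {1..n}" by (rule bij_imp_permutes) auto
  moreover have "f = g \<circ> ?\<eta>" using h(2) f g by (auto simp: words_def)
  ultimately show ?thesis by blast
qed

section \<open>The stabilizer and its action on the labelled parts\<close>

locale diagram =
  fixes l n :: nat and P L :: "nat set set"
  assumes pd: "partial_diagram l n P L"
begin

abbreviation "H \<equiv> diagram_stabilizer l P L"
abbreviation "\<rho> \<equiv> induced_perm L"

lemma part: "partition_on {1..l} P" and LP: "L \<subseteq> P" and cardL: "card L = n"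
  using pd by (simp_all add: partial_diagram_def)

lemma part_props:
  assumes "A \<in> P"
  shows "finite A" "A \<noteq> {}" "A \<subseteq> {1..l}"
proof -
  show s: "A \<subseteq> {1..l}" using part assms by (auto simp: partition_on_def)
  show "finite A" by (rule finite_subset[OF s]) simp
  show "A \<noteq> {}" using part assms by (auto simp: partition_on_def)
qed

lemma disj: "A \<in> P \<Longrightarrow> B \<in> P \<Longrightarrow> x \<in> A \<Longrightarrow> x \<in> B \<Longrightarrow> A = B"
  using part unfolding partition_on_def disjoint_def by blast

lemma finite_L: "finite L"
proof -
  have "\<Union>P = {1..l}" using part by (simp add: partition_on_def)
  then have "finite P" by (intro finite_UnionD) simp
  then show ?thesis using LP finite_subset by blast
qed

lemma Min_inj: "A \<in> L \<Longrightarrow> B \<in> L \<Longrightarrow> Min A = Min B \<Longrightarrow> A = B"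
proof -
  assume A: "A \<in> L" and B: "B \<in> L" and eq: "Min A = Min B"
  then have P: "A \<in> P" "B \<in> P" using LP by auto
  have "Min A \<in> A" "Min B \<in> B" using part_props(1,2)[OF P(1)] part_props(1,2)[OF P(2)] by (auto intro: Min_in)
  then show "A = B" using disj[OF P, of "Min A"] eq by simp
qed

text \<open>Distinct labelled parts have distinct minima, so the rank of the minimum is injective
  and takes n values in {1..n}.\<close>

lemma part_number_bij: "bij_betw (part_number L) L {1..n}"
proof -
  have lt: "part_number L A < part_number L B" if "A \<in> L" "B \<in> L" "Min A < Min B" for A B
    unfolding part_number_def
  proof (rule psubset_card_mono)
    have "B \<in> {C\<in>L. Min C \<le> Min B}" "B \<notin> {C\<in>L. Min C \<le> Min A}" using that by auto
    moreover have "{C\<in>L. Min C \<le> Min A} \<subseteq> {C\<in>L. Min C \<le> Min B}" using that by auto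
    ultimately show "{C\<in>L. Min C \<le> Min A} \<subset> {C\<in>L. Min C \<le> Min B}" by blast
  qed (use finite_L in simp)
  have inj: "inj_on (part_number L) L"
  proof (rule inj_onI)
    fix A B assume AB: "A \<in> L" "B \<in> L" "part_number L A = part_number L B"
    then have "Min A = Min B" using lt[of A B] lt[of B A] by (cases "Min A" "Min B" rule: linorder_cases) auto
    then show "A = B" using AB Min_inj by blast
  qed
  have "part_number L A \<in> {1..n}" if "A \<in> L" for A
  proof -
    have "card {B\<in>L. Min B \<le> Min A} \<le> n" unfolding cardL[symmetric] using finite_L by (intro card_mono) auto
    moreover have "card {B\<in>L. Min B \<le> Min A} > 0" using that finite_L by (subst card_gt_0_iff) auto
    ultimately show ?thesis unfolding part_number_def by simp
  qed
  then have "part_number L ` L \<subseteq> {1..n}" by blast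
  moreover have "card (part_number L ` L) = card {1..n}" using card_image[OF inj] cardL by simp
  ultimately have "part_number L ` L = {1..n}" by (intro card_subset_eq) auto
  then show ?thesis using inj by (simp add: bij_betw_def)
qed

lemma labelled_part_number: "A \<in> L \<Longrightarrow> labelled_part L (part_number L A) = A"
  unfolding labelled_part_def using part_number_bij by (intro the_equality) (auto simp: bij_betw_def inj_on_def)

lemma labelled_part: "j \<in> {1..n} \<Longrightarrow> labelled_part L j \<in> L" "j \<in> {1..n} \<Longrightarrow> part_number L (labelled_part L j) = j"
proof -
  assume "j \<in> {1..n}"
  then have "j \<in> part_number L ` L" using part_number_bij by (simp add: bij_betw_def)
  then obtain A where "A \<in> L" "j = part_number L A" by blast
  then show "labelled_part L j \<in> L" "part_number L (labelled_part L j) = j" by (simp_all add: labelled_part_number)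
qed

lemma H_D: "h \<in> H \<Longrightarrow> h permutes {1..l}" "h \<in> H \<Longrightarrow> A \<in> L \<Longrightarrow> h ` A \<in> L"
  by (auto simp: diagram_stabilizer_def)

lemma induced_perm_eq: "\<rho> h j = (if j \<in> {1..n} then part_number L (h ` labelled_part L j) else j)"
  by (simp add: induced_perm_def cardL)

lemma labelled_part_rho: "h \<in> H \<Longrightarrow> j \<in> {1..n} \<Longrightarrow> labelled_part L (\<rho> h j) = h ` labelled_part L j"
  by (simp add: induced_perm_eq labelled_part_number H_D labelled_part)

lemma rho_in: "h \<in> H \<Longrightarrow> j \<in> {1..n} \<Longrightarrow> \<rho> h j \<in> {1..n}"
  using bij_betwE[OF part_number_bij] H_D(2) labelled_part(1) by (auto simp: induced_perm_eq)

lemma H_comp: "h \<in> H \<Longrightarrow> k \<in> H \<Longrightarrow> h \<circ> k \<in> H"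
  unfolding diagram_stabilizer_def
  by (simp add: permutes_compose image_comp[symmetric] image_image[symmetric])

lemma H_id: "id \<in> H"
  by (simp add: diagram_stabilizer_def permutes_id)

lemma H_inv:
  assumes "h \<in> H"
  shows "pinv h \<in> H"
proof -
  have p: "h permutes {1..l}" by (rule H_D(1)[OF assms])
  have "(\<lambda>A. pinv h ` A) ` (\<lambda>A. h ` A) ` S = S" for S
    by (simp add: image_image permutes_inverses[OF p])
  then have "(\<lambda>A. pinv h ` A) ` S = S" if "(\<lambda>A. h ` A) ` S = S" for S
    using that by metis
  then show ?thesis using assms permutes_inv[OF p] by (simp add: diagram_stabilizer_def)
qed

lemma rho_comp: "h \<in> H \<Longrightarrow> k \<in> H \<Longrightarrow> \<rho> (h \<circ> k) = \<rho> h \<circ> \<rho> k"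
proof
  fix j assume h: "h \<in> H" and k: "k \<in> H"
  show "\<rho> (h \<circ> k) j = (\<rho> h \<circ> \<rho> k) j"
  proof (cases "j \<in> {1..n}")
    case True
    then show ?thesis
      using rho_in[OF k True] labelled_part_rho[OF k True]
      by (simp add: induced_perm_eq[of "h \<circ> k"] induced_perm_eq[of h] image_comp)
  qed (auto simp: induced_perm_eq)
qed

lemma rho_id: "\<rho> id = id"
  by (auto simp: induced_perm_eq labelled_part fun_eq_iff)

lemma rho_permutes:
  assumes "h \<in> H"
  shows "\<rho> h permutes {1..n}"
proof -
  have "\<rho> (pinv h) \<circ> \<rho> h = id" "\<rho> h \<circ> \<rho> (pinv h) = id"
    using rho_comp[OF H_inv[OF assms] assms] rho_comp[OF assms H_inv[OF assms]]
      permutes_inv_o[OF H_D(1)[OF assms]] rho_id by simp_all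
  then have "bij (\<rho> h)" by (rule o_bij)
  then have "inj_on (\<rho> h) {1..n}" by (meson bij_is_inj inj_on_subset subset_UNIV)
  moreover have "\<rho> h ` {1..n} \<subseteq> {1..n}" using rho_in[OF assms] by blast
  ultimately have "bij_betw (\<rho> h) {1..n} {1..n}" by (simp add: bij_betw_def endo_inj_surj)
  then show ?thesis by (rule bij_imp_permutes) (auto simp: induced_perm_eq)
qed

lemma rho_inv: "h \<in> H \<Longrightarrow> \<rho> (pinv h) = pinv (\<rho> h)"
proof -
  assume h: "h \<in> H"
  have "\<rho> (pinv h) \<circ> \<rho> h = id"
    using rho_comp[OF H_inv[OF h] h] permutes_inv_o[OF H_D(1)[OF h]] rho_id by simp
  then show ?thesis using permutes_inv_o[OF rho_permutes[OF h]] by (metis comp_assoc comp_id id_comp)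
qed

lemma H_subgroup: "subgroup H (symmetric_group l)"
proof
  show "inv\<^bsub>symmetric_group l\<^esub> h \<in> H" if "h \<in> H" for h
    using H_inv[OF that] H_D(1)[OF that] by (simp add: inv_symmetric_group)
  show "H \<subseteq> carrier (symmetric_group l)" using H_D(1) unfolding symmetric_group_simps by blast
qed (simp_all add: symmetric_group_simps H_comp H_id)

text \<open>The word \<open>\<tau>\<close> numbers the colour types of the labelled parts for the colouring \<open>\<chi>\<close> of the dots.
  Thus \<open>\<rho> (H \<inter> Stab \<chi>) = Stab \<tau>\<close>: a permutation of the labelled parts preserving colour types is
  realized by colour-preserving bijections between the parts.\<close>

lemma type_word:
  fixes \<chi> :: "nat \<Rightarrow> nat"
  shows "\<exists>\<tau> r. (\<forall>b. b \<notin> {1..n} \<longrightarrow> \<tau> b = 0) \<and> (\<forall>b\<in>{1..n}. \<tau> b < (r::nat)) \<and>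
    \<rho> ` {h\<in>H. \<chi> \<circ> h = \<chi>} = {\<eta>. \<eta> permutes {1..n} \<and> \<tau> \<circ> \<eta> = \<tau>}"
proof -
  \<comment> \<open>The colour type of a part: how many of its dots have each colour.\<close>
  define ct where "ct A c = card {x\<in>A. \<chi> x = c}" for A c
  have "finite (ct ` L)" using finite_L by simp
  \<comment> \<open>Only finitely many types occur, so they can be numbered below some
    \<open>r\<close>; these numbers become the letters of \<tau>.\<close>
  then obtain code r where code: "code ` ct ` L = {i::nat. i < r}" "inj_on code (ct ` L)"
    using finite_imp_inj_to_nat_seg by metis
  define \<tau> where "\<tau> b = (if b \<in> {1..n} then code (ct (labelled_part L b)) else 0)" for b
  have "\<tau> b < r" if "b \<in> {1..n}" for b
    using code(1) labelled_part(1)[OF that] that by (auto simp: \<tau>_def)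
  moreover have "\<rho> ` {h\<in>H. \<chi> \<circ> h = \<chi>} = {\<eta>. \<eta> permutes {1..n} \<and> \<tau> \<circ> \<eta> = \<tau>}"
  proof (intro equalityI subsetI)
    fix \<eta> assume "\<eta> \<in> \<rho> ` {h\<in>H. \<chi> \<circ> h = \<chi>}"
    then obtain h where h: "h \<in> H" "\<chi> \<circ> h = \<chi>" "\<eta> = \<rho> h" by auto
    have inj: "inj_on h A" for A using permutes_inj[OF H_D(1)[OF h(1)]] by (rule inj_on_subset) simp
    have "ct (h ` A) = ct A" for A
    proof
      fix c
      have "{x\<in>h ` A. \<chi> x = c} = h ` {x\<in>A. \<chi> x = c}" using h(2) by (auto simp: fun_eq_iff)
      then show "ct (h ` A) c = ct A c" unfolding ct_def by (simp add: card_image[OF inj])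
    qed
    then have "\<tau> (\<eta> j) = \<tau> j" for j
      using rho_in[OF h(1), of j] labelled_part_rho[OF h(1), of j]
      by (cases "j \<in> {1..n}") (auto simp: \<tau>_def h(3) induced_perm_eq[of h j])
    then show "\<eta> \<in> {\<eta>. \<eta> permutes {1..n} \<and> \<tau> \<circ> \<eta> = \<tau>}"
      using rho_permutes[OF h(1)] by (auto simp: h(3))
  next
    fix \<eta> assume "\<eta> \<in> {\<eta>. \<eta> permutes {1..n} \<and> \<tau> \<circ> \<eta> = \<tau>}"
    then have e: "\<eta> permutes {1..n}" "\<And>j. \<tau> (\<eta> j) = \<tau> j" by (auto simp: fun_eq_iff)
    let ?p = "labelled_part L"
    have ein: "\<eta> j \<in> {1..n}" if "j \<in> {1..n}" for j using permutes_in_image[OF e(1)] that by blast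
    have pin: "?p j \<in> L" "?p j \<in> P" if "j \<in> {1..n}" for j using labelled_part(1)[OF that] LP by auto
    \<comment> \<open>As \<eta> preserves \<tau>, the parts numbered \<open>j\<close> and
      \<open>\<eta> j\<close> have the same type and admit a colour-preserving bijection.\<close>
    have "\<exists>k. bij_betw k (?p j) (?p (\<eta> j)) \<and> (\<forall>x\<in>?p j. \<chi> (k x) = \<chi> x)" if j: "j \<in> {1..n}" for j
    proof (rule ex_bij_betw_fibers)
      have "code (ct (?p j)) = code (ct (?p (\<eta> j)))" using e(2)[of j] j ein[OF j] by (simp add: \<tau>_def)
      then have "ct (?p j) = ct (?p (\<eta> j))" using code(2) pin(1)[OF j] pin(1)[OF ein[OF j]] by (auto simp: inj_on_def)
      then show "card {a\<in>?p j. \<chi> a = c} = card {a\<in>?p (\<eta> j). \<chi> a = c}" for c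
        unfolding ct_def by (rule fun_cong)
    qed (use part_props(1) pin(2) j ein in auto)
    then obtain k where k: "\<And>j. j \<in> {1..n} \<Longrightarrow> bij_betw (k j) (?p j) (?p (\<eta> j))"
      "\<And>j x. j \<in> {1..n} \<Longrightarrow> x \<in> ?p j \<Longrightarrow> \<chi> (k j x) = \<chi> x" by metis
    define idx where "idx x = (THE j. j \<in> {1..n} \<and> x \<in> ?p j)" for x
    have idx: "idx x = j" if "j \<in> {1..n}" "x \<in> ?p j" for x j
      unfolding idx_def
    proof (rule the_equality)
      fix i assume i: "i \<in> {1..n} \<and> x \<in> ?p i"
      then have "?p i = ?p j" using disj[of "?p i" "?p j" x] pin that by blast
      then show "i = j" using labelled_part(2) i that(1) by metis
    qed (use that in simp)
    \<comment> \<open>The bijections glue to a permutation of the dots. It fixes all dots outside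
      the labelled parts, so it stabilizes the unlabelled parts as well.\<close>
    define h where "h x = (if x \<in> \<Union>L then k (idx x) x else x)" for x
    have cov: "\<exists>j\<in>{1..n}. x \<in> ?p j" if "x \<in> \<Union>L" for x
      using that bij_betwE[OF part_number_bij] labelled_part_number by (metis UnionE)
    have hj: "h x = k j x" "h x \<in> ?p (\<eta> j)" if "j \<in> {1..n}" "x \<in> ?p j" for x j
    proof -
      have "x \<in> \<Union>L" using pin(1)[OF that(1)] that(2) by blast
      then show "h x = k j x" using idx[OF that] by (simp add: h_def)
      then show "h x \<in> ?p (\<eta> j)" using bij_betwE[OF k(1)[OF that(1)]] that(2) by simp
    qed
    have him: "h ` ?p j = ?p (\<eta> j)" if "j \<in> {1..n}" for j
    proof -
      have "h ` ?p j = k j ` ?p j" using hj(1)[OF that] by (intro image_cong) auto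
      then show ?thesis using k(1)[OF that] by (simp add: bij_betw_def)
    qed
    have UL: "\<Union>L \<subseteq> {1..l}" "finite (\<Union>L)" using part_props LP finite_L by blast+
    have "inj_on h (\<Union>L)"
    proof (rule inj_onI)
      fix x y assume x: "x \<in> \<Union>L" and y: "y \<in> \<Union>L" and eq: "h x = h y"
      obtain i j where i: "i \<in> {1..n}" "x \<in> ?p i" and j: "j \<in> {1..n}" "y \<in> ?p j" using cov x y by blast
      have "h x \<in> ?p (\<eta> i)" "h x \<in> ?p (\<eta> j)" using hj(2)[OF i] hj(2)[OF j] eq by auto
      then have "\<eta> i = \<eta> j" using idx[OF ein[OF i(1)]] idx[OF ein[OF j(1)]] by metis
      then have "i = j" using permutes_inj[OF e(1)] by (auto dest: injD)
      then show "x = y" using hj(1)[OF i] hj(1)[OF j] eq k(1)[OF i(1)] i(2) j(2) by (auto simp: bij_betw_def inj_on_def)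
    qed
    moreover have "h ` \<Union>L \<subseteq> \<Union>L"
    proof
      fix y assume "y \<in> h ` \<Union>L"
      then obtain j x where "j \<in> {1..n}" "x \<in> ?p j" "y = h x" using cov by blast
      then show "y \<in> \<Union>L" using hj(2) pin(1)[OF ein] by blast
    qed
    ultimately have "bij_betw h (\<Union>L) (\<Union>L)" using endo_inj_surj[OF UL(2)] by (simp add: bij_betw_def)
    then have "h permutes \<Union>L" by (rule bij_imp_permutes) (simp add: h_def)
    then have hp: "h permutes {1..l}" using UL(1) by (rule permutes_subset)
    have imL: "(\<lambda>A. h ` A) ` L = L"
    proof (intro endo_inj_surj[OF finite_L])
      show "(\<lambda>A. h ` A) ` L \<subseteq> L"
      proof clarify
        fix A assume A: "A \<in> L"
        have j: "part_number L A \<in> {1..n}" using bij_betwE[OF part_number_bij] A by blast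
        show "h ` A \<in> L" using him[OF j] pin(1)[OF ein[OF j]] by (simp add: labelled_part_number[OF A])
      qed
      show "inj_on (\<lambda>A. h ` A) L" using permutes_inj[OF hp] by (simp add: inj_on_def inj_image_eq_iff)
    qed
    have "h ` A = A" if "A \<in> P - L" for A
    proof -
      have "h x = x" if "x \<in> A" for x
        using disj[of A _ x] that \<open>A \<in> P - L\<close> LP by (auto simp: h_def)
      then show ?thesis by simp
    qed
    then have "(\<lambda>A. h ` A) ` (P - L) = P - L" by simp
    then have hH: "h \<in> H" using hp imL by (simp add: diagram_stabilizer_def)
    have "\<chi> (h x) = \<chi> x" for x
    proof (cases "x \<in> \<Union>L")
      case True
      then obtain j where "j \<in> {1..n}" "x \<in> ?p j" using cov by blast
      then show ?thesis using hj(1) k(2) by simp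
    qed (auto simp: h_def)
    moreover have "\<rho> h = \<eta>"
    proof
      fix j
      show "\<rho> h j = \<eta> j"
        using him[of j] labelled_part(2)[OF ein, of j] permutes_not_in[OF e(1), of j]
        by (auto simp: induced_perm_eq)
    qed
    ultimately show "\<eta> \<in> \<rho> ` {h\<in>H. \<chi> \<circ> h = \<chi>}" using hH by (intro image_eqI[of _ _ h]) auto
  qed
  ultimately show ?thesis by (intro exI[of _ \<tau>] exI[of _ r]) (simp add: \<tau>_def)
qed

end

section \<open>Young subgroups\<close>

text \<open>The colour of a dot is the number of its block; other numbers get colour 0 and are fixed
  by all permutations considered. The composites with permutations stand for the cosets of the Young
  subgroup.\<close>

definition block_index :: "nat list \<Rightarrow> nat \<Rightarrow> nat" where
  "block_index lam a = (if a \<in> {1..sum_list lam} then LEAST i. a \<le> sum_list (take (Suc i) lam) else 0)"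

lemma sum_list_take_mono: "i \<le> j \<Longrightarrow> sum_list (take i lam) \<le> sum_list (take j (lam :: nat list))"
  by (metis le_add1 min.absorb2 append_take_drop_id sum_list_append take_take min.commute)

lemma block_index_iff:
  assumes a: "a \<in> {1..sum_list lam}"
  shows "block_index lam a < length lam"
    "a \<in> {sum_list (take i lam)<..sum_list (take (Suc i) lam)} \<longleftrightarrow> block_index lam a = i"
proof -
  let ?S = "\<lambda>i. sum_list (take i lam)"
  let ?i = "LEAST i. a \<le> ?S (Suc i)"
  have ne: "lam \<noteq> []" using a by auto
  have ex: "a \<le> ?S (Suc (length lam - 1))" using a ne by simp
  have le: "a \<le> ?S (Suc ?i)" using ex by (rule LeastI)
  have least: "j < ?i \<Longrightarrow> ?S (Suc j) < a" for j using not_less_Least by fastforce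
  have gt: "?S ?i < a" using least[of "?i - 1"] a by (cases ?i) auto
  have bi: "block_index lam a = ?i" using a by (simp add: block_index_def)
  have "?i \<le> length lam - 1" using ex by (rule Least_le)
  moreover have "length lam > 0" using ne by simp
  ultimately have "?i < length lam" by linarith
  then show "block_index lam a < length lam" unfolding bi .
  show "a \<in> {?S i<..?S (Suc i)} \<longleftrightarrow> block_index lam a = i"
  proof
    assume i: "a \<in> {?S i<..?S (Suc i)}"
    have "?i = i"
    proof (rule Least_equality)
      show "a \<le> ?S (Suc i)" using i by simp
      fix j assume j: "a \<le> ?S (Suc j)"
      show "i \<le> j"
      proof (rule ccontr)
        assume "\<not> i \<le> j"
        then have "?S (Suc j) \<le> ?S i" by (intro sum_list_take_mono) simp
        then show False using i j by simp
      qed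
    qed
    then show "block_index lam a = i" using a by (simp add: block_index_def)
  next
    assume "block_index lam a = i"
    then have "i = ?i" using a by (simp add: block_index_def)
    then show "a \<in> {?S i<..?S (Suc i)}" using le gt by simp
  qed
qed

lemma young_subgroup_eq:
  "young_subgroup lam = {\<sigma>. \<sigma> permutes {1..sum_list lam} \<and> block_index lam \<circ> \<sigma> = block_index lam}"
proof -
  let ?B = "\<lambda>i. {sum_list (take i lam)<..sum_list (take (Suc i) lam)}"
  let ?A = "{1..sum_list lam}"
  have sub: "?B i \<subseteq> ?A" for i
  proof
    fix a assume a: "a \<in> ?B i"
    have "sum_list (take (Suc i) lam) \<le> sum_list lam"
      using sum_list_take_mono[of "Suc i" "Suc i + length lam" lam] by simp
    then show "a \<in> ?A" using a by auto
  qed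
  have B: "?B i = {a\<in>?A. block_index lam a = i}" for i using block_index_iff(2)[of _ lam i] sub[of i] by blast
  have "(\<forall>i<length lam. \<sigma> ` ?B i = ?B i) \<longleftrightarrow> block_index lam \<circ> \<sigma> = block_index lam" if p: "\<sigma> permutes ?A" for \<sigma>
  proof
    assume im: "\<forall>i<length lam. \<sigma> ` ?B i = ?B i"
    show "block_index lam \<circ> \<sigma> = block_index lam"
    proof
      fix a
      show "(block_index lam \<circ> \<sigma>) a = block_index lam a"
      proof (cases "a \<in> ?A")
        case True
        let ?i = "block_index lam a"
        have "a \<in> ?B ?i" using B[of ?i] True by blast
        then have "\<sigma> a \<in> ?B ?i" using im block_index_iff(1)[OF True] by blast
        then show ?thesis using B[of ?i] by simp
      qed (use p in \<open>simp add: permutes_not_in\<close>)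
    qed
  next
    assume eq: "block_index lam \<circ> \<sigma> = block_index lam"
    show "\<forall>i<length lam. \<sigma> ` ?B i = ?B i"
    proof (intro allI impI endo_inj_surj)
      fix i
      show "\<sigma> ` ?B i \<subseteq> ?B i"
        unfolding B using permutes_in_image[OF p] eq by (auto simp: fun_eq_iff)
      show "inj_on \<sigma> (?B i)" using permutes_inj[OF p] by (rule inj_on_subset) simp
    qed simp
  qed
  then show ?thesis unfolding young_subgroup_def by auto
qed

section \<open>Double cosets and amalgamated products of words\<close>

lemma left_module_subgroup:
  assumes N: "left_module (group_algebra G :: ('g \<Rightarrow>\<^sub>0 'k::field) ring) N" and G: "group G" and H: "subgroup H G"
  shows "left_module (group_algebra (G\<lparr>carrier := H\<rparr>) :: ('g \<Rightarrow>\<^sub>0 'k) ring) N"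
proof -
  interpret N: left_module "group_algebra G :: ('g \<Rightarrow>\<^sub>0 'k) ring" N by fact
  have sub: "a \<in> carrier (group_algebra G)" if "a \<in> carrier (group_algebra (G\<lparr>carrier := H\<rparr>))" for a :: "'g \<Rightarrow>\<^sub>0 'k"
    using that subgroup.subset[OF H] by (auto simp: group_algebra_simps)
  have ops: "mult (group_algebra (G\<lparr>carrier := H\<rparr>) :: ('g \<Rightarrow>\<^sub>0 'k) ring) = mult (group_algebra G)"
    "add (group_algebra (G\<lparr>carrier := H\<rparr>) :: ('g \<Rightarrow>\<^sub>0 'k) ring) = add (group_algebra G)"
    "one (group_algebra (G\<lparr>carrier := H\<rparr>) :: ('g \<Rightarrow>\<^sub>0 'k) ring) = one (group_algebra G)"
    by (simp_all add: group_algebra_simps)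
  show ?thesis
    by (intro left_module.intro left_module_axioms.intro N.M.abelian_group_axioms
          ring_group_algebra subgroup.subgroup_is_group[OF H G])
       (use sub in \<open>auto simp: ops N.smult_closed N.smult_l_distr N.smult_r_distr N.smult_assoc N.smult_one\<close>)
qed

lemma left_module_iso: "module_isomorphic R M N \<Longrightarrow> left_module R M"
  by (simp add: module_isomorphic_def)

section \<open>Colourings and double cosets\<close>

locale diagram_reps = diagram l n P L for l n and P L :: "nat set set" +
  fixes lam :: "nat list" and q :: nat and \<pi> :: "nat \<Rightarrow> nat \<Rightarrow> nat"
  assumes lam: "is_partition lam l"
    and reps: "double_coset_reps (symmetric_group l) (diagram_stabilizer l P L) (young_subgroup lam) q \<pi>"
begin

abbreviation "Y \<equiv> young_subgroup lam"
abbreviation "S\<^sub>l \<equiv> symmetric_group l"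
abbreviation "S\<^sub>n \<equiv> symmetric_group n"

interpretation Sl: group S\<^sub>l by (rule group_symmetric_group)

definition "X = {block_index lam \<circ> g | g. g permutes {1..l}}"
definition "\<chi> i = block_index lam \<circ> \<pi> i"

lemma Y_eq: "Y = {g. g permutes {1..l} \<and> block_index lam \<circ> g = block_index lam}"
  using lam by (simp add: young_subgroup_eq is_partition_def)

lemma pi_permutes: "i \<in> {1..q} \<Longrightarrow> \<pi> i permutes {1..l}"
  using reps by (auto simp: double_coset_reps_def symmetric_group_simps)

lemma group_set_X: "group_set S\<^sub>l (\<lambda>g f. f \<circ> g) X"
proof (intro group_set.intro group_symmetric_group group_set_axioms.intro)
  fix g x assume "g \<in> carrier S\<^sub>l" "x \<in> X"
  then obtain g' where "x = block_index lam \<circ> g'" "g' permutes {1..l}" "g permutes {1..l}"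
    by (auto simp: X_def symmetric_group_simps)
  then show "x \<circ> g \<in> X"
    unfolding X_def by (auto simp: o_assoc intro!: exI[of _ "g' \<circ> g"] permutes_compose)
qed (simp_all add: symmetric_group_simps o_assoc)

lemma permutation_module_Y:
  "module_isomorphic (group_algebra S\<^sub>l :: (_ \<Rightarrow>\<^sub>0 'k::field) ring) (permutation_module S\<^sub>l Y) (perm_rep (\<lambda>g f. f \<circ> g) X)"
proof (rule group_set.permutation_module_iso[OF group_set_X, of "block_index lam"])
  show "block_index lam \<in> X" unfolding X_def using permutes_id by (auto intro!: exI[of _ id])
qed (auto simp: X_def symmetric_group_simps Y_eq)

text \<open>Products are written in the order of concatenation, so the product of h, g and y is the
  composite of the maps in reverse order.\<close>

lemma double_coset: "x \<in> H <#>\<^bsub>S\<^sub>l\<^esub> (g <#\<^bsub>S\<^sub>l\<^esub> Y) \<longleftrightarrow> (\<exists>h\<in>H. \<exists>y\<in>Y. x = y \<circ> g \<circ> h)"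
  by (auto simp: set_mult_def l_coset_def symmetric_group_simps)

text \<open>Orbits of \<open>H\<close> on colourings correspond to double cosets. Here the double
  coset of \<open>g\<close> supplies the representative; \<open>chi_unique\<close> shows that
  distinct representatives have disjoint orbits.\<close>

lemma X_cases:
  assumes "x \<in> X"
  obtains i h where "i \<in> {1..q}" "h \<in> H" "x = \<chi> i \<circ> h"
proof -
  obtain g where g: "x = block_index lam \<circ> g" "g permutes {1..l}" using assms by (auto simp: X_def)
  have "H <#>\<^bsub>S\<^sub>l\<^esub> (g <#\<^bsub>S\<^sub>l\<^esub> Y) \<in> (\<lambda>i. H <#>\<^bsub>S\<^sub>l\<^esub> (\<pi> i <#\<^bsub>S\<^sub>l\<^esub> Y)) ` {1..q}"
    using reps g(2) unfolding double_coset_reps_def bij_betw_def by (simp add: symmetric_group_simps)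
  then obtain i where i: "i \<in> {1..q}" "H <#>\<^bsub>S\<^sub>l\<^esub> (g <#\<^bsub>S\<^sub>l\<^esub> Y) = H <#>\<^bsub>S\<^sub>l\<^esub> (\<pi> i <#\<^bsub>S\<^sub>l\<^esub> Y)" by auto
  have "id \<in> Y" using permutes_id by (auto simp: Y_eq)
  then have "g \<in> H <#>\<^bsub>S\<^sub>l\<^esub> (g <#\<^bsub>S\<^sub>l\<^esub> Y)" using H_id by (auto simp: double_coset intro!: bexI[of _ id])
  then obtain h y where "h \<in> H" "y \<in> Y" "g = y \<circ> \<pi> i \<circ> h" unfolding i(2) double_coset by blast
  then have "x = \<chi> i \<circ> h" by (simp add: g \<chi>_def Y_eq o_assoc)
  then show thesis using that i(1) \<open>h \<in> H\<close> by blast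
qed

lemma chi_in_X: "i \<in> {1..q} \<Longrightarrow> h \<in> H \<Longrightarrow> \<chi> i \<circ> h \<in> X"
  unfolding X_def \<chi>_def using pi_permutes H_D(1)
  by (auto simp: o_assoc intro!: exI[of _ "\<pi> i \<circ> h"] permutes_compose)

lemma chi_unique:
  assumes i: "i \<in> {1..q}" "h \<in> H" and j: "j \<in> {1..q}" "k \<in> H" and eq: "\<chi> i \<circ> h = \<chi> j \<circ> k"
  shows "i = j"
proof -
  \<comment> \<open>The permutation relating the two composites; it lies in the Young subgroup
    because both give the same colouring.\<close>
  let ?y = "\<pi> i \<circ> h \<circ> pinv (\<pi> j \<circ> k)"
  have pj: "\<pi> j \<circ> k permutes {1..l}" "\<pi> i \<circ> h permutes {1..l}"
    using pi_permutes H_D(1) i j by (auto intro: permutes_compose)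
  have "block_index lam \<circ> ?y = block_index lam \<circ> (\<pi> j \<circ> k) \<circ> pinv (\<pi> j \<circ> k)"
    using eq by (simp add: \<chi>_def o_assoc)
  also have "\<dots> = block_index lam" using permutes_inv_o[OF pj(1)] by (simp only: comp_assoc comp_id)
  finally have y: "?y \<in> Y" using permutes_compose[OF permutes_inv[OF pj(1)] pj(2)] by (simp add: Y_eq)
  have e: "\<pi> i \<circ> h = ?y \<circ> (\<pi> j \<circ> k)" using permutes_inv_o[OF pj(1)] by (simp only: comp_assoc comp_id)
  have yp: "?y permutes {1..l}" and yc: "block_index lam \<circ> ?y = block_index lam" using y by (auto simp: Y_eq)
  have yinv: "pinv ?y \<in> Y"
  proof -
    have "block_index lam \<circ> pinv ?y = block_index lam \<circ> ?y \<circ> pinv ?y" using yc by simp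
    also have "\<dots> = block_index lam" using permutes_inv_o[OF yp] by (simp only: comp_assoc comp_id)
    finally show ?thesis using permutes_inv[OF yp] by (simp add: Y_eq)
  qed
  have "pinv ?y \<circ> (\<pi> i \<circ> h) = pinv ?y \<circ> (?y \<circ> (\<pi> j \<circ> k))" by (rule arg_cong[OF e])
  also have "\<dots> = (pinv ?y \<circ> ?y) \<circ> (\<pi> j \<circ> k)" by (rule comp_assoc[symmetric])
  also have "\<dots> = \<pi> j \<circ> k" by (simp only: permutes_inv_o[OF yp] id_comp)
  finally have e': "\<pi> j \<circ> k = pinv ?y \<circ> (\<pi> i \<circ> h)" by (rule sym)
  have YY: "a \<circ> b \<in> Y" if "a \<in> Y" "b \<in> Y" for a b
    using that by (auto simp: Y_eq permutes_compose o_assoc)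
  have sub: "H <#>\<^bsub>S\<^sub>l\<^esub> (\<pi> i <#\<^bsub>S\<^sub>l\<^esub> Y) \<subseteq> H <#>\<^bsub>S\<^sub>l\<^esub> (\<pi> j <#\<^bsub>S\<^sub>l\<^esub> Y)"
    if h: "h \<in> H" "k \<in> H" and y: "y \<in> Y" and e: "\<pi> i \<circ> h = y \<circ> (\<pi> j \<circ> k)" for i j h k y
  proof
    fix x assume "x \<in> H <#>\<^bsub>S\<^sub>l\<^esub> (\<pi> i <#\<^bsub>S\<^sub>l\<^esub> Y)"
    then obtain h' y' where x: "h' \<in> H" "y' \<in> Y" "x = y' \<circ> \<pi> i \<circ> h'" by (auto simp: double_coset)
    have "\<pi> i = y \<circ> (\<pi> j \<circ> k) \<circ> pinv h"
      unfolding e[symmetric] using permutes_inv_o[OF H_D(1)[OF h(1)]] by (simp only: comp_assoc comp_id)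
    then have "x = (y' \<circ> y) \<circ> \<pi> j \<circ> (k \<circ> pinv h \<circ> h')" using x(3) by (simp only: comp_assoc)
    then show "x \<in> H <#>\<^bsub>S\<^sub>l\<^esub> (\<pi> j <#\<^bsub>S\<^sub>l\<^esub> Y)"
      unfolding double_coset using YY[OF x(2) y] H_comp[OF H_comp[OF h(2) H_inv[OF h(1)]] x(1)] by blast
  qed
  have "H <#>\<^bsub>S\<^sub>l\<^esub> (\<pi> i <#\<^bsub>S\<^sub>l\<^esub> Y) = H <#>\<^bsub>S\<^sub>l\<^esub> (\<pi> j <#\<^bsub>S\<^sub>l\<^esub> Y)"
    using sub[OF i(2) j(2) y e] sub[OF j(2) i(2) yinv e'] by (rule equalityI)
  then show ?thesis using reps i(1) j(1) unfolding double_coset_reps_def bij_betw_def inj_on_def by blast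
qed

text \<open>An element \<open>h\<close> fixes the colouring \<open>\<chi> i\<close> exactly if its
  conjugate by \<open>\<pi> i\<close> fixes the colouring by blocks, that is, lies in the Young
  subgroup.\<close>

lemma nu_eq:
  assumes i: "i \<in> {1..q}"
  shows "H \<inter> ((\<pi> i <#\<^bsub>S\<^sub>l\<^esub> Y) #>\<^bsub>S\<^sub>l\<^esub> inv\<^bsub>S\<^sub>l\<^esub> (\<pi> i)) = {h\<in>H. \<chi> i \<circ> h = \<chi> i}"
proof -
  have p: "\<pi> i permutes {1..l}" by (rule pi_permutes[OF i])
  have c: "h \<in> (\<pi> i <#\<^bsub>S\<^sub>l\<^esub> Y) #>\<^bsub>S\<^sub>l\<^esub> inv\<^bsub>S\<^sub>l\<^esub> (\<pi> i) \<longleftrightarrow> (\<exists>y\<in>Y. h = pinv (\<pi> i) \<circ> (y \<circ> \<pi> i))" for h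
    by (auto simp: l_coset_def r_coset_def inv_symmetric_group[OF p] symmetric_group_simps)
  have "(\<exists>y\<in>Y. h = pinv (\<pi> i) \<circ> (y \<circ> \<pi> i)) \<longleftrightarrow> \<chi> i \<circ> h = \<chi> i" if h: "h \<in> H" for h
  proof
    assume "\<exists>y\<in>Y. h = pinv (\<pi> i) \<circ> (y \<circ> \<pi> i)"
    then obtain y where y: "y \<in> Y" "h = pinv (\<pi> i) \<circ> (y \<circ> \<pi> i)" by blast
    have "\<chi> i \<circ> h = block_index lam \<circ> ((\<pi> i \<circ> pinv (\<pi> i)) \<circ> (y \<circ> \<pi> i))"
      by (simp only: \<chi>_def y(2) comp_assoc)
    also have "\<dots> = block_index lam \<circ> y \<circ> \<pi> i" using permutes_inv_o[OF p] by (simp add: o_assoc)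
    also have "\<dots> = \<chi> i" using y(1) by (simp add: Y_eq \<chi>_def)
    finally show "\<chi> i \<circ> h = \<chi> i" .
  next
    assume e: "\<chi> i \<circ> h = \<chi> i"
    let ?y = "\<pi> i \<circ> h \<circ> pinv (\<pi> i)"
    have "block_index lam \<circ> ?y = block_index lam \<circ> \<pi> i \<circ> pinv (\<pi> i)"
      using e by (simp add: \<chi>_def o_assoc)
    also have "\<dots> = block_index lam" using permutes_inv_o[OF p] by (simp only: comp_assoc comp_id)
    finally have "?y \<in> Y"
      using permutes_compose[OF permutes_inv[OF p] permutes_compose[OF H_D(1)[OF h] p]] by (simp add: Y_eq o_assoc)
    moreover have "pinv (\<pi> i) \<circ> (?y \<circ> \<pi> i) = (pinv (\<pi> i) \<circ> \<pi> i) \<circ> h \<circ> (pinv (\<pi> i) \<circ> \<pi> i)"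
      by (simp only: comp_assoc)
    then have "h = pinv (\<pi> i) \<circ> (?y \<circ> \<pi> i)" using permutes_inv_o[OF p] by simp
    ultimately show "\<exists>y\<in>Y. h = pinv (\<pi> i) \<circ> (y \<circ> \<pi> i)" by blast
  qed
  then show ?thesis using c by auto
qed

section \<open>Words of colour types and their stabilizers\<close>

definition "\<nu> i = \<rho> ` (H \<inter> ((\<pi> i <#\<^bsub>S\<^sub>l\<^esub> Y) #>\<^bsub>S\<^sub>l\<^esub> inv\<^bsub>S\<^sub>l\<^esub> (\<pi> i)))"

definition "type_spec i \<tau> r \<longleftrightarrow> (\<forall>b. b \<notin> {1..n} \<longrightarrow> \<tau> b = 0) \<and> (\<forall>b\<in>{1..n}. \<tau> b < (r::nat)) \<and>
    \<rho> ` {h\<in>H. \<chi> i \<circ> h = \<chi> i} = {\<eta>. \<eta> permutes {1..n} \<and> \<tau> \<circ> \<eta> = \<tau>}"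

definition "\<tau> i = (SOME \<tau>. \<exists>r. type_spec i \<tau> r)"
definition "r i = (SOME r. type_spec i (\<tau> i) r)"

lemma type_spec: "type_spec i (\<tau> i) (r i)"
proof -
  have "\<exists>\<tau> r. type_spec i \<tau> r" using type_word[of "\<chi> i"] unfolding type_spec_def .
  then have "\<exists>r. type_spec i (\<tau> i) r" unfolding \<tau>_def by (rule someI_ex)
  then show ?thesis unfolding r_def by (rule someI_ex)
qed

text \<open>With the content of \<open>\<tau> i\<close> itself, \<open>words\<close> is the full
  orbit of \<open>\<tau> i\<close> under permutations of the labelled parts.\<close>

definition "cont i a = card {b\<in>{1..n}. \<tau> i b = a}"

lemma tau_words: "\<tau> i \<in> words n (r i) (cont i)"
  using type_spec[of i] unfolding type_spec_def words_def cont_def by blast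

lemma rho_stab: "\<rho> ` {h\<in>H. \<chi> i \<circ> h = \<chi> i} = {\<eta>. \<eta> permutes {1..n} \<and> \<tau> i \<circ> \<eta> = \<tau> i}"
  using type_spec[of i] unfolding type_spec_def by blast

lemma nu_stab: "i \<in> {1..q} \<Longrightarrow> \<nu> i = {\<eta>. \<eta> permutes {1..n} \<and> \<tau> i \<circ> \<eta> = \<tau> i}"
  unfolding \<nu>_def by (simp only: nu_eq rho_stab)

lemma permutation_module_nu:
  assumes "i \<in> {1..q}"
  shows "module_isomorphic (group_algebra S\<^sub>n :: (_ \<Rightarrow>\<^sub>0 'k::field) ring) (permutation_module S\<^sub>n (\<nu> i))
    (perm_rep (\<lambda>g f. f \<circ> g) (words n (r i) (cont i)))"
proof (rule group_set.permutation_module_iso[OF group_set_words tau_words])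
  show "\<exists>g\<in>carrier S\<^sub>n. z = \<tau> i \<circ> g" if "z \<in> words n (r i) (cont i)" for z
    using words_transitive[OF that tau_words] by (auto simp: symmetric_group_simps)
qed (auto simp: nu_stab[OF assms] symmetric_group_simps)

text \<open>A word \<open>x = \<chi> i \<circ> h\<close> in the orbit of \<open>h\<close> is sent to \<open>\<tau> i \<circ> \<rho> h\<close>, so that \<open>(g, x)\<close> goes to
  \<open>(i, \<tau> i \<circ> \<rho> h \<circ> g)\<close> under the identification of the amalgamated product with the union of the orbits of
  the \<open>\<tau> i\<close>.\<close>

definition "orb x = (SOME i. i \<in> {1..q} \<and> (\<exists>h\<in>H. x = \<chi> i \<circ> h))"
definition "lift x = (SOME h. h \<in> H \<and> x = \<chi> (orb x) \<circ> h)"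
definition "Q g x = (orb x, \<tau> (orb x) \<circ> \<rho> (lift x) \<circ> g)"

text \<open>Independence of the choices in \<open>orb\<close> and \<open>lift\<close>:
  \<open>chi_unique\<close> fixes the index, and two lifts differ by an element that fixes
  \<open>\<chi> i\<close>, whose image under \<rho> fixes \<open>\<tau> i\<close>.\<close>

lemma Q_eq:
  assumes i: "i \<in> {1..q}" and h: "h \<in> H"
  shows "Q g (\<chi> i \<circ> h) = (i, \<tau> i \<circ> \<rho> h \<circ> g)"
proof -
  let ?x = "\<chi> i \<circ> h"
  have "orb ?x \<in> {1..q} \<and> (\<exists>k\<in>H. ?x = \<chi> (orb ?x) \<circ> k)"
    unfolding orb_def by (rule someI[of _ i]) (use i h in blast)
  then obtain k where "orb ?x \<in> {1..q}" "k \<in> H" "?x = \<chi> (orb ?x) \<circ> k" by blast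
  then have o: "orb ?x = i" using chi_unique[OF i h] by metis
  have "lift ?x \<in> H \<and> ?x = \<chi> (orb ?x) \<circ> lift ?x"
    unfolding lift_def by (rule someI[of _ h]) (simp only: o h simp_thms)
  then have k: "lift ?x \<in> H" "\<chi> i \<circ> h = \<chi> i \<circ> lift ?x" using o by auto
  let ?m = "h \<circ> pinv (lift ?x)"
  have m: "?m \<in> H" by (rule H_comp[OF h H_inv[OF k(1)]])
  have "\<chi> i \<circ> ?m = (\<chi> i \<circ> h) \<circ> pinv (lift ?x)" by (simp only: comp_assoc)
  also have "\<dots> = \<chi> i \<circ> lift ?x \<circ> pinv (lift ?x)" by (simp only: k(2)[symmetric])
  also have "\<dots> = \<chi> i" using permutes_inv_o[OF H_D(1)[OF k(1)]] by (simp only: comp_assoc comp_id)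
  finally have "\<rho> ?m \<in> \<rho> ` {h\<in>H. \<chi> i \<circ> h = \<chi> i}" using m by blast
  then have t: "\<tau> i \<circ> \<rho> ?m = \<tau> i" unfolding rho_stab by blast
  have "h = ?m \<circ> lift ?x" using permutes_inv_o[OF H_D(1)[OF k(1)]] by (simp only: comp_assoc comp_id)
  then have "\<rho> h = \<rho> ?m \<circ> \<rho> (lift ?x)" using rho_comp[OF m k(1)] by simp
  then have "\<tau> i \<circ> \<rho> h = \<tau> i \<circ> \<rho> (lift ?x)" using t by (simp add: o_assoc)
  then show ?thesis by (simp add: Q_def o)
qed

text \<open>Mackey's formula on the level of sets: \<open>Q\<close> exhibits the disjoint union of
  the orbits of the words as the amalgamated product of the symmetric group on the parts with the
  colourings, over \<open>H\<close>.\<close>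

theorem mackey_iso:
  fixes act :: "((nat \<Rightarrow> nat) \<Rightarrow>\<^sub>0 'k::field) \<Rightarrow> ((nat \<Rightarrow> nat) \<Rightarrow>\<^sub>0 'k) \<Rightarrow> ((nat \<Rightarrow> nat) \<Rightarrow>\<^sub>0 'k)"
  defines "act \<equiv> \<lambda>\<eta> \<zeta>. \<eta> \<otimes>\<^bsub>group_algebra S\<^sub>n\<^esub> linear_ext \<rho> \<zeta>"
  shows "module_isomorphic (group_algebra S\<^sub>n) (tensor_product (regular_module (group_algebra S\<^sub>n)) act
      (group_algebra (S\<^sub>l\<lparr>carrier := H\<rparr>)) (permutation_module S\<^sub>l Y))
    (perm_rep (\<lambda>g (i, f). (i, f \<circ> g)) (Sigma {1..q} (\<lambda>i. words n (r i) (cont i))))"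
proof -
  let ?N = "permutation_module S\<^sub>l Y :: ((nat \<Rightarrow> nat) \<Rightarrow>\<^sub>0 'k, _) module"
  let ?H = "S\<^sub>l\<lparr>carrier := H\<rparr>" and ?Z = "Sigma {1..q} (\<lambda>i. words n (r i) (cont i))"
  obtain \<phi> where phi: "bij_betw \<phi> (carrier ?N) (carrier (perm_rep (\<lambda>g f. f \<circ> g) X))"
     "\<forall>x\<in>carrier ?N. \<forall>y\<in>carrier ?N. \<phi> (x \<oplus>\<^bsub>?N\<^esub> y) = \<phi> x \<oplus>\<^bsub>perm_rep (\<lambda>g f. f \<circ> g) X\<^esub> \<phi> y"
     "\<forall>a\<in>carrier (group_algebra S\<^sub>l). \<forall>x\<in>carrier ?N. \<phi> (a \<odot>\<^bsub>?N\<^esub> x) = a \<odot>\<^bsub>perm_rep (\<lambda>g f. f \<circ> g) X\<^esub> \<phi> x"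
    using permutation_module_Y[where 'k='k] unfolding module_isomorphic_def by blast
  have gH: "group ?H" by (rule subgroup.subgroup_is_group[OF H_subgroup group_symmetric_group])
  have HS: "\<And>h. h \<in> H \<Longrightarrow> h \<in> carrier S\<^sub>l" using subgroup.subset[OF H_subgroup] by blast
  interpret X: group_set ?H "\<lambda>g f. f \<circ> g" X
    by (intro group_set.intro gH group_set_axioms.intro)
       (simp_all add: group_set.act_closed[OF group_set_X] HS symmetric_group_simps(2,3) o_assoc)
  interpret Sn: group S\<^sub>n by (rule group_symmetric_group)
  interpret N: left_module "group_algebra ?H" ?N
    by (rule left_module_subgroup[OF left_module_iso[OF permutation_module_Y] group_symmetric_group H_subgroup])
  interpret tensor_perm S\<^sub>n ?H "\<lambda>g f. f \<circ> g" X ?N \<phi> \<rho> act "\<lambda>g (i, f). (i, f \<circ> g)" ?Z Q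
  proof (intro tensor_perm.intro tensor_perm_axioms.intro Sn.group_axioms gH X.group_set_axioms N.left_module_axioms)
    show "bij_betw \<phi> (carrier ?N) {v. keys v \<subseteq> X}" using phi(1) by (simp add: perm_rep_simps)
    show "\<phi> (x \<oplus>\<^bsub>?N\<^esub> y) = \<phi> x + \<phi> y" if "x \<in> carrier ?N" "y \<in> carrier ?N" for x y
      using phi(2) that by (simp add: perm_rep_simps)
    show "\<phi> (a \<odot>\<^bsub>?N\<^esub> y) = conv (\<lambda>g f. f \<circ> g) a (\<phi> y)" if "keys a \<subseteq> carrier ?H" "y \<in> carrier ?N" for a y
    proof -
      have "a \<in> carrier (group_algebra S\<^sub>l)" using that(1) HS by (auto simp: group_algebra_simps)
      then show ?thesis using phi(3) that(2) by (simp add: perm_rep_simps)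
    qed
    show "\<rho> h \<in> carrier S\<^sub>n" if "h \<in> carrier ?H" for h
      using rho_permutes that by (simp add: symmetric_group_simps)
    show "\<rho> \<one>\<^bsub>?H\<^esub> = \<one>\<^bsub>S\<^sub>n\<^esub>" by (simp add: symmetric_group_simps rho_id)
    show "act a b = conv (\<otimes>\<^bsub>S\<^sub>n\<^esub>) a (linear_ext \<rho> b)" for a b
      by (simp add: act_def group_algebra_simps)
  next
    fix g x assume g: "g \<in> carrier S\<^sub>n" and x: "x \<in> X"
    obtain i h where i: "i \<in> {1..q}" "h \<in> H" "x = \<chi> i \<circ> h" using X_cases[OF x] by blast
    have gp: "g permutes {1..n}" using g by (simp add: symmetric_group_simps)
    have "\<tau> i \<circ> \<rho> h \<circ> g \<in> words n (r i) (cont i)"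
      by (intro words_closed tau_words gp rho_permutes i)
    then show "Q g x \<in> ?Z" using i by (simp add: Q_eq)
    show "Q (g' \<otimes>\<^bsub>S\<^sub>n\<^esub> g) x = (case Q g x of (i, f) \<Rightarrow> (i, f \<circ> g'))" for g'
      unfolding i(3) Q_eq[OF i(1,2)] by (simp add: symmetric_group_simps o_assoc)
    show "Q (g \<otimes>\<^bsub>S\<^sub>n\<^esub> \<rho> k) x = Q g (x \<circ> k)" if "k \<in> carrier ?H" for k
    proof -
      have k: "k \<in> H" using that by simp
      have "x \<circ> k = \<chi> i \<circ> (h \<circ> k)" by (simp add: i(3) o_assoc)
      then have "Q g (x \<circ> k) = (i, \<tau> i \<circ> \<rho> (h \<circ> k) \<circ> g)"
        by (simp only: Q_eq[OF i(1) H_comp[OF i(2) k]])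
      moreover have "Q (g \<otimes>\<^bsub>S\<^sub>n\<^esub> \<rho> k) x = (i, \<tau> i \<circ> \<rho> h \<circ> (\<rho> k \<circ> g))"
        by (simp only: i(3) Q_eq[OF i(1,2)] symmetric_group_simps)
      ultimately show ?thesis by (simp only: rho_comp[OF i(2) k] comp_assoc)
    qed
  next
    fix z assume "z \<in> ?Z"
    then obtain i f where z: "z = (i, f)" "i \<in> {1..q}" "f \<in> words n (r i) (cont i)" by blast
    obtain \<eta> where e: "\<eta> permutes {1..n}" "f = \<tau> i \<circ> \<eta>" using words_transitive[OF z(3) tau_words] by blast
    have "z = Q \<eta> (\<chi> i \<circ> id)" using Q_eq[OF z(2) H_id, of \<eta>] by (simp add: z(1) e(2) rho_id)
    then show "\<exists>g\<in>carrier S\<^sub>n. \<exists>x\<in>X. z = Q g x"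
      using chi_in_X[OF z(2) H_id] e(1) by (auto simp: symmetric_group_simps)
  next
    fix g g' x x' assume g: "g \<in> carrier S\<^sub>n" "g' \<in> carrier S\<^sub>n" and x: "x \<in> X" "x' \<in> X" and eq: "Q g x = Q g' x'"
    obtain i a where i: "i \<in> {1..q}" "a \<in> H" "x = \<chi> i \<circ> a" using X_cases[OF x(1)] by blast
    obtain j a' where j: "j \<in> {1..q}" "a' \<in> H" "x' = \<chi> j \<circ> a'" using X_cases[OF x(2)] by blast
    have ij: "j = i" and t: "\<tau> i \<circ> \<rho> a \<circ> g = \<tau> i \<circ> \<rho> a' \<circ> g'" using eq i j by (auto simp: Q_eq)
    have gp: "g permutes {1..n}" "g' permutes {1..n}" using g by (simp_all add: symmetric_group_simps)
    let ?m = "\<rho> a' \<circ> g'"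
    \<comment> \<open>This permutation fixes \<open>\<tau> i\<close>, so it is the image under
      \<rho> of some \<open>k\<close> in \<open>H\<close> that fixes \<open>\<chi> i\<close>; here
      surjectivity onto the stabilizer of the word is used.\<close>
    let ?\<eta> = "\<rho> a \<circ> g \<circ> pinv ?m"
    have mp: "?m permutes {1..n}" using permutes_compose[OF gp(2) rho_permutes[OF j(2)]] .
    have "\<tau> i \<circ> ?\<eta> = (\<tau> i \<circ> \<rho> a \<circ> g) \<circ> pinv ?m" by (simp only: comp_assoc)
    also have "\<dots> = \<tau> i \<circ> \<rho> a' \<circ> g' \<circ> pinv ?m" by (simp only: t)
    also have "\<dots> = \<tau> i \<circ> (?m \<circ> pinv ?m)" by (simp only: comp_assoc)
    also have "\<dots> = \<tau> i" using permutes_inv_o[OF mp] by simp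
    finally have "?\<eta> \<in> {\<eta>. \<eta> permutes {1..n} \<and> \<tau> i \<circ> \<eta> = \<tau> i}"
      using permutes_compose[OF permutes_inv[OF mp] permutes_compose[OF gp(1) rho_permutes[OF i(2)]]] by simp
    then obtain k where k: "k \<in> H" "\<chi> i \<circ> k = \<chi> i" "\<rho> k = ?\<eta>" unfolding rho_stab[symmetric] by auto
    \<comment> \<open>Conjugating \<open>k\<close> by the shifts \<open>a\<close> and
      \<open>a'\<close> gives the element that takes \<open>x\<close> to \<open>x'\<close> and
      accounts for the difference between \<open>g\<close> and \<open>g'\<close>.\<close>
    let ?h = "pinv a \<circ> k \<circ> a'"
    have hH: "?h \<in> H" by (intro H_comp H_inv i(2) k(1) j(2))
    have "\<rho> k \<circ> ?m = \<rho> a \<circ> g \<circ> (pinv ?m \<circ> ?m)" unfolding k(3) by (simp only: comp_assoc)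
    then have km: "\<rho> k \<circ> ?m = \<rho> a \<circ> g" using permutes_inv_o[OF mp] by simp
    have "\<rho> ?h = pinv (\<rho> a) \<circ> \<rho> k \<circ> \<rho> a'"
      using rho_comp[OF H_comp[OF H_inv[OF i(2)] k(1)] j(2)] rho_comp[OF H_inv[OF i(2)] k(1)] rho_inv[OF i(2)] by simp
    then have "\<rho> ?h \<circ> g' = pinv (\<rho> a) \<circ> (\<rho> k \<circ> ?m)" by (simp only: comp_assoc)
    also have "\<dots> = (pinv (\<rho> a) \<circ> \<rho> a) \<circ> g" unfolding km by (simp only: comp_assoc)
    also have "\<dots> = g" using permutes_inv_o[OF rho_permutes[OF i(2)]] by simp
    finally have "g = g' \<otimes>\<^bsub>S\<^sub>n\<^esub> \<rho> ?h" by (simp add: symmetric_group_simps)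
    moreover have "x' = x \<circ> ?h"
    proof -
      have "x \<circ> ?h = \<chi> i \<circ> ((a \<circ> pinv a) \<circ> (k \<circ> a'))" unfolding i(3) by (simp only: comp_assoc)
      also have "\<dots> = \<chi> i \<circ> k \<circ> a'" using permutes_inv_o[OF H_D(1)[OF i(2)]] by (simp add: o_assoc)
      finally show ?thesis using k(2) by (simp add: j(3) ij)
    qed
    ultimately show "\<exists>h\<in>carrier ?H. g = g' \<otimes>\<^bsub>S\<^sub>n\<^esub> \<rho> h \<and> x' = x \<circ> h" using hH by auto
  qed
  show ?thesis by (rule tensor_iso)
qed

theorem direct_sum_iso:
  "module_isomorphic (group_algebra S\<^sub>n :: (_ \<Rightarrow>\<^sub>0 'k::field) ring)
    (perm_rep (\<lambda>g (i, f). (i, f \<circ> g)) (Sigma {1..q} (\<lambda>i. words n (r i) (cont i))))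
    (direct_sum {1..q} (\<lambda>i. permutation_module S\<^sub>n (\<nu> i)))"
  by (rule direct_sum_perm_rep_iso) (auto simp: group_set_words group_symmetric_group intro: permutation_module_nu)

theorem filtration:
  "has_filtration_by (group_algebra S\<^sub>n :: (_ \<Rightarrow>\<^sub>0 'k::field) ring)
    (perm_rep (\<lambda>g (i, f). (i, f \<circ> g)) (Sigma {1..q} (\<lambda>i. words n (r i) (cont i)))) (dual_specht_modules n)"
proof -
  interpret W: word_rep n "{1..q}" r cont "TYPE('k)" by unfold_locales simp
  show ?thesis using W.has_filtration_words unfolding W.Z_def W.actZ_def .
qed

end

theorem proposition21:
  fixes n l q :: nat
    and P L :: "nat set set"
    and lam :: "nat list"
    and \<pi> :: "nat \<Rightarrow> (nat \<Rightarrow> nat)"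
  defines "S\<^sub>n \<equiv> symmetric_group n"
    and "S\<^sub>l \<equiv> symmetric_group l"
    and "Y \<equiv> young_subgroup lam"
    and "H \<equiv> diagram_stabilizer l P L"
  defines "kS\<^sub>n \<equiv> (group_algebra S\<^sub>n :: ((nat \<Rightarrow> nat) \<Rightarrow>\<^sub>0 'k::alg_closed_field) ring)"
  defines "M \<equiv> tensor_product (regular_module kS\<^sub>n)
                 (\<lambda>\<eta> \<zeta>. \<eta> \<otimes>\<^bsub>kS\<^sub>n\<^esub> linear_ext (induced_perm L) \<zeta>)
                 (group_algebra (S\<^sub>l\<lparr>carrier := H\<rparr>))
                 (permutation_module S\<^sub>l Y)"
    and "\<nu> \<equiv> \<lambda>i. induced_perm L ` (H \<inter> ((\<pi> i <#\<^bsub>S\<^sub>l\<^esub> Y) #>\<^bsub>S\<^sub>l\<^esub> inv\<^bsub>S\<^sub>l\<^esub> (\<pi> i)))"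
  assumes "n \<le> l"
    and "partial_diagram l n P L"
    and "is_partition lam l"
    and "double_coset_reps S\<^sub>l H Y q \<pi>"
  shows "module_isomorphic kS\<^sub>n M (direct_sum {1..q} (\<lambda>i. permutation_module S\<^sub>n (\<nu> i)))
    \<and> has_filtration_by kS\<^sub>n M (dual_specht_modules n)"
proof -
  interpret D: diagram_reps l n P L lam q \<pi>
    using assms(9-11) unfolding S\<^sub>l_def H_def Y_def by unfold_locales
  have iso: "module_isomorphic kS\<^sub>n M
      (perm_rep (\<lambda>g (i, f). (i, f \<circ> g)) (Sigma {1..q} (\<lambda>i. words n (D.r i) (D.cont i))))"
    unfolding M_def kS\<^sub>n_def S\<^sub>n_def S\<^sub>l_def H_def Y_def by (rule D.mackey_iso)
  have nu: "\<nu> = D.\<nu>"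
    unfolding \<nu>_def S\<^sub>l_def H_def Y_def by (simp add: fun_eq_iff D.\<nu>_def)
  have "module_isomorphic kS\<^sub>n M (direct_sum {1..q} (\<lambda>i. permutation_module S\<^sub>n (\<nu> i)))"
    unfolding nu using module_isomorphic_trans[OF iso] D.direct_sum_iso unfolding kS\<^sub>n_def S\<^sub>n_def by blast
  moreover have "has_filtration_by kS\<^sub>n M (dual_specht_modules n)"
    using has_filtration_by_iso[OF _ module_isomorphic_sym[OF iso]] D.filtration
    unfolding kS\<^sub>n_def S\<^sub>n_def by blast
  ultimately show ?thesis ..
qed

end
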